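(* Let $M\ge 2$, let $\sigma_{\mathrm c}^2,\sigma_{\mathrm r}^2>0$, and let $C(\rho)$ be the capacity, under average power $\rho$, of the electro-optic comb phase-noise channel described in the context. Then $$C(\rho)\ge (M-1)\log\Big(\frac{\rho}{M-1}\Big)+2\log\pi-h(\boldsymbol\Delta^{\mathrm c},\boldsymbol\Delta^{\mathrm r})-\sum_{m=2}^{M-1}g_{\mathrm{hsnr}}(m)+o(1),\qquad\rho\to\infty,$$ where $\boldsymbol\Delta^{\mathrm c}\sim\mathcal{WN}(0,\sigma_{\mathrm c}^2)$ and $\boldsymbol\Delta^{\mathrm r}\sim\mathcal{WN}(0,\sigma_{\mathrm r}^2)$ are independent, $o(1)$ is a function of $\rho$ that vanishes as $\rho\to\infty$, and $$g_{\mathrm{hsnr}}(2)=\mathbb E\Big[\log\Big(1+4\frac{\mathbf u_2^2}{\mathbf u_1^2}+\frac{\mathbf u_2^2}{\mathbf u_0^2}\Big)\Big],\qquad g_{\mathrm{hsnr}}(m)=\mathbb E\Big[\log\Big(1+\frac{\mathbf u_m^2}{\mathbf u_{m-1}^2}+\frac{\mathbf u_m^2}{\mathbf u_{m-2}^2}+\frac{\mathbf u_m^2}{\mathbf u_{m-3}^2}\Big)\Big]\quad(m>2).$$ Here $\mathbf u_0,\dots,\mathbf u_{M-1}$ are independent positive random variables such that $\mathbf u_m^2$ has the gamma distribution with scale $1$ and shape $\alpha_m^*$, i.e. density $r^{\alpha_m^*-1}e^{-r}/\Gamma(\alpha_m^* )$ on $r>0$, where $\alpha_0^*=\alpha_1^*=\tfrac12$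 and $\alpha_m^*=1$ for $m\in\{2,\dots,M-1\}$.
   Context: Conventions: $\log$ is base 2; $h$ and $I$ denote differential entropy and mutual information (in bits); $j$ is the imaginary unit; $\mathrm{wrap}_\pi(\theta)=((\theta+\pi)\bmod 2\pi)-\pi\in[-\pi,\pi)$ and $\theta\oplus\phi=\mathrm{wrap}_\pi(\theta+\phi)$. $\mathcal{CN}(0,1)$ is the standard circularly symmetric complex Gaussian law; $\mathcal{WN}(0,\sigma^2)$ is the law of $\mathrm{wrap}_\pi(X)$ for $X\sim\mathcal N(0,\sigma^2)$. $\Gamma$ is the gamma function and $\|\cdot\|$ is the Euclidean norm. Channel: for $k=1,2,\dots$ and $m=0,\dots,M-1$, the output is $\mathbf y_{k,m}=e^{j\boldsymbol\theta_{k,m}}\mathbf x_{k,m}+\mathbf w_{k,m}$, where the $\mathbf w_{k,m}$ are i.i.d. $\mathcal{CN}(0,1)$ and $\boldsymbol\theta_{k,m}=\mathrm{wrap}_\pi(\boldsymbol\theta_k^{\mathrm c}+m\boldsymbol\theta_k^{\mathrm r})$. The two processes $(\boldsymbol\theta^{\mathrm c}_k)_{k\ge0}$, $(\boldsymbol\theta^{\mathrm r}_k)_{k\ge0}$ are independent of each other; for each of them, $\boldsymbol\theta_0^{\mathrm{c/r}}$ is uniform on $[-\pi,\pi)$ and $\boldsymbol\theta_k^{\mathrm{c/r}}=\boldsymbol\Delta_k^{\mathrm{c/r}}\oplus\boldsymbol\theta_{k-1}^{\mathrm{c/r}}$ for $k\ge1$, where the $\boldsymbol\Delta_k^{\mathrm{c/r}}$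 are i.i.d. $\mathcal{WN}(0,\sigma_{\mathrm{c/r}}^2)$, independent of $\boldsymbol\theta_0^{\mathrm{c/r}}$. Inputs, phase noises and additive noise are independent. Capacity: with $\underline{\mathbf x}_k=(\mathbf x_{k,0},\dots,\mathbf x_{k,M-1})\in\mathbb C^M$ and similarly $\underline{\mathbf y}_k$, $C(\rho)=\lim_{n\to\infty}\frac1n\sup I(\underline{\mathbf x}_1,\dots,\underline{\mathbf x}_n;\underline{\mathbf y}_1,\dots,\underline{\mathbf y}_n)$, the supremum being over all laws of $(\underline{\mathbf x}_1,\dots,\underline{\mathbf x}_n)$ with $\sum_{k=1}^n\mathbb E[\|\underline{\mathbf x}_k\|^2]\le n\rho$. *)

theory Defs
  imports "HOL-Probability.Probability" "HOL-Library.Real_Mod"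
begin

definition wrap_pi :: "real \<Rightarrow> real" where
  "wrap_pi \<theta> = ((\<theta> + pi) rmod (2 * pi)) - pi"

definition circ_add :: "real \<Rightarrow> real \<Rightarrow> real" where
  "circ_add \<theta> \<phi> = wrap_pi (\<theta> + \<phi>)"

definition uniform_phase :: "real measure" where
  "uniform_phase = uniform_measure lborel {-pi..<pi}"

text \<open>The parameter \<open>\<sigma>\<close> is the standard deviation, so this is the law WN(0, \<open>\<sigma>\<^sup>2\<close>).\<close>

definition wrapped_normal :: "real \<Rightarrow> real measure" where
  "wrapped_normal \<sigma> = distr (density lborel (\<lambda>x. ennreal (normal_density 0 \<sigma> x))) borel wrap_pi"

text \<open>CN(0,1) has unit total variance (1/2 per real dimension).\<close>

definition std_complex_normal :: "complex measure" where
  "std_complex_normal = density lborel (\<lambda>z. ennreal (exp (- (cmod z)\<^sup>2) / pi))"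

definition gamma_density :: "real \<Rightarrow> real \<Rightarrow> real" where
  "gamma_density \<alpha> r = (if r > 0 then r powr (\<alpha> - 1) * exp (- r) / Gamma \<alpha> else 0)"

text \<open>
  Blocks are indexed by \<open>{1..n}\<close> and the symbols of a block by \<open>{..<M}\<close>; both the input and the
  output of \<open>n\<close> channel uses live in this space.
\<close>

definition block_space :: "nat \<Rightarrow> nat \<Rightarrow> (nat \<Rightarrow> nat \<Rightarrow> complex) measure" where
  "block_space M n = Pi\<^sub>M {1..n} (\<lambda>k. Pi\<^sub>M {..<M} (\<lambda>m. borel))"

text \<open>An outcome of one phase noise process: its initial value and its increments.\<close>

definition phase_source :: "real \<Rightarrow> (real \<times> (nat \<Rightarrow> real)) measure" where
  "phase_source \<sigma> = uniform_phase \<Otimes>\<^sub>M Pi\<^sub>M {1..} (\<lambda>k. wrapped_normal \<sigma>)"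

primrec phase :: "real \<times> (nat \<Rightarrow> real) \<Rightarrow> nat \<Rightarrow> real" where
  "phase s 0 = fst s"
| "phase s (Suc k) = circ_add (snd s (Suc k)) (phase s k)"

type_synonym noise = "(real \<times> (nat \<Rightarrow> real)) \<times> (real \<times> (nat \<Rightarrow> real)) \<times> (nat \<times> nat \<Rightarrow> complex)"

definition noise_space :: "nat \<Rightarrow> real \<Rightarrow> real \<Rightarrow> noise measure" where
  "noise_space M \<sigma>\<^sub>c \<sigma>\<^sub>r =
     phase_source \<sigma>\<^sub>c \<Otimes>\<^sub>M phase_source \<sigma>\<^sub>r \<Otimes>\<^sub>M Pi\<^sub>M ({1..} \<times> {..<M}) (\<lambda>(k, m). std_complex_normal)"

definition comb_phase :: "noise \<Rightarrow> nat \<Rightarrow> nat \<Rightarrow> real" where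
  "comb_phase = (\<lambda>(s\<^sub>c, s\<^sub>r, w) k m. wrap_pi (phase s\<^sub>c k + real m * phase s\<^sub>r k))"

definition comb_additive :: "noise \<Rightarrow> nat \<Rightarrow> nat \<Rightarrow> complex" where
  "comb_additive = (\<lambda>(s\<^sub>c, s\<^sub>r, w) k m. w (k, m))"

definition comb_output ::
  "nat \<Rightarrow> nat \<Rightarrow> (nat \<Rightarrow> nat \<Rightarrow> complex) \<Rightarrow> noise \<Rightarrow> (nat \<Rightarrow> nat \<Rightarrow> complex)" where
  "comb_output M n x \<omega> =
     (\<lambda>k\<in>{1..n}. \<lambda>m\<in>{..<M}. exp (\<i> * of_real (comb_phase \<omega> k m)) * x k m + comb_additive \<omega> k m)"

definition input_laws :: "nat \<Rightarrow> nat \<Rightarrow> real \<Rightarrow> (nat \<Rightarrow> nat \<Rightarrow> complex) measure set" where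
  "input_laws M n \<rho> =
     {\<mu>. prob_space \<mu> \<and> sets \<mu> = sets (block_space M n) \<and>
          (\<Sum>k=1..n. \<integral>\<^sup>+ x. ennreal ((L2_set (\<lambda>m. cmod (x k m)) {..<M})\<^sup>2) \<partial>\<mu>)
            \<le> ennreal (real n * \<rho>)}"

text \<open>
  Mutual information in bits between the first \<open>n\<close> input blocks, of law \<open>\<mu>\<close>, and the first \<open>n\<close>
  output blocks, with the noise independent of the input.  The Gaussian noise makes the joint law
  absolutely continuous with respect to the product of its marginals, and under a finite power
  constraint the mutual information is finite, so the conventions of the real-valued
  \<^const>\<open>prob_space.mutual_information\<close> for the degenerate cases never come into play.
\<close>

definition comb_MI ::
  "nat \<Rightarrow> real \<Rightarrow> real \<Rightarrow> nat \<Rightarrow> (nat \<Rightarrow> nat \<Rightarrow> complex) measure \<Rightarrow> real" where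
  "comb_MI M \<sigma>\<^sub>c \<sigma>\<^sub>r n \<mu> =
     prob_space.mutual_information (\<mu> \<Otimes>\<^sub>M noise_space M \<sigma>\<^sub>c \<sigma>\<^sub>r) 2
       (block_space M n) (block_space M n)
       (\<lambda>(x, \<omega>). x) (\<lambda>(x, \<omega>). comb_output M n x \<omega>)"

text \<open>
  The limit exists for \<open>\<rho> > 0\<close>: the phases are stationary, so the suprema are superadditive in \<open>n\<close>.
\<close>

definition comb_capacity :: "nat \<Rightarrow> real \<Rightarrow> real \<Rightarrow> real \<Rightarrow> ereal" where
  "comb_capacity M \<sigma>\<^sub>c \<sigma>\<^sub>r \<rho> =
     lim (\<lambda>n. ereal (1 / real n) * (SUP \<mu> \<in> input_laws M n \<rho>. ereal (comb_MI M \<sigma>\<^sub>c \<sigma>\<^sub>r n \<mu>)))"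

text \<open>
  The library's \<^const>\<open>prob_space.entropy\<close> relative to Lebesgue measure on the plane is the joint
  differential entropy, here of a pair of independent wrapped normal variables.
\<close>

definition increment_entropy :: "real \<Rightarrow> real \<Rightarrow> real" where
  "increment_entropy \<sigma>\<^sub>c \<sigma>\<^sub>r =
     prob_space.entropy (wrapped_normal \<sigma>\<^sub>c \<Otimes>\<^sub>M wrapped_normal \<sigma>\<^sub>r) 2
       (lborel \<Otimes>\<^sub>M lborel) (\<lambda>(\<delta>\<^sub>c, \<delta>\<^sub>r). (\<delta>\<^sub>c, \<delta>\<^sub>r))"

definition alpha_star :: "nat \<Rightarrow> real" where
  "alpha_star m = (if m < 2 then 1 / 2 else 1)"

text \<open>The law of the positive variable whose square is gamma distributed.\<close>

definition amplitude_law :: "nat \<Rightarrow> real measure" where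
  "amplitude_law m =
     distr (density lborel (\<lambda>r. ennreal (gamma_density (alpha_star m) r))) borel sqrt"

text \<open>Only the values for \<open>2 \<le> m < M\<close> are meaningful.\<close>

definition g_hsnr :: "nat \<Rightarrow> nat \<Rightarrow> real" where
  "g_hsnr M m =
     (\<integral>u. (if m = 2
            then log 2 (1 + 4 * ((u 2)\<^sup>2 / (u 1)\<^sup>2) + (u 2)\<^sup>2 / (u 0)\<^sup>2)
            else log 2 (1 + (u m)\<^sup>2 / (u (m - 1))\<^sup>2 + (u m)\<^sup>2 / (u (m - 2))\<^sup>2
                          + (u m)\<^sup>2 / (u (m - 3))\<^sup>2))
        \<partial>Pi\<^sub>M {..<M} amplitude_law)"

end

theory Submission
  imports Defs
begin

text \<open>
  For a channel with bounded transition density, the mutual information is at least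
  \<open>E (log F (X, Y))\<close> for every \<open>F \<ge> 0\<close> with \<open>\<integral> F (x, y) \<mu>(dx) \<le> 1\<close> for all \<open>y\<close>, with equality for the
  information density. Taking \<open>F\<close> to be a product of two information densities and shifting the
  stationary noise, one sees that the maximal information is superadditive in the number of blocks,
  so the capacity is a supremum over block lengths.

  The input has independent symbols, scaled by \<open>s\<close> with \<open>s\<^sup>2 = \<rho> / (M - 1)\<close>: the first two are a real
  Gaussian amplitude with a uniform phase, the others are circularly symmetric Gaussian. The
  function \<open>F\<close> is a product over blocks and symbols, each factor of mean at most \<open>1\<close> over the current
  symbol. The first two symbols of a block are scored by their amplitude and by the density of the
  phase increment relative to the previous block; symbol \<open>m \<ge> 2\<close> is scored by a Gaussian around its
  prediction from the phases observed on earlier symbols of the block. As \<open>s \<rightarrow> \<infinity>\<close> the observed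
  phases become exact, and dominated convergence gives the expected score up to \<open>o(1)\<close>.
\<close>

text \<open>Bounding by a score \<open>F\<close> sidesteps the output law, whose phase memory
  couples all blocks: the constraint on \<open>F\<close> is imposed for each fixed output, so only
  averages over the independent inputs occur, and they are taken one symbol at a time because each
  factor looks at present and past inputs only. The constants arise as follows. Relative to
  \<open>ln s\<close> for each of the first two symbols and \<open>2 * ln s\<close> for the others,
  the energy terms cancel the noise terms: shape 1/2 against radial noise of mean square 1/2, shape
  1 against a normalised prediction error of mean at most 1. The shapes add up to
  \<open>M - 1\<close>, hence the scale of the input. The first two symbols each lose
  \<open>ln 2\<close>, as only the modulus of a signed Gaussian amplitude is scored; this turns
  \<open>2 * log 2 (2 * pi)\<close> into \<open>2 * log 2 pi\<close>. The obstacle is domination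
  uniform in \<open>s\<close>: small inputs spoil the observed phases and make logarithms singular.
  The variance of the Gaussian score is chosen so large that the normalised error is bounded by a
  polynomial in the noise alone, and a density of order \<open>r powr (-1/2)\<close> at 0 leaves the
  remaining logarithms integrable.\<close>

section \<open>Mutual information as a maximum over scores\<close>

text \<open>Gibbs inequality in variational form: \<open>ln (F / D) \<le> F / D - 1\<close>, and the
  mean of \<open>F / D\<close> under \<open>density M D\<close> is at most the integral of
  \<open>F\<close> over \<open>M\<close>.\<close>

lemma KL_divergence_ge_integral_log:
  fixes D F :: "'a \<Rightarrow> real"
  assumes M: "prob_space M"
    and [measurable]: "D \<in> borel_measurable M" and D0: "\<And>x. x \<in> space M \<Longrightarrow> 0 \<le> D x"
    and P: "prob_space (density M D)"
    and [measurable]: "F \<in> borel_measurable M" and F0: "\<And>x. x \<in> space M \<Longrightarrow> 0 \<le> F x"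
    and F1: "(\<integral>\<^sup>+x. F x \<partial>M) \<le> 1"
    and Fpos: "AE x in density M D. 0 < F x"
    and intF: "integrable (density M D) (\<lambda>x. ln (F x))"
    and intD: "integrable (density M D) (\<lambda>x. ln (D x))"
  shows "(\<integral>x. log 2 (F x) \<partial>density M D) \<le> KL_divergence 2 M (density M D)"
proof -
  interpret M: prob_space M by fact
  interpret P: prob_space "density M D" by fact
  have Dae: "AE x in M. 0 \<le> D x"
    using D0 by auto
  have KL: "KL_divergence 2 M (density M D) = (\<integral>x. log 2 (D x) \<partial>density M D)"
    by (subst M.KL_density) (use Dae in \<open>auto simp: integral_density\<close>)
  have Dpos: "AE x in density M D. 0 < D x"
    by (subst AE_density) auto
  \<comment> \<open>Only an inequality: mass of \<open>F\<close> on the set where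
    \<open>D = 0\<close> is lost under \<open>density M D\<close>.\<close>
  have nn: "(\<integral>\<^sup>+x. ennreal (F x / D x) \<partial>density M D) \<le> 1"
  proof -
    have "(\<integral>\<^sup>+x. ennreal (F x / D x) \<partial>density M D) = (\<integral>\<^sup>+x. ennreal (D x) * ennreal (F x / D x) \<partial>M)"
      by (subst nn_integral_density) auto
    also have "\<dots> \<le> (\<integral>\<^sup>+x. F x \<partial>M)"
      by (intro nn_integral_mono) (use D0 F0 in \<open>auto simp flip: ennreal_mult'\<close>)
    finally show ?thesis
      using F1 by simp
  qed
  have int: "integrable (density M D) (\<lambda>x. F x / D x)"
    using nn D0 F0
    by (intro integrableI_nonneg) (auto intro: le_less_trans)
  have "(\<integral>x. F x / D x \<partial>density M D) \<le> 1"
    using nn by (intro integral_real_bounded) (auto simp: one_ennreal_def)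
  moreover have "(\<integral>x. ln (F x) - ln (D x) \<partial>density M D) \<le> (\<integral>x. F x / D x - 1 \<partial>density M D)"
  proof (rule integral_mono_AE)
    show "AE x in density M D. ln (F x) - ln (D x) \<le> F x / D x - 1"
      using Fpos Dpos
    proof eventually_elim
      case (elim x)
      have "ln (F x / D x) \<le> F x / D x - 1"
        using elim by (intro ln_le_minus_one) auto
      then show ?case
        using elim by (simp add: ln_div)
    qed
  qed (use intF intD int in auto)
  ultimately have "(\<integral>x. ln (F x) \<partial>density M D) \<le> (\<integral>x. ln (D x) \<partial>density M D)"
    using intF intD int P.prob_space by simp
  then show ?thesis
    unfolding KL log_def by (simp add: divide_right_mono)
qed

text \<open>The assumption \<open>dom\<close> expresses that every conditional output law has a
  density at most \<open>exp (S y)\<close> relative to \<open>Q\<close>. It is phrased through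
  integrals, so that no kernel or conditional density has to be constructed. Integrability of
  \<open>S\<close> along the output bounds the information density from above.\<close>

locale dominated_channel = X: prob_space X + N: prob_space N + Q: prob_space Q
  for X :: "'x measure" and N :: "'n measure" and Q :: "'y measure" +
  fixes Y :: "'x \<Rightarrow> 'n \<Rightarrow> 'y" and S :: "'y \<Rightarrow> real"
  assumes Y: "(\<lambda>(x, \<omega>). Y x \<omega>) \<in> measurable (X \<Otimes>\<^sub>M N) Q"
    and S[measurable]: "S \<in> borel_measurable Q" and S_nonneg: "\<And>y. 0 \<le> S y"
    and dom: "\<And>x h. x \<in> space X \<Longrightarrow> h \<in> borel_measurable Q \<Longrightarrow>
      (\<integral>\<^sup>+\<omega>. h (Y x \<omega>) \<partial>N) \<le> (\<integral>\<^sup>+y. h y * ennreal (exp (S y)) \<partial>Q)"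
    and int_S: "integrable (X \<Otimes>\<^sub>M N) (\<lambda>(x, \<omega>). S (Y x \<omega>))"
begin

sublocale XN: pair_prob_space X N ..
sublocale XQ: pair_prob_space X Q ..

definition joint :: "('x \<times> 'y) measure" where
  "joint = distr (X \<Otimes>\<^sub>M N) (X \<Otimes>\<^sub>M Q) (\<lambda>(x, \<omega>). (x, Y x \<omega>))"

definition output_law :: "'y measure" where
  "output_law = distr (X \<Otimes>\<^sub>M N) Q (\<lambda>(x, \<omega>). Y x \<omega>)"

lemma Y_joint[measurable]: "(\<lambda>(x, \<omega>). (x, Y x \<omega>)) \<in> measurable (X \<Otimes>\<^sub>M N) (X \<Otimes>\<^sub>M Q)"
  using Y by (auto simp: split_beta' intro!: measurable_Pair)

lemma sets_joint[measurable_cong, simp]: "sets joint = sets (X \<Otimes>\<^sub>M Q)"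
  by (simp add: joint_def)

lemma sets_output_law[measurable_cong, simp]: "sets output_law = sets Q"
  by (simp add: output_law_def)

lemma prob_space_joint: "prob_space joint"
  unfolding joint_def by (intro XN.prob_space_distr) auto

lemma prob_space_output_law: "prob_space output_law"
  unfolding output_law_def using Y by (intro XN.prob_space_distr)

lemma nn_integral_joint_le:
  assumes h[measurable]: "h \<in> borel_measurable (X \<Otimes>\<^sub>M Q)"
  shows "(\<integral>\<^sup>+z. h z \<partial>joint) \<le> (\<integral>\<^sup>+z. h z * ennreal (exp (S (snd z))) \<partial>(X \<Otimes>\<^sub>M Q))"
proof -
  have "(\<integral>\<^sup>+z. h z \<partial>joint) = (\<integral>\<^sup>+z. h ((\<lambda>(x, \<omega>). (x, Y x \<omega>)) z) \<partial>(X \<Otimes>\<^sub>M N))"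
    unfolding joint_def by (subst nn_integral_distr) auto
  also have "\<dots> = (\<integral>\<^sup>+x. \<integral>\<^sup>+\<omega>. h (x, Y x \<omega>) \<partial>N \<partial>X)"
    by (subst N.nn_integral_fst[symmetric]) auto
  also have "\<dots> \<le> (\<integral>\<^sup>+x. \<integral>\<^sup>+y. h (x, y) * ennreal (exp (S y)) \<partial>Q \<partial>X)"
    by (intro nn_integral_mono dom) auto
  also have "\<dots> = (\<integral>\<^sup>+z. h z * ennreal (exp (S (snd z))) \<partial>(X \<Otimes>\<^sub>M Q))"
    by (subst Q.nn_integral_fst[symmetric]) auto
  finally show ?thesis .
qed

text \<open>A Radon-Nikodym derivative obeys the bound only almost everywhere. Truncating it at
  \<open>exp (S (snd z))\<close> changes it on a null set and gives the bound at every point, which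
  later makes the output density finite for every \<open>y\<close>.\<close>

lemma ex_joint_density:
  "\<exists>p. p \<in> borel_measurable (X \<Otimes>\<^sub>M Q) \<and> (\<forall>z. 0 \<le> p z \<and> p z \<le> exp (S (snd z))) \<and>
    joint = density (X \<Otimes>\<^sub>M Q) (\<lambda>z. ennreal (p z))"
proof -
  let ?R = "X \<Otimes>\<^sub>M Q" and ?e = "\<lambda>z. ennreal (exp (S (snd z)))"
  interpret J: prob_space joint by (rule prob_space_joint)
  have ac: "absolutely_continuous ?R joint"
    unfolding absolutely_continuous_def
  proof
    fix A assume A: "A \<in> null_sets ?R"
    then have [measurable]: "A \<in> sets ?R" by auto
    have "emeasure joint A = (\<integral>\<^sup>+z. indicator A z \<partial>joint)"
      by simp
    also have "\<dots> \<le> (\<integral>\<^sup>+z. indicator A z * ?e z \<partial>?R)"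
      by (rule nn_integral_joint_le) auto
    also have "\<dots> = (\<integral>\<^sup>+z. ?e z * indicator A z \<partial>?R)"
      by (simp add: mult.commute)
    also have "\<dots> = 0"
      using A by (rule nn_integral_null_set)
    finally show "A \<in> null_sets joint"
      using A by (auto simp: null_sets_def)
  qed
  define q where "q = RN_deriv ?R joint"
  have [measurable]: "q \<in> borel_measurable ?R" unfolding q_def by simp
  have dq: "density ?R q = joint"
    unfolding q_def using ac by (intro XQ.density_RN_deriv) auto
  \<comment> \<open>On the set where the derivative exceeds the bound, domination forces both
    functions to have the same finite integral, so the excess vanishes almost everywhere.\<close>
  define A where "A = {z \<in> space ?R. q z > ?e z}"
  have [measurable]: "A \<in> sets ?R" unfolding A_def by measurable
  have q_A: "(\<integral>\<^sup>+z. q z * indicator A z \<partial>?R) = emeasure joint A"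
    by (subst dq[symmetric]) (simp add: emeasure_density)
  have e_A: "(\<integral>\<^sup>+z. ?e z * indicator A z \<partial>?R) \<ge> emeasure joint A"
  proof -
    have "emeasure joint A = (\<integral>\<^sup>+z. indicator A z \<partial>joint)"
      by simp
    also have "\<dots> \<le> (\<integral>\<^sup>+z. indicator A z * ?e z \<partial>?R)"
      by (rule nn_integral_joint_le) auto
    finally show ?thesis
      by (simp add: mult.commute)
  qed
  have e_A': "(\<integral>\<^sup>+z. ?e z * indicator A z \<partial>?R) \<le> emeasure joint A"
    unfolding q_A[symmetric] by (intro nn_integral_mono) (auto simp: A_def split: split_indicator)
  have "(\<integral>\<^sup>+z. q z * indicator A z - ?e z * indicator A z \<partial>?R) =
      (\<integral>\<^sup>+z. q z * indicator A z \<partial>?R) - (\<integral>\<^sup>+z. ?e z * indicator A z \<partial>?R)"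
    using e_A' J.emeasure_finite[of A]
    by (intro nn_integral_diff) (auto simp: A_def top_unique split: split_indicator)
  also have "\<dots> = 0"
    using e_A e_A' J.emeasure_finite[of A] unfolding q_A by (simp add: antisym)
  finally have "AE z in ?R. q z * indicator A z - ?e z * indicator A z = 0"
    by (subst (asm) nn_integral_0_iff_AE) auto
  then have q_le: "AE z in ?R. q z \<le> ?e z"
    using AE_space
  proof eventually_elim
    case (elim z)
    show ?case
    proof (rule ccontr)
      assume "\<not> q z \<le> ?e z"
      with elim have "z \<in> A" "q z > ?e z" by (auto simp: A_def)
      with elim show False
        by (auto simp: diff_eq_0_iff_ennreal top_unique)
    qed
  qed
  define p where "p z = enn2real (min (q z) (?e z))" for z
  have p: "ennreal (p z) = min (q z) (?e z)" for z
    unfolding p_def by (intro ennreal_enn2real le_less_trans[OF min.cobounded2]) simp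
  have [measurable]: "p \<in> borel_measurable ?R"
    unfolding p_def by measurable
  have "density ?R (\<lambda>z. ennreal (p z)) = density ?R q"
    by (rule density_cong) (use q_le in \<open>auto simp: p min_def\<close>)
  moreover have "p z \<le> exp (S (snd z))" for z
  proof -
    have "ennreal (p z) \<le> ?e z" by (simp add: p)
    then show ?thesis by simp
  qed
  ultimately show ?thesis
    using dq by (intro exI[of _ p]) (auto simp: p_def)
qed

lemma mutual_information_channel:
  assumes "sets BX = sets X" "sets BY = sets Q"
  shows "prob_space.mutual_information (X \<Otimes>\<^sub>M N) 2 BX BY (\<lambda>(x, \<omega>). x) (\<lambda>(x, \<omega>). Y x \<omega>)
    = KL_divergence 2 (X \<Otimes>\<^sub>M output_law) joint"
proof -
  have "distr (X \<Otimes>\<^sub>M N) BX (\<lambda>(x, \<omega>). x) = distr (X \<Otimes>\<^sub>M N) X fst"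
    using assms by (intro distr_cong) auto
  then have 1: "distr (X \<Otimes>\<^sub>M N) BX (\<lambda>(x, \<omega>). x) = X"
    by (simp add: N.distr_pair_fst)
  have 2: "distr (X \<Otimes>\<^sub>M N) BY (\<lambda>(x, \<omega>). Y x \<omega>) = output_law"
    unfolding output_law_def using assms by (intro distr_cong) auto
  have 3: "distr (X \<Otimes>\<^sub>M N) (BX \<Otimes>\<^sub>M BY) (\<lambda>x. ((\<lambda>(x, \<omega>). x) x, (\<lambda>(x, \<omega>). Y x \<omega>) x)) = joint"
    unfolding joint_def using assms by (intro distr_cong sets_pair_measure_cong) auto
  show ?thesis
    unfolding XN.mutual_information_def 1 2 3 ..
qed

text \<open>The witness is the joint density divided by the output density \<open>g\<close>. Its
  logarithm is integrable because \<open>ln D \<le> S + 1 / g\<close> and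
  \<open>- ln D \<le> 1 / D\<close>, where \<open>1 / g\<close> and \<open>1 / D\<close> have mean
  at most 1 under the joint law.\<close>

lemma ex_information_density:
  "\<exists>D. D \<in> borel_measurable (X \<Otimes>\<^sub>M Q) \<and> (\<forall>z. 0 \<le> D z) \<and>
    (\<forall>y\<in>space Q. (\<integral>\<^sup>+x. ennreal (D (x, y)) \<partial>X) \<le> 1) \<and>
    joint = density (X \<Otimes>\<^sub>M output_law) (\<lambda>z. ennreal (D z)) \<and>
    integrable joint (\<lambda>z. ln (D z))"
proof -
  let ?R = "X \<Otimes>\<^sub>M Q"
  interpret J: prob_space joint by (rule prob_space_joint)
  interpret O: prob_space output_law by (rule prob_space_output_law)
  obtain p where [measurable]: "p \<in> borel_measurable ?R" and p0: "\<And>z. 0 \<le> p z"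
    and p1: "\<And>z. p z \<le> exp (S (snd z))" and J: "joint = density ?R (\<lambda>z. ennreal (p z))"
    using ex_joint_density by blast
  define g where "g y = enn2real (\<integral>\<^sup>+x. ennreal (p (x, y)) \<partial>X)" for y
  have [measurable]: "g \<in> borel_measurable Q" unfolding g_def by measurable
  have g0: "0 \<le> g y" for y by (simp add: g_def)
  have g: "ennreal (g y) = (\<integral>\<^sup>+x. ennreal (p (x, y)) \<partial>X)" for y
  proof -
    have "(\<integral>\<^sup>+x. ennreal (p (x, y)) \<partial>X) \<le> (\<integral>\<^sup>+x. ennreal (exp (S y)) \<partial>X)"
      by (intro nn_integral_mono) (use p1[of "(_, y)"] in \<open>auto intro!: ennreal_leI\<close>)
    also have "\<dots> < \<top>"
      by (simp add: X.emeasure_space_1)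
    finally show ?thesis
      unfolding g_def by simp
  qed
  have out: "output_law = density Q (\<lambda>y. ennreal (g y))"
  proof (rule measure_eqI)
    fix A assume "A \<in> sets output_law"
    then have [measurable]: "A \<in> sets Q" by simp
    have "emeasure output_law A = emeasure joint (space X \<times> A)"
      unfolding output_law_def joint_def using Y
      by (subst (1 2) emeasure_distr) (auto intro!: arg_cong[where f="emeasure _"] simp: space_pair_measure)
    also have "\<dots> = (\<integral>\<^sup>+z. ennreal (p z) * indicator (space X \<times> A) z \<partial>?R)"
      unfolding J by (subst emeasure_density) auto
    also have "\<dots> = (\<integral>\<^sup>+y. \<integral>\<^sup>+x. ennreal (p (x, y)) * indicator (space X \<times> A) (x, y) \<partial>X \<partial>Q)"
      by (subst XQ.nn_integral_snd[symmetric]) (auto simp: split_beta')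
    also have "\<dots> = (\<integral>\<^sup>+y. \<integral>\<^sup>+x. ennreal (p (x, y)) * indicator A y \<partial>X \<partial>Q)"
      by (intro nn_integral_cong) (auto split: split_indicator)
    also have "\<dots> = (\<integral>\<^sup>+y. ennreal (g y) * indicator A y \<partial>Q)"
      by (intro nn_integral_cong) (simp add: nn_integral_multc g)
    also have "\<dots> = emeasure (density Q (\<lambda>y. ennreal (g y))) A"
      by (subst emeasure_density) auto
    finally show "emeasure output_law A = emeasure (density Q (\<lambda>y. ennreal (g y))) A" .
  qed simp
  have Xout: "X \<Otimes>\<^sub>M output_law = density ?R (\<lambda>(x, y). 1 * ennreal (g y))"
    unfolding out by (subst (1) density_1[symmetric, of X], subst pair_measure_density)
      (use O.sigma_finite_measure_axioms in \<open>auto simp: out[symmetric] Q.sigma_finite_measure_axioms\<close>)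
  \<comment> \<open>Division by zero gives \<open>D = 0\<close> where \<open>g\<close> vanishes, so
    the average over the input is at most 1 for every \<open>y\<close> and not merely for almost
    every one.\<close>
  define D where "D z = p z / g (snd z)" for z
  have [measurable]: "D \<in> borel_measurable ?R" unfolding D_def by measurable
  have D0: "0 \<le> D z" for z by (simp add: D_def p0 g0)
  have D1: "(\<integral>\<^sup>+x. ennreal (D (x, y)) \<partial>X) \<le> 1" if "y \<in> space Q" for y
  proof (cases "g y = 0")
    case False
    then have gy: "g y > 0" using g0[of y] by simp
    have "(\<integral>\<^sup>+x. ennreal (D (x, y)) \<partial>X) = (\<integral>\<^sup>+x. ennreal (p (x, y)) * ennreal (1 / g y) \<partial>X)"
      by (intro nn_integral_cong) (use p0 g0 in \<open>simp add: D_def flip: ennreal_mult'\<close>)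
    also have "\<dots> = ennreal (g y) * ennreal (1 / g y)"
      using that by (subst nn_integral_multc) (auto simp: g)
    also have "\<dots> = 1"
      using gy by (simp flip: ennreal_mult')
    finally show ?thesis by simp
  qed (simp add: D_def)
  have g_AE: "AE z in joint. 0 < g (snd z)"
  proof -
    have "AE y in output_law. 0 < g y"
      unfolding out by (subst AE_density) (auto)
    then show ?thesis
      unfolding output_law_def joint_def using Y
      by (subst (asm) AE_distr_iff, simp, simp, subst AE_distr_iff) (auto simp: split_beta')
  qed
  have JD: "joint = density (X \<Otimes>\<^sub>M output_law) (\<lambda>z. ennreal (D z))"
  proof -
    have "AE z in ?R. 0 < p z \<longrightarrow> 0 < g (snd z)"
      using g_AE unfolding J by (subst (asm) AE_density) auto
    then have "density ?R (\<lambda>z. ennreal (p z)) = density ?R (\<lambda>z. (\<lambda>(x, y). 1 * ennreal (g y)) z * ennreal (D z))"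
    proof (intro density_cong)
      show "AE z in ?R. 0 < p z \<longrightarrow> 0 < g (snd z) \<Longrightarrow>
          AE z in ?R. ennreal (p z) = (\<lambda>(x, y). 1 * ennreal (g y)) z * ennreal (D z)"
      proof (elim eventually_mono)
        fix z assume "0 < p z \<longrightarrow> 0 < g (snd z)"
        then show "ennreal (p z) = (\<lambda>(x, y). 1 * ennreal (g y)) z * ennreal (D z)"
          using p0[of z] g0[of "snd z"]
          by (cases "p z = 0") (auto simp: D_def split_beta' simp flip: ennreal_mult')
      qed
    qed auto
    also have "\<dots> = density (density ?R (\<lambda>(x, y). 1 * ennreal (g y))) (\<lambda>z. ennreal (D z))"
      by (rule density_density_eq[symmetric]) auto
    finally show ?thesis unfolding J Xout .
  qed
  \<comment> \<open>Under the output law the weight \<open>g\<close> cancels \<open>1 / g\<close>,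
    leaving the \<open>Q\<close>-mass of the set where \<open>g\<close> is positive.\<close>
  have intg: "(\<integral>\<^sup>+z. ennreal (1 / g (snd z)) \<partial>joint) \<le> 1"
  proof -
    have "(\<integral>\<^sup>+z. ennreal (1 / g (snd z)) \<partial>joint) = (\<integral>\<^sup>+y. ennreal (1 / g y) \<partial>output_law)"
      unfolding joint_def output_law_def using Y
      by (subst (1 2) nn_integral_distr) (auto simp: split_beta')
    also have "\<dots> = (\<integral>\<^sup>+y. ennreal (g y) * ennreal (1 / g y) \<partial>Q)"
      unfolding out by (subst nn_integral_density) auto
    also have "\<dots> \<le> (\<integral>\<^sup>+y. 1 \<partial>Q)"
      using g0 by (intro nn_integral_mono) (auto simp flip: ennreal_mult')
    finally show ?thesis by (simp add: Q.emeasure_space_1)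
  qed
  have XO: "prob_space (X \<Otimes>\<^sub>M output_law)"
    by (intro prob_space_pair X.prob_space_axioms O.prob_space_axioms)
  have mD[measurable]: "D \<in> borel_measurable (X \<Otimes>\<^sub>M output_law)"
    by (simp cong: measurable_cong_sets)
  have intD: "(\<integral>\<^sup>+z. ennreal (1 / D z) \<partial>joint) \<le> 1"
  proof -
    have "(\<integral>\<^sup>+z. ennreal (1 / D z) \<partial>joint) = (\<integral>\<^sup>+z. ennreal (D z) * ennreal (1 / D z) \<partial>(X \<Otimes>\<^sub>M output_law))"
      unfolding JD by (subst nn_integral_density) auto
    also have "\<dots> \<le> (\<integral>\<^sup>+z. 1 \<partial>(X \<Otimes>\<^sub>M output_law))"
      using D0 by (intro nn_integral_mono) (auto simp flip: ennreal_mult')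
    finally show ?thesis by (simp add: prob_space.emeasure_space_1[OF XO])
  qed
  have i1: "integrable joint (\<lambda>z. 1 / g (snd z))" "integrable joint (\<lambda>z. 1 / D z)"
    using intg intD g0 D0
    by (auto intro!: integrableI_nonneg intro: le_less_trans)
  have i2: "integrable joint (\<lambda>z. S (snd z))"
    unfolding joint_def using int_S by (subst integrable_distr_eq) (auto simp: split_beta')
  have D_AE: "AE z in joint. 0 < D z"
    unfolding JD by (subst AE_density) auto
  have "integrable joint (\<lambda>z. ln (D z))"
  proof (rule Bochner_Integration.integrable_bound)
    show "integrable joint (\<lambda>z. S (snd z) + 1 / g (snd z) + 1 / D z)"
      using i1 i2 by auto
    show "AE z in joint. norm (ln (D z)) \<le> norm (S (snd z) + 1 / g (snd z) + 1 / D z)"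
      using g_AE D_AE
    proof eventually_elim
      case (elim z)
      have "D z \<le> exp (S (snd z)) * (1 / g (snd z))"
        using p1[of z] elim by (simp add: D_def divide_right_mono)
      then have "ln (D z) \<le> ln (exp (S (snd z)) * (1 / g (snd z)))"
        using elim by (subst ln_le_cancel_iff) auto
      also have "\<dots> = S (snd z) + ln (1 / g (snd z))"
        using elim by (subst ln_mult) auto
      also have "ln (1 / g (snd z)) \<le> 1 / g (snd z)"
        using elim by (intro ln_bound) auto
      finally have a: "ln (D z) \<le> S (snd z) + 1 / g (snd z)" by simp
      have "ln (1 / D z) \<le> 1 / D z"
        using elim by (intro ln_bound) auto
      then have b: "- ln (D z) \<le> 1 / D z"
        using elim by (simp add: ln_div)
      have "S (snd z) \<ge> 0" "1 / g (snd z) > 0" "1 / D z > 0"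
        using elim S_nonneg by auto
      then show ?case using a b unfolding real_norm_def by linarith
    qed
  qed auto
  then show ?thesis
    using D0 D1 JD by (intro exI[of _ D]) auto
qed

text \<open>The constraint is pointwise in \<open>y\<close>, so integrating over the input first
  gives mean at most 1 under the product of the marginals, whatever the output law is. Hence the
  output law never has to be computed.\<close>

theorem information_ge:
  fixes F :: "'x \<times> 'y \<Rightarrow> real"
  assumes B: "sets BX = sets X" "sets BY = sets Q"
    and [measurable]: "F \<in> borel_measurable (X \<Otimes>\<^sub>M Q)" and F0: "\<And>z. z \<in> space (X \<Otimes>\<^sub>M Q) \<Longrightarrow> 0 \<le> F z"
    and F1: "\<And>y. y \<in> space Q \<Longrightarrow> (\<integral>\<^sup>+x. ennreal (F (x, y)) \<partial>X) \<le> 1"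
    and Fpos: "AE (x, \<omega>) in X \<Otimes>\<^sub>M N. 0 < F (x, Y x \<omega>)"
    and int: "integrable (X \<Otimes>\<^sub>M N) (\<lambda>(x, \<omega>). ln (F (x, Y x \<omega>)))"
  shows "(\<integral>(x, \<omega>). log 2 (F (x, Y x \<omega>)) \<partial>(X \<Otimes>\<^sub>M N)) \<le>
    prob_space.mutual_information (X \<Otimes>\<^sub>M N) 2 BX BY (\<lambda>(x, \<omega>). x) (\<lambda>(x, \<omega>). Y x \<omega>)"
proof -
  interpret O: prob_space output_law by (rule prob_space_output_law)
  interpret XO: pair_prob_space X output_law ..
  obtain D where [measurable]: "D \<in> borel_measurable (X \<Otimes>\<^sub>M Q)" and D0: "\<And>z. 0 \<le> D z"
    and J: "joint = density (X \<Otimes>\<^sub>M output_law) (\<lambda>z. ennreal (D z))" and D: "integrable joint (\<lambda>z. ln (D z))"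
    using ex_information_density by blast
  have sp: "space (X \<Otimes>\<^sub>M output_law) = space (X \<Otimes>\<^sub>M Q)" "space output_law = space Q"
    by (auto intro!: sets_eq_imp_space_eq)
  have "(\<integral>z. log 2 (F z) \<partial>density (X \<Otimes>\<^sub>M output_law) (\<lambda>z. ennreal (D z))) \<le>
      KL_divergence 2 (X \<Otimes>\<^sub>M output_law) (density (X \<Otimes>\<^sub>M output_law) (\<lambda>z. ennreal (D z)))"
  proof (rule KL_divergence_ge_integral_log)
    show "prob_space (X \<Otimes>\<^sub>M output_law)"
      by (intro prob_space_pair X.prob_space_axioms O.prob_space_axioms)
    show "prob_space (density (X \<Otimes>\<^sub>M output_law) (\<lambda>z. ennreal (D z)))"
      unfolding J[symmetric] by (rule prob_space_joint)
    show "(\<integral>\<^sup>+z. ennreal (F z) \<partial>(X \<Otimes>\<^sub>M output_law)) \<le> 1"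
    proof -
      have "(\<integral>\<^sup>+z. ennreal (F z) \<partial>(X \<Otimes>\<^sub>M output_law)) = (\<integral>\<^sup>+y. \<integral>\<^sup>+x. ennreal (F (x, y)) \<partial>X \<partial>output_law)"
        by (subst XO.nn_integral_snd[symmetric]) (auto simp: split_beta')
      also have "\<dots> \<le> (\<integral>\<^sup>+y. 1 \<partial>output_law)"
        by (intro nn_integral_mono F1) (simp add: sp)
      finally show ?thesis by (simp add: O.emeasure_space_1)
    qed
    show "AE z in density (X \<Otimes>\<^sub>M output_law) (\<lambda>z. ennreal (D z)). 0 < F z"
      unfolding J[symmetric] joint_def using Fpos by (subst AE_distr_iff) (auto simp: split_beta')
    show "integrable (density (X \<Otimes>\<^sub>M output_law) (\<lambda>z. ennreal (D z))) (\<lambda>z. ln (F z))"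
      unfolding J[symmetric] joint_def using int by (subst integrable_distr_eq) (auto simp: split_beta')
    show "integrable (density (X \<Otimes>\<^sub>M output_law) (\<lambda>z. ennreal (D z))) (\<lambda>z. ln (D z))"
      unfolding J[symmetric] by fact
  qed (use D0 F0 sp in auto)
  then have "(\<integral>z. log 2 (F z) \<partial>joint) \<le> KL_divergence 2 (X \<Otimes>\<^sub>M output_law) joint"
    unfolding J[symmetric] .
  moreover have "(\<integral>z. log 2 (F z) \<partial>joint) = (\<integral>(x, \<omega>). log 2 (F (x, Y x \<omega>)) \<partial>(X \<Otimes>\<^sub>M N))"
    unfolding joint_def by (subst integral_distr) (auto simp: split_beta')
  ultimately show ?thesis
    unfolding mutual_information_channel[OF B] by simp
qed

text \<open>The information density itself satisfies all conditions of
  \<open>information_ge\<close>, so the variational bound is attained. Attainment is what allows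
  optimal scores of short channels to be multiplied into a score of a long one.\<close>

theorem information_eq:
  assumes B: "sets BX = sets X" "sets BY = sets Q"
  shows "\<exists>F :: 'x \<times> 'y \<Rightarrow> real. F \<in> borel_measurable (X \<Otimes>\<^sub>M Q) \<and> (\<forall>z. 0 \<le> F z) \<and>
    (\<forall>y\<in>space Q. (\<integral>\<^sup>+x. ennreal (F (x, y)) \<partial>X) \<le> 1) \<and>
    (AE (x, \<omega>) in X \<Otimes>\<^sub>M N. 0 < F (x, Y x \<omega>)) \<and>
    integrable (X \<Otimes>\<^sub>M N) (\<lambda>(x, \<omega>). ln (F (x, Y x \<omega>))) \<and>
    prob_space.mutual_information (X \<Otimes>\<^sub>M N) 2 BX BY (\<lambda>(x, \<omega>). x) (\<lambda>(x, \<omega>). Y x \<omega>)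
      = (\<integral>(x, \<omega>). log 2 (F (x, Y x \<omega>)) \<partial>(X \<Otimes>\<^sub>M N))"
proof -
  interpret O: prob_space output_law by (rule prob_space_output_law)
  interpret XO: pair_prob_space X output_law ..
  obtain D where D[measurable]: "D \<in> borel_measurable (X \<Otimes>\<^sub>M Q)" and D0: "\<And>z. 0 \<le> D z"
    and D1: "\<forall>y\<in>space Q. (\<integral>\<^sup>+x. ennreal (D (x, y)) \<partial>X) \<le> 1"
    and J: "joint = density (X \<Otimes>\<^sub>M output_law) (\<lambda>z. ennreal (D z))" and int: "integrable joint (\<lambda>z. ln (D z))"
    using ex_information_density by blast
  have mD[measurable]: "D \<in> borel_measurable (X \<Otimes>\<^sub>M output_law)"
    by (simp cong: measurable_cong_sets)
  have D_AE: "AE z in joint. 0 < D z"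
    unfolding J by (subst AE_density) auto
  then have 1: "AE (x, \<omega>) in X \<Otimes>\<^sub>M N. 0 < D (x, Y x \<omega>)"
    unfolding joint_def by (subst (asm) AE_distr_iff) (auto simp: split_beta')
  have 2: "integrable (X \<Otimes>\<^sub>M N) (\<lambda>(x, \<omega>). ln (D (x, Y x \<omega>)))"
    using int unfolding joint_def by (subst (asm) integrable_distr_eq) (auto simp: split_beta')
  have "KL_divergence 2 (X \<Otimes>\<^sub>M output_law) joint = (\<integral>z. log 2 (D z) \<partial>joint)"
    unfolding J by (subst XO.KL_density) (auto simp: D0 integral_density)
  also have "\<dots> = (\<integral>(x, \<omega>). log 2 (D (x, Y x \<omega>)) \<partial>(X \<Otimes>\<^sub>M N))"
    unfolding joint_def by (subst integral_distr) (auto simp: split_beta')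
  finally show ?thesis
    unfolding mutual_information_channel[OF B] using D D0 D1 1 2 by blast
qed

end

section \<open>Reduction modulo the period\<close>

lemma wrap_pi_cong: "\<exists>k::int. wrap_pi x = x + 2 * pi * of_int k"
proof -
  have "[x + pi = (x + pi) rmod (2 * pi)] (rmod (2 * pi))"
    by simp
  then obtain n where "(x + pi) rmod (2 * pi) = x + pi + of_int n * (2 * pi)"
    unfolding rcong_altdef by auto
  then show ?thesis
    unfolding wrap_pi_def by (intro exI[of _ n]) simp
qed

lemma wrap_pi_bounds: "- pi \<le> wrap_pi x" "wrap_pi x < pi"
  using rmod_nonneg[of "2 * pi" "x + pi"] rmod_less[of "2 * pi" "x + pi"]
  by (auto simp: wrap_pi_def)

lemma wrap_pi_add_period: "wrap_pi (x + 2 * pi * of_int k) = wrap_pi x"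
proof -
  have "(x + pi + of_int k * (2 * pi)) rmod (2 * pi) = ((x + pi) rmod (2 * pi) + (of_int k * (2 * pi)) rmod (2 * pi)) rmod (2 * pi)"
    by (rule rmod_add[symmetric])
  then have "(x + pi + of_int k * (2 * pi)) rmod (2 * pi) = (x + pi) rmod (2 * pi)"
    by simp
  then show ?thesis
    by (simp add: wrap_pi_def algebra_simps)
qed

lemma wrap_pi_id: "- pi \<le> x \<Longrightarrow> x < pi \<Longrightarrow> wrap_pi x = x"
  by (simp add: wrap_pi_def)

lemma cis_wrap_pi [simp]: "cis (wrap_pi x) = cis x"
proof -
  obtain k :: int where "wrap_pi x = x + 2 * pi * of_int k"
    using wrap_pi_cong by blast
  then show ?thesis
    unfolding cis_eq_iff rcong_altdef by (intro exI[of _ "-k"]) simp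
qed

text \<open>Phases are compared through \<open>cis\<close> from here on; this carries such
  comparisons back to functions of \<open>wrap_pi\<close>.\<close>

lemma wrap_pi_eqI: "cis x = cis y \<Longrightarrow> wrap_pi x = wrap_pi y"
  unfolding cis_eq_iff rcong_altdef using wrap_pi_add_period[of x] by (auto simp: mult_ac)

lemma measurable_wrap_pi [measurable]: "wrap_pi \<in> borel_measurable borel"
  unfolding wrap_pi_def rmod_def by measurable

lemma measurable_circ_add [measurable]:
  "case_prod circ_add \<in> borel_measurable (borel \<Otimes>\<^sub>M borel)"
  unfolding circ_add_def by measurable

text \<open>The translates of \<open>{-pi..<pi}\<close> by multiples of \<open>2 * pi\<close> tile
  the line. The enumeration \<open>int_decode\<close> indexes them by natural numbers, so that
  series over the tiles are ordinary \<open>suminf\<close>.\<close>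

lemma unique_period: "\<exists>!n. x - 2 * pi * of_int (int_decode n) \<in> {-pi..<pi}"
proof -
  obtain k :: int where k: "wrap_pi x = x + 2 * pi * of_int k"
    using wrap_pi_cong by blast
  show ?thesis
  proof (rule ex1I[of _ "int_encode (-k)"])
    show "x - 2 * pi * of_int (int_decode (int_encode (-k))) \<in> {-pi..<pi}"
      using wrap_pi_bounds[of x] k by simp
  next
    fix n assume n: "x - 2 * pi * of_int (int_decode n) \<in> {-pi..<pi}"
    have "wrap_pi (x + 2 * pi * of_int (- int_decode n)) = wrap_pi x"
      by (rule wrap_pi_add_period)
    moreover have "wrap_pi (x + 2 * pi * of_int (- int_decode n)) = x + 2 * pi * of_int (- int_decode n)"
      using n by (intro wrap_pi_id) auto
    ultimately have "2 * pi * (of_int k + of_int (int_decode n)) = 0"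
      using k by (simp add: algebra_simps)
    then have "of_int (k + int_decode n) = (0 :: real)" by simp
    then have "int_decode n = - k" by linarith
    then show "n = int_encode (-k)" by (metis int_decode_inverse)
  qed
qed

lemma suminf_unique_period:
  "(\<Sum>n. f n * indicator {-pi..<pi} (x - 2 * pi * of_int (int_decode n)) :: ennreal) =
    f (THE n. x - 2 * pi * of_int (int_decode n) \<in> {-pi..<pi})"
proof -
  define N where "N = (THE n. x - 2 * pi * of_int (int_decode n) \<in> {-pi..<pi})"
  have N: "x - 2 * pi * of_int (int_decode N) \<in> {-pi..<pi}"
    unfolding N_def by (rule theI'[OF unique_period])
  have "(\<Sum>n. f n * indicator {-pi..<pi} (x - 2 * pi * of_int (int_decode n))) =
      (\<Sum>n\<in>{N}. f n * indicator {-pi..<pi} (x - 2 * pi * of_int (int_decode n)))"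
  proof (rule suminf_finite)
    fix n assume "n \<notin> {N}"
    then have "x - 2 * pi * of_int (int_decode n) \<notin> {-pi..<pi}"
      using unique_period[of x] N by auto
    then show "f n * indicator {-pi..<pi} (x - 2 * pi * of_int (int_decode n)) = 0"
      by (simp only: indicator_simps mult_zero_right not_False_eq_True)
  qed simp
  then show ?thesis
    using N unfolding N_def[symmetric] by (simp only: sum.insert finite.emptyI sum.empty indicator_simps) simp
qed

text \<open>The indicators of the tiles form a partition of unity; each tile is translated back to
  \<open>{-pi..<pi}\<close> and the sum exchanged with the integral.\<close>

lemma nn_integral_unwrap:
  fixes h :: "real \<Rightarrow> ennreal"
  assumes [measurable]: "h \<in> borel_measurable borel"
  shows "(\<integral>\<^sup>+x. h x \<partial>lborel) =
    (\<integral>\<^sup>+t. (\<Sum>n. h (t + 2 * pi * of_int (int_decode n))) * indicator {-pi..<pi} t \<partial>lborel)"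
proof -
  have "(\<integral>\<^sup>+x. h x \<partial>lborel) =
      (\<integral>\<^sup>+x. (\<Sum>n. h x * indicator {-pi..<pi} (x - 2 * pi * of_int (int_decode n))) \<partial>lborel)"
    by (simp only: suminf_unique_period)
  also have "\<dots> = (\<Sum>n. \<integral>\<^sup>+x. h x * indicator {-pi..<pi} (x - 2 * pi * of_int (int_decode n)) \<partial>lborel)"
    by (intro nn_integral_suminf) measurable
  also have "\<dots> = (\<Sum>n. \<integral>\<^sup>+t. h (t + 2 * pi * of_int (int_decode n)) * indicator {-pi..<pi} t \<partial>lborel)"
  proof (intro suminf_cong)
    fix n
    show "(\<integral>\<^sup>+x. h x * indicator {-pi..<pi} (x - 2 * pi * of_int (int_decode n)) \<partial>lborel) =
        (\<integral>\<^sup>+t. h (t + 2 * pi * of_int (int_decode n)) * indicator {-pi..<pi} t \<partial>lborel)"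
      by (subst nn_integral_real_affine[where c=1 and t="2 * pi * of_int (int_decode n)"])
        (auto simp: add.commute)
  qed
  also have "\<dots> = (\<integral>\<^sup>+t. (\<Sum>n. h (t + 2 * pi * of_int (int_decode n)) * indicator {-pi..<pi} t) \<partial>lborel)"
    by (intro nn_integral_suminf[symmetric]) measurable
  finally show ?thesis
    by simp
qed

text \<open>Rotation invariance of Lebesgue measure on the circle. After translation the integrand
  is periodic apart from the indicator of a shifted window, and unwrapping sums that indicator to
  1.\<close>

lemma nn_integral_wrap_shift:
  fixes h :: "real \<Rightarrow> ennreal"
  assumes [measurable]: "h \<in> borel_measurable borel"
  shows "(\<integral>\<^sup>+t. h (wrap_pi (t + a)) * indicator {-pi..<pi} t \<partial>lborel) =
    (\<integral>\<^sup>+t. h t * indicator {-pi..<pi} t \<partial>lborel)"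
proof -
  \<comment> \<open>The tiling lemma subtracts the periods whereas here they are added; passing to a
    sum over the integers allows the reflection \<open>i \<mapsto> - i\<close>.\<close>
  have 1: "(\<Sum>n. indicator {-pi..<pi} (t + 2 * pi * of_int (int_decode n) - a) :: ennreal) = 1" for t
  proof -
    have "(\<Sum>n. 1 * indicator {-pi..<pi} ((a - t) - 2 * pi * of_int (int_decode n)) :: ennreal) = 1" for a t :: real
      by (subst suminf_unique_period) simp
    then have "1 = (\<integral>\<^sup>+i. indicator {-pi..<pi} ((t - a) - 2 * pi * of_int i) \<partial>count_space (UNIV::int set))"
      by (subst nn_integral_bij_count_space[symmetric, OF bij_int_decode])
        (simp add: nn_integral_count_space_nat)
    also have "\<dots> = (\<integral>\<^sup>+i. indicator {-pi..<pi} ((t - a) - 2 * pi * of_int (- i)) \<partial>count_space (UNIV::int set))"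
      by (rule nn_integral_bij_count_space[symmetric]) (auto intro!: bij_uminus)
    also have "\<dots> = (\<Sum>n. indicator {-pi..<pi} (t + 2 * pi * of_int (int_decode n) - a))"
      by (subst nn_integral_bij_count_space[symmetric, OF bij_int_decode])
        (simp add: nn_integral_count_space_nat algebra_simps)
    finally show ?thesis by simp
  qed
  have "(\<integral>\<^sup>+t. h (wrap_pi (t + a)) * indicator {-pi..<pi} t \<partial>lborel) =
      (\<integral>\<^sup>+u. h (wrap_pi u) * indicator {-pi..<pi} (u - a) \<partial>lborel)"
    by (subst nn_integral_real_affine[where c=1 and t="-a"]) auto
  also have "\<dots> = (\<integral>\<^sup>+t. (\<Sum>n. h (wrap_pi (t + 2 * pi * of_int (int_decode n))) *
      indicator {-pi..<pi} (t + 2 * pi * of_int (int_decode n) - a)) * indicator {-pi..<pi} t \<partial>lborel)"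
    by (rule nn_integral_unwrap) measurable
  also have "\<dots> = (\<integral>\<^sup>+t. h (wrap_pi t) * indicator {-pi..<pi} t \<partial>lborel)"
    by (simp add: wrap_pi_add_period 1)
  also have "\<dots> = (\<integral>\<^sup>+t. h t * indicator {-pi..<pi} t \<partial>lborel)"
    by (intro nn_integral_cong) (auto simp: wrap_pi_id split: split_indicator)
  finally show ?thesis .
qed

lemma prob_space_uniform_phase: "prob_space uniform_phase"
  unfolding uniform_phase_def by (rule prob_space_uniform_measure) auto

lemma sets_uniform_phase [measurable_cong, simp]: "sets uniform_phase = sets borel"
  by (simp add: uniform_phase_def)

lemma space_uniform_phase [simp]: "space uniform_phase = UNIV"
  by (simp add: uniform_phase_def)

lemma nn_integral_uniform_phase:
  assumes [measurable]: "h \<in> borel_measurable borel"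
  shows "(\<integral>\<^sup>+t. h t \<partial>uniform_phase) = (\<integral>\<^sup>+t. h t * indicator {-pi..<pi} t \<partial>lborel) / ennreal (2 * pi)"
  unfolding uniform_phase_def by (subst nn_integral_uniform_measure) auto

lemma nn_integral_uniform_phase_shift:
  assumes [measurable]: "h \<in> borel_measurable borel"
  shows "(\<integral>\<^sup>+t. h (wrap_pi (t + a)) \<partial>uniform_phase) = (\<integral>\<^sup>+t. h t \<partial>uniform_phase)"
  by (subst (1 2) nn_integral_uniform_phase) (auto simp: nn_integral_wrap_shift)

section \<open>The wrapped normal density\<close>

definition wrapped_normal_density :: "real \<Rightarrow> real \<Rightarrow> real" where
  "wrapped_normal_density \<sigma> t = (\<Sum>n. normal_density 0 \<sigma> (t + 2 * pi * of_int (int_decode n)))"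

text \<open>The \<open>n\<close>-th integer has modulus at least \<open>n / 2\<close>, and one
  period exceeds 6, which leaves room for the offset of at most \<open>pi\<close>. The linear growth
  makes the wrapped series summable with an explicit majorant.\<close>

lemma abs_int_decode_shift_ge:
  assumes "\<bar>t\<bar> \<le> pi" "n > 0"
  shows "real n \<le> \<bar>t + 2 * pi * of_int (int_decode n)\<bar>"
proof (cases "even n")
  case True
  then obtain j where j: "n = 2 * j" by auto
  then have "int_decode n = int j"
    by (simp add: int_decode_def sum_decode_def)
  moreover have "pi * real j \<ge> 3 * real j"
    using pi_gt3 by (auto intro!: mult_right_mono)
  moreover have "pi * 1 \<le> pi * real j"
    using assms j by (intro mult_left_mono) auto
  ultimately have "2 * real j \<le> t + 2 * (pi * real j)" "int_decode n = int j"
    using assms(1) by linarith+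
  then show ?thesis
    using j abs_ge_self[of "t + 2 * (pi * real j)"] by (simp add: mult.assoc)
next
  case False
  then obtain j where j: "n = 2 * j + 1" by (auto elim: oddE)
  then have "int_decode n = - int j - 1"
    by (simp add: int_decode_def sum_decode_def)
  moreover have "pi * real j \<ge> 3 * real j"
    using pi_gt3 by (auto intro!: mult_right_mono)
  ultimately have "2 * real j + 1 \<le> - (t + 2 * pi * (- real j - 1))" "int_decode n = - int j - 1"
    using assms(1) pi_gt3 by (simp_all add: algebra_simps abs_le_iff)
  then show ?thesis
    using j abs_ge_minus_self[of "t + 2 * pi * (- real j - 1)"] by simp
qed

text \<open>Weierstrass majorant: \<open>exp (- u) \<le> 1 / u\<close> applied to the Gaussian
  exponent at distance at least \<open>n\<close> from the origin. Index 0 carries no decay and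
  receives the peak value.\<close>

definition wrapped_bound :: "real \<Rightarrow> nat \<Rightarrow> real" where
  "wrapped_bound \<sigma> n = (1 / sqrt (2 * pi * \<sigma>\<^sup>2)) * (if n = 0 then 1 else 2 * \<sigma>\<^sup>2 * inverse ((real n)\<^sup>2))"

lemma normal_density_le_wrapped_bound:
  assumes "\<sigma> > 0" "\<bar>t\<bar> \<le> pi"
  shows "normal_density 0 \<sigma> (t + 2 * pi * of_int (int_decode n)) \<le> wrapped_bound \<sigma> n"
proof (cases "n = 0")
  case True
  then show ?thesis
    using assms by (auto simp: normal_density_def wrapped_bound_def intro!: divide_right_mono)
next
  case False
  define x where "x = t + 2 * pi * of_int (int_decode n)"
  have x: "real n \<le> \<bar>x\<bar>"
    unfolding x_def using assms False by (intro abs_int_decode_shift_ge) auto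
  then have x2: "(real n)\<^sup>2 \<le> x\<^sup>2"
    by (metis abs_of_nat power2_abs power_mono of_nat_0_le_iff)
  have n2: "0 < (real n)\<^sup>2" using False by simp
  have "1 + x\<^sup>2 / (2 * \<sigma>\<^sup>2) \<le> exp (x\<^sup>2 / (2 * \<sigma>\<^sup>2))"
    by (rule exp_ge_add_one_self)
  then have "(real n)\<^sup>2 / (2 * \<sigma>\<^sup>2) \<le> exp (x\<^sup>2 / (2 * \<sigma>\<^sup>2))"
    using divide_right_mono[OF x2, of "2 * \<sigma>\<^sup>2"] zero_le_power2[of \<sigma>] by linarith
  then have "inverse (exp (x\<^sup>2 / (2 * \<sigma>\<^sup>2))) \<le> inverse ((real n)\<^sup>2 / (2 * \<sigma>\<^sup>2))"
    using n2 assms by (intro le_imp_inverse_le) auto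
  then have "exp (- x\<^sup>2 / (2 * \<sigma>\<^sup>2)) \<le> 2 * \<sigma>\<^sup>2 * inverse ((real n)\<^sup>2)"
    by (simp add: exp_minus inverse_eq_divide)
  then show ?thesis
    using False assms unfolding x_def[symmetric]
    by (auto simp: normal_density_def wrapped_bound_def intro!: divide_right_mono)
qed

lemma summable_wrapped_bound: "summable (wrapped_bound \<sigma>)"
proof -
  have "summable (\<lambda>n. inverse ((real n)\<^sup>2))"
    by (rule inverse_power_summable) simp
  then have "summable (\<lambda>n. 1 / sqrt (2 * pi * \<sigma>\<^sup>2) * (2 * \<sigma>\<^sup>2 * inverse ((real n)\<^sup>2)))"
    by (intro summable_mult)
  then show ?thesis
    by (rule summable_cong[THEN iffD1, rotated])
      (auto simp: wrapped_bound_def eventually_sequentially intro!: exI[of _ 1])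
qed

lemma summable_wrapped_normal:
  assumes "\<sigma> > 0" "\<bar>t\<bar> \<le> pi"
  shows "summable (\<lambda>n. normal_density 0 \<sigma> (t + 2 * pi * of_int (int_decode n)))"
  by (rule summable_comparison_test'[OF summable_wrapped_bound[of \<sigma>], of 0])
    (use normal_density_le_wrapped_bound[OF assms] in auto)

lemma wrapped_normal_density_le:
  assumes "\<sigma> > 0" "\<bar>t\<bar> \<le> pi"
  shows "wrapped_normal_density \<sigma> t \<le> suminf (wrapped_bound \<sigma>)"
  unfolding wrapped_normal_density_def
  by (intro suminf_le normal_density_le_wrapped_bound summable_wrapped_normal summable_wrapped_bound assms)

text \<open>All terms are nonnegative, so the term of index 0 alone bounds the series from below. A
  positive lower bound, uniform in \<open>t\<close>, keeps the logarithm of the density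
  bounded.\<close>

lemma wrapped_normal_density_ge:
  assumes "\<sigma> > 0" "\<bar>t\<bar> \<le> pi"
  shows "normal_density 0 \<sigma> pi \<le> wrapped_normal_density \<sigma> t"
proof -
  have "normal_density 0 \<sigma> pi \<le> normal_density 0 \<sigma> t"
    using assms abs_le_square_iff[of t pi]
    by (auto simp: normal_density_def intro!: divide_right_mono)
  also have "\<dots> = (\<Sum>n\<in>{0}. normal_density 0 \<sigma> (t + 2 * pi * of_int (int_decode n)))"
    by (simp add: int_decode_def sum_decode_def)
  also have "\<dots> \<le> wrapped_normal_density \<sigma> t"
    unfolding wrapped_normal_density_def
    by (intro sum_le_suminf summable_wrapped_normal assms) auto
  finally show ?thesis .
qed

lemma continuous_on_wrapped_normal_density:
  assumes "\<sigma> > 0"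
  shows "continuous_on {-pi..pi} (wrapped_normal_density \<sigma>)"
proof (rule uniform_limit_theorem)
  show "uniform_limit {-pi..pi} (\<lambda>m t. \<Sum>n<m. normal_density 0 \<sigma> (t + 2 * pi * of_int (int_decode n)))
      (wrapped_normal_density \<sigma>) sequentially"
    unfolding wrapped_normal_density_def[abs_def]
    by (rule Weierstrass_m_test[OF _ summable_wrapped_bound[of \<sigma>]])
      (use assms in \<open>auto simp: abs_le_iff intro!: normal_density_le_wrapped_bound\<close>)
  show "\<forall>\<^sub>F m in sequentially. continuous_on {-pi..pi}
      (\<lambda>t. \<Sum>n<m. normal_density 0 \<sigma> (t + 2 * pi * of_int (int_decode n)))"
    using assms by (intro always_eventually allI continuous_intros) (auto simp: normal_density_def intro!: continuous_intros)
qed simp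

lemma measurable_wrapped_normal_density [measurable]:
  "wrapped_normal_density \<sigma> \<in> borel_measurable borel"
  unfolding wrapped_normal_density_def[abs_def] by measurable

text \<open>Unwrapping the Gaussian integral gathers one residue class into the series
  \<open>wrapped_normal_density\<close>; the test set is evaluated at \<open>wrap_pi\<close> and
  hence does not see the period.\<close>

lemma wrapped_normal_eq_density:
  assumes "\<sigma> > 0"
  shows "wrapped_normal \<sigma> =
    density lborel (\<lambda>t. ennreal (indicator {-pi..<pi} t * wrapped_normal_density \<sigma> t))"
proof (rule measure_eqI)
  fix A assume "A \<in> sets (wrapped_normal \<sigma>)"
  then have [measurable]: "A \<in> sets borel" by (simp add: wrapped_normal_def)
  have "emeasure (wrapped_normal \<sigma>) A =
      (\<integral>\<^sup>+x. ennreal (normal_density 0 \<sigma> x) * indicator A (wrap_pi x) \<partial>lborel)"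
    unfolding wrapped_normal_def
    by (subst emeasure_distr, simp, simp, subst emeasure_density)
      (auto intro!: nn_integral_cong measurable_sets_borel[OF measurable_wrap_pi] split: split_indicator)
  also have "\<dots> = (\<integral>\<^sup>+t. (\<Sum>n. ennreal (normal_density 0 \<sigma> (t + 2 * pi * of_int (int_decode n))) *
      indicator A (wrap_pi (t + 2 * pi * of_int (int_decode n)))) * indicator {-pi..<pi} t \<partial>lborel)"
    by (rule nn_integral_unwrap) measurable
  also have "\<dots> = (\<integral>\<^sup>+t. ennreal (indicator {-pi..<pi} t * wrapped_normal_density \<sigma> t) * indicator A t \<partial>lborel)"
  proof (intro nn_integral_cong)
    fix t :: real
    show "(\<Sum>n. ennreal (normal_density 0 \<sigma> (t + 2 * pi * of_int (int_decode n))) *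
      indicator A (wrap_pi (t + 2 * pi * of_int (int_decode n)))) * indicator {-pi..<pi} t =
      ennreal (indicator {-pi..<pi} t * wrapped_normal_density \<sigma> t) * indicator A t"
    proof (cases "t \<in> {-pi..<pi}")
      case True
      then have t: "\<bar>t\<bar> \<le> pi" "wrap_pi t = t" by (auto simp: abs_le_iff wrap_pi_id)
      have "(\<Sum>n. ennreal (normal_density 0 \<sigma> (t + 2 * pi * of_int (int_decode n)))) =
          ennreal (wrapped_normal_density \<sigma> t)"
        unfolding wrapped_normal_density_def
        by (intro suminf_ennreal2 summable_wrapped_normal assms t) auto
      then show ?thesis
        using True t by (simp add: wrap_pi_add_period)
    qed simp
  qed
  also have "\<dots> = emeasure (density lborel (\<lambda>t. ennreal (indicator {-pi..<pi} t * wrapped_normal_density \<sigma> t))) A"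
    by (subst emeasure_density) auto
  finally show "emeasure (wrapped_normal \<sigma>) A = \<dots>" .
qed (simp add: wrapped_normal_def)

lemma prob_space_wrapped_normal: "\<sigma> > 0 \<Longrightarrow> prob_space (wrapped_normal \<sigma>)"
  unfolding wrapped_normal_def
  by (intro prob_space.prob_space_distr prob_space_normal_density) auto

lemma sets_wrapped_normal [measurable_cong, simp]: "sets (wrapped_normal \<sigma>) = sets borel"
  by (simp add: wrapped_normal_def)

lemma space_wrapped_normal [simp]: "space (wrapped_normal \<sigma>) = UNIV"
  by (simp add: wrapped_normal_def)

text \<open>The left end point, at which \<open>wrap_pi\<close> jumps, is excluded: limits of scores
  are taken at interior points only.\<close>

lemma AE_wrapped_normal:
  assumes "\<sigma> > 0"
  shows "AE t in wrapped_normal \<sigma>. - pi < t \<and> t < pi"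
  unfolding wrapped_normal_eq_density[OF assms]
  by (subst AE_density) (auto intro: AE_mp[OF AE_lborel_singleton[of "-pi"]] split: split_indicator)

text \<open>The factor \<open>2 * pi\<close> turns the Lebesgue density into the density relative to
  the uniform phase, which is the form in which it serves as a score of a uniformly distributed
  input phase.\<close>

lemma nn_integral_wrapped_normal_density:
  assumes "\<sigma> > 0"
  shows "(\<integral>\<^sup>+t. ennreal (2 * pi * wrapped_normal_density \<sigma> t) \<partial>uniform_phase) = 1"
proof -
  interpret prob_space "wrapped_normal \<sigma>" by (rule prob_space_wrapped_normal) fact
  have "1 = emeasure (wrapped_normal \<sigma>) UNIV"
    using emeasure_space_1 by simp
  also have "\<dots> = (\<integral>\<^sup>+t. ennreal (indicator {-pi..<pi} t * wrapped_normal_density \<sigma> t) \<partial>lborel)"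
    by (subst wrapped_normal_eq_density[OF assms], subst emeasure_density) auto
  finally have 1: "(\<integral>\<^sup>+t. ennreal (indicator {-pi..<pi} t * wrapped_normal_density \<sigma> t) \<partial>lborel) = 1" ..
  have "(\<integral>\<^sup>+t. ennreal (2 * pi * wrapped_normal_density \<sigma> t) \<partial>uniform_phase) =
      (\<integral>\<^sup>+t. ennreal (2 * pi) * ennreal (indicator {-pi..<pi} t * wrapped_normal_density \<sigma> t) \<partial>lborel) / ennreal (2 * pi)"
    by (subst nn_integral_uniform_phase)
      (auto intro!: arg_cong[where f="\<lambda>x. x / _"] nn_integral_cong simp: ennreal_mult' split: split_indicator)
  also have "\<dots> = ennreal (2 * pi) / ennreal (2 * pi)"
    by (subst nn_integral_cmult) (auto simp: 1)
  also have "\<dots> = 1"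
    by (subst divide_ennreal) auto
  finally show ?thesis .
qed

section \<open>Gamma laws of squared moduli\<close>

text \<open>Covers infinite measures that are finite on lower half-lines, such as images of Lebesgue
  measure under squaring.\<close>

lemma measure_eqI_atMost:
  fixes M N :: "real measure"
  assumes sets: "sets M = sets borel" "sets N = sets borel"
    and eq: "\<And>x. emeasure M {..x} = emeasure N {..x}"
    and fin: "\<And>x. emeasure M {..x} \<noteq> \<infinity>"
  shows "M = N"
proof (rule measure_eqI_generator_eq[where E="range atMost" and \<Omega>=UNIV and A="\<lambda>n. {..real n}"])
  show "Int_stable (range (atMost :: real \<Rightarrow> _))"
    by (auto simp: Int_stable_def)
  show "sets M = sigma_sets UNIV (range atMost)" "sets N = sigma_sets UNIV (range atMost)"
    using sets by (simp_all add: borel_eq_atMost)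
  show "(\<Union>n. {..real n}) = UNIV"
    using real_arch_simple by fastforce
qed (use eq fin in auto)

text \<open>Sublevel sets of the square are intervals of length \<open>2 * sqrt x\<close>. Knowing
  the image of Lebesgue measure, any law whose density depends on the square alone can be pushed
  forward by multiplying with that density.\<close>

lemma distr_power2_lborel:
  "distr lborel borel (\<lambda>x::real. x\<^sup>2) = density lborel (\<lambda>r. ennreal (indicator {0<..} r * r powr (-1/2)))"
proof (rule measure_eqI_atMost)
  have 1: "emeasure (distr lborel borel (\<lambda>x::real. x\<^sup>2)) {..x} = ennreal (2 * sqrt x)" for x
  proof (cases "x \<ge> 0")
    case True
    have "r\<^sup>2 \<le> x \<longleftrightarrow> \<bar>r\<bar> \<le> sqrt x" for r
      using real_sqrt_le_iff[of "r\<^sup>2" x] by simp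
    then have "(\<lambda>x::real. x\<^sup>2) -` {..x} = {- sqrt x..sqrt x}"
      by (auto simp: abs_le_iff)
    then show ?thesis
      using True by (subst emeasure_distr) auto
  next
    case False
    then have "(\<lambda>x::real. x\<^sup>2) -` {..x} = {}"
      by (auto simp: not_le dest: order_trans[OF zero_le_power2])
    then show ?thesis
      using False by (subst emeasure_distr) (auto simp: ennreal_neg)
  qed
  have 2: "emeasure (density lborel (\<lambda>r. ennreal (indicator {0<..} r * r powr (-1/2)))) {..x} = ennreal (2 * sqrt x)" for x :: real
  proof (cases "x \<ge> 0")
    case True
    have "((\<lambda>r. r powr (-1/2)) has_integral (x powr (-1/2 + 1) / (-1/2 + 1))) {0..x}"
      using True by (intro has_integral_powr_from_0) auto
    then have "(\<integral>\<^sup>+r. ennreal (indicator {0..x} r * r powr (-1/2)) \<partial>lborel) = ennreal (x powr (-1/2 + 1) / (-1/2 + 1))"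
      by (intro nn_integral_has_integral_lebesgue) auto
    also have "x powr (-1/2 + 1) / (-1/2 + 1) = 2 * sqrt x"
      using True by (simp add: powr_half_sqrt)
    also have "(\<integral>\<^sup>+r. ennreal (indicator {0..x} r * r powr (-1/2)) \<partial>lborel) =
        emeasure (density lborel (\<lambda>r. ennreal (indicator {0<..} r * r powr (-1/2)))) {..x}"
      by (subst emeasure_density) (auto intro!: nn_integral_cong split: split_indicator)
    finally show ?thesis .
  next
    case False
    then show ?thesis
      by (subst emeasure_density) (auto simp: ennreal_neg nn_integral_0_iff_AE split: split_indicator)
  qed
  show "emeasure (distr lborel borel (\<lambda>x::real. x\<^sup>2)) {..x} =
    emeasure (density lborel (\<lambda>r. ennreal (indicator {0<..} r * r powr (-1/2)))) {..x}" for x :: real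
    unfolding 1 2 ..
  show "emeasure (distr lborel borel (\<lambda>x::real. x\<^sup>2)) {..x} \<noteq> \<infinity>" for x
    unfolding 1 by simp
qed auto

text \<open>Sublevel sets are discs of area \<open>pi * x\<close>, so the image is a multiple of
  Lebesgue measure on the positive axis.\<close>

lemma distr_cmod_power2_lborel:
  "distr lborel borel (\<lambda>z::complex. (cmod z)\<^sup>2) = density lborel (\<lambda>r. ennreal (indicator {0<..} r * pi))"
proof (rule measure_eqI_atMost)
  have 1: "emeasure (distr lborel borel (\<lambda>z::complex. (cmod z)\<^sup>2)) {..x} = ennreal (pi * x)" for x
  proof (cases "x \<ge> 0")
    case True
    have "(\<lambda>z::complex. (cmod z)\<^sup>2) -` {..x} = cball 0 (sqrt x)"
      using True by (auto intro: real_le_rsqrt) (metis norm_ge_zero power_mono real_sqrt_pow2)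
    then show ?thesis
      using True by (subst emeasure_distr) (auto simp: emeasure_cball eval_unit_ball_vol)
  next
    case False
    then have "(\<lambda>z::complex. (cmod z)\<^sup>2) -` {..x} = {}"
      by (auto simp: not_le dest: order_trans[OF zero_le_power2])
    then show ?thesis
      using False by (subst emeasure_distr) (auto simp: ennreal_neg mult_nonneg_nonpos)
  qed
  have 2: "emeasure (density lborel (\<lambda>r. ennreal (indicator {0<..} r * pi))) {..x} = ennreal (pi * x)" for x :: real
  proof -
    have "emeasure (density lborel (\<lambda>r. ennreal (indicator {0<..} r * pi))) {..x} =
        (\<integral>\<^sup>+r. ennreal pi * indicator {0<..x} r \<partial>lborel)"
      by (subst emeasure_density) (auto intro!: nn_integral_cong split: split_indicator)
    also have "\<dots> = ennreal (pi * x)"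
      by (cases "x \<ge> 0") (auto simp: nn_integral_cmult ennreal_mult' ennreal_neg mult_nonneg_nonpos)
    finally show ?thesis .
  qed
  show "emeasure (distr lborel borel (\<lambda>z::complex. (cmod z)\<^sup>2)) {..x} =
    emeasure (density lborel (\<lambda>r. ennreal (indicator {0<..} r * pi))) {..x}" for x :: real
    unfolding 1 2 ..
  show "emeasure (distr lborel borel (\<lambda>z::complex. (cmod z)\<^sup>2)) {..x} \<noteq> \<infinity>" for x
    unfolding 1 by simp
qed auto

definition gamma_law :: "real \<Rightarrow> real measure" where
  "gamma_law \<alpha> = density lborel (\<lambda>r. ennreal (gamma_density \<alpha> r))"

text \<open>The real Gaussian law of variance 1/2. Its square has the gamma law of shape 1/2, and
  the variance equals that of one real component of the additive noise.\<close>

definition real_normal_half :: "real measure" where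
  "real_normal_half = density lborel (\<lambda>g. ennreal (exp (- g\<^sup>2) / sqrt pi))"

lemma measurable_gamma_density [measurable]: "gamma_density \<alpha> \<in> borel_measurable borel"
  unfolding gamma_density_def[abs_def] by measurable

lemma sets_gamma_law [measurable_cong, simp]: "sets (gamma_law \<alpha>) = sets borel"
  by (simp add: gamma_law_def)

lemma sets_real_normal_half [measurable_cong, simp]: "sets real_normal_half = sets borel"
  by (simp add: real_normal_half_def)

lemma space_real_normal_half [simp]: "space real_normal_half = UNIV"
  by (simp add: real_normal_half_def)

lemma sets_std_complex_normal [measurable_cong, simp]: "sets std_complex_normal = sets borel"
  by (simp add: std_complex_normal_def)

lemma space_std_complex_normal [simp]: "space std_complex_normal = UNIV"
  by (simp add: std_complex_normal_def)

lemma space_gamma_law [simp]: "space (gamma_law \<alpha>) = UNIV"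
  by (simp add: gamma_law_def)

lemma distr_power2_real_normal_half: "distr real_normal_half borel (\<lambda>x. x\<^sup>2) = gamma_law (1/2)"
proof -
  have "distr real_normal_half borel (\<lambda>x. x\<^sup>2) =
      density (distr lborel borel (\<lambda>x. x\<^sup>2)) (\<lambda>r. ennreal (exp (- r) / sqrt pi))"
    unfolding real_normal_half_def by (subst density_distr) auto
  also have "\<dots> = gamma_law (1/2)"
    unfolding distr_power2_lborel gamma_law_def
    by (subst density_density_eq)
      (auto intro!: density_cong AE_I2 simp: gamma_density_def Gamma_one_half_real simp flip: ennreal_mult' split: split_indicator)
  finally show ?thesis .
qed

lemma distr_power2_std_complex_normal:
  "distr std_complex_normal borel (\<lambda>z. (cmod z)\<^sup>2) = gamma_law 1"
proof -
  have "distr std_complex_normal borel (\<lambda>z. (cmod z)\<^sup>2) =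
      density (distr lborel borel (\<lambda>z::complex. (cmod z)\<^sup>2)) (\<lambda>r. ennreal (exp (- r) / pi))"
    unfolding std_complex_normal_def by (subst density_distr) auto
  also have "\<dots> = gamma_law 1"
    unfolding distr_cmod_power2_lborel gamma_law_def
    by (subst density_density_eq)
      (auto intro!: density_cong AE_I2 simp: gamma_density_def simp flip: ennreal_mult' split: split_indicator)
  finally show ?thesis .
qed

lemma nn_integral_gamma_law_powr:
  assumes "\<alpha> > 0" "\<alpha> + a > 0"
  shows "(\<integral>\<^sup>+r. ennreal (r powr a) \<partial>gamma_law \<alpha>) = ennreal (Gamma (\<alpha> + a) / Gamma \<alpha>)"
proof -
  have "(\<integral>\<^sup>+r. ennreal (r powr a) \<partial>gamma_law \<alpha>) =
      (\<integral>\<^sup>+r. ennreal (gamma_density \<alpha> r) * ennreal (r powr a) \<partial>lborel)"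
    unfolding gamma_law_def by (subst nn_integral_density) auto
  also have "\<dots> = (\<integral>\<^sup>+r. ennreal (1 / Gamma \<alpha>) * ennreal (indicator {0..} r * r powr (\<alpha> + a - 1) / exp r) \<partial>lborel)"
  proof (intro nn_integral_cong_AE, use AE_lborel_singleton[of "0::real"] in eventually_elim)
    fix r :: real assume "r \<noteq> 0"
    then show "ennreal (gamma_density \<alpha> r) * ennreal (r powr a) =
      ennreal (1 / Gamma \<alpha>) * ennreal (indicator {0..} r * r powr (\<alpha> + a - 1) / exp r)"
      using Gamma_real_pos[OF assms(1)]
      by (cases "r > 0") (auto simp: gamma_density_def exp_minus field_simps powr_add powr_diff simp flip: ennreal_mult')
  qed
  also have "\<dots> = ennreal (1 / Gamma \<alpha>) * ennreal (Gamma (\<alpha> + a))"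
    by (subst nn_integral_cmult, simp, subst Gamma_conv_nn_integral_real[OF assms(2)]) simp
  also have "\<dots> = ennreal (Gamma (\<alpha> + a) / Gamma \<alpha>)"
    using Gamma_real_pos[OF assms(1)] by (simp flip: ennreal_mult')
  finally show ?thesis .
qed

lemma AE_gamma_law_pos: "AE r in gamma_law \<alpha>. 0 < r"
  unfolding gamma_law_def by (subst AE_density) (auto simp: gamma_density_def)

lemma prob_space_gamma_law: "\<alpha> > 0 \<Longrightarrow> prob_space (gamma_law \<alpha>)"
proof
  assume a: "\<alpha> > 0"
  have "emeasure (gamma_law \<alpha>) UNIV = (\<integral>\<^sup>+r. 1 \<partial>gamma_law \<alpha>)"
    by simp
  also have "\<dots> = (\<integral>\<^sup>+r. ennreal (r powr 0) \<partial>gamma_law \<alpha>)"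
    by (intro nn_integral_cong_AE, use AE_gamma_law_pos[of \<alpha>] in eventually_elim) auto
  also have "\<dots> = 1"
    using a less_imp_neq[OF Gamma_real_pos[OF a]] by (subst nn_integral_gamma_law_powr) auto
  finally show "emeasure (gamma_law \<alpha>) (space (gamma_law \<alpha>)) = 1" by simp
qed

lemma has_bochner_integral_gamma_law_powr:
  assumes "\<alpha> > 0" "\<alpha> + a > 0"
  shows "has_bochner_integral (gamma_law \<alpha>) (\<lambda>r. r powr a) (Gamma (\<alpha> + a) / Gamma \<alpha>)"
  using Gamma_real_pos[OF assms(1)] Gamma_real_pos[OF assms(2)]
  by (intro has_bochner_integral_nn_integral) (auto simp: nn_integral_gamma_law_powr assms)

lemma has_bochner_integral_gamma_law_id:
  assumes "\<alpha> > 0"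
  shows "has_bochner_integral (gamma_law \<alpha>) (\<lambda>r. r) \<alpha>"
proof -
  have "has_bochner_integral (gamma_law \<alpha>) (\<lambda>r. r powr 1) (Gamma (\<alpha> + 1) / Gamma \<alpha>)"
    using assms by (intro has_bochner_integral_gamma_law_powr) auto
  also have "Gamma (\<alpha> + 1) / Gamma \<alpha> = \<alpha>"
    using assms less_imp_neq[OF Gamma_real_pos[OF assms]]
    by (subst Gamma_plus1) (auto dest: nonpos_Ints_nonpos)
  finally show ?thesis
    by (rule has_bochner_integral_cong_AE[THEN iffD1, rotated -1])
      (use AE_gamma_law_pos[of \<alpha>] in \<open>auto elim: eventually_mono\<close>)
qed

lemma integrable_gamma_law_power2:
  assumes "\<alpha> > 0"
  shows "integrable (gamma_law \<alpha>) (\<lambda>r. r\<^sup>2)"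
proof -
  have "integrable (gamma_law \<alpha>) (\<lambda>r. r powr 2)"
    using has_bochner_integral_gamma_law_powr[of \<alpha> 2] assms by (auto simp: has_bochner_integral_iff)
  then show ?thesis
    by (rule integrable_cong_AE[THEN iffD1, rotated -1])
      (use AE_gamma_law_pos[of \<alpha>] in \<open>auto elim!: eventually_mono simp: powr_numeral\<close>)
qed

text \<open>The exponent has to be below 1/2: under the gamma law of shape 1/2 the density behaves
  like \<open>r powr (-1/2)\<close> at 0, against which \<open>r powr (-1/4)\<close> is still
  integrable.\<close>

lemma ln_one_plus_le_powr_quarter:
  fixes t :: real
  assumes "t \<ge> 0"
  shows "ln (1 + t) \<le> 4 * t powr (1/4)"
proof (cases "t = 0")
  case False
  \<comment> \<open>In terms of the fourth root, \<open>1 + v ^ 4 \<le> (1 + v) ^ 4\<close> and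
    \<open>ln (1 + v) \<le> v\<close>.\<close>
  define v where "v = t powr (1/4)"
  have v: "v > 0" using False by (simp add: v_def)
  have "t = v ^ 4"
    using False assms by (simp add: v_def powr_powr flip: powr_realpow)
  also have "1 + v ^ 4 \<le> (1 + v) ^ 4"
    using v by (simp add: power4_eq_xxxx algebra_simps)
  finally have "ln (1 + t) \<le> ln ((1 + v) ^ 4)"
    using assms v by (subst ln_le_cancel_iff) auto
  also have "\<dots> = 4 * ln (1 + v)"
    using v by (simp add: ln_realpow)
  also have "\<dots> \<le> 4 * v"
    using v ln_add_one_self_le_self[of v] by simp
  finally show ?thesis by (simp add: v_def)
qed simp

lemma integrable_gamma_law_ln:
  assumes "\<alpha> > 1/4" "c \<ge> 0"
  shows "integrable (gamma_law \<alpha>) (\<lambda>r. ln (1 + c / r))"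
proof (rule Bochner_Integration.integrable_bound)
  show "integrable (gamma_law \<alpha>) (\<lambda>r. 4 * c powr (1/4) * r powr (-1/4))"
    using has_bochner_integral_gamma_law_powr[of \<alpha> "-1/4"] assms by (auto simp: has_bochner_integral_iff)
  show "AE r in gamma_law \<alpha>. norm (ln (1 + c / r)) \<le> norm (4 * c powr (1/4) * r powr (-1/4))"
    using AE_gamma_law_pos[of \<alpha>]
  proof eventually_elim
    case (elim r)
    have "ln (1 + c / r) \<le> 4 * (c / r) powr (1/4)"
      using elim assms by (intro ln_one_plus_le_powr_quarter) auto
    also have "(c / r) powr (1/4) = c powr (1/4) * r powr (-1/4)"
      using elim assms by (simp add: powr_divide powr_minus_divide)
    finally show ?case
      using elim assms by (simp add: abs_of_nonneg)
  qed
qed simp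

section \<open>Gaussian integrals\<close>

text \<open>Squaring preserves total mass, so the Gaussian normalisation is inherited from the gamma
  law.\<close>

lemma prob_space_real_normal_half: "prob_space real_normal_half"
proof
  interpret prob_space "gamma_law (1/2)" by (rule prob_space_gamma_law) simp
  have "emeasure real_normal_half UNIV = emeasure (distr real_normal_half borel (\<lambda>x. x\<^sup>2)) UNIV"
    by (subst emeasure_distr) auto
  then show "emeasure real_normal_half (space real_normal_half) = 1"
    unfolding distr_power2_real_normal_half using emeasure_space_1 by simp
qed

lemma prob_space_std_complex_normal: "prob_space std_complex_normal"
proof
  interpret prob_space "gamma_law 1" by (rule prob_space_gamma_law) simp
  have "emeasure std_complex_normal UNIV = emeasure (distr std_complex_normal borel (\<lambda>z. (cmod z)\<^sup>2)) UNIV"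
    by (subst emeasure_distr) auto
  then show "emeasure std_complex_normal (space std_complex_normal) = 1"
    unfolding distr_power2_std_complex_normal using emeasure_space_1 by simp
qed

lemma nn_integral_lborel_affine:
  fixes f :: "'a::euclidean_space \<Rightarrow> ennreal"
  assumes [measurable]: "f \<in> borel_measurable borel" and c: "c \<noteq> 0"
  shows "(\<integral>\<^sup>+x. f x \<partial>lborel) = ennreal (\<bar>c\<bar> ^ DIM('a)) * (\<integral>\<^sup>+x. f (t + c *\<^sub>R x) \<partial>lborel)"
  by (subst lborel_affine[OF c, of t]) (simp add: nn_integral_density nn_integral_distr nn_integral_cmult)

lemma nn_integral_gauss_real: "(\<integral>\<^sup>+x. ennreal (exp (- x\<^sup>2)) \<partial>(lborel :: real measure)) = ennreal (sqrt pi)"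
proof -
  interpret prob_space real_normal_half by (rule prob_space_real_normal_half)
  have "(\<integral>\<^sup>+x. ennreal (exp (- x\<^sup>2)) \<partial>(lborel :: real measure)) =
      (\<integral>\<^sup>+x. ennreal (sqrt pi) * ennreal (exp (- x\<^sup>2) / sqrt pi) \<partial>lborel)"
    by (intro nn_integral_cong) (simp flip: ennreal_mult')
  also have "\<dots> = ennreal (sqrt pi) * emeasure real_normal_half UNIV"
    by (subst nn_integral_cmult) (auto simp: real_normal_half_def emeasure_density)
  finally show ?thesis using emeasure_space_1 by simp
qed

lemma nn_integral_gauss_complex: "(\<integral>\<^sup>+x. ennreal (exp (- (cmod x)\<^sup>2)) \<partial>lborel) = ennreal pi"
proof -
  interpret prob_space std_complex_normal by (rule prob_space_std_complex_normal)
  have "(\<integral>\<^sup>+x. ennreal (exp (- (cmod x)\<^sup>2)) \<partial>lborel) =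
      (\<integral>\<^sup>+x. ennreal pi * ennreal (exp (- (cmod x)\<^sup>2) / pi) \<partial>lborel)"
    by (intro nn_integral_cong) (simp flip: ennreal_mult')
  also have "\<dots> = ennreal pi * emeasure std_complex_normal UNIV"
    by (subst nn_integral_cmult) (auto simp: std_complex_normal_def emeasure_density)
  finally show ?thesis using emeasure_space_1 by simp
qed

lemma nn_integral_gauss_scaled_real:
  fixes c a :: real
  assumes "c > 0"
  shows "(\<integral>\<^sup>+x. ennreal (exp (- (c * (x - a)\<^sup>2))) \<partial>lborel) = ennreal (sqrt pi / sqrt c)"
proof -
  have "(\<integral>\<^sup>+x. ennreal (exp (- (c * (x - a)\<^sup>2))) \<partial>lborel) =
      ennreal (\<bar>1 / sqrt c\<bar> ^ DIM(real)) * (\<integral>\<^sup>+x. ennreal (exp (- (c * (a + (1 / sqrt c) *\<^sub>R x - a)\<^sup>2))) \<partial>lborel)"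
    using assms by (intro nn_integral_lborel_affine) auto
  also have "(\<lambda>x. exp (- (c * (a + (1 / sqrt c) *\<^sub>R x - a)\<^sup>2))) = (\<lambda>x. exp (- x\<^sup>2))"
    using assms by (auto simp: fun_eq_iff power_divide)
  finally show ?thesis
    using assms by (simp add: nn_integral_gauss_real flip: ennreal_mult')
qed

lemma nn_integral_gauss_scaled_complex:
  fixes c :: real and a :: complex
  assumes "c > 0"
  shows "(\<integral>\<^sup>+x. ennreal (exp (- (c * (cmod (x - a))\<^sup>2))) \<partial>lborel) = ennreal (pi / c)"
proof -
  have "(\<integral>\<^sup>+x. ennreal (exp (- (c * (cmod (x - a))\<^sup>2))) \<partial>lborel) =
      ennreal (\<bar>1 / sqrt c\<bar> ^ DIM(complex)) * (\<integral>\<^sup>+x. ennreal (exp (- (c * (cmod (a + (1 / sqrt c) *\<^sub>R x - a))\<^sup>2))) \<partial>lborel)"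
    using assms by (intro nn_integral_lborel_affine) auto
  also have "(\<lambda>x. exp (- (c * (cmod (a + (1 / sqrt c) *\<^sub>R x - a))\<^sup>2))) = (\<lambda>x. exp (- (cmod x)\<^sup>2))"
    using assms by (auto simp: fun_eq_iff power_divide power_mult_distrib)
  finally show ?thesis
    using assms by (simp add: nn_integral_gauss_complex power_divide flip: ennreal_mult')
qed

text \<open>Up to normalisation this is a convolution of two Gaussians of variances
  \<open>s\<^sup>2 / 2\<close> and 1/2, evaluated at \<open>t\<close>.\<close>

lemma nn_integral_real_normal_half_gauss:
  "(\<integral>\<^sup>+g. ennreal (exp (- (t - s * g)\<^sup>2)) \<partial>real_normal_half) =
    ennreal (exp (- (t\<^sup>2 / (s\<^sup>2 + 1))) / sqrt (s\<^sup>2 + 1))"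
proof -
  let ?c = "s\<^sup>2 + 1" and ?a = "s * t / (s\<^sup>2 + 1)"
  have c: "?c > 0" by (simp add: add_nonneg_pos)
  \<comment> \<open>Completing the square in \<open>g\<close>; the quadratic coefficients add up to
    \<open>s\<^sup>2 + 1\<close>.\<close>
  have sq: "g\<^sup>2 + (t - s * g)\<^sup>2 = ?c * (g - ?a)\<^sup>2 + t\<^sup>2 / ?c" for g
  proof -
    define a where "a = ?a"
    have a: "?c * a = s * t" using c by (simp add: a_def)
    have "?c * (t\<^sup>2 / ?c) = t\<^sup>2" using c by simp
    moreover have "?c * (g\<^sup>2 + (t - s * g)\<^sup>2) = (?c * g - ?c * a)\<^sup>2 + t\<^sup>2"
      unfolding a by (simp add: power2_eq_square algebra_simps)
    moreover have "(?c * g - ?c * a)\<^sup>2 = ?c * (?c * (g - a)\<^sup>2)"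
      by (simp add: power2_eq_square algebra_simps)
    ultimately have "?c * (g\<^sup>2 + (t - s * g)\<^sup>2) = ?c * (?c * (g - a)\<^sup>2 + t\<^sup>2 / ?c)"
      by (simp only: distrib_left)
    then show ?thesis using c unfolding a_def by simp
  qed
  have "(\<integral>\<^sup>+g. ennreal (exp (- (t - s * g)\<^sup>2)) \<partial>real_normal_half) =
      (\<integral>\<^sup>+g. ennreal (exp (- g\<^sup>2) / sqrt pi) * ennreal (exp (- (t - s * g)\<^sup>2)) \<partial>lborel)"
    unfolding real_normal_half_def by (subst nn_integral_density) auto
  also have "\<dots> = (\<integral>\<^sup>+g. ennreal (exp (- (t\<^sup>2 / ?c)) / sqrt pi) * ennreal (exp (- (?c * (g - ?a)\<^sup>2))) \<partial>lborel)"
  proof (intro nn_integral_cong)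
    fix g
    have "exp (- g\<^sup>2) * exp (- (t - s * g)\<^sup>2) = exp (- (t\<^sup>2 / ?c)) * exp (- (?c * (g - ?a)\<^sup>2))"
      unfolding exp_add[symmetric] using sq[of g] by (intro arg_cong[where f=exp]) linarith
    then show "ennreal (exp (- g\<^sup>2) / sqrt pi) * ennreal (exp (- (t - s * g)\<^sup>2)) =
        ennreal (exp (- (t\<^sup>2 / ?c)) / sqrt pi) * ennreal (exp (- (?c * (g - ?a)\<^sup>2)))"
      by (simp flip: ennreal_mult' del: mult_exp_exp)
  qed
  also have "\<dots> = ennreal (exp (- (t\<^sup>2 / ?c)) / sqrt pi) * ennreal (sqrt pi / sqrt ?c)"
    by (subst nn_integral_cmult, simp, subst nn_integral_gauss_scaled_real[OF c]) simp
  also have "\<dots> = ennreal (exp (- (t\<^sup>2 / ?c)) / sqrt ?c)"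
    using c by (simp flip: ennreal_mult')
  finally show ?thesis .
qed

text \<open>Multiplying by \<open>cnj e\<close> removes the rotation, after which the square is
  completed separately in the real and the imaginary part.\<close>

lemma nn_integral_std_complex_normal_gauss:
  assumes e: "cmod e = 1" and V: "V > 0"
  shows "(\<integral>\<^sup>+z. ennreal (exp (- ((cmod (y - e * (of_real s * z)))\<^sup>2 / V))) \<partial>std_complex_normal) =
    ennreal (V / (s\<^sup>2 + V) * exp (- ((cmod y)\<^sup>2 / (s\<^sup>2 + V))))"
proof -
  let ?w = "s\<^sup>2 + V"
  let ?c = "?w / V" and ?a = "of_real (s / ?w) * (cnj e * y)"
  have w: "?w > 0" using V by (simp add: add_nonneg_pos)
  then have c: "?c > 0" using V by simp
  have sq: "(cmod z)\<^sup>2 + (cmod (y - e * (of_real s * z)))\<^sup>2 / V = ?c * (cmod (z - ?a))\<^sup>2 + (cmod y)\<^sup>2 / ?w" for z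
  proof -
    define u where "u = cnj e * y"
    have ee: "e * cnj e = 1"
      using e by (simp add: complex_norm_square[symmetric])
    have "e * u = y" unfolding u_def using ee by (simp flip: mult.assoc)
    then have "y - e * (of_real s * z) = e * (u - of_real s * z)"
      by (simp add: algebra_simps)
    then have 1: "cmod (y - e * (of_real s * z)) = cmod (u - of_real s * z)"
      using e by (simp add: norm_mult)
    have 2: "cmod y = cmod u"
      using e by (simp add: u_def norm_mult)
    have 3: "(cmod (z - of_real (s / ?w) * u))\<^sup>2 = (Re z - s / ?w * Re u)\<^sup>2 + (Im z - s / ?w * Im u)\<^sup>2"
      "(cmod (u - of_real s * z))\<^sup>2 = (Re u - s * Re z)\<^sup>2 + (Im u - s * Im z)\<^sup>2"
      by (simp_all add: cmod_power2 minus_complex.sel)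
    have aux: "W * (p - s / W * q) = W * p - s * q" if "W > 0" for W p q :: real
      using that by (simp add: field_simps)
    have real: "p\<^sup>2 + (q - s * p)\<^sup>2 / V = ?c * (p - s / ?w * q)\<^sup>2 + q\<^sup>2 / ?w" for p q :: real
    proof -
      have "V * (?w * (p\<^sup>2 + (q - s * p)\<^sup>2 / V)) = ?w * (V * p\<^sup>2 + (q - s * p)\<^sup>2)"
        using V by (simp add: field_simps)
      also have "\<dots> = (?w * p - s * q)\<^sup>2 + V * q\<^sup>2"
        by (simp add: power2_eq_square algebra_simps)
      also have "?w * p - s * q = ?w * (p - s / ?w * q)"
        using aux[OF w] by simp
      also have "(?w * (p - s / ?w * q))\<^sup>2 + V * q\<^sup>2 = V * (?w * (?c * (p - s / ?w * q)\<^sup>2 + q\<^sup>2 / ?w))"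
        using V w by (simp add: distrib_left power2_eq_square)
      finally show ?thesis
        using V w by simp
    qed
    show ?thesis
      unfolding u_def[symmetric] 1 2 3 using real[of "Re z" "Re u"] real[of "Im z" "Im u"]
      unfolding cmod_power2 add_divide_distrib distrib_left by linarith
  qed
  have "(\<integral>\<^sup>+z. ennreal (exp (- ((cmod (y - e * (of_real s * z)))\<^sup>2 / V))) \<partial>std_complex_normal) =
      (\<integral>\<^sup>+z. ennreal (exp (- (cmod z)\<^sup>2) / pi) * ennreal (exp (- ((cmod (y - e * (of_real s * z)))\<^sup>2 / V))) \<partial>lborel)"
    unfolding std_complex_normal_def by (subst nn_integral_density) auto
  also have "\<dots> = (\<integral>\<^sup>+z. ennreal (exp (- ((cmod y)\<^sup>2 / ?w)) / pi) * ennreal (exp (- (?c * (cmod (z - ?a))\<^sup>2))) \<partial>lborel)"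
  proof (intro nn_integral_cong)
    fix z
    have "exp (- (cmod z)\<^sup>2) * exp (- ((cmod (y - e * (of_real s * z)))\<^sup>2 / V)) =
        exp (- ((cmod y)\<^sup>2 / ?w)) * exp (- (?c * (cmod (z - ?a))\<^sup>2))"
      unfolding exp_add[symmetric] using sq[of z] by (intro arg_cong[where f=exp]) linarith
    then show "ennreal (exp (- (cmod z)\<^sup>2) / pi) * ennreal (exp (- ((cmod (y - e * (of_real s * z)))\<^sup>2 / V))) =
        ennreal (exp (- ((cmod y)\<^sup>2 / ?w)) / pi) * ennreal (exp (- (?c * (cmod (z - ?a))\<^sup>2)))"
      by (simp flip: ennreal_mult' del: mult_exp_exp)
  qed
  also have "\<dots> = ennreal (exp (- ((cmod y)\<^sup>2 / ?w)) / pi) * ennreal (pi / ?c)"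
    by (subst nn_integral_cmult, simp, subst nn_integral_gauss_scaled_complex[OF c]) simp
  also have "\<dots> = ennreal (V / ?w * exp (- ((cmod y)\<^sup>2 / ?w)))"
    using V w by (simp add: mult_ac flip: ennreal_mult')
  finally show ?thesis .
qed

text \<open>A quarter turn sends boxes to boxes, so invariance can be read off from box volumes.
  Together with negation it supplies the symmetries from which the moments of
  \<open>Re (a * w)\<close> are computed.\<close>

lemma distr_imaginary_unit_lborel: "distr lborel borel ((*) \<i>) = lborel"
proof (rule lborel_eqI[symmetric])
  fix l u :: complex
  assume le: "\<And>b. b \<in> Basis \<Longrightarrow> l \<bullet> b \<le> u \<bullet> b"
  have lu: "Re l \<le> Re u" "Im l \<le> Im u"
    using le[of 1] le[of \<i>] by (auto simp: Basis_complex_def)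
  have "(*) \<i> -` box l u = box (Complex (Im l) (- Re u)) (Complex (Im u) (- Re l))"
    by (auto simp: in_box_complex_iff)
  then show "emeasure (distr lborel borel ((*) \<i>)) (box l u) = ennreal (\<Prod>b\<in>Basis. (u - l) \<bullet> b)"
    using lu by (subst emeasure_distr)
      (auto simp: emeasure_lborel_box_eq Basis_complex_def inner_complex_def mult.commute)
qed simp

lemma nn_integral_std_complex_normal_cong_distr:
  assumes T: "distr lborel borel T = (lborel :: complex measure)" "T \<in> borel_measurable borel"
    and n: "\<And>z. cmod (T z) = cmod z"
  shows "distr std_complex_normal borel T = std_complex_normal"
proof -
  have "distr std_complex_normal borel T =
      distr (density lborel (\<lambda>z. ennreal (exp (- (cmod (T z))\<^sup>2) / pi))) borel T"
    unfolding std_complex_normal_def n ..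
  also have "\<dots> = density (distr lborel borel T) (\<lambda>z. ennreal (exp (- (cmod z)\<^sup>2) / pi))"
    using T(2) by (subst density_distr) auto
  also have "\<dots> = std_complex_normal"
    unfolding T(1) std_complex_normal_def ..
  finally show ?thesis .
qed

lemma distr_uminus_std_complex_normal: "distr std_complex_normal borel uminus = std_complex_normal"
proof (rule nn_integral_std_complex_normal_cong_distr)
  have "(lborel :: complex measure) = distr lborel borel uminus"
    by (subst lborel_affine[of "-1" 0]) (auto simp: density_1)
  then show "distr lborel borel uminus = (lborel :: complex measure)" ..
qed auto

lemma distr_imaginary_unit_std_complex_normal:
  "distr std_complex_normal borel ((*) \<i>) = std_complex_normal"
  by (rule nn_integral_std_complex_normal_cong_distr[OF distr_imaginary_unit_lborel])
    (auto simp: norm_mult)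

lemma has_bochner_integral_cmod_power2_std_complex_normal:
  "has_bochner_integral std_complex_normal (\<lambda>w. (cmod w)\<^sup>2) 1"
  using has_bochner_integral_gamma_law_id[of 1]
  unfolding distr_power2_std_complex_normal[symmetric]
  by (auto simp: has_bochner_integral_iff integrable_distr_eq integral_distr)

lemma integrable_cmod_power4_std_complex_normal:
  "integrable std_complex_normal (\<lambda>w. (cmod w) ^ 4)"
  using integrable_gamma_law_power2[OF zero_less_one]
  unfolding distr_power2_std_complex_normal[symmetric]
  by (subst (asm) integrable_distr_eq) (auto simp: power_mult[symmetric])

lemma integrable_Re_std_complex_normal: "integrable std_complex_normal (\<lambda>w. Re (a * w))"
proof (rule Bochner_Integration.integrable_bound)
  interpret prob_space std_complex_normal by (rule prob_space_std_complex_normal)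
  show "integrable std_complex_normal (\<lambda>w. cmod a * (1 + (cmod w)\<^sup>2))"
    using has_bochner_integral_cmod_power2_std_complex_normal by (auto simp: has_bochner_integral_iff)
  show "AE w in std_complex_normal. norm (Re (a * w)) \<le> norm (cmod a * (1 + (cmod w)\<^sup>2))"
  proof (intro AE_I2)
    fix w :: complex
    have "\<bar>Re (a * w)\<bar> \<le> cmod a * cmod w"
      using abs_Re_le_cmod[of "a * w"] by (simp add: norm_mult)
    also have "\<dots> \<le> cmod a * (1 + (cmod w)\<^sup>2)"
    proof (intro mult_left_mono)
      have "0 \<le> (cmod w - 1)\<^sup>2" by simp
      also have "\<dots> = 1 + (cmod w)\<^sup>2 - 2 * cmod w"
        by (simp add: power2_eq_square algebra_simps)
      finally show "cmod w \<le> 1 + (cmod w)\<^sup>2"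
        using norm_ge_zero[of w] by linarith
    qed simp
    finally show "norm (Re (a * w)) \<le> norm (cmod a * (1 + (cmod w)\<^sup>2))"
      by (simp add: abs_mult)
  qed
qed simp

lemma integral_Re_std_complex_normal: "(\<integral>w. Re (a * w) \<partial>std_complex_normal) = 0"
proof -
  have "(\<integral>w. Re (a * w) \<partial>std_complex_normal) = (\<integral>w. Re (a * w) \<partial>distr std_complex_normal borel uminus)"
    by (simp only: distr_uminus_std_complex_normal)
  also have "\<dots> = (\<integral>w. Re (a * - w) \<partial>std_complex_normal)"
    by (subst integral_distr) auto
  also have "\<dots> = - (\<integral>w. Re (a * w) \<partial>std_complex_normal)"
    by (simp only: mult_minus_right uminus_complex.sel Bochner_Integration.integral_minus)
  finally show ?thesis by simp
qed

lemma integrable_Re_power2_std_complex_normal: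
  "integrable std_complex_normal (\<lambda>w. (Re (a * w))\<^sup>2)"
proof (rule Bochner_Integration.integrable_bound)
  show "integrable std_complex_normal (\<lambda>w. (cmod a)\<^sup>2 * (cmod w)\<^sup>2)"
    using has_bochner_integral_cmod_power2_std_complex_normal by (auto simp: has_bochner_integral_iff)
  show "AE w in std_complex_normal. norm ((Re (a * w))\<^sup>2) \<le> norm ((cmod a)\<^sup>2 * (cmod w)\<^sup>2)"
    using abs_Re_le_cmod[of "a * _"]
    by (intro AE_I2) (auto simp: power_mult_distrib[symmetric] norm_mult[symmetric] abs_le_square_iff[symmetric])
qed simp

text \<open>The squares of \<open>Re (a * w)\<close> and \<open>Re (a * \<i> * w)\<close> add up to
  the squared modulus of \<open>a * w\<close>, and a quarter turn gives them equal means.\<close>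

lemma integral_Re_power2_std_complex_normal:
  "(\<integral>w. (Re (a * w))\<^sup>2 \<partial>std_complex_normal) = (cmod a)\<^sup>2 / 2"
proof -
  have "(\<integral>w. (Re (a * w))\<^sup>2 \<partial>std_complex_normal) =
      (\<integral>w. (Re (a * w))\<^sup>2 \<partial>distr std_complex_normal borel ((*) \<i>))"
    by (simp only: distr_imaginary_unit_std_complex_normal)
  also have "\<dots> = (\<integral>w. (Re ((a * \<i>) * w))\<^sup>2 \<partial>std_complex_normal)"
    by (subst integral_distr) (auto simp: mult.assoc)
  finally have "2 * (\<integral>w. (Re (a * w))\<^sup>2 \<partial>std_complex_normal) =
      (\<integral>w. (Re (a * w))\<^sup>2 + (Re ((a * \<i>) * w))\<^sup>2 \<partial>std_complex_normal)"
    by (subst Bochner_Integration.integral_add[OF integrable_Re_power2_std_complex_normal integrable_Re_power2_std_complex_normal]) simp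
  also have "\<dots> = (\<integral>w. (cmod a)\<^sup>2 * (cmod w)\<^sup>2 \<partial>std_complex_normal)"
    by (intro Bochner_Integration.integral_cong refl)
      (simp add: cmod_power2, simp add: power2_eq_square algebra_simps)
  also have "\<dots> = (cmod a)\<^sup>2"
    using has_bochner_integral_cmod_power2_std_complex_normal by (simp add: has_bochner_integral_iff)
  finally show ?thesis by simp
qed

section \<open>The noise space\<close>

abbreviation increments :: "real \<Rightarrow> (nat \<Rightarrow> real) measure" where
  "increments \<sigma> \<equiv> Pi\<^sub>M {1..} (\<lambda>k. wrapped_normal \<sigma>)"

abbreviation additive_noise :: "nat \<Rightarrow> (nat \<times> nat \<Rightarrow> complex) measure" where
  "additive_noise M \<equiv> Pi\<^sub>M ({1..} \<times> {..<M}) (\<lambda>_. std_complex_normal)"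

text \<open>The law of the output for zero input; it is the reference measure \<open>Q\<close> of
  the dominated channel.\<close>

definition block_noise :: "nat \<Rightarrow> nat \<Rightarrow> (nat \<Rightarrow> nat \<Rightarrow> complex) measure" where
  "block_noise M n = Pi\<^sub>M {1..n} (\<lambda>_. Pi\<^sub>M {..<M} (\<lambda>_. std_complex_normal))"

lemma noise_space_alt:
  "noise_space M \<sigma>\<^sub>c \<sigma>\<^sub>r = phase_source \<sigma>\<^sub>c \<Otimes>\<^sub>M phase_source \<sigma>\<^sub>r \<Otimes>\<^sub>M additive_noise M"
  unfolding noise_space_def case_prod_const ..

lemma sets_block_noise [measurable_cong, simp]: "sets (block_noise M n) = sets (block_space M n)"
  unfolding block_noise_def block_space_def by (intro sets_PiM_cong refl) auto

lemma prob_space_block_noise: "prob_space (block_noise M n)"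
  unfolding block_noise_def by (intro prob_space_PiM prob_space_std_complex_normal)

lemma prob_space_increments: "\<sigma> > 0 \<Longrightarrow> prob_space (increments \<sigma>)"
  by (intro prob_space_PiM prob_space_wrapped_normal)

lemma prob_space_phase_source: "\<sigma> > 0 \<Longrightarrow> prob_space (phase_source \<sigma>)"
  unfolding phase_source_def
  by (intro prob_space_pair prob_space_uniform_phase prob_space_increments)

lemma prob_space_additive_noise: "prob_space (additive_noise M)"
  by (intro prob_space_PiM prob_space_std_complex_normal)

lemma prob_space_noise_space: "\<sigma>\<^sub>c > 0 \<Longrightarrow> \<sigma>\<^sub>r > 0 \<Longrightarrow> prob_space (noise_space M \<sigma>\<^sub>c \<sigma>\<^sub>r)"
  unfolding noise_space_alt
  by (intro prob_space_pair prob_space_phase_source prob_space_additive_noise)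

lemma measurable_snd_phase_source:
  "k \<ge> 1 \<Longrightarrow> (\<lambda>s. snd s k) \<in> borel_measurable (phase_source \<sigma>)"
  unfolding phase_source_def by measurable

lemma measurable_phase [measurable]: "(\<lambda>s. phase s k) \<in> borel_measurable (phase_source \<sigma>)"
proof (induction k)
  case 0
  show ?case by (simp add: phase_source_def)
next
  case (Suc k)
  note [measurable] = Suc measurable_snd_phase_source[of "Suc k" \<sigma>]
  show ?case
    unfolding phase.simps circ_add_def by measurable
qed

lemma measurable_comb_phase [measurable]:
  "(\<lambda>\<omega>. comb_phase \<omega> k m) \<in> borel_measurable (noise_space M \<sigma>\<^sub>c \<sigma>\<^sub>r)"
  unfolding comb_phase_def noise_space_alt split_beta' by measurable

lemma measurable_comb_additive [measurable (raw)]: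
  assumes "k \<ge> 1" "m < M"
  shows "(\<lambda>\<omega>. comb_additive \<omega> k m) \<in> borel_measurable (noise_space M \<sigma>\<^sub>c \<sigma>\<^sub>r)"
proof -
  have "(\<lambda>w. w (k, m)) \<in> borel_measurable (additive_noise M)"
    using assms measurable_component_singleton[of "(k, m)" "{1..} \<times> {..<M}" "\<lambda>_. std_complex_normal"]
    by (simp cong: measurable_cong_sets)
  then have "(\<lambda>\<omega>. snd (snd \<omega>) (k, m)) \<in> borel_measurable (noise_space M \<sigma>\<^sub>c \<sigma>\<^sub>r)"
    unfolding noise_space_alt by measurable
  then show ?thesis
    by (simp add: comb_additive_def split_beta')
qed

lemma measurable_block_component [measurable (raw)]:
  assumes "k \<in> {1..n}" "m < M"
  shows "(\<lambda>x. x k m) \<in> borel_measurable (block_space M n)"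
proof -
  have "(\<lambda>x. x k) \<in> measurable (block_space M n) (Pi\<^sub>M {..<M} (\<lambda>_. borel))"
    unfolding block_space_def using assms by (intro measurable_component_singleton)
  then show ?thesis
    by (rule measurable_compose) (use assms in \<open>auto intro: measurable_component_singleton\<close>)
qed

lemma measurable_block_lambda [measurable (raw)]:
  assumes "\<And>k m. k \<in> {1..n} \<Longrightarrow> m < M \<Longrightarrow> (\<lambda>x. f x k m) \<in> borel_measurable A"
  shows "(\<lambda>x. \<lambda>k\<in>{1..n}. \<lambda>m\<in>{..<M}. f x k m) \<in> measurable A (block_space M n)"
  unfolding block_space_def using assms by (intro measurable_restrict) auto

lemma measurable_comb_output [measurable]:
  "(\<lambda>(x, \<omega>). comb_output M n x \<omega>) \<in>
    measurable (block_space M n \<Otimes>\<^sub>M noise_space M \<sigma>\<^sub>c \<sigma>\<^sub>r) (block_space M n)"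
  unfolding comb_output_def split_beta'
proof (rule measurable_block_lambda)
  fix k m assume km: "k \<in> {1..n}" "m < M"
  note [measurable] = measurable_block_component[OF km] measurable_comb_additive[of k m M \<sigma>\<^sub>c \<sigma>\<^sub>r]
  have [measurable]: "(\<lambda>z. fst z k m) \<in> borel_measurable (block_space M n \<Otimes>\<^sub>M noise_space M \<sigma>\<^sub>c \<sigma>\<^sub>r)"
    by (rule measurable_compose[OF measurable_fst measurable_block_component[OF km]])
  have [measurable]: "(\<lambda>z. comb_additive (snd z) k m) \<in> borel_measurable (block_space M n \<Otimes>\<^sub>M noise_space M \<sigma>\<^sub>c \<sigma>\<^sub>r)"
    by (rule measurable_compose[OF measurable_snd measurable_comb_additive]) (use km in auto)
  show "(\<lambda>z. exp (\<i> * of_real (comb_phase (snd z) k m)) * fst z k m + comb_additive (snd z) k m)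
      \<in> borel_measurable (block_space M n \<Otimes>\<^sub>M noise_space M \<sigma>\<^sub>c \<sigma>\<^sub>r)"
    by measurable
qed

section \<open>Stationarity of the noise\<close>

text \<open>Restarts the process at time \<open>a\<close>: the phase reached there becomes the
  initial value and the increments are renumbered from 1. The restriction keeps the result in the
  extensional product space.\<close>

definition phase_shift :: "nat \<Rightarrow> real \<times> (nat \<Rightarrow> real) \<Rightarrow> real \<times> (nat \<Rightarrow> real)" where
  "phase_shift a s = (phase s a, \<lambda>k\<in>{1..}. snd s (k + a))"

lemma phase_phase_shift: "phase (phase_shift a s) k = phase s (k + a)"
  by (induction k) (auto simp: phase_shift_def)

lemma phase_shift_Suc: "phase_shift (Suc a) s = phase_shift 1 (phase_shift a s)"
  by (auto simp: phase_shift_def fun_eq_iff restrict_def)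

lemma measurable_phase_shift [measurable]:
  "phase_shift a \<in> measurable (phase_source \<sigma>) (phase_source \<sigma>)"
proof -
  have [measurable]: "k \<ge> 1 \<Longrightarrow> (\<lambda>s. snd s k) \<in> borel_measurable (phase_source \<sigma>)" for k
    by (rule measurable_snd_phase_source)
  have 1: "(\<lambda>s. phase s a) \<in> measurable (phase_source \<sigma>) uniform_phase"
    by measurable
  have "(\<lambda>s. \<lambda>k\<in>{1..}. snd s (k + a)) \<in> measurable (phase_source \<sigma>) (increments \<sigma>)"
    by (intro measurable_restrict) (auto simp: measurable_snd_phase_source cong: measurable_cong_sets)
  with 1 show ?thesis
    unfolding phase_shift_def[abs_def] by (subst (2) phase_source_def) (rule measurable_Pair)
qed

text \<open>The uniform phase absorbs an independent increment, and removing one increment from an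
  i.i.d. sequence does not change its law.\<close>

lemma distr_phase_shift_1:
  assumes "\<sigma> > 0"
  shows "distr (phase_source \<sigma>) (phase_source \<sigma>) (phase_shift 1) = phase_source \<sigma>"
proof (rule measure_eqI)
  note One_nat_def [simp del]
  interpret G: prob_space "wrapped_normal \<sigma>" by (rule prob_space_wrapped_normal) fact
  interpret U: prob_space uniform_phase by (rule prob_space_uniform_phase)
  interpret seq: sequence_space "wrapped_normal \<sigma>" ..
  interpret D: prob_space "increments \<sigma>" by (rule prob_space_increments) fact
  let ?S = "Pi\<^sub>M (UNIV :: nat set) (\<lambda>_. wrapped_normal \<sigma>)"
  have Ssf: "sigma_finite_measure ?S"
    by (intro prob_space_imp_sigma_finite prob_space_PiM prob_space_wrapped_normal assms)
  interpret UG: pair_sigma_finite uniform_phase "wrapped_normal \<sigma>" ..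
  \<comment> \<open>Increments start at index 1, whereas the splitting off of the first element of a
    sequence is formulated for sequences starting at 0; \<open>re\<close> translates between the
    two.\<close>
  define re :: "(nat \<Rightarrow> real) \<Rightarrow> nat \<Rightarrow> real" where "re = (\<lambda>\<omega>. \<lambda>k\<in>{1..}. \<omega> (k - 1))"
  have [measurable]: "re \<in> measurable ?S (increments \<sigma>)"
    unfolding re_def by (intro measurable_restrict) measurable
  have re: "distr ?S (increments \<sigma>) re = increments \<sigma>"
    unfolding re_def
    by (rule distr_PiM_reindex[of UNIV "\<lambda>_. wrapped_normal \<sigma>" "\<lambda>k. k - 1" "{1..}"])
      (auto simp: inj_on_def prob_space_wrapped_normal assms)
  have *: "phase_shift 1 (\<theta>, re (case_nat g \<omega>)) = (wrap_pi (\<theta> + g), re \<omega>)" for \<theta> g \<omega>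
    by (auto simp: phase_shift_def re_def fun_eq_iff circ_add_def add.commute restrict_def One_nat_def split: nat.split)
  have PS: "sets (phase_source \<sigma>) = sets (uniform_phase \<Otimes>\<^sub>M increments \<sigma>)"
    unfolding phase_source_def ..
  fix A assume "A \<in> sets (distr (phase_source \<sigma>) (phase_source \<sigma>) (phase_shift 1))"
  then have A[measurable]: "A \<in> sets (uniform_phase \<Otimes>\<^sub>M increments \<sigma>)" by (simp add: PS)
  have [measurable]: "phase_shift 1 \<in> measurable (uniform_phase \<Otimes>\<^sub>M increments \<sigma>) (uniform_phase \<Otimes>\<^sub>M increments \<sigma>)"
    using measurable_phase_shift[of 1 \<sigma>] unfolding phase_source_def .
  define \<phi> where "\<phi> t = (\<integral>\<^sup>+\<omega>. indicator A (t, re \<omega>) \<partial>?S)" for t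
  have [measurable]: "\<phi> \<in> borel_measurable borel"
  proof -
    have "\<phi> \<in> borel_measurable uniform_phase"
      unfolding \<phi>_def by measurable
    then show ?thesis by (simp cong: measurable_cong_sets)
  qed
  have "emeasure (distr (phase_source \<sigma>) (phase_source \<sigma>) (phase_shift 1)) A =
      (\<integral>\<^sup>+s. indicator A (phase_shift 1 s) \<partial>(uniform_phase \<Otimes>\<^sub>M increments \<sigma>))"
    using A by (subst nn_integral_indicator[symmetric], simp add: PS, subst nn_integral_distr)
      (auto simp: phase_source_def)
  also have "\<dots> = (\<integral>\<^sup>+\<theta>. \<integral>\<^sup>+d. indicator A (phase_shift 1 (\<theta>, d)) \<partial>distr ?S (increments \<sigma>) re \<partial>uniform_phase)"
    by (subst D.nn_integral_fst[symmetric]) (auto simp: re)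
  also have "\<dots> = (\<integral>\<^sup>+\<theta>. \<integral>\<^sup>+\<omega>. indicator A (phase_shift 1 (\<theta>, re \<omega>)) \<partial>distr (wrapped_normal \<sigma> \<Otimes>\<^sub>M ?S) ?S (\<lambda>(s, \<omega>). case_nat s \<omega>) \<partial>uniform_phase)"
    by (subst seq.PiM_iter, intro nn_integral_cong, subst nn_integral_distr) auto
  also have "\<dots> = (\<integral>\<^sup>+\<theta>. \<integral>\<^sup>+z. indicator A (phase_shift 1 (\<theta>, re (case_nat (fst z) (snd z)))) \<partial>(wrapped_normal \<sigma> \<Otimes>\<^sub>M ?S) \<partial>uniform_phase)"
    by (intro nn_integral_cong, subst nn_integral_distr) (auto simp: split_beta')
  also have "\<dots> = (\<integral>\<^sup>+\<theta>. \<integral>\<^sup>+z. indicator A (wrap_pi (\<theta> + fst z), re (snd z)) \<partial>(wrapped_normal \<sigma> \<Otimes>\<^sub>M ?S) \<partial>uniform_phase)"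
    unfolding * ..
  also have "\<dots> = (\<integral>\<^sup>+\<theta>. \<integral>\<^sup>+g. \<phi> (wrap_pi (\<theta> + g)) \<partial>wrapped_normal \<sigma> \<partial>uniform_phase)"
    unfolding \<phi>_def by (intro nn_integral_cong, subst sigma_finite_measure.nn_integral_fst[OF Ssf, symmetric]) auto
  \<comment> \<open>With the increment frozen by Fubini, the inner integral over the uniform phase
    is invariant under the shift by \<open>g\<close>.\<close>
  also have "\<dots> = (\<integral>\<^sup>+g. \<integral>\<^sup>+\<theta>. \<phi> (wrap_pi (\<theta> + g)) \<partial>uniform_phase \<partial>wrapped_normal \<sigma>)"
    by (rule UG.Fubini'[symmetric]) measurable
  also have "\<dots> = (\<integral>\<^sup>+g. \<integral>\<^sup>+\<theta>. \<phi> \<theta> \<partial>uniform_phase \<partial>wrapped_normal \<sigma>)"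
    by (subst nn_integral_uniform_phase_shift) auto
  also have "\<dots> = (\<integral>\<^sup>+\<theta>. \<phi> \<theta> \<partial>uniform_phase)"
    using G.emeasure_space_1 by simp
  also have "\<dots> = (\<integral>\<^sup>+\<theta>. \<integral>\<^sup>+d. indicator A (\<theta>, d) \<partial>distr ?S (increments \<sigma>) re \<partial>uniform_phase)"
    unfolding \<phi>_def by (intro nn_integral_cong, subst nn_integral_distr) auto
  also have "\<dots> = emeasure (phase_source \<sigma>) A"
    unfolding re phase_source_def by (subst D.nn_integral_fst) (auto simp: nn_integral_indicator[OF A])
  finally show "emeasure (distr (phase_source \<sigma>) (phase_source \<sigma>) (phase_shift 1)) A = emeasure (phase_source \<sigma>) A" .
qed simp

lemma distr_phase_shift:
  assumes "\<sigma> > 0"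
  shows "distr (phase_source \<sigma>) (phase_source \<sigma>) (phase_shift a) = phase_source \<sigma>"
proof (induction a)
  case 0
  have "distr (phase_source \<sigma>) (phase_source \<sigma>) (phase_shift 0) = distr (phase_source \<sigma>) (phase_source \<sigma>) (\<lambda>x. x)"
    by (intro distr_cong refl)
      (auto simp: phase_shift_def phase_source_def space_pair_measure space_PiM PiE_def extensional_restrict)
  then show ?case by simp
next
  case (Suc a)
  have "distr (phase_source \<sigma>) (phase_source \<sigma>) (phase_shift (Suc a)) =
      distr (distr (phase_source \<sigma>) (phase_source \<sigma>) (phase_shift a)) (phase_source \<sigma>) (phase_shift 1)"
    by (subst distr_distr) (auto simp: comp_def phase_shift_Suc[symmetric] simp del: One_nat_def)
  then show ?case
    by (simp only: Suc distr_phase_shift_1[OF assms])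
qed

definition noise_shift :: "nat \<Rightarrow> nat \<Rightarrow> noise \<Rightarrow> noise" where
  "noise_shift M a = (\<lambda>(s\<^sub>c, s\<^sub>r, w). (phase_shift a s\<^sub>c, phase_shift a s\<^sub>r,
     \<lambda>i\<in>{1..} \<times> {..<M}. w (fst i + a, snd i)))"

lemma measurable_additive_shift [measurable]:
  "(\<lambda>w. \<lambda>i\<in>{1..} \<times> {..<M}. w (fst i + a, snd i)) \<in> measurable (additive_noise M) (additive_noise M)"
  by (intro measurable_restrict measurable_component_singleton) auto

lemma measurable_noise_shift [measurable]:
  "noise_shift M a \<in> measurable (noise_space M \<sigma>\<^sub>c \<sigma>\<^sub>r) (noise_space M \<sigma>\<^sub>c \<sigma>\<^sub>r)"
  unfolding noise_shift_def noise_space_alt split_beta' by measurable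

lemma distr_noise_shift:
  assumes "\<sigma>\<^sub>c > 0" "\<sigma>\<^sub>r > 0"
  shows "distr (noise_space M \<sigma>\<^sub>c \<sigma>\<^sub>r) (noise_space M \<sigma>\<^sub>c \<sigma>\<^sub>r) (noise_shift M a) = noise_space M \<sigma>\<^sub>c \<sigma>\<^sub>r"
proof -
  have w: "distr (additive_noise M) (additive_noise M) (\<lambda>w. \<lambda>i\<in>{1..} \<times> {..<M}. w (fst i + a, snd i)) = additive_noise M"
    by (rule distr_PiM_reindex[of "{1..} \<times> {..<M}" "\<lambda>_. std_complex_normal" "\<lambda>i. (fst i + a, snd i)" "{1..} \<times> {..<M}"])
      (auto simp: inj_on_def prob_space_std_complex_normal)
  interpret W: prob_space "additive_noise M" by (rule prob_space_additive_noise)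
  interpret R: prob_space "phase_source \<sigma>\<^sub>r" by (rule prob_space_phase_source) fact
  interpret RW: pair_prob_space "phase_source \<sigma>\<^sub>r" "additive_noise M" ..
  have 1: "phase_source \<sigma>\<^sub>r \<Otimes>\<^sub>M additive_noise M = distr (phase_source \<sigma>\<^sub>r \<Otimes>\<^sub>M additive_noise M)
     (phase_source \<sigma>\<^sub>r \<Otimes>\<^sub>M additive_noise M) (\<lambda>(s, w). (phase_shift a s, \<lambda>i\<in>{1..} \<times> {..<M}. w (fst i + a, snd i)))"
    by (subst (1) distr_phase_shift[OF assms(2), of a, symmetric], subst (1) w[symmetric],
      rule pair_measure_distr[OF measurable_phase_shift measurable_additive_shift], unfold w)
      (rule W.sigma_finite_measure_axioms)
  have m: "(\<lambda>(s, w). (phase_shift a s, \<lambda>i\<in>{1..} \<times> {..<M}. w (fst i + a, snd i))) \<in>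
      measurable (phase_source \<sigma>\<^sub>r \<Otimes>\<^sub>M additive_noise M) (phase_source \<sigma>\<^sub>r \<Otimes>\<^sub>M additive_noise M)"
    unfolding split_beta' by measurable
  have "noise_space M \<sigma>\<^sub>c \<sigma>\<^sub>r = distr (phase_source \<sigma>\<^sub>c) (phase_source \<sigma>\<^sub>c) (phase_shift a) \<Otimes>\<^sub>M
     distr (phase_source \<sigma>\<^sub>r \<Otimes>\<^sub>M additive_noise M) (phase_source \<sigma>\<^sub>r \<Otimes>\<^sub>M additive_noise M)
     (\<lambda>(s, w). (phase_shift a s, \<lambda>i\<in>{1..} \<times> {..<M}. w (fst i + a, snd i)))"
    unfolding noise_space_alt distr_phase_shift[OF assms(1)] 1[symmetric] ..
  also have "\<dots> = distr (noise_space M \<sigma>\<^sub>c \<sigma>\<^sub>r) (noise_space M \<sigma>\<^sub>c \<sigma>\<^sub>r)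
     (\<lambda>(s, z). (phase_shift a s, (\<lambda>(s, w). (phase_shift a s, \<lambda>i\<in>{1..} \<times> {..<M}. w (fst i + a, snd i))) z))"
    unfolding noise_space_alt
    by (rule pair_measure_distr[OF measurable_phase_shift m], unfold 1[symmetric])
      (rule RW.sigma_finite_measure_axioms)
  also have "(\<lambda>(s, z). (phase_shift a s, (\<lambda>(s, w). (phase_shift a s, \<lambda>i\<in>{1..} \<times> {..<M}. w (fst i + a, snd i))) z)) =
      noise_shift M a"
    by (auto simp: noise_shift_def)
  finally show ?thesis ..
qed

definition window :: "nat \<Rightarrow> nat \<Rightarrow> nat \<Rightarrow> (nat \<Rightarrow> nat \<Rightarrow> complex) \<Rightarrow> nat \<Rightarrow> nat \<Rightarrow> complex" where
  "window M a b x = (\<lambda>k\<in>{1..b}. \<lambda>m\<in>{..<M}. x (k + a) m)"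

lemma measurable_window [measurable (raw)]:
  assumes "a + b \<le> n"
  shows "window M a b \<in> measurable (block_space M n) (block_space M b)"
  unfolding window_def using assms by (intro measurable_block_lambda measurable_block_component) auto

text \<open>Blocks \<open>a + 1\<close> to \<open>a + b\<close> pass through the same channel with
  its clock restarted at \<open>a\<close>. Together with the invariance of the noise law this is the
  stationarity used for superadditivity.\<close>

lemma window_comb_output:
  assumes "a + b \<le> n"
  shows "window M a b (comb_output M n x \<omega>) = comb_output M b (window M a b x) (noise_shift M a \<omega>)"
  using assms
  by (auto simp: window_def comb_output_def fun_eq_iff comb_phase_def comb_additive_def noise_shift_def
      phase_phase_shift split_beta' restrict_def)

section \<open>Domination of the channel by the noise law\<close>

lemma distr_pair_snd:
  assumes "prob_space M" "prob_space N"
  shows "distr (M \<Otimes>\<^sub>M N) N snd = N"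
proof (rule measure_eqI)
  interpret M: prob_space M by fact
  interpret N: prob_space N by fact
  fix A assume "A \<in> sets (distr (M \<Otimes>\<^sub>M N) N snd)"
  then have A: "A \<in> sets N" by simp
  then have "snd -` A \<inter> space (M \<Otimes>\<^sub>M N) = space M \<times> A"
    using sets.sets_into_space by (auto simp: space_pair_measure)
  then show "emeasure (distr (M \<Otimes>\<^sub>M N) N snd) A = emeasure N A"
    using A by (simp add: emeasure_distr N.emeasure_pair_measure_Times M.emeasure_space_1)
qed simp

lemma indep_vars_additive_noise:
  assumes "M \<ge> 1"
  shows "prob_space.indep_vars (additive_noise M) (\<lambda>_. borel) (\<lambda>i w. w i) ({1..} \<times> {..<M})"
proof -
  interpret W: prob_space "additive_noise M" by (rule prob_space_additive_noise)
  let ?I = "{1..} \<times> {..<M} :: (nat \<times> nat) set"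
  have comp: "(\<lambda>w. w i) \<in> borel_measurable (additive_noise M)" if "i \<in> ?I" for i
    using measurable_component_singleton[OF that, of "\<lambda>_. std_complex_normal"]
    by (simp cong: measurable_cong_sets)
  have distr_comp: "distr (additive_noise M) borel (\<lambda>w. w i) = std_complex_normal" if "i \<in> ?I" for i
  proof -
    have "distr (additive_noise M) borel (\<lambda>w. w i) = distr (additive_noise M) std_complex_normal (\<lambda>w. w i)"
      by (intro distr_cong) auto
    also have "\<dots> = std_complex_normal"
      using that by (intro distr_PiM_component prob_space_std_complex_normal)
    finally show ?thesis .
  qed
  have "distr (additive_noise M) (Pi\<^sub>M ?I (\<lambda>_. borel)) (\<lambda>w. \<lambda>i\<in>?I. w i) = distr (additive_noise M) (additive_noise M) (\<lambda>w. w)"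
  proof (rule distr_cong)
    show "sets (Pi\<^sub>M ?I (\<lambda>_. borel)) = sets (additive_noise M)"
      by (intro sets_PiM_cong) auto
  qed (auto simp: space_PiM PiE_def extensional_restrict)
  also have "\<dots> = Pi\<^sub>M ?I (\<lambda>i. distr (additive_noise M) borel (\<lambda>w. w i))"
    unfolding distr_id2[OF refl] by (intro PiM_cong refl distr_comp[symmetric])
  finally show ?thesis
    using assms comp by (subst W.indep_vars_iff_distr_eq_PiM') (auto simp: lessThan_empty_iff)
qed

text \<open>The noise space indexes its complex Gaussians by pairs over infinitely many blocks,
  whereas outputs live in a finite product of finite products. Independence of the groups of
  coordinates identifies the two.\<close>

lemma distr_additive_noise_blocks:
  assumes "M \<ge> 1" "n \<ge> 1"
  shows "distr (additive_noise M) (block_space M n) (\<lambda>w. \<lambda>k\<in>{1..n}. \<lambda>m\<in>{..<M}. w (k, m)) = block_noise M n"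
proof -
  interpret W: prob_space "additive_noise M" by (rule prob_space_additive_noise)
  let ?I = "{1..} \<times> {..<M} :: (nat \<times> nat) set"
  have comp: "(\<lambda>w. w i) \<in> borel_measurable (additive_noise M)" if "i \<in> ?I" for i
    using measurable_component_singleton[OF that, of "\<lambda>_. std_complex_normal"]
    by (simp cong: measurable_cong_sets)
  note indep = indep_vars_additive_noise[OF assms(1)]
  have "W.indep_vars (\<lambda>k. Pi\<^sub>M ({k} \<times> {..<M}) (\<lambda>_. borel)) (\<lambda>k w. restrict (\<lambda>i. w i) ({k} \<times> {..<M})) {1..n}"
    by (rule W.indep_vars_restrict[OF indep]) (auto simp: disjoint_family_on_def)
  then have "W.indep_vars (\<lambda>k. Pi\<^sub>M {..<M} (\<lambda>_. borel))
      (\<lambda>k w. (\<lambda>v. \<lambda>m\<in>{..<M}. v (k, m)) (restrict (\<lambda>i. w i) ({k} \<times> {..<M}))) {1..n}"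
    by (rule W.indep_vars_compose2) (intro measurable_restrict measurable_component_singleton, auto)
  moreover have "(\<lambda>v. \<lambda>m\<in>{..<M}. v (k, m)) (restrict (\<lambda>i. w i) ({k} \<times> {..<M})) = (\<lambda>m\<in>{..<M}. w (k, m))"
    for k and w :: "nat \<times> nat \<Rightarrow> complex"
    by (auto simp: restrict_def fun_eq_iff)
  ultimately have indep2: "W.indep_vars (\<lambda>k. Pi\<^sub>M {..<M} (\<lambda>_. borel)) (\<lambda>k w. \<lambda>m\<in>{..<M}. w (k, m)) {1..n}"
    by simp
  have m2: "(\<lambda>w. \<lambda>m\<in>{..<M}. w (k, m)) \<in> measurable (additive_noise M) (Pi\<^sub>M {..<M} (\<lambda>_. borel))" if "k \<ge> 1" for k
    using that by (intro measurable_restrict comp) auto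
  have "distr (additive_noise M) (Pi\<^sub>M {1..n} (\<lambda>k. Pi\<^sub>M {..<M} (\<lambda>_. borel))) (\<lambda>w. \<lambda>k\<in>{1..n}. \<lambda>m\<in>{..<M}. w (k, m)) =
      Pi\<^sub>M {1..n} (\<lambda>k. distr (additive_noise M) (Pi\<^sub>M {..<M} (\<lambda>_. borel)) (\<lambda>w. \<lambda>m\<in>{..<M}. w (k, m)))"
    using indep2 assms m2 by (subst (asm) W.indep_vars_iff_distr_eq_PiM') auto
  also have "\<dots> = Pi\<^sub>M {1..n} (\<lambda>k. Pi\<^sub>M {..<M} (\<lambda>_. std_complex_normal))"
  proof (intro PiM_cong refl)
    fix k :: nat assume k: "k \<in> {1..n}"
    have "distr (additive_noise M) (Pi\<^sub>M {..<M} (\<lambda>_. borel)) (\<lambda>w. \<lambda>m\<in>{..<M}. w (k, m)) =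
        distr (additive_noise M) (Pi\<^sub>M {..<M} (\<lambda>_. std_complex_normal)) (\<lambda>w. \<lambda>m\<in>{..<M}. w (k, m))"
      by (intro distr_cong refl sets_PiM_cong) auto
    also have "\<dots> = Pi\<^sub>M {..<M} (\<lambda>_. std_complex_normal)"
      by (rule distr_PiM_reindex[of ?I "\<lambda>_. std_complex_normal" "\<lambda>m. (k, m)" "{..<M}"])
        (use k in \<open>auto simp: inj_on_def prob_space_std_complex_normal\<close>)
    finally show "distr (additive_noise M) (Pi\<^sub>M {..<M} (\<lambda>_. borel)) (\<lambda>w. \<lambda>m\<in>{..<M}. w (k, m)) =
        Pi\<^sub>M {..<M} (\<lambda>_. std_complex_normal)" .
  qed
  finally show ?thesis
    unfolding block_space_def block_noise_def .
qed

section \<open>Domination of shifted noise, one coordinate at a time\<close>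

text \<open>Tensorisation of a domination bound that holds for every single coordinate. It is
  applied twice below, to the symbols of a block and to the blocks. The maps \<open>T i\<close> may
  differ between coordinates, as a shift by the input does, but share the factor
  \<open>c\<close>.\<close>

lemma nn_integral_PiM_transform_le:
  fixes T :: "'i \<Rightarrow> 'b \<Rightarrow> 'b" and c :: "'b \<Rightarrow> ennreal"
  assumes \<nu>: "prob_space \<nu>"
    and T [measurable]: "\<And>i. T i \<in> measurable \<nu> \<nu>" and c [measurable]: "c \<in> borel_measurable \<nu>"
    and le: "\<And>i h. h \<in> borel_measurable \<nu> \<Longrightarrow> (\<integral>\<^sup>+u. h (T i u) \<partial>\<nu>) \<le> (\<integral>\<^sup>+u. h u * c u \<partial>\<nu>)"
    and "finite I"
  shows "h \<in> borel_measurable (Pi\<^sub>M I (\<lambda>_. \<nu>)) \<Longrightarrow>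
    (\<integral>\<^sup>+u. h (\<lambda>i\<in>I. T i (u i)) \<partial>Pi\<^sub>M I (\<lambda>_. \<nu>)) \<le> (\<integral>\<^sup>+u. h u * (\<Prod>i\<in>I. c (u i)) \<partial>Pi\<^sub>M I (\<lambda>_. \<nu>))"
  using \<open>finite I\<close>
proof (induction I arbitrary: h rule: finite_induct)
  case empty
  interpret \<nu>: prob_space \<nu> by fact
  interpret product_prob_space "\<lambda>_. \<nu>" ..
  show ?case
    by (simp add: PiM_empty nn_integral_count_space_finite restrict_def)
next
  case (insert i I)
  interpret \<nu>: prob_space \<nu> by fact
  interpret product_prob_space "\<lambda>_::'i. \<nu>" ..
  note [measurable] = insert.prems
  have upd[measurable]: "y \<in> space \<nu> \<Longrightarrow> (\<lambda>x. x(i := y)) \<in> measurable (Pi\<^sub>M I (\<lambda>_. \<nu>)) (Pi\<^sub>M (insert i I) (\<lambda>_. \<nu>))" for y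
    by (rule measurable_fun_upd[where J=I]) auto
  have upd2[measurable]: "x \<in> space (Pi\<^sub>M I (\<lambda>_. \<nu>)) \<Longrightarrow> (\<lambda>y. x(i := y)) \<in> measurable \<nu> (Pi\<^sub>M (insert i I) (\<lambda>_. \<nu>))" for x
    by (rule measurable_component_update) (use insert in auto)
  have cp[measurable]: "(\<lambda>x. \<Prod>j\<in>I. c (x j)) \<in> borel_measurable (Pi\<^sub>M (insert i I) (\<lambda>_. \<nu>))"
    "(\<lambda>x. \<Prod>j\<in>I. c (x j)) \<in> borel_measurable (Pi\<^sub>M I (\<lambda>_. \<nu>))"
    by (auto intro!: borel_measurable_prod_ennreal measurable_compose[OF _ c] measurable_component_singleton)
  have Ti[measurable]: "(\<lambda>x. x(i := T i (x i))) \<in> measurable (Pi\<^sub>M (insert i I) (\<lambda>_. \<nu>)) (Pi\<^sub>M (insert i I) (\<lambda>_. \<nu>))"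
    by (rule measurable_fun_upd[where J="insert i I"]) auto
  have all[measurable]: "(\<lambda>x. \<lambda>j\<in>insert i I. T j (x j)) \<in> measurable (Pi\<^sub>M (insert i I) (\<lambda>_. \<nu>)) (Pi\<^sub>M (insert i I) (\<lambda>_. \<nu>))"
    by (intro measurable_restrict) measurable
  have hT: "(\<lambda>u. h (\<lambda>j\<in>insert i I. T j (u j))) \<in> borel_measurable (Pi\<^sub>M (insert i I) (\<lambda>_. \<nu>))"
    by (rule measurable_compose[OF all insert.prems])
  have "(\<integral>\<^sup>+u. h (\<lambda>j\<in>insert i I. T j (u j)) \<partial>Pi\<^sub>M (insert i I) (\<lambda>_. \<nu>)) =
      (\<integral>\<^sup>+y. \<integral>\<^sup>+x. h ((\<lambda>j\<in>I. T j (x j))(i := T i y)) \<partial>Pi\<^sub>M I (\<lambda>_. \<nu>) \<partial>\<nu>)"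
    using insert.hyps
    by (subst product_nn_integral_insert_rev[OF insert.hyps hT])
      (auto intro!: nn_integral_cong arg_cong[where f=h] simp: fun_eq_iff restrict_def)
  \<comment> \<open>The induction hypothesis handles the old coordinates while the new one is frozen
    at its transformed value.\<close>
  also have "\<dots> \<le> (\<integral>\<^sup>+y. \<integral>\<^sup>+x. h (x(i := T i y)) * (\<Prod>j\<in>I. c (x j)) \<partial>Pi\<^sub>M I (\<lambda>_. \<nu>) \<partial>\<nu>)"
  proof (rule nn_integral_mono)
    fix y assume "y \<in> space \<nu>"
    then have "T i y \<in> space \<nu>" by (rule measurable_space[OF T])
    note [measurable] = upd[OF this]
    show "(\<integral>\<^sup>+x. h ((\<lambda>j\<in>I. T j (x j))(i := T i y)) \<partial>Pi\<^sub>M I (\<lambda>_. \<nu>)) \<le>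
        (\<integral>\<^sup>+x. h (x(i := T i y)) * (\<Prod>j\<in>I. c (x j)) \<partial>Pi\<^sub>M I (\<lambda>_. \<nu>))"
      by (rule insert.IH[of "\<lambda>x. h (x(i := T i y))"]) measurable
  qed
  \<comment> \<open>Passing through the full product exchanges the order of integration, so that the
    bound for the new coordinate applies inside.\<close>
  also have "\<dots> = (\<integral>\<^sup>+u. h (u(i := T i (u i))) * (\<Prod>j\<in>I. c (u j)) \<partial>Pi\<^sub>M (insert i I) (\<lambda>_. \<nu>))"
    using insert.hyps
    by (subst product_nn_integral_insert_rev) (auto intro!: nn_integral_cong arg_cong2[where f="(*)"] prod.cong)
  also have "\<dots> = (\<integral>\<^sup>+x. \<integral>\<^sup>+y. h (x(i := T i y)) * (\<Prod>j\<in>I. c (x j)) \<partial>\<nu> \<partial>Pi\<^sub>M I (\<lambda>_. \<nu>))"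
    using insert.hyps
    by (subst product_nn_integral_insert) (auto intro!: nn_integral_cong arg_cong2[where f="(*)"] prod.cong)
  also have "\<dots> \<le> (\<integral>\<^sup>+x. \<integral>\<^sup>+y. h (x(i := y)) * (c y * (\<Prod>j\<in>I. c (x j))) \<partial>\<nu> \<partial>Pi\<^sub>M I (\<lambda>_. \<nu>))"
  proof (rule nn_integral_mono)
    fix x assume "x \<in> space (Pi\<^sub>M I (\<lambda>_. \<nu>))"
    note [measurable] = upd2[OF this]
    have "(\<integral>\<^sup>+y. h (x(i := T i y)) * (\<Prod>j\<in>I. c (x j)) \<partial>\<nu>) = (\<integral>\<^sup>+y. h (x(i := T i y)) \<partial>\<nu>) * (\<Prod>j\<in>I. c (x j))"
      by (rule nn_integral_multc) measurable
    also have "\<dots> \<le> (\<integral>\<^sup>+y. h (x(i := y)) * c y \<partial>\<nu>) * (\<Prod>j\<in>I. c (x j))"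
      by (intro mult_right_mono le) auto
    also have "\<dots> = (\<integral>\<^sup>+y. h (x(i := y)) * c y * (\<Prod>j\<in>I. c (x j)) \<partial>\<nu>)"
      by (rule nn_integral_multc[symmetric]) measurable
    finally show "(\<integral>\<^sup>+y. h (x(i := T i y)) * (\<Prod>j\<in>I. c (x j)) \<partial>\<nu>) \<le>
        (\<integral>\<^sup>+y. h (x(i := y)) * (c y * (\<Prod>j\<in>I. c (x j))) \<partial>\<nu>)"
      by (simp add: mult.assoc)
  qed
  also have "\<dots> = (\<integral>\<^sup>+u. h u * (\<Prod>j\<in>insert i I. c (u j)) \<partial>Pi\<^sub>M (insert i I) (\<lambda>_. \<nu>))"
    using insert.hyps
    by (subst product_nn_integral_insert)
      (auto intro!: nn_integral_cong arg_cong2[where f="(*)"] prod.cong simp: borel_measurable_prod_ennreal)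
  finally show ?case .
qed

text \<open>The shifted density is at most its peak \<open>1 / pi\<close>, which equals the
  unshifted density times \<open>exp ((cmod u)\<^sup>2)\<close>. The bound is uniform in the shift,
  hence in the input and the phases.\<close>

lemma nn_integral_std_complex_normal_shift_le:
  assumes [measurable]: "h \<in> borel_measurable borel"
  shows "(\<integral>\<^sup>+u. h (v + u) \<partial>std_complex_normal) \<le> (\<integral>\<^sup>+u. h u * ennreal (exp ((cmod u)\<^sup>2)) \<partial>std_complex_normal)"
proof -
  have "(\<integral>\<^sup>+u. h (v + u) \<partial>std_complex_normal) = (\<integral>\<^sup>+u. ennreal (exp (- (cmod u)\<^sup>2) / pi) * h (v + u) \<partial>lborel)"
    unfolding std_complex_normal_def by (subst nn_integral_density) auto
  also have "\<dots> \<le> (\<integral>\<^sup>+u. ennreal (1 / pi) * h (v + u) \<partial>lborel)"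
    by (intro nn_integral_mono mult_right_mono ennreal_leI divide_right_mono) auto
  also have "\<dots> = (\<integral>\<^sup>+u. ennreal (1 / pi) * h u \<partial>distr lborel borel ((+) v))"
    by (subst nn_integral_distr) auto
  also have "\<dots> = (\<integral>\<^sup>+u. ennreal (exp (- (cmod u)\<^sup>2) / pi) * (h u * ennreal (exp ((cmod u)\<^sup>2))) \<partial>lborel)"
    unfolding lborel_distr_plus
  proof (intro nn_integral_cong)
    fix u
    have "ennreal (exp (- (cmod u)\<^sup>2) / pi) * (h u * ennreal (exp ((cmod u)\<^sup>2))) =
        (ennreal (exp (- (cmod u)\<^sup>2) / pi) * ennreal (exp ((cmod u)\<^sup>2))) * h u"
      by (simp add: mult_ac)
    also have "ennreal (exp (- (cmod u)\<^sup>2) / pi) * ennreal (exp ((cmod u)\<^sup>2)) = ennreal (1 / pi)"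
      by (subst ennreal_mult'[symmetric]) (auto simp: exp_minus)
    finally show "ennreal (1 / pi) * h u = ennreal (exp (- (cmod u)\<^sup>2) / pi) * (h u * ennreal (exp ((cmod u)\<^sup>2)))" ..
  qed
  also have "\<dots> = (\<integral>\<^sup>+u. h u * ennreal (exp ((cmod u)\<^sup>2)) \<partial>std_complex_normal)"
    unfolding std_complex_normal_def by (subst nn_integral_density) auto
  finally show ?thesis .
qed

definition block_energy :: "nat \<Rightarrow> nat \<Rightarrow> (nat \<Rightarrow> nat \<Rightarrow> complex) \<Rightarrow> real" where
  "block_energy M n y = (\<Sum>k=1..n. \<Sum>m<M. (cmod (y k m))\<^sup>2)"

lemma block_energy_nonneg: "0 \<le> block_energy M n y"
  unfolding block_energy_def by (intro sum_nonneg) auto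

lemma measurable_block_energy [measurable]: "block_energy M n \<in> borel_measurable (block_space M n)"
proof -
  have [measurable]: "k \<in> {1..n} \<Longrightarrow> m \<in> {..<M} \<Longrightarrow> (\<lambda>y. y k m) \<in> borel_measurable (block_space M n)" for k m
    by (rule measurable_block_component) auto
  show ?thesis
    unfolding block_energy_def[abs_def] by (intro borel_measurable_sum) measurable
qed

lemma nn_integral_block_noise_shift_le:
  assumes h: "h \<in> borel_measurable (block_space M n)"
  shows "(\<integral>\<^sup>+u. h (\<lambda>k\<in>{1..n}. \<lambda>m\<in>{..<M}. v k m + u k m) \<partial>block_noise M n) \<le>
    (\<integral>\<^sup>+u. h u * ennreal (exp (block_energy M n u)) \<partial>block_noise M n)"
proof -
  let ?\<nu> = "Pi\<^sub>M {..<M} (\<lambda>_. std_complex_normal)"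
  let ?T = "\<lambda>k u. \<lambda>m\<in>{..<M}. v k m + u m"
  let ?c = "\<lambda>u :: nat \<Rightarrow> complex. \<Prod>m\<in>{..<M}. ennreal (exp ((cmod (u m))\<^sup>2))"
  have c: "?c \<in> borel_measurable ?\<nu>"
    by (intro borel_measurable_prod_ennreal) measurable
  have T: "?T k \<in> measurable ?\<nu> ?\<nu>" for k
    by (intro measurable_restrict) measurable
  have "(\<integral>\<^sup>+u. g (?T k u) \<partial>?\<nu>) \<le> (\<integral>\<^sup>+u. g u * ?c u \<partial>?\<nu>)" if "g \<in> borel_measurable ?\<nu>" for k g
    by (rule nn_integral_PiM_transform_le[OF prob_space_std_complex_normal, of "\<lambda>m u. v k m + u"
          "\<lambda>u. ennreal (exp ((cmod u)\<^sup>2))"])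
      (use that in \<open>auto intro!: nn_integral_std_complex_normal_shift_le\<close>)
  then have "(\<integral>\<^sup>+u. h (\<lambda>k\<in>{1..n}. ?T k (u k)) \<partial>Pi\<^sub>M {1..n} (\<lambda>_. ?\<nu>)) \<le>
      (\<integral>\<^sup>+u. h u * (\<Prod>k\<in>{1..n}. ?c (u k)) \<partial>Pi\<^sub>M {1..n} (\<lambda>_. ?\<nu>))"
  proof (intro nn_integral_PiM_transform_le[OF _ T c])
    show "prob_space ?\<nu>"
      by (intro prob_space_PiM prob_space_std_complex_normal)
    show "h \<in> borel_measurable (Pi\<^sub>M {1..n} (\<lambda>_. ?\<nu>))"
      using h unfolding block_noise_def[symmetric] by (simp cong: measurable_cong_sets)
  qed auto
  moreover have "(\<Prod>k\<in>{1..n}. ?c (u k)) = ennreal (exp (block_energy M n u))" for u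
    by (simp add: block_energy_def exp_sum prod_ennreal prod_nonneg)
  ultimately show ?thesis
    by (simp add: block_noise_def)
qed

text \<open>Given both phase processes the output is additive noise shifted by the rotated input.
  The bound for shifts is uniform, so averaging over the phases preserves it.\<close>

lemma nn_integral_comb_output_le:
  assumes M: "M \<ge> 1" "n \<ge> 1" and \<sigma>: "\<sigma>\<^sub>c > 0" "\<sigma>\<^sub>r > 0"
    and x: "x \<in> space (block_space M n)" and h[measurable]: "h \<in> borel_measurable (block_space M n)"
  shows "(\<integral>\<^sup>+\<omega>. h (comb_output M n x \<omega>) \<partial>noise_space M \<sigma>\<^sub>c \<sigma>\<^sub>r) \<le>
    (\<integral>\<^sup>+y. h y * ennreal (exp (block_energy M n y)) \<partial>block_noise M n)" (is "_ \<le> ?R")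
proof -
  interpret C: prob_space "phase_source \<sigma>\<^sub>c" by (rule prob_space_phase_source) fact
  interpret R: prob_space "phase_source \<sigma>\<^sub>r" by (rule prob_space_phase_source) fact
  interpret W: prob_space "additive_noise M" by (rule prob_space_additive_noise)
  interpret RW: pair_prob_space "phase_source \<sigma>\<^sub>r" "additive_noise M" ..
  have [measurable]: "(\<lambda>\<omega>. comb_output M n x \<omega>) \<in> measurable (noise_space M \<sigma>\<^sub>c \<sigma>\<^sub>r) (block_space M n)"
    using measurable_compose[OF measurable_Pair1'[OF x] measurable_comb_output] by simp
  have hm[measurable]: "(\<lambda>\<omega>. h (comb_output M n x \<omega>)) \<in>
      borel_measurable (phase_source \<sigma>\<^sub>c \<Otimes>\<^sub>M phase_source \<sigma>\<^sub>r \<Otimes>\<^sub>M additive_noise M)"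
    unfolding noise_space_alt[symmetric] by measurable
  have blocks[measurable]: "(\<lambda>w. \<lambda>k\<in>{1..n}. \<lambda>m\<in>{..<M}. w (k, m)) \<in> measurable (additive_noise M) (block_space M n)"
  proof (rule measurable_block_lambda)
    fix k m assume "k \<in> {1..n}" "m < M"
    then have "(k, m) \<in> {1..} \<times> {..<M}" by auto
    from measurable_component_singleton[OF this, of "\<lambda>_. std_complex_normal"]
    show "(\<lambda>w. w (k, m)) \<in> borel_measurable (additive_noise M)"
      by (simp cong: measurable_cong_sets)
  qed
  have inner: "(\<integral>\<^sup>+w. h (comb_output M n x (s, r, w)) \<partial>additive_noise M) \<le> ?R" for s r
  proof -
    \<comment> \<open>\<open>comb_phase\<close> is determined by the two phase sources, so the zero
      function can stand in for the additive noise.\<close>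
    let ?v = "\<lambda>k m. exp (\<i> * of_real (comb_phase (s, r, \<lambda>_. 0) k m)) * x k m"
    let ?g = "\<lambda>u. h (\<lambda>k\<in>{1..n}. \<lambda>m\<in>{..<M}. ?v k m + u k m)"
    have [measurable]: "(\<lambda>u. \<lambda>k\<in>{1..n}. \<lambda>m\<in>{..<M}. ?v k m + u k m) \<in> measurable (block_space M n) (block_space M n)"
    proof (rule measurable_block_lambda)
      fix k m assume "k \<in> {1..n}" "m < M"
      note [measurable] = measurable_block_component[OF this]
      show "(\<lambda>u. ?v k m + u k m) \<in> borel_measurable (block_space M n)"
        by measurable
    qed
    have "comb_output M n x (s, r, w) = (\<lambda>k\<in>{1..n}. \<lambda>m\<in>{..<M}. ?v k m + (\<lambda>k\<in>{1..n}. \<lambda>m\<in>{..<M}. w (k, m)) k m)" for w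
      by (auto simp: comb_output_def comb_phase_def comb_additive_def fun_eq_iff restrict_def)
    then have "(\<integral>\<^sup>+w. h (comb_output M n x (s, r, w)) \<partial>additive_noise M) =
        (\<integral>\<^sup>+w. ?g (\<lambda>k\<in>{1..n}. \<lambda>m\<in>{..<M}. w (k, m)) \<partial>additive_noise M)"
      by simp
    also have "\<dots> = (\<integral>\<^sup>+u. ?g u \<partial>distr (additive_noise M) (block_space M n) (\<lambda>w. \<lambda>k\<in>{1..n}. \<lambda>m\<in>{..<M}. w (k, m)))"
      by (rule nn_integral_distr[symmetric]) measurable
    also have "\<dots> = (\<integral>\<^sup>+u. ?g u \<partial>block_noise M n)"
      unfolding distr_additive_noise_blocks[OF M] ..
    also have "\<dots> \<le> ?R"
      by (rule nn_integral_block_noise_shift_le) measurable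
    finally show ?thesis .
  qed
  have "(\<integral>\<^sup>+\<omega>. h (comb_output M n x \<omega>) \<partial>noise_space M \<sigma>\<^sub>c \<sigma>\<^sub>r) =
      (\<integral>\<^sup>+s. \<integral>\<^sup>+z. h (comb_output M n x (s, z)) \<partial>(phase_source \<sigma>\<^sub>r \<Otimes>\<^sub>M additive_noise M) \<partial>phase_source \<sigma>\<^sub>c)"
    unfolding noise_space_alt by (rule RW.nn_integral_fst[symmetric, OF hm])
  also have "\<dots> = (\<integral>\<^sup>+s. \<integral>\<^sup>+r. \<integral>\<^sup>+w. h (comb_output M n x (s, r, w)) \<partial>additive_noise M \<partial>phase_source \<sigma>\<^sub>r \<partial>phase_source \<sigma>\<^sub>c)"
  proof (intro nn_integral_cong W.nn_integral_fst[symmetric])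
    fix s assume "s \<in> space (phase_source \<sigma>\<^sub>c)"
    then show "(\<lambda>z. h (comb_output M n x (s, z))) \<in> borel_measurable (phase_source \<sigma>\<^sub>r \<Otimes>\<^sub>M additive_noise M)"
      using measurable_compose[OF measurable_Pair1' hm] by simp
  qed
  also have "\<dots> \<le> (\<integral>\<^sup>+s. \<integral>\<^sup>+r. ?R \<partial>phase_source \<sigma>\<^sub>r \<partial>phase_source \<sigma>\<^sub>c)"
    by (intro nn_integral_mono inner)
  also have "\<dots> = ?R"
    by (simp add: C.emeasure_space_1 R.emeasure_space_1)
  finally show ?thesis .
qed

lemma cmod_add_power2_le: "(cmod (a + b))\<^sup>2 \<le> 2 * (cmod a)\<^sup>2 + 2 * (cmod b)\<^sup>2"
proof -
  have "(cmod (a + b))\<^sup>2 \<le> (cmod a + cmod b)\<^sup>2"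
    by (intro power_mono norm_triangle_ineq) auto
  also have "\<dots> + (cmod a - cmod b)\<^sup>2 = 2 * (cmod a)\<^sup>2 + 2 * (cmod b)\<^sup>2"
    by (simp add: power2_eq_square algebra_simps)
  finally show ?thesis
    using zero_le_power2[of "cmod a - cmod b"] by linarith
qed

lemma distr_comb_additive:
  assumes \<sigma>: "\<sigma>\<^sub>c > 0" "\<sigma>\<^sub>r > 0" and km: "k \<ge> 1" "m < M"
  shows "distr (noise_space M \<sigma>\<^sub>c \<sigma>\<^sub>r) borel (\<lambda>\<omega>. comb_additive \<omega> k m) = std_complex_normal"
proof -
  interpret C: prob_space "phase_source \<sigma>\<^sub>c" by (rule prob_space_phase_source) fact
  interpret R: prob_space "phase_source \<sigma>\<^sub>r" by (rule prob_space_phase_source) fact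
  interpret W: prob_space "additive_noise M" by (rule prob_space_additive_noise)
  interpret RW: pair_prob_space "phase_source \<sigma>\<^sub>r" "additive_noise M" ..
  interpret CRW: pair_prob_space "phase_source \<sigma>\<^sub>c" "phase_source \<sigma>\<^sub>r \<Otimes>\<^sub>M additive_noise M" ..
  have i: "(k, m) \<in> {1..} \<times> {..<M}" using km by auto
  have comp: "(\<lambda>w. w (k, m)) \<in> measurable (additive_noise M) borel"
    using measurable_component_singleton[OF i, of "\<lambda>_. std_complex_normal"]
    by (simp cong: measurable_cong_sets)
  have "std_complex_normal = distr (additive_noise M) std_complex_normal (\<lambda>w. w (k, m))"
    using i by (intro distr_PiM_component[symmetric] prob_space_std_complex_normal)
  also have "\<dots> = distr (additive_noise M) borel (\<lambda>w. w (k, m))"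
    by (intro distr_cong) auto
  also have "\<dots> = distr (distr (phase_source \<sigma>\<^sub>r \<Otimes>\<^sub>M additive_noise M) (additive_noise M) snd) borel (\<lambda>w. w (k, m))"
    by (subst distr_pair_snd[OF R.prob_space_axioms W.prob_space_axioms]) simp
  also have "\<dots> = distr (distr (distr (noise_space M \<sigma>\<^sub>c \<sigma>\<^sub>r) (phase_source \<sigma>\<^sub>r \<Otimes>\<^sub>M additive_noise M) snd) (additive_noise M) snd) borel (\<lambda>w. w (k, m))"
    unfolding noise_space_alt by (subst distr_pair_snd[OF C.prob_space_axioms RW.prob_space_axioms]) simp
  also have "\<dots> = distr (noise_space M \<sigma>\<^sub>c \<sigma>\<^sub>r) borel (\<lambda>\<omega>. comb_additive \<omega> k m)"
    unfolding noise_space_alt using comp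
    by (simp add: distr_distr comp_def comb_additive_def split_beta')
  finally show ?thesis ..
qed

lemma integrable_cmod_power2_comb_additive:
  assumes "\<sigma>\<^sub>c > 0" "\<sigma>\<^sub>r > 0" "k \<ge> 1" "m < M"
  shows "integrable (noise_space M \<sigma>\<^sub>c \<sigma>\<^sub>r) (\<lambda>\<omega>. (cmod (comb_additive \<omega> k m))\<^sup>2)"
proof -
  have "integrable (distr (noise_space M \<sigma>\<^sub>c \<sigma>\<^sub>r) borel (\<lambda>\<omega>. comb_additive \<omega> k m)) (\<lambda>w. (cmod w)\<^sup>2)"
    unfolding distr_comb_additive[OF assms]
    using has_bochner_integral_cmod_power2_std_complex_normal by (simp add: has_bochner_integral_iff)
  then show ?thesis
    using measurable_comb_additive[OF assms(3,4)] by (subst (asm) integrable_distr_eq) auto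
qed

lemma cmod_exp_i_times [simp]: "cmod (exp (\<i> * of_real t)) = 1"
  by (simp flip: cis_conv_exp)

lemma input_lawsD:
  assumes "\<mu> \<in> input_laws M n \<rho>"
  shows "prob_space \<mu>" "sets \<mu> = sets (block_space M n)"
    "\<And>k m. k \<in> {1..n} \<Longrightarrow> m < M \<Longrightarrow> integrable \<mu> (\<lambda>x. (cmod (x k m))\<^sup>2)"
proof -
  show "prob_space \<mu>" and sets: "sets \<mu> = sets (block_space M n)"
    using assms by (auto simp: input_laws_def)
  fix k m assume km: "k \<in> {1..n}" "m < M"
  have "(\<integral>\<^sup>+x. ennreal ((cmod (x k m))\<^sup>2) \<partial>\<mu>) \<le> (\<integral>\<^sup>+x. ennreal ((L2_set (\<lambda>m. cmod (x k m)) {..<M})\<^sup>2) \<partial>\<mu>)"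
    using km by (intro nn_integral_mono ennreal_leI power_mono member_le_L2_set) auto
  also have "\<dots> \<le> (\<Sum>k=1..n. \<integral>\<^sup>+x. ennreal ((L2_set (\<lambda>m. cmod (x k m)) {..<M})\<^sup>2) \<partial>\<mu>)"
    using km by (intro member_le_sum) auto
  also have "\<dots> \<le> ennreal (real n * \<rho>)"
    using assms by (auto simp: input_laws_def)
  also have "\<dots> < \<infinity>" by simp
  finally show "integrable \<mu> (\<lambda>x. (cmod (x k m))\<^sup>2)"
    using measurable_block_component[OF km]
    by (intro integrableI_nonneg) (auto simp: measurable_cong_sets[OF sets refl])
qed

text \<open>The power constraint enters here: the exponent of the domination is the output energy,
  whose mean is finite because each term is at most twice the input energy plus twice the noise
  energy.\<close>

lemma dominated_channel_comb:
  assumes M: "M \<ge> 1" "n \<ge> 1" and \<sigma>: "\<sigma>\<^sub>c > 0" "\<sigma>\<^sub>r > 0"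
    and \<mu>: "\<mu> \<in> input_laws M n \<rho>"
  shows "dominated_channel \<mu> (noise_space M \<sigma>\<^sub>c \<sigma>\<^sub>r) (block_noise M n) (comb_output M n) (block_energy M n)"
proof -
  note \<mu>D = input_lawsD[OF \<mu>]
  interpret \<mu>: prob_space \<mu> by (rule \<mu>D)
  interpret N: prob_space "noise_space M \<sigma>\<^sub>c \<sigma>\<^sub>r" by (rule prob_space_noise_space[OF \<sigma>])
  interpret \<mu>N: pair_prob_space \<mu> "noise_space M \<sigma>\<^sub>c \<sigma>\<^sub>r" ..
  note [measurable_cong] = \<mu>D(2)
  show ?thesis
  proof (intro dominated_channel.intro dominated_channel_axioms.intro prob_space_block_noise
      \<mu>.prob_space_axioms N.prob_space_axioms block_energy_nonneg)
    show m: "(\<lambda>(x, \<omega>). comb_output M n x \<omega>) \<in> measurable (\<mu> \<Otimes>\<^sub>M noise_space M \<sigma>\<^sub>c \<sigma>\<^sub>r) (block_noise M n)"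
      by measurable
    show "block_energy M n \<in> borel_measurable (block_noise M n)"
      by measurable
    show "(\<integral>\<^sup>+\<omega>. h (comb_output M n x \<omega>) \<partial>noise_space M \<sigma>\<^sub>c \<sigma>\<^sub>r) \<le>
        (\<integral>\<^sup>+y. h y * ennreal (exp (block_energy M n y)) \<partial>block_noise M n)"
      if "x \<in> space \<mu>" "h \<in> borel_measurable (block_noise M n)" for x h
      using that sets_eq_imp_space_eq[OF \<mu>D(2)]
      by (intro nn_integral_comb_output_le M \<sigma>) (auto cong: measurable_cong_sets)
    show "integrable (\<mu> \<Otimes>\<^sub>M noise_space M \<sigma>\<^sub>c \<sigma>\<^sub>r) (\<lambda>(x, \<omega>). block_energy M n (comb_output M n x \<omega>))"
    proof (rule Bochner_Integration.integrable_bound)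
      have "integrable (\<mu> \<Otimes>\<^sub>M noise_space M \<sigma>\<^sub>c \<sigma>\<^sub>r)
          (\<lambda>z. 2 * (cmod (fst z k m))\<^sup>2 + 2 * (cmod (comb_additive (snd z) k m))\<^sup>2)" if km: "k \<in> {1..n}" "m < M" for k m
      proof (intro Bochner_Integration.integrable_add integrable_mult_right)
        have "integrable (distr (\<mu> \<Otimes>\<^sub>M noise_space M \<sigma>\<^sub>c \<sigma>\<^sub>r) \<mu> fst) (\<lambda>x. (cmod (x k m))\<^sup>2)"
          using \<mu>D(3)[OF km] by (simp add: N.distr_pair_fst)
        then show "integrable (\<mu> \<Otimes>\<^sub>M noise_space M \<sigma>\<^sub>c \<sigma>\<^sub>r) (\<lambda>z. (cmod (fst z k m))\<^sup>2)"
          using \<mu>D(3)[OF km] by (subst (asm) integrable_distr_eq) auto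
        have i: "integrable (noise_space M \<sigma>\<^sub>c \<sigma>\<^sub>r) (\<lambda>\<omega>. (cmod (comb_additive \<omega> k m))\<^sup>2)"
          using km by (intro integrable_cmod_power2_comb_additive \<sigma>) auto
        then have "integrable (distr (\<mu> \<Otimes>\<^sub>M noise_space M \<sigma>\<^sub>c \<sigma>\<^sub>r) (noise_space M \<sigma>\<^sub>c \<sigma>\<^sub>r) snd) (\<lambda>\<omega>. (cmod (comb_additive \<omega> k m))\<^sup>2)"
          by (subst distr_pair_snd[OF \<mu>.prob_space_axioms N.prob_space_axioms])
        then show "integrable (\<mu> \<Otimes>\<^sub>M noise_space M \<sigma>\<^sub>c \<sigma>\<^sub>r) (\<lambda>z. (cmod (comb_additive (snd z) k m))\<^sup>2)"
          using i by (subst (asm) integrable_distr_eq) auto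
      qed
      then show "integrable (\<mu> \<Otimes>\<^sub>M noise_space M \<sigma>\<^sub>c \<sigma>\<^sub>r)
          (\<lambda>z. \<Sum>k=1..n. \<Sum>m<M. 2 * (cmod (fst z k m))\<^sup>2 + 2 * (cmod (comb_additive (snd z) k m))\<^sup>2)"
        by (intro Bochner_Integration.integrable_sum) auto
      show "AE z in \<mu> \<Otimes>\<^sub>M noise_space M \<sigma>\<^sub>c \<sigma>\<^sub>r. norm ((\<lambda>(x, \<omega>). block_energy M n (comb_output M n x \<omega>)) z) \<le>
          norm (\<Sum>k=1..n. \<Sum>m<M. 2 * (cmod (fst z k m))\<^sup>2 + 2 * (cmod (comb_additive (snd z) k m))\<^sup>2)"
      proof (intro AE_I2)
        fix z :: "(nat \<Rightarrow> nat \<Rightarrow> complex) \<times> noise"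
        have "block_energy M n (comb_output M n (fst z) (snd z)) \<le>
            (\<Sum>k=1..n. \<Sum>m<M. 2 * (cmod (fst z k m))\<^sup>2 + 2 * (cmod (comb_additive (snd z) k m))\<^sup>2)"
          unfolding block_energy_def
        proof (intro sum_mono)
          fix k m assume "k \<in> {1..n}" "m \<in> {..<M}"
          then show "(cmod (comb_output M n (fst z) (snd z) k m))\<^sup>2 \<le>
              2 * (cmod (fst z k m))\<^sup>2 + 2 * (cmod (comb_additive (snd z) k m))\<^sup>2"
            using cmod_add_power2_le[of "exp (\<i> * of_real (comb_phase (snd z) k m)) * fst z k m" "comb_additive (snd z) k m"]
            by (simp add: comb_output_def norm_mult)
        qed
        then show "norm ((\<lambda>(x, \<omega>). block_energy M n (comb_output M n x \<omega>)) z) \<le>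
          norm (\<Sum>k=1..n. \<Sum>m<M. 2 * (cmod (fst z k m))\<^sup>2 + 2 * (cmod (comb_additive (snd z) k m))\<^sup>2)"
          using block_energy_nonneg[of M n "comb_output M n (fst z) (snd z)"] by (simp add: split_beta')
      qed
    qed measurable
  qed
qed

section \<open>Superadditivity and the capacity limit\<close>

lemma distr_window_noise_shift:
  assumes \<sigma>: "\<sigma>\<^sub>c > 0" "\<sigma>\<^sub>r > 0" and ab: "a + b \<le> n"
    and \<mu>: "prob_space \<mu>" "sets \<mu> = sets (block_space M n)"
    and \<mu>': "prob_space \<mu>'" "sets \<mu>' = sets (block_space M b)"
    and d: "distr \<mu> \<mu>' (window M a b) = \<mu>'"
  shows "distr (\<mu> \<Otimes>\<^sub>M noise_space M \<sigma>\<^sub>c \<sigma>\<^sub>r) (\<mu>' \<Otimes>\<^sub>M noise_space M \<sigma>\<^sub>c \<sigma>\<^sub>r)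
    (\<lambda>(x, \<omega>). (window M a b x, noise_shift M a \<omega>)) = \<mu>' \<Otimes>\<^sub>M noise_space M \<sigma>\<^sub>c \<sigma>\<^sub>r"
proof -
  interpret N: prob_space "noise_space M \<sigma>\<^sub>c \<sigma>\<^sub>r" by (rule prob_space_noise_space[OF \<sigma>])
  have "window M a b \<in> measurable \<mu> \<mu>'"
    using measurable_window[OF ab] by (simp add: measurable_cong_sets[OF \<mu>(2) \<mu>'(2)])
  then have "distr \<mu> \<mu>' (window M a b) \<Otimes>\<^sub>M distr (noise_space M \<sigma>\<^sub>c \<sigma>\<^sub>r) (noise_space M \<sigma>\<^sub>c \<sigma>\<^sub>r) (noise_shift M a) =
    distr (\<mu> \<Otimes>\<^sub>M noise_space M \<sigma>\<^sub>c \<sigma>\<^sub>r) (\<mu>' \<Otimes>\<^sub>M noise_space M \<sigma>\<^sub>c \<sigma>\<^sub>r)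
      (\<lambda>(x, \<omega>). (window M a b x, noise_shift M a \<omega>))"
    by (rule pair_measure_distr[OF _ measurable_noise_shift], unfold distr_noise_shift[OF \<sigma>])
      (rule N.sigma_finite_measure_axioms)
  then show ?thesis
    unfolding d distr_noise_shift[OF \<sigma>] ..
qed

text \<open>Stationarity in the three forms in which it is used: positivity almost everywhere,
  integrability and expectation of a functional of \<open>b\<close> consecutive blocks do not depend
  on where the window starts.\<close>

lemma window_channel_transfer:
  fixes f :: "(nat \<Rightarrow> nat \<Rightarrow> complex) \<times> (nat \<Rightarrow> nat \<Rightarrow> complex) \<Rightarrow> real"
  assumes \<sigma>: "\<sigma>\<^sub>c > 0" "\<sigma>\<^sub>r > 0" and ab: "a + b \<le> n"
    and \<mu>: "prob_space \<mu>" "sets \<mu> = sets (block_space M n)"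
    and \<mu>': "prob_space \<mu>'" "sets \<mu>' = sets (block_space M b)"
    and d: "distr \<mu> \<mu>' (window M a b) = \<mu>'"
    and f: "f \<in> borel_measurable (block_space M b \<Otimes>\<^sub>M block_space M b)"
  shows "(AE (x, \<omega>) in \<mu>' \<Otimes>\<^sub>M noise_space M \<sigma>\<^sub>c \<sigma>\<^sub>r. 0 < f (x, comb_output M b x \<omega>)) \<longleftrightarrow>
      (AE (x, \<omega>) in \<mu> \<Otimes>\<^sub>M noise_space M \<sigma>\<^sub>c \<sigma>\<^sub>r. 0 < f (window M a b x, window M a b (comb_output M n x \<omega>)))" (is ?A)
    and "integrable (\<mu>' \<Otimes>\<^sub>M noise_space M \<sigma>\<^sub>c \<sigma>\<^sub>r) (\<lambda>(x, \<omega>). f (x, comb_output M b x \<omega>)) \<longleftrightarrow>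
      integrable (\<mu> \<Otimes>\<^sub>M noise_space M \<sigma>\<^sub>c \<sigma>\<^sub>r) (\<lambda>(x, \<omega>). f (window M a b x, window M a b (comb_output M n x \<omega>)))" (is ?B)
    and "(\<integral>(x, \<omega>). f (x, comb_output M b x \<omega>) \<partial>(\<mu>' \<Otimes>\<^sub>M noise_space M \<sigma>\<^sub>c \<sigma>\<^sub>r)) =
      (\<integral>(x, \<omega>). f (window M a b x, window M a b (comb_output M n x \<omega>)) \<partial>(\<mu> \<Otimes>\<^sub>M noise_space M \<sigma>\<^sub>c \<sigma>\<^sub>r))" (is ?C)
proof -
  let ?N = "noise_space M \<sigma>\<^sub>c \<sigma>\<^sub>r"
  let ?\<Phi> = "\<lambda>(x, \<omega>). (window M a b x, noise_shift M a \<omega>)"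
  note [measurable] = f and [measurable_cong] = \<mu>(2) \<mu>'(2)
  have w[measurable]: "window M a b \<in> measurable \<mu> \<mu>'"
    using measurable_window[OF ab] by (simp add: measurable_cong_sets[OF \<mu>(2) \<mu>'(2)])
  have \<Phi>[measurable]: "?\<Phi> \<in> measurable (\<mu> \<Otimes>\<^sub>M ?N) (\<mu>' \<Otimes>\<^sub>M ?N)"
    unfolding split_beta' by measurable
  have g[measurable]: "(\<lambda>(x, \<omega>). f (x, comb_output M b x \<omega>)) \<in> borel_measurable (\<mu>' \<Otimes>\<^sub>M ?N)"
    unfolding split_beta' by measurable
  have eq: "(\<lambda>(x, \<omega>). f (x, comb_output M b x \<omega>)) (?\<Phi> z) =
      (\<lambda>(x, \<omega>). f (window M a b x, window M a b (comb_output M n x \<omega>))) z" for z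
    by (simp add: window_comb_output[OF ab] split_beta')
  note D = distr_window_noise_shift[OF \<sigma> ab \<mu> \<mu>' d]
  have P: "Measurable.pred (\<mu>' \<Otimes>\<^sub>M ?N) (\<lambda>z. 0 < (\<lambda>(x, \<omega>). f (x, comb_output M b x \<omega>)) z)"
    by measurable
  have "(AE z in \<mu>' \<Otimes>\<^sub>M ?N. 0 < (\<lambda>(x, \<omega>). f (x, comb_output M b x \<omega>)) z) \<longleftrightarrow>
      (AE z in \<mu> \<Otimes>\<^sub>M ?N. 0 < (\<lambda>(x, \<omega>). f (window M a b x, window M a b (comb_output M n x \<omega>))) z)"
    using AE_distr_iff[OF \<Phi>, of "\<lambda>z. 0 < (\<lambda>(x, \<omega>). f (x, comb_output M b x \<omega>)) z"] P
    unfolding D eq by (simp add: pred_def)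
  then show ?A by (simp add: split_beta')
  show ?B
    using integrable_distr_eq[OF \<Phi> g] unfolding D eq .
  show ?C
    using integral_distr[OF \<Phi> g] unfolding D eq .
qed

section \<open>Concatenation of independent inputs\<close>

definition concat_blocks :: "nat \<Rightarrow> nat \<Rightarrow> nat \<Rightarrow>
    (nat \<Rightarrow> nat \<Rightarrow> complex) \<times> (nat \<Rightarrow> nat \<Rightarrow> complex) \<Rightarrow> nat \<Rightarrow> nat \<Rightarrow> complex" where
  "concat_blocks M a b z = (\<lambda>k\<in>{1..a + b}. \<lambda>m\<in>{..<M}. if k \<le> a then fst z k m else snd z (k - a) m)"

lemma measurable_concat_blocks [measurable]:
  "concat_blocks M a b \<in> measurable (block_space M a \<Otimes>\<^sub>M block_space M b) (block_space M (a + b))"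
  unfolding concat_blocks_def[abs_def]
proof (rule measurable_block_lambda)
  fix k m assume km: "k \<in> {1..a + b}" "m < M"
  show "(\<lambda>z. if k \<le> a then fst z k m else snd z (k - a) m) \<in> borel_measurable (block_space M a \<Otimes>\<^sub>M block_space M b)"
  proof (cases "k \<le> a")
    case True
    then have "(\<lambda>x. x k m) \<in> borel_measurable (block_space M a)"
      using km by (intro measurable_block_component) auto
    from measurable_compose[OF measurable_fst this] True show ?thesis by simp
  next
    case False
    then have "(\<lambda>x. x (k - a) m) \<in> borel_measurable (block_space M b)"
      using km by (intro measurable_block_component) auto
    from measurable_compose[OF measurable_snd this] False show ?thesis by simp
  qed
qed

lemma block_space_eqI:
  assumes "x \<in> space (block_space M n)" "y \<in> space (block_space M n)"
    and "\<And>k m. k \<in> {1..n} \<Longrightarrow> m < M \<Longrightarrow> x k m = y k m"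
  shows "x = y"
proof (rule PiE_ext)
  show "x \<in> {1..n} \<rightarrow>\<^sub>E ({..<M} \<rightarrow>\<^sub>E UNIV)" "y \<in> {1..n} \<rightarrow>\<^sub>E ({..<M} \<rightarrow>\<^sub>E UNIV)"
    using assms(1,2) by (simp_all add: block_space_def space_PiM)
  then show "x k = y k" if "k \<in> {1..n}" for k
    using that assms(3)[of k] by (intro PiE_ext[of "x k" "{..<M}" "\<lambda>_. UNIV"]) auto
qed

lemma window_in_space:
  assumes "a + b \<le> n" "x \<in> space (block_space M n)"
  shows "window M a b x \<in> space (block_space M b)"
  by (rule measurable_space[OF measurable_window[OF assms(1)] assms(2)])

lemma window_concat_blocks:
  assumes "x \<in> space (block_space M a)" "x' \<in> space (block_space M b)"
  shows "window M 0 a (concat_blocks M a b (x, x')) = x"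
    and "window M a b (concat_blocks M a b (x, x')) = x'"
proof -
  have c: "concat_blocks M a b (x, x') \<in> space (block_space M (a + b))"
    by (rule measurable_space[OF measurable_concat_blocks]) (use assms in \<open>auto simp: space_pair_measure\<close>)
  show "window M 0 a (concat_blocks M a b (x, x')) = x"
    by (rule block_space_eqI[OF window_in_space[OF _ c] assms(1)]) (auto simp: window_def concat_blocks_def)
  show "window M a b (concat_blocks M a b (x, x')) = x'"
    by (rule block_space_eqI[OF window_in_space[OF _ c] assms(2)]) (auto simp: window_def concat_blocks_def)
qed

lemma comb_MI_superadditive:
  assumes M: "M \<ge> 1" and ab: "a \<ge> 1" "b \<ge> 1" and \<sigma>: "\<sigma>\<^sub>c > 0" "\<sigma>\<^sub>r > 0" and \<rho>: "\<rho> > 0"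
    and \<mu>1: "\<mu>1 \<in> input_laws M a \<rho>" and \<mu>2: "\<mu>2 \<in> input_laws M b \<rho>"
  shows "\<exists>\<mu>\<in>input_laws M (a + b) \<rho>.
    comb_MI M \<sigma>\<^sub>c \<sigma>\<^sub>r a \<mu>1 + comb_MI M \<sigma>\<^sub>c \<sigma>\<^sub>r b \<mu>2 \<le> comb_MI M \<sigma>\<^sub>c \<sigma>\<^sub>r (a + b) \<mu>"
proof
  let ?N = "noise_space M \<sigma>\<^sub>c \<sigma>\<^sub>r"
  define \<mu> where "\<mu> = distr (\<mu>1 \<Otimes>\<^sub>M \<mu>2) (block_space M (a + b)) (concat_blocks M a b)"
  note D1 = input_lawsD[OF \<mu>1] and D2 = input_lawsD[OF \<mu>2]
  interpret \<mu>1: prob_space \<mu>1 by (rule D1)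
  interpret \<mu>2: prob_space \<mu>2 by (rule D2)
  interpret \<mu>12: pair_prob_space \<mu>1 \<mu>2 ..
  interpret N: prob_space ?N by (rule prob_space_noise_space[OF \<sigma>])
  note [measurable_cong] = D1(2) D2(2)
  have sp: "space \<mu>1 = space (block_space M a)" "space \<mu>2 = space (block_space M b)"
    by (rule sets_eq_imp_space_eq[OF D1(2)], rule sets_eq_imp_space_eq[OF D2(2)])
  have sets_\<mu>[measurable_cong]: "sets \<mu> = sets (block_space M (a + b))" by (simp add: \<mu>_def)
  have c[measurable]: "concat_blocks M a b \<in> measurable (\<mu>1 \<Otimes>\<^sub>M \<mu>2) (block_space M (a + b))"
    by measurable
  have \<mu>: "prob_space \<mu>"
    unfolding \<mu>_def by (rule \<mu>12.prob_space_distr) measurable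
  have w1: "distr \<mu> \<mu>1 (window M 0 a) = \<mu>1"
  proof -
    have "window M 0 a \<in> measurable (block_space M (a + b)) \<mu>1"
      using measurable_window[of 0 a "a + b" M] by (simp add: measurable_cong_sets[OF refl D1(2)])
    then have "distr \<mu> \<mu>1 (window M 0 a) = distr (\<mu>1 \<Otimes>\<^sub>M \<mu>2) \<mu>1 (window M 0 a \<circ> concat_blocks M a b)"
      unfolding \<mu>_def by (rule distr_distr[OF _ c])
    also have "\<dots> = distr (\<mu>1 \<Otimes>\<^sub>M \<mu>2) \<mu>1 fst"
      by (intro distr_cong refl) (auto simp: space_pair_measure sp window_concat_blocks)
    finally show ?thesis by (simp add: \<mu>2.distr_pair_fst)
  qed
  have w2: "distr \<mu> \<mu>2 (window M a b) = \<mu>2"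
  proof -
    have "window M a b \<in> measurable (block_space M (a + b)) \<mu>2"
      using measurable_window[of a b "a + b" M] by (simp add: measurable_cong_sets[OF refl D2(2)])
    then have "distr \<mu> \<mu>2 (window M a b) = distr (\<mu>1 \<Otimes>\<^sub>M \<mu>2) \<mu>2 (window M a b \<circ> concat_blocks M a b)"
      unfolding \<mu>_def by (rule distr_distr[OF _ c])
    also have "\<dots> = distr (\<mu>1 \<Otimes>\<^sub>M \<mu>2) \<mu>2 snd"
      by (intro distr_cong refl) (auto simp: space_pair_measure sp window_concat_blocks)
    finally show ?thesis by (simp add: distr_pair_snd D1 D2)
  qed
  let ?p = "\<lambda>k x. ennreal ((L2_set (\<lambda>m. cmod (x k m)) {..<M})\<^sup>2)"
  have L2m: "?p k \<in> borel_measurable (block_space M n)" if "k \<in> {1..n}" for k n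
  proof -
    have [measurable]: "m \<in> {..<M} \<Longrightarrow> (\<lambda>x. x k m) \<in> borel_measurable (block_space M n)" for m
      using that by (intro measurable_block_component) auto
    show ?thesis unfolding L2_set_def by measurable
  qed
  have L2_window: "L2_set (\<lambda>m. cmod (window M c d x k m)) {..<M} = L2_set (\<lambda>m. cmod (x (k + c) m)) {..<M}"
    if "k \<in> {1..d}" for k d c and x :: "nat \<Rightarrow> nat \<Rightarrow> complex"
    using that by (intro L2_set_cong) (auto simp: window_def)
  show \<mu>_in: "\<mu> \<in> input_laws M (a + b) \<rho>"
  proof -
    have p1: "(\<integral>\<^sup>+x. ?p k x \<partial>\<mu>) = (\<integral>\<^sup>+x. ?p k x \<partial>\<mu>1)" if k: "k \<in> {1..a}" for k
    proof -
      have "(\<integral>\<^sup>+x. ?p k x \<partial>\<mu>1) = (\<integral>\<^sup>+x. ?p k x \<partial>distr \<mu> \<mu>1 (window M 0 a))"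
        by (simp only: w1)
      also have "\<dots> = (\<integral>\<^sup>+x. ?p k (window M 0 a x) \<partial>\<mu>)"
        using measurable_window[of 0 a "a + b" M] L2m[OF k]
        by (intro nn_integral_distr) (auto simp: measurable_cong_sets[OF sets_\<mu> D1(2)] cong: measurable_cong_sets)
      also have "\<dots> = (\<integral>\<^sup>+x. ?p k x \<partial>\<mu>)"
        using L2_window[of k a 0] k by simp
      finally show ?thesis ..
    qed
    have p2: "(\<integral>\<^sup>+x. ?p (k + a) x \<partial>\<mu>) = (\<integral>\<^sup>+x. ?p k x \<partial>\<mu>2)" if k: "k \<in> {1..b}" for k
    proof -
      have "(\<integral>\<^sup>+x. ?p k x \<partial>\<mu>2) = (\<integral>\<^sup>+x. ?p k x \<partial>distr \<mu> \<mu>2 (window M a b))"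
        by (simp only: w2)
      also have "\<dots> = (\<integral>\<^sup>+x. ?p k (window M a b x) \<partial>\<mu>)"
        using measurable_window[of a b "a + b" M] L2m[OF k]
        by (intro nn_integral_distr) (auto simp: measurable_cong_sets[OF sets_\<mu> D2(2)] cong: measurable_cong_sets)
      also have "\<dots> = (\<integral>\<^sup>+x. ?p (k + a) x \<partial>\<mu>)"
        using L2_window[of k b a] k by simp
      finally show ?thesis ..
    qed
    have "(\<Sum>k=1..a + b. \<integral>\<^sup>+x. ?p k x \<partial>\<mu>) =
        (\<Sum>k=1..a. \<integral>\<^sup>+x. ?p k x \<partial>\<mu>) + (\<Sum>k=a + 1..a + b. \<integral>\<^sup>+x. ?p k x \<partial>\<mu>)"
      by (rule sum.ub_add_nat) simp
    also have "(\<Sum>k=a + 1..a + b. \<integral>\<^sup>+x. ?p k x \<partial>\<mu>) = (\<Sum>k=1..b. \<integral>\<^sup>+x. ?p (k + a) x \<partial>\<mu>)"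
      using sum.shift_bounds_cl_nat_ivl[of "\<lambda>k. \<integral>\<^sup>+x. ?p k x \<partial>\<mu>" 1 a b] by (simp add: add.commute)
    also have "(\<Sum>k=1..a. \<integral>\<^sup>+x. ?p k x \<partial>\<mu>) + (\<Sum>k=1..b. \<integral>\<^sup>+x. ?p (k + a) x \<partial>\<mu>) =
        (\<Sum>k=1..a. \<integral>\<^sup>+x. ?p k x \<partial>\<mu>1) + (\<Sum>k=1..b. \<integral>\<^sup>+x. ?p k x \<partial>\<mu>2)"
      by (intro arg_cong2[where f="(+)"] sum.cong p1 p2 refl)
    also have "\<dots> \<le> ennreal (real a * \<rho>) + ennreal (real b * \<rho>)"
      using \<mu>1 \<mu>2 by (intro add_mono) (auto simp: input_laws_def)
    also have "\<dots> = ennreal (real (a + b) * \<rho>)"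
      using \<rho> by (simp add: algebra_simps flip: ennreal_plus)
    finally show ?thesis
      using \<mu> sets_\<mu> by (simp add: input_laws_def)
  qed
  interpret C1: dominated_channel \<mu>1 ?N "block_noise M a" "comb_output M a" "block_energy M a"
    by (rule dominated_channel_comb[OF M ab(1) \<sigma> \<mu>1])
  interpret C2: dominated_channel \<mu>2 ?N "block_noise M b" "comb_output M b" "block_energy M b"
    by (rule dominated_channel_comb[OF M ab(2) \<sigma> \<mu>2])
  interpret C: dominated_channel \<mu> ?N "block_noise M (a + b)" "comb_output M (a + b)" "block_energy M (a + b)"
    using ab by (intro dominated_channel_comb[OF M _ \<sigma> \<mu>_in]) auto
  obtain F1 where F1m: "F1 \<in> borel_measurable (\<mu>1 \<Otimes>\<^sub>M block_noise M a)" and F1_0: "\<And>z. 0 \<le> F1 z"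
    and F1_1: "\<And>y. y \<in> space (block_noise M a) \<Longrightarrow> (\<integral>\<^sup>+x. ennreal (F1 (x, y)) \<partial>\<mu>1) \<le> 1"
    and F1_p: "AE (x, \<omega>) in \<mu>1 \<Otimes>\<^sub>M ?N. 0 < F1 (x, comb_output M a x \<omega>)"
    and F1_i: "integrable (\<mu>1 \<Otimes>\<^sub>M ?N) (\<lambda>(x, \<omega>). ln (F1 (x, comb_output M a x \<omega>)))"
    and F1_I: "comb_MI M \<sigma>\<^sub>c \<sigma>\<^sub>r a \<mu>1 = (\<integral>(x, \<omega>). log 2 (F1 (x, comb_output M a x \<omega>)) \<partial>(\<mu>1 \<Otimes>\<^sub>M ?N))"
    using C1.information_eq[OF D1(2)[symmetric] sets_block_noise[symmetric]] unfolding comb_MI_def[symmetric] by blast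
  obtain F2 where F2m: "F2 \<in> borel_measurable (\<mu>2 \<Otimes>\<^sub>M block_noise M b)" and F2_0: "\<And>z. 0 \<le> F2 z"
    and F2_1: "\<And>y. y \<in> space (block_noise M b) \<Longrightarrow> (\<integral>\<^sup>+x. ennreal (F2 (x, y)) \<partial>\<mu>2) \<le> 1"
    and F2_p: "AE (x, \<omega>) in \<mu>2 \<Otimes>\<^sub>M ?N. 0 < F2 (x, comb_output M b x \<omega>)"
    and F2_i: "integrable (\<mu>2 \<Otimes>\<^sub>M ?N) (\<lambda>(x, \<omega>). ln (F2 (x, comb_output M b x \<omega>)))"
    and F2_I: "comb_MI M \<sigma>\<^sub>c \<sigma>\<^sub>r b \<mu>2 = (\<integral>(x, \<omega>). log 2 (F2 (x, comb_output M b x \<omega>)) \<partial>(\<mu>2 \<Otimes>\<^sub>M ?N))"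
    using C2.information_eq[OF D2(2)[symmetric] sets_block_noise[symmetric]] unfolding comb_MI_def[symmetric] by blast
  have F1m'[measurable]: "F1 \<in> borel_measurable (block_space M a \<Otimes>\<^sub>M block_space M a)"
    using F1m by (simp cong: measurable_cong_sets)
  have F2m'[measurable]: "F2 \<in> borel_measurable (block_space M b \<Otimes>\<^sub>M block_space M b)"
    using F2m by (simp cong: measurable_cong_sets)
  have [measurable]: "window M 0 a \<in> measurable (block_space M (a + b)) (block_space M a)"
    "window M a b \<in> measurable (block_space M (a + b)) (block_space M b)"
    by (auto intro: measurable_window)
  \<comment> \<open>The logarithm of a product is the sum of the two information densities, so its
    mean is exactly the sum of the two informations.\<close>
  define F where "F z = F1 (window M 0 a (fst z), window M 0 a (snd z)) * F2 (window M a b (fst z), window M a b (snd z))" for z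
  have Fm: "F \<in> borel_measurable (\<mu> \<Otimes>\<^sub>M block_noise M (a + b))"
    unfolding F_def by measurable
  have T1: "0 + a \<le> a + b" and T2: "a + b \<le> a + b" by auto
  note tr1 = window_channel_transfer[OF \<sigma> T1 \<mu> sets_\<mu> D1(1,2) w1]
  note tr2 = window_channel_transfer[OF \<sigma> T2 \<mu> sets_\<mu> D2(1,2) w2]
  have p1: "AE z in \<mu> \<Otimes>\<^sub>M ?N. 0 < F1 (window M 0 a (fst z), window M 0 a (comb_output M (a + b) (fst z) (snd z)))"
    using tr1(1)[OF F1m'] F1_p by (simp add: split_beta')
  have p2: "AE z in \<mu> \<Otimes>\<^sub>M ?N. 0 < F2 (window M a b (fst z), window M a b (comb_output M (a + b) (fst z) (snd z)))"
    using tr2(1)[OF F2m'] F2_p by (simp add: split_beta')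
  have i1: "integrable (\<mu> \<Otimes>\<^sub>M ?N) (\<lambda>z. ln (F1 (window M 0 a (fst z), window M 0 a (comb_output M (a + b) (fst z) (snd z)))))"
    using tr1(2)[of "\<lambda>z. ln (F1 z)"] F1_i by (simp add: split_beta')
  have i2: "integrable (\<mu> \<Otimes>\<^sub>M ?N) (\<lambda>z. ln (F2 (window M a b (fst z), window M a b (comb_output M (a + b) (fst z) (snd z)))))"
    using tr2(2)[of "\<lambda>z. ln (F2 z)"] F2_i by (simp add: split_beta')
  have ln: "AE z in \<mu> \<Otimes>\<^sub>M ?N. ln (F (fst z, comb_output M (a + b) (fst z) (snd z))) =
      ln (F1 (window M 0 a (fst z), window M 0 a (comb_output M (a + b) (fst z) (snd z)))) +
      ln (F2 (window M a b (fst z), window M a b (comb_output M (a + b) (fst z) (snd z))))"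
    using p1 p2 by eventually_elim (simp add: F_def ln_mult)
  have Fm2[measurable]: "(\<lambda>z. F (fst z, comb_output M (a + b) (fst z) (snd z))) \<in> borel_measurable (\<mu> \<Otimes>\<^sub>M ?N)"
    using Fm by measurable
  have int: "integrable (\<mu> \<Otimes>\<^sub>M ?N) (\<lambda>(x, \<omega>). ln (F (x, comb_output M (a + b) x \<omega>)))"
    unfolding split_beta'
    by (rule integrable_cong_AE_imp[OF Bochner_Integration.integrable_add[OF i1 i2]])
      (use ln in \<open>auto elim: eventually_mono\<close>)
  have "(\<integral>(x, \<omega>). log 2 (F (x, comb_output M (a + b) x \<omega>)) \<partial>(\<mu> \<Otimes>\<^sub>M ?N)) =
      (\<integral>z. (ln (F1 (window M 0 a (fst z), window M 0 a (comb_output M (a + b) (fst z) (snd z)))) +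
      ln (F2 (window M a b (fst z), window M a b (comb_output M (a + b) (fst z) (snd z))))) / ln 2 \<partial>(\<mu> \<Otimes>\<^sub>M ?N))"
    unfolding split_beta' log_def
    by (rule integral_cong_AE) (use ln i1 i2 in \<open>auto elim: eventually_mono\<close>)
  also have "\<dots> = (\<integral>z. log 2 (F1 (window M 0 a (fst z), window M 0 a (comb_output M (a + b) (fst z) (snd z)))) \<partial>(\<mu> \<Otimes>\<^sub>M ?N)) +
      (\<integral>z. log 2 (F2 (window M a b (fst z), window M a b (comb_output M (a + b) (fst z) (snd z)))) \<partial>(\<mu> \<Otimes>\<^sub>M ?N))"
    unfolding log_def add_divide_distrib using i1 i2 by (intro Bochner_Integration.integral_add) auto
  also have "\<dots> = comb_MI M \<sigma>\<^sub>c \<sigma>\<^sub>r a \<mu>1 + comb_MI M \<sigma>\<^sub>c \<sigma>\<^sub>r b \<mu>2"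
    using tr1(3)[of "\<lambda>z. log 2 (F1 z)"] tr2(3)[of "\<lambda>z. log 2 (F2 z)"]
    by (simp add: F1_I F2_I split_beta')
  finally have val: "(\<integral>(x, \<omega>). log 2 (F (x, comb_output M (a + b) x \<omega>)) \<partial>(\<mu> \<Otimes>\<^sub>M ?N)) =
      comb_MI M \<sigma>\<^sub>c \<sigma>\<^sub>r a \<mu>1 + comb_MI M \<sigma>\<^sub>c \<sigma>\<^sub>r b \<mu>2" .
  have "(\<integral>(x, \<omega>). log 2 (F (x, comb_output M (a + b) x \<omega>)) \<partial>(\<mu> \<Otimes>\<^sub>M ?N)) \<le> comb_MI M \<sigma>\<^sub>c \<sigma>\<^sub>r (a + b) \<mu>"
    unfolding comb_MI_def
  proof (rule C.information_ge[OF _ _ Fm])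
    \<comment> \<open>The output is fixed here, so only independence of the two input parts matters
      and the integral factorises. The dependence of the two output windows through the phase memory
      does not enter.\<close>
    show "(\<integral>\<^sup>+x. ennreal (F (x, y)) \<partial>\<mu>) \<le> 1" if "y \<in> space (block_noise M (a + b))" for y
    proof -
      have y: "y \<in> space (block_space M (a + b))"
        using that sets_eq_imp_space_eq[OF sets_block_noise] by blast
      then have y1: "window M 0 a y \<in> space (block_space M a)" and y2: "window M a b y \<in> space (block_space M b)"
        using window_in_space[of 0 a "a + b" y M] window_in_space[of a b "a + b" y M] by simp_all
      have m1[measurable]: "(\<lambda>x. F1 (x, window M 0 a y)) \<in> borel_measurable \<mu>1"
        and m2[measurable]: "(\<lambda>x. F2 (x, window M a b y)) \<in> borel_measurable \<mu>2"
        using measurable_compose[OF measurable_Pair2'[OF y1] F1m'] measurable_compose[OF measurable_Pair2'[OF y2] F2m']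
        by (simp_all cong: measurable_cong_sets)
      note [measurable] = measurable_compose[OF measurable_fst m1] measurable_compose[OF measurable_snd m2]
      have "(\<integral>\<^sup>+x. ennreal (F (x, y)) \<partial>\<mu>) = (\<integral>\<^sup>+z. ennreal (F (concat_blocks M a b z, y)) \<partial>(\<mu>1 \<Otimes>\<^sub>M \<mu>2))"
        unfolding \<mu>_def using Fm y
        by (intro nn_integral_distr c) (auto simp: F_def)
      also have "\<dots> = (\<integral>\<^sup>+z. ennreal (F1 (fst z, window M 0 a y)) * ennreal (F2 (snd z, window M a b y)) \<partial>(\<mu>1 \<Otimes>\<^sub>M \<mu>2))"
        by (intro nn_integral_cong)
          (auto simp: F_def space_pair_measure sp window_concat_blocks ennreal_mult F1_0 F2_0)
      also have "\<dots> = (\<integral>\<^sup>+x. \<integral>\<^sup>+x'. ennreal (F1 (x, window M 0 a y)) * ennreal (F2 (x', window M a b y)) \<partial>\<mu>2 \<partial>\<mu>1)"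
        by (subst \<mu>2.nn_integral_fst[symmetric]) auto
      also have "\<dots> = (\<integral>\<^sup>+x. ennreal (F1 (x, window M 0 a y)) * (\<integral>\<^sup>+x'. ennreal (F2 (x', window M a b y)) \<partial>\<mu>2) \<partial>\<mu>1)"
        by (intro nn_integral_cong nn_integral_cmult) auto
      also have "\<dots> = (\<integral>\<^sup>+x. ennreal (F1 (x, window M 0 a y)) \<partial>\<mu>1) * (\<integral>\<^sup>+x'. ennreal (F2 (x', window M a b y)) \<partial>\<mu>2)"
        by (rule nn_integral_multc) auto
      also have "\<dots> \<le> 1 * 1"
        using y1 y2 sets_eq_imp_space_eq[OF sets_block_noise]
        by (intro mult_mono F1_1 F2_1) auto
      finally show ?thesis by simp
    qed
    show "AE (x, \<omega>) in \<mu> \<Otimes>\<^sub>M ?N. 0 < F (x, comb_output M (a + b) x \<omega>)"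
      unfolding split_beta' using p1 p2 by eventually_elim (simp add: F_def)
    show "integrable (\<mu> \<Otimes>\<^sub>M ?N) (\<lambda>(x, \<omega>). ln (F (x, comb_output M (a + b) x \<omega>)))"
      by (rule int)
  qed (auto simp: sets_\<mu> F_def F1_0 F2_0)
  then show "comb_MI M \<sigma>\<^sub>c \<sigma>\<^sub>r a \<mu>1 + comb_MI M \<sigma>\<^sub>c \<sigma>\<^sub>r b \<mu>2 \<le> comb_MI M \<sigma>\<^sub>c \<sigma>\<^sub>r (a + b) \<mu>"
    unfolding val .
qed

text \<open>The constant score 1 is admissible and has logarithm 0.\<close>

lemma comb_MI_nonneg:
  assumes M: "M \<ge> 1" "n \<ge> 1" and \<sigma>: "\<sigma>\<^sub>c > 0" "\<sigma>\<^sub>r > 0" and \<mu>: "\<mu> \<in> input_laws M n \<rho>"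
  shows "0 \<le> comb_MI M \<sigma>\<^sub>c \<sigma>\<^sub>r n \<mu>"
proof -
  interpret dominated_channel \<mu> "noise_space M \<sigma>\<^sub>c \<sigma>\<^sub>r" "block_noise M n" "comb_output M n" "block_energy M n"
    by (rule dominated_channel_comb[OF M \<sigma> \<mu>])
  have "(\<integral>(x, \<omega>). log 2 ((\<lambda>_. 1) (x, comb_output M n x \<omega>)) \<partial>(\<mu> \<Otimes>\<^sub>M noise_space M \<sigma>\<^sub>c \<sigma>\<^sub>r)) \<le> comb_MI M \<sigma>\<^sub>c \<sigma>\<^sub>r n \<mu>"
    unfolding comb_MI_def using input_lawsD[OF \<mu>] X.emeasure_space_1
    by (intro information_ge) (auto simp: split_beta')
  then show ?thesis by (simp add: split_beta')
qed

lemma input_laws_nonempty: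
  assumes "\<rho> > 0"
  shows "input_laws M n \<rho> \<noteq> {}"
proof -
  let ?z = "\<lambda>k\<in>{1..n}. \<lambda>m\<in>{..<M}. 0 :: complex"
  have z: "?z \<in> space (block_space M n)"
    by (auto simp: block_space_def space_PiM)
  have "return (block_space M n) ?z \<in> input_laws M n \<rho>"
    unfolding input_laws_def
  proof (intro CollectI conjI)
    show "prob_space (return (block_space M n) ?z)"
      by (rule prob_space_return[OF z])
    have "(\<Sum>k=1..n. \<integral>\<^sup>+x. ennreal ((L2_set (\<lambda>m. cmod (x k m)) {..<M})\<^sup>2) \<partial>return (block_space M n) ?z) = 0"
    proof (intro sum.neutral ballI)
      fix k assume k: "k \<in> {1..n}"
      have [measurable]: "m \<in> {..<M} \<Longrightarrow> (\<lambda>x. x k m) \<in> borel_measurable (block_space M n)" for m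
        using k by (intro measurable_block_component) auto
      have "(\<integral>\<^sup>+x. ennreal ((L2_set (\<lambda>m. cmod (x k m)) {..<M})\<^sup>2) \<partial>return (block_space M n) ?z) =
          ennreal ((L2_set (\<lambda>m. cmod (?z k m)) {..<M})\<^sup>2)"
        unfolding L2_set_def by (rule nn_integral_return[OF z]) measurable
      then show "(\<integral>\<^sup>+x. ennreal ((L2_set (\<lambda>m. cmod (x k m)) {..<M})\<^sup>2) \<partial>return (block_space M n) ?z) = 0"
        using k by (simp add: L2_set_def)
    qed
    then show "(\<Sum>k=1..n. \<integral>\<^sup>+x. ennreal ((L2_set (\<lambda>m. cmod (x k m)) {..<M})\<^sup>2) \<partial>return (block_space M n) ?z)
        \<le> ennreal (real n * \<rho>)"
      by (simp only:) simp
  qed simp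
  then show ?thesis by auto
qed

text \<open>Fekete's lemma in the extended reals, where the limit may be infinite.\<close>

lemma superadditive_tendsto_SUP:
  fixes c :: "nat \<Rightarrow> ereal"
  assumes nonneg: "\<And>n. n \<ge> 1 \<Longrightarrow> 0 \<le> c n"
    and super: "\<And>m n. m \<ge> 1 \<Longrightarrow> n \<ge> 1 \<Longrightarrow> c m + c n \<le> c (m + n)"
  shows "(\<lambda>n. ereal (1 / real n) * c n) \<longlonglongrightarrow> (SUP n\<in>{1..}. ereal (1 / real n) * c n)"
proof (rule order_tendstoI)
  fix a assume "(SUP n\<in>{1..}. ereal (1 / real n) * c n) < a"
  then have "ereal (1 / real n) * c n < a" if "n \<ge> 1" for n
    using SUP_upper[of n "{1..}" "\<lambda>n. ereal (1 / real n) * c n"] that by auto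
  then show "\<forall>\<^sub>F n in sequentially. ereal (1 / real n) * c n < a"
    unfolding eventually_sequentially by blast
next
  fix a assume "a < (SUP n\<in>{1..}. ereal (1 / real n) * c n)"
  then obtain m where m: "m \<ge> 1" and am: "a < ereal (1 / real m) * c m"
    unfolding less_SUP_iff by auto
  then obtain r where r: "a < ereal r" "ereal r < ereal (1 / real m) * c m"
    using ereal_dense2 by blast
  \<comment> \<open>The gap between \<open>r'\<close> and \<open>r\<close> absorbs the loss
    \<open>real m * r / real n\<close> caused by the incomplete last group of fewer than
    \<open>m\<close> indices.\<close>
  then obtain r' where r': "a < ereal r'" "r' < r"
    using ereal_dense2[OF r(1)] by auto
  show "\<forall>\<^sub>F n in sequentially. a < ereal (1 / real n) * c n"
  \<comment> \<open>For \<open>r \<le> 0\<close> nonnegativity of \<open>c\<close> suffices; for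
    positive \<open>r\<close> the multiple \<open>n div m * m\<close> may be replaced by the smaller
    number \<open>n - m\<close>.\<close>
  proof (cases "r \<le> 0")
    case True
    have "a < ereal (1 / real n) * c n" if "n \<ge> 1" for n
    proof -
      have "ereal r \<le> 0" using True by simp
      also have "0 \<le> ereal (1 / real n) * c n"
        by (rule ereal_0_le_mult) (use nonneg[OF that] in auto)
      finally show ?thesis
        by (rule less_le_trans[OF r(1)])
    qed
    then show ?thesis
      unfolding eventually_sequentially by blast
  next
    case False
    have cm: "ereal (real m * r) \<le> c m"
    proof -
      have "ereal (real m) * ereal r \<le> ereal (real m) * (ereal (1 / real m) * c m)"
        using r(2) by (intro ereal_mult_left_mono) auto
      also have "\<dots> = c m"
        using m by (simp add: mult.assoc[symmetric] one_ereal_def[symmetric])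
      finally show ?thesis by simp
    qed
    have q: "ereal (real q * (real m * r)) \<le> c (q * m)" if "q \<ge> 1" for q
      using that
    proof (induction q rule: dec_induct)
      case base
      show ?case using cm by simp
    next
      case (step q)
      have "ereal (real (Suc q) * (real m * r)) = ereal (real m * r) + ereal (real q * (real m * r))"
        by (simp add: algebra_simps)
      also have "\<dots> \<le> c m + c (q * m)"
        by (intro add_mono cm step.IH)
      also have "\<dots> \<le> c (m + q * m)"
        using step.hyps m by (intro super) auto
      finally show ?case by simp
    qed
    have lower: "ereal ((real n - real m) * r) \<le> c n" if n: "n \<ge> m" for n
    proof -
      have d: "n div m \<ge> 1" using n m by (simp add: div_greater_zero_iff Suc_le_eq)
      have "real n = real (n div m) * real m + real (n mod m)"
        by (metis div_mult_mod_eq of_nat_add of_nat_mult)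
      moreover have "real (n mod m) \<le> real m"
        using m by (simp add: less_imp_le)
      ultimately have "(real n - real m) * r \<le> real (n div m) * real m * r"
        using False by (intro mult_right_mono) auto
      then have "ereal ((real n - real m) * r) \<le> ereal (real (n div m) * (real m * r))"
        by (simp add: mult.assoc)
      also have "\<dots> \<le> c (n div m * m)"
        by (rule q[OF d])
      also have "\<dots> \<le> c n"
      proof (cases "n mod m = 0")
        case True
        then show ?thesis by (metis add.right_neutral div_mult_mod_eq order_refl)
      next
        case False
        have "c (n div m * m) + 0 \<le> c (n div m * m) + c (n mod m)"
          using False by (intro add_left_mono nonneg) auto
        also have "\<dots> \<le> c (n div m * m + n mod m)"
          using d m False by (intro super) (auto simp: Suc_le_eq)
        finally show ?thesis by simp
      qed
      finally show ?thesis .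
    qed
    have "(\<lambda>n. r - real m * r / real n) \<longlonglongrightarrow> r - 0"
      by (intro tendsto_diff tendsto_const lim_const_over_n)
    then have "\<forall>\<^sub>F n in sequentially. r' < r - real m * r / real n"
      using r'(2) by (intro order_tendstoD) auto
    then show ?thesis
      using eventually_ge_at_top[of m]
    proof eventually_elim
      case (elim n)
      then have n: "n \<ge> 1" using m by simp
      have "a < ereal r'" by (rule r')
      also have "ereal r' \<le> ereal (r - real m * r / real n)" using elim by simp
      also have "\<dots> = ereal (1 / real n) * ereal ((real n - real m) * r)"
        using n by (simp add: field_simps)
      also have "\<dots> \<le> ereal (1 / real n) * c n"
        using lower[of n] elim by (intro ereal_mult_left_mono) auto
      finally show ?case .
    qed
  qed
qed

lemma comb_capacity_eq_SUP:
  assumes M: "M \<ge> 1" and \<sigma>: "\<sigma>\<^sub>c > 0" "\<sigma>\<^sub>r > 0" and \<rho>: "\<rho> > 0"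
  shows "comb_capacity M \<sigma>\<^sub>c \<sigma>\<^sub>r \<rho> =
    (SUP n\<in>{1..}. ereal (1 / real n) * (SUP \<mu> \<in> input_laws M n \<rho>. ereal (comb_MI M \<sigma>\<^sub>c \<sigma>\<^sub>r n \<mu>)))"
  unfolding comb_capacity_def
proof (intro limI superadditive_tendsto_SUP)
  fix n :: nat assume n: "n \<ge> 1"
  obtain \<mu> where \<mu>: "\<mu> \<in> input_laws M n \<rho>"
    using input_laws_nonempty[OF \<rho>] by blast
  then show "0 \<le> (SUP \<mu> \<in> input_laws M n \<rho>. ereal (comb_MI M \<sigma>\<^sub>c \<sigma>\<^sub>r n \<mu>))"
    using comb_MI_nonneg[OF M n \<sigma> \<mu>] by (intro SUP_upper2) auto
next
  fix a b :: nat assume ab: "a \<ge> 1" "b \<ge> 1"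
  let ?I = "\<lambda>n \<mu>. ereal (comb_MI M \<sigma>\<^sub>c \<sigma>\<^sub>r n \<mu>)"
  have le: "?I a \<mu>1 + ?I b \<mu>2 \<le> (SUP \<mu> \<in> input_laws M (a + b) \<rho>. ?I (a + b) \<mu>)"
    if "\<mu>1 \<in> input_laws M a \<rho>" "\<mu>2 \<in> input_laws M b \<rho>" for \<mu>1 \<mu>2
    using comb_MI_superadditive[OF M ab \<sigma> \<rho> that] by (auto intro: SUP_upper2)
  have nn: "0 \<le> ?I a \<mu>1" if "\<mu>1 \<in> input_laws M a \<rho>" for \<mu>1
    using comb_MI_nonneg[OF M ab(1) \<sigma> that] by simp
  obtain \<mu>0 where \<mu>0: "\<mu>0 \<in> input_laws M b \<rho>"
    using input_laws_nonempty[OF \<rho>] by blast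
  have nnb: "0 \<le> (SUP \<mu> \<in> input_laws M b \<rho>. ?I b \<mu>)"
    using comb_MI_nonneg[OF M ab(2) \<sigma> \<mu>0] \<mu>0 by (intro SUP_upper2) auto
  \<comment> \<open>Moving a supremum out of an extended-real sum must avoid the value minus
    infinity, which nonnegativity of the information rules out.\<close>
  have "(SUP \<mu> \<in> input_laws M a \<rho>. ?I a \<mu>) + (SUP \<mu> \<in> input_laws M b \<rho>. ?I b \<mu>) =
      (SUP \<mu>1 \<in> input_laws M a \<rho>. ?I a \<mu>1 + (SUP \<mu> \<in> input_laws M b \<rho>. ?I b \<mu>))"
    using nnb nn input_laws_nonempty[OF \<rho>] by (intro SUP_ereal_add_left[symmetric]) auto
  also have "\<dots> = (SUP \<mu>1 \<in> input_laws M a \<rho>. SUP \<mu>2 \<in> input_laws M b \<rho>. ?I a \<mu>1 + ?I b \<mu>2)"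
    using input_laws_nonempty[OF \<rho>] by (intro SUP_cong refl SUP_ereal_add_right[symmetric]) auto
  also have "\<dots> \<le> (SUP \<mu> \<in> input_laws M (a + b) \<rho>. ?I (a + b) \<mu>)"
    by (intro SUP_least le)
  finally show "(SUP \<mu> \<in> input_laws M a \<rho>. ?I a \<mu>) + (SUP \<mu> \<in> input_laws M b \<rho>. ?I b \<mu>) \<le>
    (SUP \<mu> \<in> input_laws M (a + b) \<rho>. ?I (a + b) \<mu>)" .
qed

text \<open>Because the limit is a supremum over \<open>n\<close>, one input law for one block
  length already bounds the capacity from below.\<close>

lemma comb_capacity_ge:
  assumes M: "M \<ge> 1" "n \<ge> 1" and \<sigma>: "\<sigma>\<^sub>c > 0" "\<sigma>\<^sub>r > 0" and \<rho>: "\<rho> > 0"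
    and \<mu>: "\<mu> \<in> input_laws M n \<rho>"
  shows "ereal (comb_MI M \<sigma>\<^sub>c \<sigma>\<^sub>r n \<mu> / real n) \<le> comb_capacity M \<sigma>\<^sub>c \<sigma>\<^sub>r \<rho>"
proof -
  have "ereal (comb_MI M \<sigma>\<^sub>c \<sigma>\<^sub>r n \<mu> / real n) = ereal (1 / real n) * ereal (comb_MI M \<sigma>\<^sub>c \<sigma>\<^sub>r n \<mu>)"
    by simp
  also have "\<dots> \<le> ereal (1 / real n) * (SUP \<mu> \<in> input_laws M n \<rho>. ereal (comb_MI M \<sigma>\<^sub>c \<sigma>\<^sub>r n \<mu>))"
    using \<mu> by (intro ereal_mult_left_mono SUP_upper) auto
  also have "\<dots> \<le> comb_capacity M \<sigma>\<^sub>c \<sigma>\<^sub>r \<rho>"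
    unfolding comb_capacity_eq_SUP[OF M(1) \<sigma> \<rho>] using M(2) by (intro SUP_upper) auto
  finally show ?thesis .
qed

section \<open>The input law\<close>

lemma measurable_Arg [measurable]: "Arg \<in> borel_measurable borel"
proof -
  have A: "- \<real>\<^sub>\<le>\<^sub>0 \<in> sets (borel :: complex measure)"
    by (intro borel_comp borel_closed closed_nonpos_Reals_complex)
  have c: "continuous_on (- \<real>\<^sub>\<le>\<^sub>0) Arg"
    by (intro continuous_at_imp_continuous_on ballI continuous_at_Arg) auto
  have "(\<lambda>z. if z \<in> - \<real>\<^sub>\<le>\<^sub>0 then Arg z else pi) \<in> borel_measurable borel"
    by (rule borel_measurable_continuous_on_if[OF A c continuous_on_const])
  then have "(\<lambda>z. if z = 0 then 0 else if z \<in> - \<real>\<^sub>\<le>\<^sub>0 then Arg z else pi) \<in> borel_measurable borel"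
    by (rule measurable_If[OF borel_measurable_const]) auto
  also have "(\<lambda>z. if z = 0 then 0 else if z \<in> - \<real>\<^sub>\<le>\<^sub>0 then Arg z else pi) = Arg"
  proof
    fix z :: complex
    show "(if z = 0 then 0 else if z \<in> - \<real>\<^sub>\<le>\<^sub>0 then Arg z else pi) = Arg z"
    proof (cases "z = 0 \<or> z \<notin> \<real>\<^sub>\<le>\<^sub>0")
      case False
      then have "Arg z = pi"
        by (subst Arg_eq_pi) (auto simp: complex_nonpos_Reals_iff complex_eq_iff)
      then show ?thesis using False by simp
    qed (auto simp: Arg_zero)
  qed
  finally show ?thesis .
qed

text \<open>For \<open>m < 2\<close> the factor \<open>g\<close> is signed; its sign is a phase of 0
  or \<open>pi\<close> and is absorbed by the uniform phase. The angle enters as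
  \<open>- \<psi>\<close> so that output phase minus input phase becomes \<open>\<psi>\<close> plus
  a constant.\<close>

definition symbol_law :: "nat \<Rightarrow> complex measure" where
  "symbol_law m = (if m < 2
     then distr (real_normal_half \<Otimes>\<^sub>M uniform_phase) borel (\<lambda>(g, \<psi>). of_real g * cis (- \<psi>))
     else std_complex_normal)"

definition block_law :: "nat \<Rightarrow> (nat \<Rightarrow> complex) measure" where
  "block_law M = Pi\<^sub>M {..<M} symbol_law"

lemma sets_symbol_law [measurable_cong, simp]: "sets (symbol_law m) = sets borel"
  by (simp add: symbol_law_def)

lemma space_symbol_law [simp]: "space (symbol_law m) = UNIV"
  by (simp add: symbol_law_def)

lemma measurable_cis [measurable]: "cis \<in> borel_measurable borel"
  by (intro borel_measurable_continuous_onI continuous_intros)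

lemma measurable_symbol_map [measurable]:
  "(\<lambda>(g, \<psi>). of_real g * cis (- \<psi>)) \<in> borel_measurable (real_normal_half \<Otimes>\<^sub>M uniform_phase)"
  unfolding split_beta' by measurable

lemma prob_space_symbol_law: "prob_space (symbol_law m)"
proof -
  interpret R: prob_space real_normal_half by (rule prob_space_real_normal_half)
  interpret U: prob_space uniform_phase by (rule prob_space_uniform_phase)
  interpret RU: pair_prob_space real_normal_half uniform_phase ..
  show ?thesis
    unfolding symbol_law_def
    by (auto intro: RU.prob_space_distr prob_space_std_complex_normal measurable_symbol_map)
qed

lemma prob_space_block_law: "prob_space (block_law M)"
  unfolding block_law_def by (intro prob_space_PiM prob_space_symbol_law)

lemma sets_block_law [measurable_cong, simp]: "sets (block_law M) = sets (Pi\<^sub>M {..<M} (\<lambda>_. borel))"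
  unfolding block_law_def by (intro sets_PiM_cong refl) auto

lemma distr_power2_symbol_law:
  "distr (symbol_law m) borel (\<lambda>z. (cmod z)\<^sup>2) = gamma_law (alpha_star m)"
proof (cases "m < 2")
  case True
  interpret U: prob_space uniform_phase by (rule prob_space_uniform_phase)
  have "distr (symbol_law m) borel (\<lambda>z. (cmod z)\<^sup>2) =
      distr (real_normal_half \<Otimes>\<^sub>M uniform_phase) borel ((\<lambda>g. g\<^sup>2) \<circ> fst)"
    using True unfolding symbol_law_def
    by (simp add: distr_distr comp_def split_beta' norm_mult)
  also have "\<dots> = distr (distr (real_normal_half \<Otimes>\<^sub>M uniform_phase) real_normal_half fst) borel (\<lambda>g. g\<^sup>2)"
    by (subst distr_distr) auto
  also have "\<dots> = gamma_law (1/2)"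
    by (simp add: U.distr_pair_fst distr_power2_real_normal_half)
  finally show ?thesis
    using True by (simp add: alpha_star_def)
qed (simp add: symbol_law_def alpha_star_def distr_power2_std_complex_normal)

lemma alpha_star_gt: "alpha_star m > 1/4"
  by (simp add: alpha_star_def)

lemma distr_cmod_symbol_law: "distr (symbol_law m) borel cmod = amplitude_law m"
proof -
  have "distr (symbol_law m) borel cmod = distr (distr (symbol_law m) borel (\<lambda>z. (cmod z)\<^sup>2)) borel sqrt"
    by (subst distr_distr) (auto simp: comp_def)
  then show ?thesis
    by (simp add: distr_power2_symbol_law amplitude_law_def gamma_law_def)
qed

lemma has_bochner_integral_symbol_law_power2:
  "has_bochner_integral (symbol_law m) (\<lambda>z. (cmod z)\<^sup>2) (alpha_star m)"
  using has_bochner_integral_gamma_law_id[of "alpha_star m"] alpha_star_gt[of m]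
  unfolding distr_power2_symbol_law[symmetric]
  by (auto simp: has_bochner_integral_iff integrable_distr_eq integral_distr)

lemma integrable_symbol_law_ln:
  assumes "c \<ge> 0"
  shows "integrable (symbol_law m) (\<lambda>z. ln (1 + c / (cmod z)\<^sup>2))"
  using integrable_gamma_law_ln[OF alpha_star_gt assms, of m]
  unfolding distr_power2_symbol_law[symmetric] by (subst (asm) integrable_distr_eq) auto

lemma AE_symbol_law_nonzero: "AE z in symbol_law m. z \<noteq> 0"
proof -
  have "AE r in distr (symbol_law m) borel (\<lambda>z. (cmod z)\<^sup>2). 0 < r"
    unfolding distr_power2_symbol_law by (rule AE_gamma_law_pos)
  then show ?thesis
    by (subst (asm) AE_distr_iff) auto
qed

section \<open>The decoder\<close>

text \<open>
  The phase of symbol \<open>m\<close> is predicted from earlier symbols by an integer combination of their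
  observed phases; the coefficients sum to \<open>1\<close> and have first moment \<open>m\<close>, so that the combination
  is exact for phases that are affine in the index.
\<close>

definition comb_coef :: "nat \<Rightarrow> nat \<Rightarrow> int" where
  "comb_coef m i = (if m = 2 then (if i = 1 then 2 else if i = 0 then - 1 else 0)
     else (if i + 1 = m \<or> i + 2 = m then 1 else if i + 3 = m then - 1 else 0))"

text \<open>Left unreduced: it is only evaluated through \<open>wrap_pi\<close> or, in integer
  combinations, through \<open>cis\<close>, and both are insensitive to multiples of
  \<open>2 * pi\<close>.\<close>

definition obs_phase :: "(nat \<Rightarrow> complex) \<Rightarrow> (nat \<Rightarrow> complex) \<Rightarrow> nat \<Rightarrow> real" where
  "obs_phase x y m = Arg (y m) - Arg (x m)"

text \<open>Logarithm of \<open>exp (- (t - r)\<^sup>2)\<close> divided by twice its average over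
  the signed Gaussian amplitude of scale \<open>s\<close>. The factor 2, entering as
  \<open>- ln 2\<close>, pays for replacing the amplitude by its modulus.\<close>

definition amp_score :: "real \<Rightarrow> real \<Rightarrow> real \<Rightarrow> real" where
  "amp_score s r t = ln (s\<^sup>2 + 1) / 2 - ln 2 + t\<^sup>2 / (s\<^sup>2 + 1) - (t - r)\<^sup>2"

definition phase_score :: "real \<Rightarrow> real \<Rightarrow> real" where
  "phase_score \<sigma> t = ln (2 * pi * wrapped_normal_density \<sigma> (wrap_pi t))"

definition pred_phase :: "nat \<Rightarrow> (nat \<Rightarrow> complex) \<Rightarrow> (nat \<Rightarrow> complex) \<Rightarrow> complex" where
  "pred_phase m x y = cis (\<Sum>i<m. of_int (comb_coef m i) * obs_phase x y i)"

text \<open>For amplitudes \<open>u\<close> an observed phase has, to first order, an error of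
  variance \<open>1 / (2 * (u i)\<^sup>2)\<close>, so half of the spread is the variance of the
  predicted phase.\<close>

definition spread :: "nat \<Rightarrow> (nat \<Rightarrow> real) \<Rightarrow> real" where
  "spread m u = (\<Sum>i<m. (of_int (comb_coef m i))\<^sup>2 / (u i)\<^sup>2)"

text \<open>
  Gaussian score with variance \<open>V\<close> for the prediction \<open>v\<close> of \<open>y\<close>, normalised against an input
  variable of variance \<open>s\<^sup>2\<close>. The variance is computed from \<open>y\<close> and not from the current input, so
  that the average over the current input is a Gaussian integral.
\<close>

definition gauss_score :: "real \<Rightarrow> real \<Rightarrow> complex \<Rightarrow> complex \<Rightarrow> real" where
  "gauss_score s V v y = ln ((s\<^sup>2 + V) / V) - (cmod (y - v))\<^sup>2 / V + (cmod y)\<^sup>2 / (s\<^sup>2 + V)"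

text \<open>The leading 1 accounts for the additive noise of the symbol and the squared output
  stands for its energy. The 1 added to that square keeps the variance from collapsing when the
  output happens to be small; it vanishes at high power, where \<open>spread\<close> is of order
  \<open>1 / s\<^sup>2\<close>.\<close>

definition symbol_var :: "nat \<Rightarrow> (nat \<Rightarrow> complex) \<Rightarrow> (nat \<Rightarrow> complex) \<Rightarrow> real" where
  "symbol_var m x y = 1 + (1 + (cmod (y m))\<^sup>2) * spread m (\<lambda>i. cmod (x i))"

text \<open>The observed phase of symbol 0 tracks the centre process. Subtracting it from that of
  symbol 1 isolates the rate process, so the second phase score sees the rate increment between the
  two blocks.\<close>

definition symbol_score :: "real \<Rightarrow> real \<Rightarrow> real \<Rightarrow> (nat \<Rightarrow> complex) \<Rightarrow> (nat \<Rightarrow> complex) \<Rightarrow>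
    (nat \<Rightarrow> complex) \<Rightarrow> (nat \<Rightarrow> complex) \<Rightarrow> nat \<Rightarrow> real" where
  "symbol_score \<sigma>\<^sub>c \<sigma>\<^sub>r s x' y' x y m =
     (if m = 0 then amp_score s (cmod (x 0)) (cmod (y 0)) + phase_score \<sigma>\<^sub>c (obs_phase x y 0 - obs_phase x' y' 0)
      else if m = 1 then amp_score s (cmod (x 1)) (cmod (y 1)) +
        phase_score \<sigma>\<^sub>r (obs_phase x y 1 - obs_phase x y 0 - obs_phase x' y' 1 + obs_phase x' y' 0)
      else gauss_score s (symbol_var m x y) (pred_phase m x y * x m) (y m))"

definition block_score :: "nat \<Rightarrow> real \<Rightarrow> real \<Rightarrow> real \<Rightarrow>
    (nat \<Rightarrow> nat \<Rightarrow> complex) \<Rightarrow> (nat \<Rightarrow> nat \<Rightarrow> complex) \<Rightarrow> nat \<Rightarrow> real" where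
  "block_score M \<sigma>\<^sub>c \<sigma>\<^sub>r s x y k =
     (\<Sum>m<M. symbol_score \<sigma>\<^sub>c \<sigma>\<^sub>r s (x (k - 1)) (y (k - 1)) (x k) (y k) m)"

text \<open>Causality in the symbol index: only symbols up to \<open>m\<close> are read. Sequential
  integration rests on this, as does passing between restricted and unrestricted input
  functions.\<close>

lemma symbol_score_cong:
  assumes "\<And>i. i \<le> m \<Longrightarrow> x i = X i" "\<And>i. i \<le> m \<Longrightarrow> y i = Y i"
    "\<And>i. i \<le> m \<Longrightarrow> x' i = X' i" "\<And>i. i \<le> m \<Longrightarrow> y' i = Y' i"
  shows "symbol_score \<sigma>\<^sub>c \<sigma>\<^sub>r s x' y' x y m = symbol_score \<sigma>\<^sub>c \<sigma>\<^sub>r s X' Y' X Y m"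
  using assms
  by (auto simp: symbol_score_def obs_phase_def symbol_var_def spread_def pred_phase_def
      intro!: arg_cong3[where f="gauss_score s"] arg_cong[where f=cis] sum.cong)

lemma spread_nonneg: "0 \<le> spread m u"
  unfolding spread_def by (intro sum_nonneg) auto

lemma symbol_var_ge_1: "1 \<le> symbol_var m x y"
  unfolding symbol_var_def using spread_nonneg by simp

lemma measurable_obs_phase [measurable (raw)]:
  assumes [measurable]: "(\<lambda>z. f z i) \<in> borel_measurable A" "(\<lambda>z. g z i) \<in> borel_measurable A"
  shows "(\<lambda>z. obs_phase (f z) (g z) i) \<in> borel_measurable A"
  unfolding obs_phase_def by measurable

lemma measurable_phase_score [measurable]: "phase_score \<sigma> \<in> borel_measurable borel"
  unfolding phase_score_def by measurable

lemma measurable_symbol_score: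
  assumes [measurable]: "\<And>i. i \<le> m \<Longrightarrow> (\<lambda>z. x z i) \<in> borel_measurable A"
    "\<And>i. i \<le> m \<Longrightarrow> (\<lambda>z. y z i) \<in> borel_measurable A"
    "\<And>i. i \<le> m \<Longrightarrow> (\<lambda>z. x' z i) \<in> borel_measurable A"
    "\<And>i. i \<le> m \<Longrightarrow> (\<lambda>z. y' z i) \<in> borel_measurable A"
  shows "(\<lambda>z. symbol_score \<sigma>\<^sub>c \<sigma>\<^sub>r s (x' z) (y' z) (x z) (y z) m) \<in> borel_measurable A"
proof -
  have [measurable]: "(\<lambda>z. spread m (\<lambda>i. cmod (x z i))) \<in> borel_measurable A"
    unfolding spread_def by (intro borel_measurable_sum) measurable
  have [measurable]: "(\<lambda>z. pred_phase m (x z) (y z)) \<in> borel_measurable A"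
    unfolding pred_phase_def by (intro measurable_compose[OF _ measurable_cis] borel_measurable_sum) measurable
  consider "m = 0" | "m = 1" | "m \<ge> 2" by linarith
  then show ?thesis
  proof cases
    case 1
    then show ?thesis
      unfolding symbol_score_def amp_score_def by simp
  next
    case 2
    then show ?thesis
      unfolding symbol_score_def amp_score_def by simp
  next
    case 3
    have "(\<lambda>z. gauss_score s (symbol_var m (x z) (y z)) (pred_phase m (x z) (y z) * x z m) (y z m)) \<in> borel_measurable A"
      unfolding gauss_score_def symbol_var_def by measurable
    then show ?thesis
      using 3 by (simp add: symbol_score_def)
  qed
qed

section \<open>Averages of exponentiated scores over the input\<close>

text \<open>The kernel with the modulus of \<open>g\<close> is one of the two kernels with
  \<open>g\<close> and \<open>- g\<close>. Bounding it by their sum gives two Gaussian convolutions,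
  each contributing 1/2.\<close>

lemma nn_integral_amp_score_le:
  assumes "s > 0"
  shows "(\<integral>\<^sup>+g. ennreal (exp (amp_score s (s * \<bar>g\<bar>) t)) \<partial>real_normal_half) \<le> 1"
proof -
  let ?w = "s\<^sup>2 + 1"
  let ?c = "sqrt ?w / 2 * exp (t\<^sup>2 / ?w)"
  have w: "?w > 0" by (simp add: add_nonneg_pos)
  have "exp (amp_score s (s * \<bar>g\<bar>) t) \<le> ?c * exp (- (t - s * g)\<^sup>2) + ?c * exp (- (t - (- s) * g)\<^sup>2)" for g
  proof -
    have "exp (amp_score s (s * \<bar>g\<bar>) t) = exp (ln ?w / 2) / exp (ln 2) * exp (t\<^sup>2 / ?w) * exp (- (t - s * \<bar>g\<bar>)\<^sup>2)"
      unfolding amp_score_def by (simp only: exp_add exp_diff exp_minus divide_inverse)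
    also have "exp (ln ?w / 2) = sqrt ?w"
      using w by (simp add: ln_sqrt[symmetric])
    also have "sqrt ?w / exp (ln 2) * exp (t\<^sup>2 / ?w) * exp (- (t - s * \<bar>g\<bar>)\<^sup>2) = ?c * exp (- (t - s * \<bar>g\<bar>)\<^sup>2)"
      by simp
    also have "\<dots> \<le> ?c * (exp (- (t - s * g)\<^sup>2) + exp (- (t - (- s) * g)\<^sup>2))"
      using w by (intro mult_left_mono) (auto simp: abs_if)
    finally show ?thesis by (simp add: distrib_left)
  qed
  then have "(\<integral>\<^sup>+g. ennreal (exp (amp_score s (s * \<bar>g\<bar>) t)) \<partial>real_normal_half) \<le>
      (\<integral>\<^sup>+g. ennreal ?c * ennreal (exp (- (t - s * g)\<^sup>2)) + ennreal ?c * ennreal (exp (- (t - (- s) * g)\<^sup>2)) \<partial>real_normal_half)"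
    using w by (intro nn_integral_mono) (simp flip: ennreal_mult' ennreal_plus add: ennreal_leI)
  also have "\<dots> = ennreal ?c * (\<integral>\<^sup>+g. ennreal (exp (- (t - s * g)\<^sup>2)) \<partial>real_normal_half) +
      ennreal ?c * (\<integral>\<^sup>+g. ennreal (exp (- (t - (- s) * g)\<^sup>2)) \<partial>real_normal_half)"
    by (subst nn_integral_add, simp, simp, subst (1 2) nn_integral_cmult) auto
  also have "\<dots> = ennreal ?c * ennreal (exp (- (t\<^sup>2 / ?w)) / sqrt ?w) + ennreal ?c * ennreal (exp (- (t\<^sup>2 / ?w)) / sqrt ?w)"
    by (simp only: nn_integral_real_normal_half_gauss power2_minus)
  also have "ennreal ?c * ennreal (exp (- (t\<^sup>2 / ?w)) / sqrt ?w) = ennreal (1 / 2)"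
  proof -
    have "?c * (exp (- (t\<^sup>2 / ?w)) / sqrt ?w) = (sqrt ?w / sqrt ?w) * (exp (t\<^sup>2 / ?w) * exp (- (t\<^sup>2 / ?w))) / 2"
      by (simp only: times_divide_eq_right times_divide_eq_left mult_ac divide_divide_eq_left)
    also have "\<dots> = 1 / 2"
      using w by (simp flip: exp_add)
    finally show ?thesis
      using w by (subst ennreal_mult'[symmetric]) (auto intro!: arg_cong[where f=ennreal])
  qed
  also have "ennreal (1 / 2) + ennreal (1 / 2) = ennreal (1 / 2 + 1 / 2)"
    by (rule ennreal_plus[symmetric]) auto
  finally show ?thesis by simp
qed

lemma phase_score_cong: "cis a = cis b \<Longrightarrow> phase_score \<sigma> a = phase_score \<sigma> b"
  unfolding phase_score_def by (simp only: wrap_pi_eqI[of a b])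

lemma cis_Arg_eq: "z \<noteq> 0 \<Longrightarrow> cis (Arg z) = sgn z"
  by (rule cis_Arg)

lemma abs_wrap_pi_le: "\<bar>wrap_pi t\<bar> \<le> pi"
  using wrap_pi_bounds[of t] by auto

lemma wrapped_normal_density_pos:
  "\<sigma> > 0 \<Longrightarrow> 0 < wrapped_normal_density \<sigma> (wrap_pi t)"
  using wrapped_normal_density_ge[OF _ abs_wrap_pi_le, of \<sigma> t] normal_density_pos[of \<sigma> 0 pi] by simp

text \<open>For a fixed nonzero amplitude the uniform phase averages the phase factor to exactly 1,
  by rotation invariance, whatever the reference angle \<open>a\<close>. The amplitude factor
  remains.\<close>

lemma nn_integral_amp_phase_score_le:
  assumes s: "s > 0" and \<sigma>: "\<sigma> > 0" and m: "m < 2"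
  shows "(\<integral>\<^sup>+\<xi>. ennreal (exp (amp_score s (cmod (of_real s * \<xi>)) t + phase_score \<sigma> (a - Arg (of_real s * \<xi>)))) \<partial>symbol_law m) \<le> 1"
proof -
  interpret U: prob_space uniform_phase by (rule prob_space_uniform_phase)
  let ?h = "\<lambda>\<xi>. ennreal (exp (amp_score s (cmod (of_real s * \<xi>)) t + phase_score \<sigma> (a - Arg (of_real s * \<xi>))))"
  let ?m = "\<lambda>g \<psi>. of_real g * cis (- \<psi>)"
  have sl: "symbol_law m = distr (real_normal_half \<Otimes>\<^sub>M uniform_phase) borel (\<lambda>(g, \<psi>). of_real g * cis (- \<psi>))"
    using m by (simp add: symbol_law_def)
  have hm[measurable]: "?h \<in> borel_measurable borel"
    unfolding amp_score_def by measurable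
  have hm2: "(\<lambda>z. ?h (?m (fst z) (snd z))) \<in> borel_measurable (real_normal_half \<Otimes>\<^sub>M uniform_phase)"
    using measurable_compose[OF measurable_symbol_map hm] by (simp add: split_beta')
  have AE0: "AE g in real_normal_half. g \<noteq> 0"
    unfolding real_normal_half_def by (subst AE_density) (auto intro: AE_mp[OF AE_lborel_singleton[of 0]])
  have "(\<integral>\<^sup>+\<xi>. ?h \<xi> \<partial>symbol_law m) = (\<integral>\<^sup>+z. ?h ((\<lambda>(g, \<psi>). ?m g \<psi>) z) \<partial>(real_normal_half \<Otimes>\<^sub>M uniform_phase))"
    unfolding sl by (rule nn_integral_distr[OF measurable_symbol_map]) (use hm in simp)
  also have "\<dots> = (\<integral>\<^sup>+g. \<integral>\<^sup>+\<psi>. ?h (?m g \<psi>) \<partial>uniform_phase \<partial>real_normal_half)"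
    using U.nn_integral_fst[OF hm2] by (simp add: split_beta')
  also have "\<dots> = (\<integral>\<^sup>+g. ennreal (exp (amp_score s (s * \<bar>g\<bar>) t)) \<partial>real_normal_half)"
  proof (intro nn_integral_cong_AE, use AE0 in eventually_elim)
    fix g :: real assume g: "g \<noteq> 0"
    \<comment> \<open>The argument of the real number \<open>g\<close> is 0 or \<open>pi\<close>, so
      the sign of the amplitude is part of the constant rotation.\<close>
    define b where "b = a - Arg (of_real g)"
    have ph: "phase_score \<sigma> (a - Arg (of_real s * ?m g \<psi>)) = phase_score \<sigma> (\<psi> + b)" for \<psi>
    proof (rule phase_score_cong)
      have "cis (Arg (of_real s * ?m g \<psi>)) = sgn (of_real s * ?m g \<psi>)"
        using s g by (intro cis_Arg_eq) auto
      also have "\<dots> = cis (Arg (of_real g)) * cis (- \<psi>)"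
        using s g by (simp add: cis_Arg_eq sgn_mult) (simp add: sgn_div_norm scaleR_conv_of_real)
      finally have "cis (Arg (of_real s * ?m g \<psi>)) = cis (Arg (of_real g) - \<psi>)"
        by (simp add: cis_mult)
      then have "cis a / cis (Arg (of_real s * ?m g \<psi>)) = cis a / cis (Arg (of_real g) - \<psi>)"
        by simp
      then show "cis (a - Arg (of_real s * ?m g \<psi>)) = cis (\<psi> + b)"
        by (simp add: cis_divide b_def algebra_simps)
    qed
    have "?h (?m g \<psi>) = ennreal (exp (amp_score s (s * \<bar>g\<bar>) t)) * ennreal (2 * pi * wrapped_normal_density \<sigma> (wrap_pi (\<psi> + b)))" for \<psi>
      unfolding exp_add ph using s wrapped_normal_density_pos[OF \<sigma>, of "\<psi> + b"]
      by (simp add: norm_mult abs_mult phase_score_def flip: ennreal_mult')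
    then have "(\<integral>\<^sup>+\<psi>. ?h (?m g \<psi>) \<partial>uniform_phase) =
        ennreal (exp (amp_score s (s * \<bar>g\<bar>) t)) * (\<integral>\<^sup>+\<psi>. ennreal (2 * pi * wrapped_normal_density \<sigma> (wrap_pi (\<psi> + b))) \<partial>uniform_phase)"
      by (simp only:) (rule nn_integral_cmult, measurable)
    also have "(\<integral>\<^sup>+\<psi>. ennreal (2 * pi * wrapped_normal_density \<sigma> (wrap_pi (\<psi> + b))) \<partial>uniform_phase) = 1"
      using nn_integral_uniform_phase_shift[of "\<lambda>t. ennreal (2 * pi * wrapped_normal_density \<sigma> t)" b]
        nn_integral_wrapped_normal_density[OF \<sigma>] by simp
    finally show "(\<integral>\<^sup>+\<psi>. ?h (?m g \<psi>) \<partial>uniform_phase) = ennreal (exp (amp_score s (s * \<bar>g\<bar>) t))"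
      by simp
  qed
  also have "\<dots> \<le> 1"
    by (rule nn_integral_amp_score_le[OF s])
  finally show ?thesis .
qed

text \<open>The first and last term of the score are the negative logarithm of the Gaussian average
  of \<open>exp (- (cmod (y - v))\<^sup>2 / V)\<close>, hence equality.\<close>

lemma nn_integral_gauss_score:
  assumes "cmod e = 1" "V > 0"
  shows "(\<integral>\<^sup>+\<xi>. ennreal (exp (gauss_score s V (e * (of_real s * \<xi>)) y)) \<partial>std_complex_normal) = 1"
proof -
  let ?w = "s\<^sup>2 + V"
  let ?c = "?w / V * exp ((cmod y)\<^sup>2 / ?w)"
  have w: "?w > 0" using assms by (simp add: add_nonneg_pos)
  have "exp (gauss_score s V (e * (of_real s * \<xi>)) y) = ?c * exp (- ((cmod (y - e * (of_real s * \<xi>)))\<^sup>2 / V))" for \<xi>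
  proof -
    have "exp (ln (?w / V)) = ?w / V"
      using w assms by simp
    then show ?thesis
      unfolding gauss_score_def exp_add exp_diff exp_minus by (simp add: divide_inverse mult_ac)
  qed
  then have "(\<integral>\<^sup>+\<xi>. ennreal (exp (gauss_score s V (e * (of_real s * \<xi>)) y)) \<partial>std_complex_normal) =
      (\<integral>\<^sup>+\<xi>. ennreal ?c * ennreal (exp (- ((cmod (y - e * (of_real s * \<xi>)))\<^sup>2 / V))) \<partial>std_complex_normal)"
    using w assms by (simp flip: ennreal_mult')
  also have "\<dots> = ennreal ?c * ennreal (V / ?w * exp (- ((cmod y)\<^sup>2 / ?w)))"
    by (subst nn_integral_cmult, simp, subst nn_integral_std_complex_normal_gauss[OF assms]) simp
  also have "\<dots> = 1"
    using w assms by (simp add: exp_minus flip: ennreal_mult')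
  finally show ?thesis .
qed

lemma nn_integral_symbol_score_le:
  assumes s: "s > 0" and \<sigma>: "\<sigma>\<^sub>c > 0" "\<sigma>\<^sub>r > 0"
  shows "(\<integral>\<^sup>+\<xi>. ennreal (exp (symbol_score \<sigma>\<^sub>c \<sigma>\<^sub>r s x' y' (x(m := of_real s * \<xi>)) y m)) \<partial>symbol_law m) \<le> 1"
proof -
  consider "m = 0" | "m = 1" | "m \<ge> 2" by linarith
  then show ?thesis
  proof cases
    case 1
    then have "symbol_score \<sigma>\<^sub>c \<sigma>\<^sub>r s x' y' (x(m := of_real s * \<xi>)) y m =
        amp_score s (cmod (of_real s * \<xi>)) (cmod (y 0)) +
        phase_score \<sigma>\<^sub>c ((Arg (y 0) - obs_phase x' y' 0) - Arg (of_real s * \<xi>))" for \<xi>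
      by (simp add: symbol_score_def obs_phase_def algebra_simps)
    then show ?thesis
      using nn_integral_amp_phase_score_le[OF s \<sigma>(1), of m] 1 by simp
  next
    case 2
    then have "symbol_score \<sigma>\<^sub>c \<sigma>\<^sub>r s x' y' (x(m := of_real s * \<xi>)) y m =
        amp_score s (cmod (of_real s * \<xi>)) (cmod (y 1)) +
        phase_score \<sigma>\<^sub>r ((Arg (y 1) - obs_phase x y 0 - obs_phase x' y' 1 + obs_phase x' y' 0) - Arg (of_real s * \<xi>))" for \<xi>
      by (simp add: symbol_score_def obs_phase_def algebra_simps)
    then show ?thesis
      using nn_integral_amp_phase_score_le[OF s \<sigma>(2), of m] 2 by simp
  next
    case 3
    \<comment> \<open>Both sums run over \<open>i < m\<close> and the energy is taken from the
      output, so the current input enters the score only through the centre of the Gaussian.\<close>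
    have "symbol_var m (x(m := of_real s * \<xi>)) y = symbol_var m x y"
      "pred_phase m (x(m := of_real s * \<xi>)) y = pred_phase m x y" for \<xi>
      by (auto simp: symbol_var_def spread_def pred_phase_def obs_phase_def intro!: arg_cong[where f=cis] sum.cong)
    then have "symbol_score \<sigma>\<^sub>c \<sigma>\<^sub>r s x' y' (x(m := of_real s * \<xi>)) y m =
        gauss_score s (symbol_var m x y) (pred_phase m x y * (of_real s * \<xi>)) (y m)" for \<xi>
      using 3 by (simp add: symbol_score_def)
    moreover have "cmod (pred_phase m x y) = 1" "symbol_var m x y > 0"
      using symbol_var_ge_1[of m x y] by (auto simp: pred_phase_def)
    ultimately show ?thesis
      using nn_integral_gauss_score[of "pred_phase m x y" "symbol_var m x y" s "y m"] 3
      by (simp add: symbol_law_def)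
  qed
qed

text \<open>A supermartingale argument: the last coordinate occurs in the last factor only, whose
  conditional mean is at most 1, so it can be integrated out and the induction continues. It serves
  for the symbols within a block and again for the blocks.\<close>

lemma nn_integral_PiM_sequential_le_1:
  fixes H :: "nat \<Rightarrow> (nat \<Rightarrow> 'b) \<Rightarrow> ennreal"
  assumes \<nu>: "\<And>i. prob_space (\<nu> i)"
    and meas: "\<And>i j. a \<le> i \<Longrightarrow> i < j \<Longrightarrow> H i \<in> borel_measurable (Pi\<^sub>M {a..<j} \<nu>)"
    and dep: "\<And>i j x t. i < j \<Longrightarrow> H i (x(j := t)) = H i x"
    and le: "\<And>i x. a \<le> i \<Longrightarrow> x \<in> space (Pi\<^sub>M {a..<i} \<nu>) \<Longrightarrow> (\<integral>\<^sup>+t. H i (x(i := t)) \<partial>\<nu> i) \<le> 1"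
    and "a \<le> N"
  shows "(\<integral>\<^sup>+x. (\<Prod>i\<in>{a..<N}. H i x) \<partial>Pi\<^sub>M {a..<N} \<nu>) \<le> 1"
  using \<open>a \<le> N\<close>
proof (induction N rule: dec_induct)
  case base
  interpret product_prob_space \<nu> by (intro product_prob_spaceI \<nu>)
  show ?case by (simp add: PiM_empty nn_integral_count_space_finite)
next
  case (step N)
  interpret product_prob_space \<nu> by (intro product_prob_spaceI \<nu>)
  have ins: "{a..<Suc N} = insert N {a..<N}"
    using step.hyps by auto
  have mm: "(\<lambda>x. \<Prod>i\<in>{a..<Suc N}. H i x) \<in> borel_measurable (Pi\<^sub>M {a..<Suc N} \<nu>)"
    by (intro borel_measurable_prod_ennreal meas) auto
  have "(\<integral>\<^sup>+x. (\<Prod>i\<in>{a..<Suc N}. H i x) \<partial>Pi\<^sub>M {a..<Suc N} \<nu>) =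
      (\<integral>\<^sup>+x. \<integral>\<^sup>+t. (\<Prod>i\<in>{a..<Suc N}. H i (x(N := t))) \<partial>\<nu> N \<partial>Pi\<^sub>M {a..<N} \<nu>)"
    using mm unfolding ins by (subst product_nn_integral_insert) auto
  also have "\<dots> = (\<integral>\<^sup>+x. (\<Prod>i\<in>{a..<N}. H i x) * (\<integral>\<^sup>+t. H N (x(N := t)) \<partial>\<nu> N) \<partial>Pi\<^sub>M {a..<N} \<nu>)"
  proof (intro nn_integral_cong)
    fix x assume x: "x \<in> space (Pi\<^sub>M {a..<N} \<nu>)"
    have upd: "(\<lambda>t. x(N := t)) \<in> measurable (\<nu> N) (Pi\<^sub>M {a..<Suc N} \<nu>)"
      unfolding ins by (rule measurable_component_update[OF x]) simp
    have "(\<integral>\<^sup>+t. (\<Prod>i\<in>{a..<Suc N}. H i (x(N := t))) \<partial>\<nu> N) =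
        (\<integral>\<^sup>+t. (\<Prod>i\<in>{a..<N}. H i x) * H N (x(N := t)) \<partial>\<nu> N)"
      using step.hyps dep by (intro nn_integral_cong) (auto simp: ins mult.commute intro!: arg_cong2[where f="(*)"] prod.cong)
    also have "\<dots> = (\<Prod>i\<in>{a..<N}. H i x) * (\<integral>\<^sup>+t. H N (x(N := t)) \<partial>\<nu> N)"
      using step.hyps by (intro nn_integral_cmult measurable_compose[OF upd] meas) auto
    finally show "(\<integral>\<^sup>+t. (\<Prod>i\<in>{a..<Suc N}. H i (x(N := t))) \<partial>\<nu> N) =
        (\<Prod>i\<in>{a..<N}. H i x) * (\<integral>\<^sup>+t. H N (x(N := t)) \<partial>\<nu> N)" .
  qed
  also have "\<dots> \<le> (\<integral>\<^sup>+x. (\<Prod>i\<in>{a..<N}. H i x) * 1 \<partial>Pi\<^sub>M {a..<N} \<nu>)"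
    using step.hyps by (intro nn_integral_mono mult_left_mono le) auto
  also have "\<dots> \<le> 1"
    using step.IH by simp
  finally show ?case .
qed

lemma nn_integral_block_score_le:
  assumes s: "s > 0" and \<sigma>: "\<sigma>\<^sub>c > 0" "\<sigma>\<^sub>r > 0"
  shows "(\<integral>\<^sup>+\<xi>. ennreal (exp (\<Sum>m<M. symbol_score \<sigma>\<^sub>c \<sigma>\<^sub>r s x' y' (\<lambda>m. of_real s * \<xi> m) y m)) \<partial>block_law M) \<le> 1"
proof -
  let ?H = "\<lambda>m \<xi>. ennreal (exp (symbol_score \<sigma>\<^sub>c \<sigma>\<^sub>r s x' y' (\<lambda>m. of_real s * \<xi> m) y m))"
  have "(\<integral>\<^sup>+\<xi>. (\<Prod>m\<in>{0..<M}. ?H m \<xi>) \<partial>Pi\<^sub>M {0..<M} symbol_law) \<le> 1"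
  proof (rule nn_integral_PiM_sequential_le_1[OF prob_space_symbol_law])
    fix i j :: nat assume ij: "0 \<le> i" "i < j"
    have comp: "(\<lambda>\<xi>. \<xi> l) \<in> borel_measurable (Pi\<^sub>M {0..<j} symbol_law)" if "l \<le> i" for l
      using measurable_component_singleton[of l "{0..<j}" symbol_law] that ij
      by (simp cong: measurable_cong_sets)
    have "(\<lambda>\<xi>. symbol_score \<sigma>\<^sub>c \<sigma>\<^sub>r s x' y' (\<lambda>m. of_real s * \<xi> m) y i) \<in> borel_measurable (Pi\<^sub>M {0..<j} symbol_law)"
      by (intro measurable_symbol_score borel_measurable_times comp) auto
    then show "?H i \<in> borel_measurable (Pi\<^sub>M {0..<j} symbol_law)"
      by measurable
  next
    fix i j :: nat and \<xi> :: "nat \<Rightarrow> complex" and t assume "i < j"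
    then show "?H i (\<xi>(j := t)) = ?H i \<xi>"
      by (intro arg_cong[where f="\<lambda>r. ennreal (exp r)"] symbol_score_cong) auto
  next
    fix i :: nat and \<xi> :: "nat \<Rightarrow> complex"
    have "(\<lambda>m. of_real s * (\<xi>(i := t)) m) = (\<lambda>m. of_real s * \<xi> m)(i := of_real s * t)" for t
      by auto
    then show "(\<integral>\<^sup>+t. ?H i (\<xi>(i := t)) \<partial>symbol_law i) \<le> 1"
      using nn_integral_symbol_score_le[OF s \<sigma>, where x="\<lambda>m. of_real s * \<xi> m" and m=i] by simp
  qed simp
  then show ?thesis
    unfolding block_law_def by (simp add: atLeast0LessThan prod_ennreal exp_sum)
qed

section \<open>The scaled independent input\<close>

definition scale_blocks :: "nat \<Rightarrow> nat \<Rightarrow> real \<Rightarrow> (nat \<Rightarrow> nat \<Rightarrow> complex) \<Rightarrow> nat \<Rightarrow> nat \<Rightarrow> complex" where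
  "scale_blocks M n s \<xi> = (\<lambda>k\<in>{1..n}. \<lambda>m\<in>{..<M}. of_real s * \<xi> k m)"

definition blocks_law :: "nat \<Rightarrow> nat \<Rightarrow> (nat \<Rightarrow> nat \<Rightarrow> complex) measure" where
  "blocks_law M n = Pi\<^sub>M {1..n} (\<lambda>_. block_law M)"

definition comb_input :: "nat \<Rightarrow> nat \<Rightarrow> real \<Rightarrow> (nat \<Rightarrow> nat \<Rightarrow> complex) measure" where
  "comb_input M n s = distr (blocks_law M n) (block_space M n) (scale_blocks M n s)"

lemma sets_blocks_law [measurable_cong, simp]: "sets (blocks_law M n) = sets (block_space M n)"
  unfolding blocks_law_def block_space_def by (intro sets_PiM_cong refl) auto

lemma prob_space_blocks_law: "prob_space (blocks_law M n)"
  unfolding blocks_law_def by (intro prob_space_PiM prob_space_block_law)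

lemma measurable_scale_blocks [measurable]:
  "scale_blocks M n s \<in> measurable (block_space M n) (block_space M n)"
  unfolding scale_blocks_def[abs_def]
  by (intro measurable_block_lambda borel_measurable_times measurable_block_component) auto

lemma sets_comb_input [measurable_cong, simp]: "sets (comb_input M n s) = sets (block_space M n)"
  by (simp add: comb_input_def)

lemma prob_space_comb_input: "prob_space (comb_input M n s)"
  unfolding comb_input_def
  by (rule prob_space.prob_space_distr[OF prob_space_blocks_law]) measurable

lemma distr_blocks_law_component:
  assumes "k \<in> {1..n}" "m < M"
  shows "distr (blocks_law M n) borel (\<lambda>\<xi>. \<xi> k m) = symbol_law m"
proof -
  have "symbol_law m = distr (block_law M) (symbol_law m) (\<lambda>x. x m)"
    unfolding block_law_def using assms
    by (intro distr_PiM_component[symmetric] prob_space_symbol_law) auto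
  also have "\<dots> = distr (block_law M) borel (\<lambda>x. x m)"
    by (intro distr_cong) auto
  also have "\<dots> = distr (distr (blocks_law M n) (block_law M) (\<lambda>\<xi>. \<xi> k)) borel (\<lambda>x. x m)"
    unfolding blocks_law_def using assms by (subst distr_PiM_component) (auto simp: prob_space_block_law)
  also have "\<dots> = distr (blocks_law M n) borel (\<lambda>\<xi>. \<xi> k m)"
  proof (subst distr_distr)
    show "(\<lambda>x. x m) \<in> borel_measurable (block_law M)"
      using assms measurable_component_singleton[of m "{..<M}" "\<lambda>_. borel"]
      by (simp cong: measurable_cong_sets)
    show "(\<lambda>\<xi>. \<xi> k) \<in> measurable (blocks_law M n) (block_law M)"
      unfolding blocks_law_def using assms by (intro measurable_component_singleton) auto
  qed (simp add: comp_def)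
  finally show ?thesis ..
qed

text \<open>The mean energy of an unscaled block, two halves and \<open>M - 2\<close> ones; it is
  the origin of the ratio of \<open>\<rho>\<close> to \<open>M - 1\<close>.\<close>

lemma sum_alpha_star: "M \<ge> 2 \<Longrightarrow> (\<Sum>m<M. alpha_star m) = real M - 1"
proof (induction M rule: dec_induct)
  case base
  show ?case by (simp add: alpha_star_def numeral_2_eq_2)
qed (simp add: alpha_star_def)

lemma comb_input_in_input_laws:
  assumes M: "M \<ge> 2" and \<rho>: "s\<^sup>2 * (real M - 1) \<le> \<rho>"
  shows "comb_input M n s \<in> input_laws M n \<rho>"
proof -
  let ?p = "\<lambda>k x. ennreal ((L2_set (\<lambda>m. cmod (x k m)) {..<M})\<^sup>2)"
  have "(\<integral>\<^sup>+x. ?p k x \<partial>comb_input M n s) = ennreal (s\<^sup>2 * (real M - 1))" if k: "k \<in> {1..n}" for k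
  proof -
    have comp[measurable]: "m \<in> {..<M} \<Longrightarrow> (\<lambda>x. x k m) \<in> borel_measurable (block_space M n)" for m
      using k by (intro measurable_block_component) auto
    have "(\<integral>\<^sup>+x. ?p k x \<partial>comb_input M n s) = (\<integral>\<^sup>+\<xi>. ?p k (scale_blocks M n s \<xi>) \<partial>blocks_law M n)"
      unfolding comb_input_def L2_set_def by (subst nn_integral_distr) auto
    also have "\<dots> = (\<integral>\<^sup>+\<xi>. (\<Sum>m<M. ennreal (s\<^sup>2) * ennreal ((cmod (\<xi> k m))\<^sup>2)) \<partial>blocks_law M n)"
    proof (intro nn_integral_cong)
      fix \<xi> :: "nat \<Rightarrow> nat \<Rightarrow> complex"
      have "(L2_set (\<lambda>m. cmod (scale_blocks M n s \<xi> k m)) {..<M})\<^sup>2 = (\<Sum>m<M. s\<^sup>2 * (cmod (\<xi> k m))\<^sup>2)"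
        using k by (simp add: L2_set_def sum_nonneg scale_blocks_def norm_mult power_mult_distrib)
      then show "?p k (scale_blocks M n s \<xi>) = (\<Sum>m<M. ennreal (s\<^sup>2) * ennreal ((cmod (\<xi> k m))\<^sup>2))"
        by (simp flip: ennreal_mult)
    qed
    also have "\<dots> = (\<Sum>m<M. ennreal (s\<^sup>2) * (\<integral>\<^sup>+\<xi>. ennreal ((cmod (\<xi> k m))\<^sup>2) \<partial>blocks_law M n))"
      by (subst nn_integral_sum) (auto intro!: sum.cong nn_integral_cmult)
    also have "\<dots> = (\<Sum>m<M. ennreal (s\<^sup>2 * alpha_star m))"
    proof (intro sum.cong refl)
      fix m assume m: "m \<in> {..<M}"
      have "(\<integral>\<^sup>+\<xi>. ennreal ((cmod (\<xi> k m))\<^sup>2) \<partial>blocks_law M n) = (\<integral>\<^sup>+z. ennreal ((cmod z)\<^sup>2) \<partial>symbol_law m)"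
        using m comp[OF m] by (simp add: nn_integral_distr flip: distr_blocks_law_component[OF k])
      also have "\<dots> = ennreal (alpha_star m)"
        using has_bochner_integral_symbol_law_power2[of m]
        by (subst nn_integral_eq_integral) (auto simp: has_bochner_integral_iff)
      finally show "ennreal (s\<^sup>2) * (\<integral>\<^sup>+\<xi>. ennreal ((cmod (\<xi> k m))\<^sup>2) \<partial>blocks_law M n) = ennreal (s\<^sup>2 * alpha_star m)"
        by (simp add: ennreal_mult')
    qed
    also have "\<dots> = ennreal (s\<^sup>2 * (real M - 1))"
      using sum_alpha_star[OF M] by (simp add: sum_ennreal alpha_star_def flip: sum_distrib_left)
    finally show ?thesis .
  qed
  then have "(\<Sum>k=1..n. \<integral>\<^sup>+x. ?p k x \<partial>comb_input M n s) = (\<Sum>k=1..n. ennreal (s\<^sup>2 * (real M - 1)))"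
    by (intro sum.cong refl)
  also have "\<dots> = ennreal (real n * (s\<^sup>2 * (real M - 1)))"
    using M by (subst sum_ennreal) auto
  also have "\<dots> \<le> ennreal (real n * \<rho>)"
    using \<rho> by (intro ennreal_leI mult_left_mono) auto
  finally show ?thesis
    by (simp add: input_laws_def prob_space_comb_input)
qed

lemma distr_comb_input_window:
  assumes "a + b \<le> n"
  shows "distr (comb_input M n s) (comb_input M b s) (window M a b) = comb_input M b s"
proof -
  have w: "window M a b \<in> measurable (block_space M n) (block_space M b)"
    by (rule measurable_window[OF assms])
  have "distr (comb_input M n s) (comb_input M b s) (window M a b) =
      distr (comb_input M n s) (block_space M b) (window M a b)"
    by (intro distr_cong) auto
  also have "\<dots> = distr (blocks_law M n) (block_space M b) (window M a b \<circ> scale_blocks M n s)"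
    unfolding comb_input_def using w by (intro distr_distr) auto
  also have "\<dots> = distr (blocks_law M n) (block_space M b) (scale_blocks M b s \<circ> (\<lambda>\<xi>. \<lambda>k\<in>{1..b}. \<xi> (k + a)))"
    using assms by (intro distr_cong refl) (auto simp: window_def scale_blocks_def fun_eq_iff restrict_def)
  also have "\<dots> = distr (distr (blocks_law M n) (blocks_law M b) (\<lambda>\<xi>. \<lambda>k\<in>{1..b}. \<xi> (k + a))) (block_space M b) (scale_blocks M b s)"
  proof (rule distr_distr[symmetric])
    show "(\<lambda>\<xi>. \<lambda>k\<in>{1..b}. \<xi> (k + a)) \<in> measurable (blocks_law M n) (blocks_law M b)"
      unfolding blocks_law_def using assms by (intro measurable_restrict measurable_component_singleton) auto
  qed measurable
  also have "distr (blocks_law M n) (blocks_law M b) (\<lambda>\<xi>. \<lambda>k\<in>{1..b}. \<xi> (k + a)) = blocks_law M b"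
    unfolding blocks_law_def using assms
    by (intro distr_PiM_reindex[of "{1..n}" "\<lambda>_. block_law M" "\<lambda>k. k + a" "{1..b}"])
      (auto simp: prob_space_block_law)
  finally show ?thesis
    by (simp add: comb_input_def)
qed

section \<open>From the score of one block to the capacity\<close>

lemma measurable_block_score:
  assumes "k \<in> {2..n}"
  shows "(\<lambda>z. block_score M \<sigma>\<^sub>c \<sigma>\<^sub>r s (fst z) (snd z) k) \<in> borel_measurable (block_space M n \<Otimes>\<^sub>M block_space M n)"
proof -
  have f1: "(\<lambda>z. fst z l i) \<in> borel_measurable (block_space M n \<Otimes>\<^sub>M block_space M n)"
    and f2: "(\<lambda>z. snd z l i) \<in> borel_measurable (block_space M n \<Otimes>\<^sub>M block_space M n)"
    if "l \<in> {1..n}" "i < M" for l i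
    by (rule measurable_compose[OF measurable_fst measurable_block_component[OF that]],
        rule measurable_compose[OF measurable_snd measurable_block_component[OF that]])
  show ?thesis
    unfolding block_score_def using assms
    by (intro borel_measurable_sum measurable_symbol_score f1 f2) auto
qed

text \<open>A block score reads two consecutive blocks, so by stationarity the second block of a
  two-block channel represents every later block.\<close>

lemma block_score_window:
  assumes "k + 2 \<le> n"
  shows "block_score M \<sigma>\<^sub>c \<sigma>\<^sub>r s (window M k 2 x) (window M k 2 y) 2 = block_score M \<sigma>\<^sub>c \<sigma>\<^sub>r s x y (k + 2)"
  unfolding block_score_def
  by (intro sum.cong refl symbol_score_cong) (auto simp: window_def)

text \<open>Given the previous block, the exponentiated score of a block has mean at most 1 over
  that block; the chain of blocks is then integrated from the last one backwards.\<close>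

lemma nn_integral_total_score_le:
  assumes s: "s > 0" and \<sigma>: "\<sigma>\<^sub>c > 0" "\<sigma>\<^sub>r > 0"
  shows "(\<integral>\<^sup>+x. ennreal (exp (\<Sum>k=2..n. block_score M \<sigma>\<^sub>c \<sigma>\<^sub>r s x y k)) \<partial>comb_input M n s) \<le> 1"
proof -
  let ?sc = "\<lambda>\<xi> k m. of_real s * \<xi> k m :: complex"
  \<comment> \<open>Block 1 has no predecessor to compare phases with and receives the trivial
    factor 1.\<close>
  let ?H = "\<lambda>k \<xi>. if k \<ge> 2 then ennreal (exp (block_score M \<sigma>\<^sub>c \<sigma>\<^sub>r s (?sc \<xi>) y k)) else 1"
  have m: "(\<lambda>x. \<Sum>k=2..n. block_score M \<sigma>\<^sub>c \<sigma>\<^sub>r s x y k) \<in> borel_measurable (block_space M n)"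
    unfolding block_score_def
    by (intro borel_measurable_sum measurable_symbol_score) (auto intro!: measurable_block_component)
  have "(\<integral>\<^sup>+x. ennreal (exp (\<Sum>k=2..n. block_score M \<sigma>\<^sub>c \<sigma>\<^sub>r s x y k)) \<partial>comb_input M n s) =
      (\<integral>\<^sup>+\<xi>. ennreal (exp (\<Sum>k=2..n. block_score M \<sigma>\<^sub>c \<sigma>\<^sub>r s (scale_blocks M n s \<xi>) y k)) \<partial>blocks_law M n)"
    unfolding comb_input_def using m by (subst nn_integral_distr) auto
  also have "\<dots> = (\<integral>\<^sup>+\<xi>. (\<Prod>k\<in>{1..<Suc n}. ?H k \<xi>) \<partial>Pi\<^sub>M {1..<Suc n} (\<lambda>_. block_law M))"
    unfolding blocks_law_def atLeastLessThanSuc_atLeastAtMost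
  proof (intro nn_integral_cong)
    fix \<xi> :: "nat \<Rightarrow> nat \<Rightarrow> complex"
    have "(\<Prod>k\<in>{1..n}. ?H k \<xi>) = (\<Prod>k\<in>{2..n}. ?H k \<xi>)"
      by (intro prod.mono_neutral_right) auto
    also have "\<dots> = (\<Prod>k\<in>{2..n}. ennreal (exp (block_score M \<sigma>\<^sub>c \<sigma>\<^sub>r s (?sc \<xi>) y k)))"
      by (intro prod.cong) auto
    also have "\<dots> = ennreal (exp (\<Sum>k=2..n. block_score M \<sigma>\<^sub>c \<sigma>\<^sub>r s (?sc \<xi>) y k))"
      by (simp add: prod_ennreal exp_sum)
    also have "(\<Sum>k=2..n. block_score M \<sigma>\<^sub>c \<sigma>\<^sub>r s (?sc \<xi>) y k) = (\<Sum>k=2..n. block_score M \<sigma>\<^sub>c \<sigma>\<^sub>r s (scale_blocks M n s \<xi>) y k)"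
      unfolding block_score_def by (intro sum.cong refl symbol_score_cong) (auto simp: scale_blocks_def)
    finally show "ennreal (exp (\<Sum>k=2..n. block_score M \<sigma>\<^sub>c \<sigma>\<^sub>r s (scale_blocks M n s \<xi>) y k)) = (\<Prod>k\<in>{1..n}. ?H k \<xi>)" ..
  qed
  also have "\<dots> \<le> 1"
  proof (rule nn_integral_PiM_sequential_le_1[OF prob_space_block_law])
    fix i j :: nat assume ij: "1 \<le> i" "i < j"
    have comp: "(\<lambda>\<xi>. \<xi> l m) \<in> borel_measurable (Pi\<^sub>M {1..<j} (\<lambda>_. block_law M))" if "l \<in> {1..i}" "m < M" for l m
    proof -
      have "(\<lambda>\<xi>. \<xi> l) \<in> measurable (Pi\<^sub>M {1..<j} (\<lambda>_. block_law M)) (block_law M)"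
        using that ij by (intro measurable_component_singleton) auto
      moreover have "(\<lambda>x. x m) \<in> borel_measurable (block_law M)"
        using that measurable_component_singleton[of m "{..<M}" "\<lambda>_. borel"] by (simp cong: measurable_cong_sets)
      ultimately show ?thesis by (rule measurable_compose)
    qed
    show "?H i \<in> borel_measurable (Pi\<^sub>M {1..<j} (\<lambda>_. block_law M))"
    proof (cases "i \<ge> 2")
      case True
      then have "(\<lambda>\<xi>. block_score M \<sigma>\<^sub>c \<sigma>\<^sub>r s (?sc \<xi>) y i) \<in> borel_measurable (Pi\<^sub>M {1..<j} (\<lambda>_. block_law M))"
        unfolding block_score_def
        by (intro borel_measurable_sum measurable_symbol_score borel_measurable_times comp borel_measurable_const) auto
      then show ?thesis
        by measurable
    qed simp
  next
    fix i j :: nat and \<xi> :: "nat \<Rightarrow> nat \<Rightarrow> complex" and t assume "i < j"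
    then show "?H i (\<xi>(j := t)) = ?H i \<xi>"
      by (simp add: block_score_def)
  next
    fix i :: nat and \<xi> :: "nat \<Rightarrow> nat \<Rightarrow> complex" assume i: "1 \<le> i"
    show "(\<integral>\<^sup>+t. ?H i (\<xi>(i := t)) \<partial>block_law M) \<le> 1"
    proof (cases "i \<ge> 2")
      case True
      then have "i - 1 \<noteq> i" by simp
      then show ?thesis
        using True nn_integral_block_score_le[OF s \<sigma>, of M "?sc \<xi> (i - 1)" "y (i - 1)" "y i"]
        by (simp add: block_score_def)
    next
      case False
      then show ?thesis
        using prob_space.emeasure_space_1[OF prob_space_block_law] by simp
    qed
  qed simp
  finally show ?thesis .
qed

text \<open>The information of \<open>n\<close> blocks is at least \<open>n - 1\<close> times the
  expected score of one block. At fixed \<open>s\<close> the loss of the first block, which only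
  provides a phase reference, disappears as \<open>n\<close> grows.\<close>

lemma comb_capacity_ge_block_score:
  assumes M: "M \<ge> 2" and s: "s > 0" and \<sigma>: "\<sigma>\<^sub>c > 0" "\<sigma>\<^sub>r > 0" and \<rho>: "s\<^sup>2 * (real M - 1) \<le> \<rho>"
    and int: "integrable (comb_input M 2 s \<Otimes>\<^sub>M noise_space M \<sigma>\<^sub>c \<sigma>\<^sub>r)
      (\<lambda>(x, \<omega>). block_score M \<sigma>\<^sub>c \<sigma>\<^sub>r s x (comb_output M 2 x \<omega>) 2)"
  shows "ereal ((\<integral>(x, \<omega>). block_score M \<sigma>\<^sub>c \<sigma>\<^sub>r s x (comb_output M 2 x \<omega>) 2
      \<partial>(comb_input M 2 s \<Otimes>\<^sub>M noise_space M \<sigma>\<^sub>c \<sigma>\<^sub>r)) / ln 2) \<le> comb_capacity M \<sigma>\<^sub>c \<sigma>\<^sub>r \<rho>"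
proof -
  let ?N = "noise_space M \<sigma>\<^sub>c \<sigma>\<^sub>r"
  define J where "J = (\<integral>(x, \<omega>). block_score M \<sigma>\<^sub>c \<sigma>\<^sub>r s x (comb_output M 2 x \<omega>) 2 \<partial>(comb_input M 2 s \<Otimes>\<^sub>M ?N))"
  have \<rho>0: "\<rho> > 0"
    using M s less_le_trans[OF _ \<rho>, of 0] by simp
  have le: "ereal (real (n - 1) / real n * (J / ln 2)) \<le> comb_capacity M \<sigma>\<^sub>c \<sigma>\<^sub>r \<rho>" if n: "n \<ge> 2" for n
  proof -
    let ?\<mu> = "comb_input M n s"
    have \<mu>: "?\<mu> \<in> input_laws M n \<rho>"
      by (rule comb_input_in_input_laws[OF M \<rho>])
    interpret dominated_channel ?\<mu> ?N "block_noise M n" "comb_output M n" "block_energy M n"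
      using M n by (intro dominated_channel_comb[OF _ _ \<sigma> \<mu>]) auto
    let ?f = "\<lambda>z. \<Sum>k=2..n. block_score M \<sigma>\<^sub>c \<sigma>\<^sub>r s (fst z) (snd z) k"
    have fm: "?f \<in> borel_measurable (?\<mu> \<Otimes>\<^sub>M block_noise M n)"
      using measurable_block_score[of _ n M \<sigma>\<^sub>c \<sigma>\<^sub>r s] by (intro borel_measurable_sum) (simp cong: measurable_cong_sets)
    have bm: "(\<lambda>z. block_score M \<sigma>\<^sub>c \<sigma>\<^sub>r s (fst z) (snd z) 2) \<in> borel_measurable (block_space M 2 \<Otimes>\<^sub>M block_space M 2)"
      by (rule measurable_block_score) auto
    have k: "integrable (?\<mu> \<Otimes>\<^sub>M ?N) (\<lambda>z. block_score M \<sigma>\<^sub>c \<sigma>\<^sub>r s (fst z) (comb_output M n (fst z) (snd z)) k) \<and>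
        (\<integral>z. block_score M \<sigma>\<^sub>c \<sigma>\<^sub>r s (fst z) (comb_output M n (fst z) (snd z)) k \<partial>(?\<mu> \<Otimes>\<^sub>M ?N)) = J"
      if k: "k \<in> {2..n}" for k
    proof -
      have k2: "(k - 2) + 2 \<le> n" "k - 2 + 2 = k" using k by auto
      note tr = window_channel_transfer[OF \<sigma> k2(1) prob_space_comb_input sets_comb_input prob_space_comb_input
          sets_comb_input distr_comb_input_window[OF k2(1)] bm]
      show ?thesis
        using tr(2,3) int unfolding J_def split_beta' fst_conv snd_conv block_score_window[OF k2(1)] k2(2) by simp
    qed
    have i: "integrable (?\<mu> \<Otimes>\<^sub>M ?N) (\<lambda>(x, \<omega>). ln (exp (?f (x, comb_output M n x \<omega>))))"
      using k by (auto simp: split_beta' intro!: Bochner_Integration.integrable_sum)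
    have "(\<integral>(x, \<omega>). log 2 (exp (?f (x, comb_output M n x \<omega>))) \<partial>(?\<mu> \<Otimes>\<^sub>M ?N)) \<le> comb_MI M \<sigma>\<^sub>c \<sigma>\<^sub>r n ?\<mu>"
      unfolding comb_MI_def
    proof (rule information_ge[where F="\<lambda>z. exp (?f z)"])
      show "(\<lambda>z. exp (?f z)) \<in> borel_measurable (?\<mu> \<Otimes>\<^sub>M block_noise M n)"
        using measurable_compose[OF fm, of exp borel] by simp
      show "(\<integral>\<^sup>+x. ennreal (exp (?f (x, y))) \<partial>?\<mu>) \<le> 1" for y
        using nn_integral_total_score_le[OF s \<sigma>] by simp
    qed (use i in \<open>auto simp: split_beta'\<close>)
    also have "(\<integral>(x, \<omega>). log 2 (exp (?f (x, comb_output M n x \<omega>))) \<partial>(?\<mu> \<Otimes>\<^sub>M ?N)) = real (n - 1) * J / ln 2"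
      using k n by (simp add: split_beta' log_def)
    finally have "real (n - 1) * J / ln 2 / real n \<le> comb_MI M \<sigma>\<^sub>c \<sigma>\<^sub>r n ?\<mu> / real n"
      by (rule divide_right_mono) simp
    then have "ereal (real (n - 1) / real n * (J / ln 2)) \<le> ereal (comb_MI M \<sigma>\<^sub>c \<sigma>\<^sub>r n ?\<mu> / real n)"
      by (simp add: mult.commute)
    also have "\<dots> \<le> comb_capacity M \<sigma>\<^sub>c \<sigma>\<^sub>r \<rho>"
      using M n by (intro comb_capacity_ge \<sigma> \<rho>0 \<mu>) auto
    finally show ?thesis .
  qed
  have "(\<lambda>n. 1 - 1 / real n) \<longlonglongrightarrow> 1 - 0"
    by (intro tendsto_diff tendsto_const lim_const_over_n)
  then have "(\<lambda>n. (1 - 1 / real n) * (J / ln 2)) \<longlonglongrightarrow> 1 * (J / ln 2)"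
    by (intro tendsto_mult tendsto_const) simp
  then have lim: "(\<lambda>n. ereal ((1 - 1 / real n) * (J / ln 2))) \<longlonglongrightarrow> ereal (J / ln 2)"
    by simp
  have bd: "ereal ((1 - 1 / real n) * (J / ln 2)) \<le> comb_capacity M \<sigma>\<^sub>c \<sigma>\<^sub>r \<rho>" if "n \<ge> 2" for n
    using le[OF that] that by (simp add: of_nat_diff field_simps)
  show ?thesis
    unfolding J_def[symmetric] using bd by (intro LIMSEQ_le_const2[OF lim] exI[of _ 2]) blast
qed

section \<open>High-power limits of the scores\<close>

lemma tendsto_of_real_inverse_at_top:
  "((\<lambda>s::real. b / of_real s) \<longlongrightarrow> (0::complex)) at_top"
proof -
  have "((\<lambda>s::real. b * of_real (inverse s)) \<longlongrightarrow> b * of_real 0) at_top"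
    by (intro tendsto_intros tendsto_inverse_0_at_top filterlim_ident)
  then show ?thesis by (simp add: divide_inverse of_real_inverse)
qed

text \<open>To first order the modulus responds only to the radial component of the perturbation;
  the difference is rationalised to a quotient of squared moduli.\<close>

lemma tendsto_cmod_diff_at_top:
  fixes a w :: complex
  assumes "a \<noteq> 0"
  shows "((\<lambda>s. cmod (of_real s * a + w) - s * cmod a) \<longlongrightarrow> Re (cnj (sgn a) * w)) at_top"
proof -
  have l: "((\<lambda>s. (2 * Re (cnj a * w) + (cmod w)\<^sup>2 * inverse s) / (cmod (a + w / of_real s) + cmod a))
      \<longlongrightarrow> (2 * Re (cnj a * w) + (cmod w)\<^sup>2 * 0) / (cmod (a + 0) + cmod a)) at_top"
    using assms by (intro tendsto_intros tendsto_inverse_0_at_top filterlim_ident tendsto_of_real_inverse_at_top) auto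
  have "\<forall>\<^sub>F s in at_top. (2 * Re (cnj a * w) + (cmod w)\<^sup>2 * inverse s) / (cmod (a + w / of_real s) + cmod a) =
      cmod (of_real s * a + w) - s * cmod a"
    using eventually_gt_at_top[of 0]
  proof eventually_elim
    case (elim s)
    have n: "cmod (of_real s * a + w) = s * cmod (a + w / of_real s)"
    proof -
      have "of_real s * a + w = of_real s * (a + w / of_real s)"
        using elim by (simp add: distrib_left)
      then show ?thesis using elim by (simp add: norm_mult)
    qed
    define p where "p = cmod (a + w / of_real s)"
    have pos: "p + cmod a > 0"
      using assms by (simp add: p_def add_nonneg_pos)
    have "(cmod (of_real s * a + w))\<^sup>2 = s\<^sup>2 * (cmod a)\<^sup>2 + 2 * s * Re (cnj a * w) + (cmod w)\<^sup>2"
      unfolding cmod_power2 by (simp add: power2_eq_square algebra_simps)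
    then have "s * (s * p\<^sup>2) = s * (s * (cmod a)\<^sup>2 + 2 * Re (cnj a * w) + (cmod w)\<^sup>2 * inverse s)"
      using elim unfolding n p_def[symmetric] by (simp add: power2_eq_square algebra_simps)
    then have "s * p\<^sup>2 - s * (cmod a)\<^sup>2 = 2 * Re (cnj a * w) + (cmod w)\<^sup>2 * inverse s"
      using elim by simp
    also have "s * p\<^sup>2 - s * (cmod a)\<^sup>2 = (s * p - s * cmod a) * (p + cmod a)"
      by (simp add: power2_eq_square algebra_simps)
    finally show ?case
      unfolding n p_def[symmetric] using pos by (simp add: eq_divide_eq[symmetric] divide_eq_eq)
  qed
  from Lim_transform_eventually[OF l this] have
    "((\<lambda>s. cmod (of_real s * a + w) - s * cmod a) \<longlongrightarrow> 2 * Re (cnj a * w) / (2 * cmod a)) at_top"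
    by simp
  moreover have "2 * Re (cnj a * w) / (2 * cmod a) = Re (cnj (sgn a) * w)"
  proof -
    have "cnj (sgn a) * w = inverse (cmod a) *\<^sub>R (cnj a * w)"
      by (simp add: sgn_div_norm scaleR_conv_of_real)
    then have "Re (cnj (sgn a) * w) = inverse (cmod a) * Re (cnj a * w)"
      by (simp only: scaleR_complex.sel)
    then show ?thesis by (simp only: divide_inverse) simp
  qed
  ultimately show ?thesis by simp
qed

text \<open>The derivative of \<open>Ln\<close> at 1, taken along the direction
  \<open>b / of_real s\<close>. The imaginary part is the tangential component of the
  perturbation.\<close>

lemma tendsto_Arg_one_plus_at_top:
  "((\<lambda>s. s * Arg (1 + b / of_real s)) \<longlongrightarrow> Im b) at_top"
proof (cases "b = 0")
  case False
  have "((\<lambda>h. (Ln (1 + h) - Ln 1) / h) \<longlongrightarrow> inverse 1) (at 0)"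
    using has_field_derivative_Ln[of 1] by (simp add: DERIV_def)
  moreover have "filterlim (\<lambda>s::real. b / of_real s) (at 0) at_top"
    unfolding filterlim_at using tendsto_of_real_inverse_at_top[of b] False
    by (auto intro: eventually_mono[OF eventually_gt_at_top[of 0]])
  ultimately have "((\<lambda>s::real. (Ln (1 + b / of_real s) - Ln 1) / (b / of_real s)) \<longlongrightarrow> inverse 1) at_top"
    by (rule filterlim_compose)
  then have l: "((\<lambda>s::real. Im (b * ((Ln (1 + b / of_real s) - Ln 1) / (b / of_real s)))) \<longlongrightarrow> Im (b * inverse 1)) at_top"
    by (intro tendsto_intros)
  have "((\<lambda>s::real. 1 + b / of_real s) \<longlongrightarrow> 1 + 0) at_top"
    by (intro tendsto_intros tendsto_of_real_inverse_at_top)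
  then have "\<forall>\<^sub>F s in at_top. 1 + b / of_real s \<noteq> 0"
    by (rule tendsto_imp_eventually_ne) simp
  then have "\<forall>\<^sub>F s in at_top. Im (b * ((Ln (1 + b / of_real s) - Ln 1) / (b / of_real s))) = s * Arg (1 + b / of_real s)"
    using eventually_gt_at_top[of 0]
  proof eventually_elim
    case (elim s)
    then have "b * ((Ln (1 + b / of_real s) - Ln 1) / (b / of_real s)) = of_real s * Ln (1 + b / of_real s)"
      using False by simp
    then show ?case
      using elim by (simp add: Arg_eq_Im_Ln)
  qed
  from Lim_transform_eventually[OF l this] show ?thesis by simp
qed simp

text \<open>The remainder of the linearisation is at most half the square of \<open>T s\<close>,
  which stays negligible after multiplication by \<open>s\<close>.\<close>

lemma tendsto_cis_minus_one_at_top: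
  assumes T: "((\<lambda>s. s * T s) \<longlongrightarrow> \<tau>) at_top"
  shows "((\<lambda>s. of_real s * (cis (T s) - 1)) \<longlongrightarrow> \<i> * of_real \<tau>) at_top"
proof -
  have bound: "cmod (cis t - 1 - \<i> * of_real t) \<le> t\<^sup>2 / 2" for t
    using iexp_approx1[of t 1] by (simp add: cis_conv_exp numeral_2_eq_2 diff_diff_eq)
  have "((\<lambda>s. of_real s * (cis (T s) - 1) - \<i> * of_real (s * T s)) \<longlongrightarrow> 0) at_top"
  proof (rule Lim_null_comparison)
    have "((\<lambda>s. (s * T s)\<^sup>2 * inverse s / 2) \<longlongrightarrow> \<tau>\<^sup>2 * 0 / 2) at_top"
      by (intro tendsto_intros T tendsto_inverse_0_at_top filterlim_ident) auto
    then show "((\<lambda>s. (s * T s)\<^sup>2 * inverse s / 2) \<longlongrightarrow> 0) at_top" by simp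
    show "\<forall>\<^sub>F s in at_top. norm (of_real s * (cis (T s) - 1) - \<i> * of_real (s * T s)) \<le> (s * T s)\<^sup>2 * inverse s / 2"
      using eventually_gt_at_top[of 0]
    proof eventually_elim
      case (elim s)
      have "of_real s * (cis (T s) - 1) - \<i> * of_real (s * T s) = of_real s * (cis (T s) - 1 - \<i> * of_real (T s))"
        by (simp add: algebra_simps)
      then have "norm (of_real s * (cis (T s) - 1) - \<i> * of_real (s * T s)) = s * cmod (cis (T s) - 1 - \<i> * of_real (T s))"
        using elim by (simp add: norm_mult)
      also have "\<dots> \<le> s * ((T s)\<^sup>2 / 2)"
        using elim bound by (intro mult_left_mono) auto
      also have "\<dots> = (s * T s)\<^sup>2 * inverse s / 2"
        using elim by (simp add: power2_eq_square)
      finally show ?case .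
    qed
  qed
  moreover have "((\<lambda>s. \<i> * of_real (s * T s)) \<longlongrightarrow> \<i> * of_real \<tau>) at_top"
    by (intro tendsto_intros T)
  ultimately have "((\<lambda>s. (of_real s * (cis (T s) - 1) - \<i> * of_real (s * T s)) + \<i> * of_real (s * T s)) \<longlongrightarrow> 0 + \<i> * of_real \<tau>) at_top"
    by (rule tendsto_add)
  then show ?thesis by simp
qed

section \<open>Errors of the observed phases\<close>

definition received :: "(nat \<Rightarrow> real) \<Rightarrow> (nat \<Rightarrow> complex) \<Rightarrow> (nat \<Rightarrow> complex) \<Rightarrow> real \<Rightarrow> nat \<Rightarrow> complex" where
  "received \<theta> \<xi> w s i = cis (\<theta> i) * (of_real s * \<xi> i) + w i"

definition sent :: "(nat \<Rightarrow> complex) \<Rightarrow> real \<Rightarrow> nat \<Rightarrow> complex" where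
  "sent \<xi> s i = of_real s * \<xi> i"

text \<open>The exact angular deviation at finite \<open>s\<close>, obtained by factoring the
  rotated input out of the received symbol.\<close>

definition phase_error :: "(nat \<Rightarrow> real) \<Rightarrow> (nat \<Rightarrow> complex) \<Rightarrow> (nat \<Rightarrow> complex) \<Rightarrow> real \<Rightarrow> nat \<Rightarrow> real" where
  "phase_error \<theta> \<xi> w s i = Arg (1 + (cis (- \<theta> i) * w i / \<xi> i) / of_real s)"

text \<open>Holds only from some \<open>s\<close> on, since the remaining factor
  \<open>1 + b / of_real s\<close> may vanish for an exceptional \<open>s\<close>, and
  \<open>Arg 0\<close> carries no information.\<close>

lemma eventually_cis_obs_phase:
  assumes "\<xi> i \<noteq> 0"
  shows "\<forall>\<^sub>F s in at_top. cis (obs_phase (sent \<xi> s) (received \<theta> \<xi> w s) i) = cis (\<theta> i + phase_error \<theta> \<xi> w s i)"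
proof -
  let ?b = "cis (- \<theta> i) * w i / \<xi> i"
  have "((\<lambda>s::real. 1 + ?b / of_real s) \<longlongrightarrow> 1 + 0) at_top"
    by (intro tendsto_intros tendsto_of_real_inverse_at_top)
  then have "\<forall>\<^sub>F s in at_top. 1 + ?b / of_real s \<noteq> 0"
    by (rule tendsto_imp_eventually_ne) simp
  then show ?thesis
    using eventually_gt_at_top[of 0]
  proof eventually_elim
    case (elim s)
    have c: "cis (\<theta> i) * cis (- \<theta> i) = 1"
      by (simp add: cis_mult)
    have "received \<theta> \<xi> w s i = cis (\<theta> i) * (of_real s * \<xi> i) + (cis (\<theta> i) * cis (- \<theta> i)) * w i"
      unfolding received_def c by simp
    also have "\<dots> = cis (\<theta> i) * sent \<xi> s i * (1 + ?b / of_real s)"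
      using assms elim by (simp add: sent_def field_simps)
    finally have r: "received \<theta> \<xi> w s i = cis (\<theta> i) * sent \<xi> s i * (1 + ?b / of_real s)" .
    have nz: "sent \<xi> s i \<noteq> 0" "received \<theta> \<xi> w s i \<noteq> 0"
      unfolding r using assms elim by (auto simp: sent_def)
    have "cis (obs_phase (sent \<xi> s) (received \<theta> \<xi> w s) i) = sgn (received \<theta> \<xi> w s i) / sgn (sent \<xi> s i)"
      using nz by (simp add: obs_phase_def cis_divide[symmetric] cis_Arg_eq)
    also have "sgn (received \<theta> \<xi> w s i) = cis (\<theta> i) * sgn (sent \<xi> s i) * sgn (1 + ?b / of_real s)"
      unfolding r sgn_mult by (simp add: sgn_div_norm)
    also have "cis (\<theta> i) * sgn (sent \<xi> s i) * sgn (1 + ?b / of_real s) / sgn (sent \<xi> s i) = cis (\<theta> i) * cis (phase_error \<theta> \<xi> w s i)"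
      using nz elim by (simp add: phase_error_def cis_Arg_eq sgn_zero_iff)
    finally show ?case by (simp add: cis_mult)
  qed
qed

lemma tendsto_phase_error:
  "((\<lambda>s. s * phase_error \<theta> \<xi> w s i) \<longlongrightarrow> Im (cis (- \<theta> i) * w i / \<xi> i)) at_top"
  unfolding phase_error_def by (rule tendsto_Arg_one_plus_at_top)

lemma tendsto_phase_error_0: "((\<lambda>s. phase_error \<theta> \<xi> w s i) \<longlongrightarrow> 0) at_top"
proof -
  have l: "((\<lambda>s. (s * phase_error \<theta> \<xi> w s i) * inverse s) \<longlongrightarrow> Im (cis (- \<theta> i) * w i / \<xi> i) * 0) at_top"
    by (intro tendsto_intros tendsto_phase_error tendsto_inverse_0_at_top filterlim_ident)
  show ?thesis
    by (rule Lim_transform_eventually[OF l[simplified mult_zero_right]])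
      (auto intro: eventually_mono[OF eventually_gt_at_top[of 0]])
qed

text \<open>Valid for perturbations of any size, unlike the linearisation; domination requires an
  estimate for every \<open>s \<ge> 1\<close>.\<close>

lemma norm_sgn_diff_le:
  fixes v w :: complex
  assumes "v \<noteq> 0" "v + w \<noteq> 0"
  shows "cmod (sgn (v + w) - sgn v) \<le> 2 * cmod w / cmod v"
proof -
  let ?y = "v + w"
  have "sgn ?y - sgn v = w /\<^sub>R cmod v + ?y /\<^sub>R cmod ?y - ?y /\<^sub>R cmod v"
    by (simp add: sgn_div_norm scaleR_add_right)
  also have "\<dots> = w /\<^sub>R cmod v + (inverse (cmod ?y) - inverse (cmod v)) *\<^sub>R ?y"
    by (simp only: scaleR_diff_left) simp
  also have "inverse (cmod ?y) - inverse (cmod v) = (cmod v - cmod ?y) / (cmod ?y * cmod v)"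
    using assms by (simp add: inverse_diff_inverse divide_inverse algebra_simps)
  finally have "cmod (sgn ?y - sgn v) \<le> cmod (w /\<^sub>R cmod v) + cmod (((cmod v - cmod ?y) / (cmod ?y * cmod v)) *\<^sub>R ?y)"
    by (metis norm_triangle_ineq)
  also have "\<dots> = cmod w / cmod v + \<bar>cmod v - cmod ?y\<bar> / cmod v"
    using assms by (simp add: divide_inverse abs_mult)
  also have "\<bar>cmod v - cmod ?y\<bar> \<le> cmod w"
    using norm_triangle_ineq3[of v ?y] by simp
  finally show ?thesis
    using assms by (simp add: divide_right_mono add_divide_distrib[symmetric])
qed

lemma cis_obs_phase_diff_le:
  assumes "\<xi> i \<noteq> 0" "s > 0"
  shows "cmod (cis (obs_phase (sent \<xi> s) (received \<theta> \<xi> w s) i) - cis (\<theta> i)) \<le> 2 * cmod (w i) / (s * cmod (\<xi> i))"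
\<comment> \<open>If the received symbol vanishes, the noise cancels the input exactly and the
  claimed bound equals 2, the diameter of the unit circle.\<close>
proof (cases "received \<theta> \<xi> w s i = 0")
  case True
  then have "cmod (w i) = cmod (cis (\<theta> i) * (of_real s * \<xi> i))"
    by (metis add_eq_0_iff received_def norm_minus_cancel)
  then have "2 * cmod (w i) / (s * cmod (\<xi> i)) = 2"
    using assms by (simp add: norm_mult)
  then show ?thesis
    using norm_triangle_ineq4[of "cis (obs_phase (sent \<xi> s) (received \<theta> \<xi> w s) i)" "cis (\<theta> i)"] by simp
next
  case False
  let ?v = "cis (\<theta> i) * sent \<xi> s i"
  have v: "?v \<noteq> 0" and sz: "sent \<xi> s i \<noteq> 0" and vw: "received \<theta> \<xi> w s i = ?v + w i"
    using assms by (auto simp: sent_def received_def)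
  have "cis (obs_phase (sent \<xi> s) (received \<theta> \<xi> w s) i) - cis (\<theta> i) =
      (sgn (?v + w i) - sgn ?v) / sgn (sent \<xi> s i)"
    using sz False
    by (simp add: obs_phase_def cis_divide[symmetric] cis_Arg_eq vw sgn_mult diff_divide_distrib sgn_zero_iff)
  then have "cmod (cis (obs_phase (sent \<xi> s) (received \<theta> \<xi> w s) i) - cis (\<theta> i)) = cmod (sgn (?v + w i) - sgn ?v)"
    using sz by (simp add: norm_divide norm_sgn)
  also have "\<dots> \<le> 2 * cmod (w i) / cmod ?v"
    using v False by (intro norm_sgn_diff_le) (auto simp: vw)
  also have "cmod ?v = s * cmod (\<xi> i)"
    using assms by (simp add: norm_mult sent_def)
  finally show ?thesis .
qed

text \<open>Integer coefficients are essential: a summand may change by any multiple of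
  \<open>2 * pi\<close>, and only integer multiples of the period are invisible to
  \<open>cis\<close>.\<close>

lemma cis_sum_cong:
  assumes "\<And>i. i \<in> I \<Longrightarrow> cis (a i) = cis (b i)"
  shows "cis (\<Sum>i\<in>I. of_int (c i) * a i) = cis (\<Sum>i\<in>I. of_int (c i) * b i)"
proof (cases "finite I")
  case True
  then show ?thesis
    using assms
  proof (induction I)
    case (insert i I)
    have "cis (a i) = cis (b i)" using insert.prems by simp
    then obtain n where "b i = a i + of_int n * (2 * pi)"
      unfolding cis_eq_iff rcong_altdef by auto
    then have "of_int (c i) * b i = of_int (c i) * a i + of_int (c i * n) * (2 * pi)"
      by (simp add: algebra_simps)
    then have "cis (of_int (c i) * a i) = cis (of_int (c i) * b i)"
      unfolding cis_eq_iff rcong_altdef by blast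
    then show ?case
      using insert by (simp add: cis_mult[symmetric])
  qed simp
qed simp

lemma norm_cis_combination_le: "cmod (cis \<alpha> * p + cis \<beta> * q) \<le> cmod p + cmod q"
  using norm_triangle_ineq[of "cis \<alpha> * p" "cis \<beta> * q"] by (simp add: norm_mult)

text \<open>Telescoping a power of a unit complex number costs one copy of the basic difference per
  factor; negative exponents reduce to positive ones by conjugation.\<close>

lemma cis_int_mult_diff_le: "cmod (cis (of_int c * a) - cis (of_int c * b)) \<le> \<bar>of_int c\<bar> * cmod (cis a - cis b)"
proof -
  have nat: "cmod (cis (real n * a) - cis (real n * b)) \<le> real n * cmod (cis a - cis b)" for n a b
  proof (induction n)
    case (Suc n)
    have eq: "cis (real (Suc n) * a) - cis (real (Suc n) * b) =
        cis a * (cis (real n * a) - cis (real n * b)) + cis (real n * b) * (cis a - cis b)"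
      by (simp add: cis_mult algebra_simps)
    have "cmod (cis (real (Suc n) * a) - cis (real (Suc n) * b)) \<le>
        cmod (cis (real n * a) - cis (real n * b)) + cmod (cis a - cis b)"
      unfolding eq by (rule norm_cis_combination_le)
    then show ?case using Suc by (simp add: algebra_simps)
  qed simp
  show ?thesis
  proof (cases "c \<ge> 0")
    case True
    then show ?thesis using nat[of "nat c" a b] by simp
  next
    case False
    have "cis (- a) - cis (- b) = cnj (cis a - cis b)"
      by (simp add: cis_cnj)
    then have "cmod (cis (- a) - cis (- b)) = cmod (cis a - cis b)"
      by (metis complex_mod_cnj)
    then show ?thesis using nat[of "nat (- c)" "- a" "- b"] False by simp
  qed
qed

lemma cis_sum_diff_le:
  "cmod (cis (\<Sum>i\<in>I. of_int (c i) * a i) - cis (\<Sum>i\<in>I. of_int (c i) * b i)) \<le>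
    (\<Sum>i\<in>I. \<bar>of_int (c i)\<bar> * cmod (cis (a i) - cis (b i)))"
proof (cases "finite I")
  case True
  then show ?thesis
  proof (induction I)
    case (insert i I)
    let ?A = "\<Sum>i\<in>I. of_int (c i) * a i" and ?B = "\<Sum>i\<in>I. of_int (c i) * b i"
    have eq: "cis (of_int (c i) * a i + ?A) - cis (of_int (c i) * b i + ?B) =
        cis ?A * (cis (of_int (c i) * a i) - cis (of_int (c i) * b i)) + cis (of_int (c i) * b i) * (cis ?A - cis ?B)"
      by (simp add: cis_mult algebra_simps)
    have "cmod (cis (of_int (c i) * a i + ?A) - cis (of_int (c i) * b i + ?B)) \<le>
        cmod (cis (of_int (c i) * a i) - cis (of_int (c i) * b i)) + cmod (cis ?A - cis ?B)"
      unfolding eq by (rule norm_cis_combination_le)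
    also have "\<dots> \<le> \<bar>of_int (c i)\<bar> * cmod (cis (a i) - cis (b i)) + (\<Sum>i\<in>I. \<bar>of_int (c i)\<bar> * cmod (cis (a i) - cis (b i)))"
      by (intro add_mono cis_int_mult_diff_le insert.IH)
    finally show ?case
      using insert.hyps by simp
  qed simp
qed simp

text \<open>After subtracting \<open>ln s\<close> the score is a continuous function of
  \<open>inverse s\<close> and of the deviation of the received modulus from
  \<open>s * cmod (\<xi> i)\<close>, which tends to the radial noise.\<close>

lemma tendsto_amp_score:
  assumes "\<xi> i \<noteq> 0"
  shows "((\<lambda>s. amp_score s (cmod (sent \<xi> s i)) (cmod (received \<theta> \<xi> w s i)) - ln s) \<longlongrightarrow>
    - ln 2 + (cmod (\<xi> i))\<^sup>2 - (Re (cnj (sgn (cis (\<theta> i) * \<xi> i)) * w i))\<^sup>2) at_top"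
proof -
  let ?a = "cis (\<theta> i) * \<xi> i"
  let ?r = "\<lambda>s. cmod (received \<theta> \<xi> w s i)"
  have r: "?r s = cmod (of_real s * ?a + w i)" for s
    by (simp add: received_def mult_ac)
  have n: "cmod ?a = cmod (\<xi> i)" by (simp add: norm_mult)
  have l1: "((\<lambda>s. ?r s - s * cmod (\<xi> i)) \<longlongrightarrow> Re (cnj (sgn ?a) * w i)) at_top"
    using tendsto_cmod_diff_at_top[of ?a "w i"] assms unfolding r n by simp
  have l2: "((\<lambda>s. (?r s - s * cmod (\<xi> i)) * inverse s + cmod (\<xi> i)) \<longlongrightarrow> Re (cnj (sgn ?a) * w i) * 0 + cmod (\<xi> i)) at_top"
    by (intro tendsto_intros l1 tendsto_inverse_0_at_top filterlim_ident)
  have l3: "((\<lambda>s::real. 1 + (inverse s)\<^sup>2) \<longlongrightarrow> 1 + 0\<^sup>2) at_top"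
    by (intro tendsto_intros tendsto_inverse_0_at_top filterlim_ident)
  have l4: "((\<lambda>s. ln (1 + (inverse s)\<^sup>2) / 2 - ln 2 + ((?r s - s * cmod (\<xi> i)) * inverse s + cmod (\<xi> i))\<^sup>2 / (1 + (inverse s)\<^sup>2)
      - (?r s - s * cmod (\<xi> i))\<^sup>2) \<longlongrightarrow>
      ln (1 + 0\<^sup>2) / 2 - ln 2 + (Re (cnj (sgn ?a) * w i) * 0 + cmod (\<xi> i))\<^sup>2 / (1 + 0\<^sup>2) - (Re (cnj (sgn ?a) * w i))\<^sup>2) at_top"
    by (intro tendsto_intros l1 l2 l3) auto
  have "\<forall>\<^sub>F s in at_top. ln (1 + (inverse s)\<^sup>2) / 2 - ln 2 + ((?r s - s * cmod (\<xi> i)) * inverse s + cmod (\<xi> i))\<^sup>2 / (1 + (inverse s)\<^sup>2)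
      - (?r s - s * cmod (\<xi> i))\<^sup>2 = amp_score s (cmod (sent \<xi> s i)) (?r s) - ln s"
    using eventually_gt_at_top[of 0]
  proof eventually_elim
    case (elim s)
    have 1: "(?r s - s * cmod (\<xi> i)) * inverse s + cmod (\<xi> i) = ?r s / s"
      using elim by (simp add: field_simps)
    have 2: "1 + (inverse s)\<^sup>2 = (s\<^sup>2 + 1) / s\<^sup>2"
      using elim by (simp add: field_simps)
    have 3: "ln ((s\<^sup>2 + 1) / s\<^sup>2) / 2 = ln (s\<^sup>2 + 1) / 2 - ln s"
    proof -
      have "s\<^sup>2 + 1 > 0" by (simp add: add_nonneg_pos)
      then show ?thesis
        using elim by (subst ln_div) (auto simp: ln_realpow diff_divide_distrib)
    qed
    have 4: "(?r s / s)\<^sup>2 / ((s\<^sup>2 + 1) / s\<^sup>2) = (?r s)\<^sup>2 / (s\<^sup>2 + 1)"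
      using elim by (simp add: power_divide)
    have 5: "cmod (sent \<xi> s i) = s * cmod (\<xi> i)"
      using elim by (simp add: sent_def norm_mult)
    show ?case
      unfolding 1 2 3 4 5 amp_score_def by simp
  qed
  from Lim_transform_eventually[OF l4 this] show ?thesis by simp
qed

lemma cmod_received_bounds:
  assumes "s > 0"
  shows "\<bar>cmod (received \<theta> \<xi> w s i) - s * cmod (\<xi> i)\<bar> \<le> cmod (w i)"
    and "(cmod (received \<theta> \<xi> w s i))\<^sup>2 \<le> 2 * s\<^sup>2 * (cmod (\<xi> i))\<^sup>2 + 2 * (cmod (w i))\<^sup>2"
    and "s\<^sup>2 * (cmod (\<xi> i))\<^sup>2 \<le> 2 * (cmod (received \<theta> \<xi> w s i))\<^sup>2 + 2 * (cmod (w i))\<^sup>2"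
proof -
  let ?v = "cis (\<theta> i) * (of_real s * \<xi> i)"
  have v: "cmod ?v = s * cmod (\<xi> i)"
    using assms by (simp add: norm_mult)
  show "\<bar>cmod (received \<theta> \<xi> w s i) - s * cmod (\<xi> i)\<bar> \<le> cmod (w i)"
    using norm_triangle_ineq3[of "received \<theta> \<xi> w s i" ?v] unfolding v by (simp add: received_def)
  show "(cmod (received \<theta> \<xi> w s i))\<^sup>2 \<le> 2 * s\<^sup>2 * (cmod (\<xi> i))\<^sup>2 + 2 * (cmod (w i))\<^sup>2"
    using cmod_add_power2_le[of ?v "w i"] unfolding v by (simp add: received_def power_mult_distrib)
  show "s\<^sup>2 * (cmod (\<xi> i))\<^sup>2 \<le> 2 * (cmod (received \<theta> \<xi> w s i))\<^sup>2 + 2 * (cmod (w i))\<^sup>2"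
    using cmod_add_power2_le[of "received \<theta> \<xi> w s i" "- w i"] v
    by (simp add: received_def power_mult_distrib norm_mult)
qed

text \<open>A majorant independent of \<open>s\<close>; the deviation of the received modulus never
  exceeds the modulus of the noise.\<close>

lemma amp_score_bound:
  assumes "s \<ge> 1"
  shows "\<bar>amp_score s (cmod (sent \<xi> s i)) (cmod (received \<theta> \<xi> w s i)) - ln s\<bar> \<le>
    2 + 2 * (cmod (\<xi> i))\<^sup>2 + 3 * (cmod (w i))\<^sup>2"
proof -
  let ?r = "cmod (received \<theta> \<xi> w s i)"
  have s: "s > 0" "s\<^sup>2 > 0" "s\<^sup>2 \<ge> 1" using assms by auto
  note b = cmod_received_bounds[OF s(1), where \<theta>=\<theta> and \<xi>=\<xi> and w=w and i=i]
  have 1: "0 \<le> ln (s\<^sup>2 + 1) / 2 - ln s" "ln (s\<^sup>2 + 1) / 2 - ln s \<le> ln 2"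
  proof -
    have e: "ln (s\<^sup>2 + 1) / 2 - ln s = ln ((s\<^sup>2 + 1) / s\<^sup>2) / 2"
      using s by (subst ln_div) (auto simp: ln_realpow add_nonneg_pos diff_divide_distrib)
    have "1 \<le> (s\<^sup>2 + 1) / s\<^sup>2" "(s\<^sup>2 + 1) / s\<^sup>2 \<le> 2"
      using s by (auto simp: field_simps)
    then have "0 \<le> ln ((s\<^sup>2 + 1) / s\<^sup>2)" "ln ((s\<^sup>2 + 1) / s\<^sup>2) \<le> ln 2"
      by (auto simp del: ln_le_cancel_iff intro!: ln_mono ln_ge_zero)
    then show "0 \<le> ln (s\<^sup>2 + 1) / 2 - ln s" "ln (s\<^sup>2 + 1) / 2 - ln s \<le> ln 2"
      unfolding e by linarith+
  qed
  have 2: "ln 2 \<le> (1::real)" "0 \<le> ln (2::real)"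
    using ln_le_minus_one[of 2] by auto
  have 3: "0 \<le> ?r\<^sup>2 / (s\<^sup>2 + 1)" "?r\<^sup>2 / (s\<^sup>2 + 1) \<le> 2 * (cmod (\<xi> i))\<^sup>2 + 2 * (cmod (w i))\<^sup>2"
  proof -
    have "?r\<^sup>2 \<le> (2 * (cmod (\<xi> i))\<^sup>2 + 2 * (cmod (w i))\<^sup>2) * (s\<^sup>2 + 1)"
    proof -
      have "2 * (cmod (w i))\<^sup>2 \<le> 2 * (cmod (w i))\<^sup>2 * s\<^sup>2"
        using s by (simp add: mult_left_le mult_le_cancel_left1)
      moreover have "0 \<le> 2 * (cmod (\<xi> i))\<^sup>2 + 2 * (cmod (w i))\<^sup>2" by simp
      moreover have "(2 * (cmod (\<xi> i))\<^sup>2 + 2 * (cmod (w i))\<^sup>2) * (s\<^sup>2 + 1) =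
          2 * s\<^sup>2 * (cmod (\<xi> i))\<^sup>2 + 2 * (cmod (w i))\<^sup>2 * s\<^sup>2 + (2 * (cmod (\<xi> i))\<^sup>2 + 2 * (cmod (w i))\<^sup>2)"
        by (simp add: algebra_simps)
      ultimately show ?thesis
        using b(2) by linarith
    qed
    then show "?r\<^sup>2 / (s\<^sup>2 + 1) \<le> 2 * (cmod (\<xi> i))\<^sup>2 + 2 * (cmod (w i))\<^sup>2"
      using s by (subst divide_le_eq) auto
  qed simp
  have 4: "0 \<le> (?r - s * cmod (\<xi> i))\<^sup>2" "(?r - s * cmod (\<xi> i))\<^sup>2 \<le> (cmod (w i))\<^sup>2"
    using b(1) by (auto simp: abs_le_square_iff[symmetric])
  have 5: "cmod (sent \<xi> s i) = s * cmod (\<xi> i)"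
    using s by (simp add: sent_def norm_mult)
  show ?thesis
    unfolding amp_score_def 5 using 1 2 3 4 by linarith
qed

lemma phase_score_bounded:
  assumes "\<sigma> > 0"
  shows "\<exists>C. \<forall>t. \<bar>phase_score \<sigma> t\<bar> \<le> C"
proof -
  let ?l = "2 * pi * normal_density 0 \<sigma> pi" and ?u = "2 * pi * suminf (wrapped_bound \<sigma>)"
  have "\<bar>phase_score \<sigma> t\<bar> \<le> \<bar>ln ?l\<bar> + \<bar>ln ?u\<bar>" for t
  proof -
    have p: "?l > 0" using assms by (simp add: normal_density_pos)
    have "?l \<le> 2 * pi * wrapped_normal_density \<sigma> (wrap_pi t)"
      by (intro mult_left_mono wrapped_normal_density_ge assms abs_wrap_pi_le) auto
    moreover have "2 * pi * wrapped_normal_density \<sigma> (wrap_pi t) \<le> ?u"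
      by (intro mult_left_mono wrapped_normal_density_le assms abs_wrap_pi_le) auto
    ultimately have "ln ?l \<le> phase_score \<sigma> t" "phase_score \<sigma> t \<le> ln ?u"
      unfolding phase_score_def using p wrapped_normal_density_pos[OF assms, of t]
      by (auto intro!: ln_mono simp del: ln_le_cancel_iff)
    then show ?thesis by linarith
  qed
  then show ?thesis by blast
qed

text \<open>At an interior point \<open>wrap_pi\<close> is eventually the identity along
  \<open>\<delta> + e s\<close>, so continuity of the density suffices. The argument
  \<open>a s\<close> itself need only agree with it modulo the period.\<close>

lemma tendsto_phase_score:
  assumes \<sigma>: "\<sigma> > 0" and \<delta>: "- pi < \<delta>" "\<delta> < pi"
    and e: "(e \<longlongrightarrow> 0) F" and a: "\<forall>\<^sub>F s in F. cis (a s) = cis (\<delta> + e s)"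
  shows "((\<lambda>s. phase_score \<sigma> (a s)) \<longlongrightarrow> ln (2 * pi * wrapped_normal_density \<sigma> \<delta>)) F"
proof -
  have de: "((\<lambda>s. \<delta> + e s) \<longlongrightarrow> \<delta> + 0) F"
    by (intro tendsto_intros e)
  then have ev: "\<forall>\<^sub>F s in F. - pi < \<delta> + e s" "\<forall>\<^sub>F s in F. \<delta> + e s < pi"
    using \<delta> by (auto intro: order_tendstoD)
  have "isCont (wrapped_normal_density \<sigma>) \<delta>"
  proof (rule continuous_on_interior[OF continuous_on_wrapped_normal_density[OF \<sigma>]])
    show "\<delta> \<in> interior {-pi..pi}" using \<delta> by simp
  qed
  then have "((\<lambda>s. wrapped_normal_density \<sigma> (\<delta> + e s)) \<longlongrightarrow> wrapped_normal_density \<sigma> \<delta>) F"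
    by (rule isCont_tendsto_compose) (use de in simp)
  moreover have "wrapped_normal_density \<sigma> \<delta> > 0"
    using wrapped_normal_density_pos[OF \<sigma>, of \<delta>] \<delta> by (simp add: wrap_pi_id)
  ultimately have l: "((\<lambda>s. ln (2 * pi * wrapped_normal_density \<sigma> (\<delta> + e s))) \<longlongrightarrow> ln (2 * pi * wrapped_normal_density \<sigma> \<delta>)) F"
    by (intro tendsto_intros) auto
  have "\<forall>\<^sub>F s in F. ln (2 * pi * wrapped_normal_density \<sigma> (\<delta> + e s)) = phase_score \<sigma> (a s)"
    using ev a
  proof eventually_elim
    case (elim s)
    have "phase_score \<sigma> (a s) = phase_score \<sigma> (\<delta> + e s)"
      by (rule phase_score_cong) (rule elim)
    then show ?case
      using elim by (simp add: phase_score_def wrap_pi_id)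
  qed
  then show ?thesis
    by (rule Lim_transform_eventually[OF l])
qed

text \<open>Separates the singularities of the individual amplitudes, so that each logarithm depends
  on a single symbol and is integrable under its law.\<close>

lemma ln_one_plus_sum_le:
  assumes "finite I" "\<And>i. i \<in> I \<Longrightarrow> 0 \<le> (a i :: real)"
  shows "ln (1 + (\<Sum>i\<in>I. a i)) \<le> (\<Sum>i\<in>I. ln (1 + a i))"
  using assms
proof (induction I)
  case (insert i I)
  have nn: "0 \<le> a i" "0 \<le> (\<Sum>i\<in>I. a i)"
    using insert.prems by (auto intro: sum_nonneg)
  have "ln (1 + (a i + (\<Sum>i\<in>I. a i))) \<le> ln ((1 + a i) * (1 + (\<Sum>i\<in>I. a i)))"
    using nn by (intro ln_mono) (auto simp: algebra_simps)
  also have "\<dots> = ln (1 + a i) + ln (1 + (\<Sum>i\<in>I. a i))"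
    using nn by (intro ln_mult_pos) auto
  also have "\<dots> \<le> ln (1 + a i) + (\<Sum>i\<in>I. ln (1 + a i))"
    using insert by (intro add_left_mono insert.IH) auto
  finally show ?case
    using insert.hyps by simp
qed simp

section \<open>The Gaussian score at high power\<close>

definition limit_var :: "nat \<Rightarrow> (nat \<Rightarrow> complex) \<Rightarrow> real" where
  "limit_var m \<xi> = 1 + (cmod (\<xi> m))\<^sup>2 * spread m (\<lambda>i. cmod (\<xi> i))"

text \<open>First-order limit of the prediction error: the noise of symbol \<open>m\<close> together
  with the accumulated phase error of the earlier symbols, which acts tangentially to the rotated
  symbol, hence the factor \<open>\<i>\<close>.\<close>

definition limit_error :: "nat \<Rightarrow> (nat \<Rightarrow> real) \<Rightarrow> (nat \<Rightarrow> complex) \<Rightarrow> (nat \<Rightarrow> complex) \<Rightarrow> complex" where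
  "limit_error m \<theta> \<xi> w = w m - \<i> * (cis (\<theta> m) * \<xi> m) *
     of_real (\<Sum>i<m. of_int (comb_coef m i) * Im (cis (- \<theta> i) * w i / \<xi> i))"

lemma limit_var_ge_1: "1 \<le> limit_var m \<xi>"
  unfolding limit_var_def using spread_nonneg by simp

lemma spread_sent:
  assumes "s > 0"
  shows "spread m (\<lambda>i. cmod (sent \<xi> s i)) = spread m (\<lambda>i. cmod (\<xi> i)) / s\<^sup>2"
  using assms
  by (simp add: spread_def sent_def norm_mult power_mult_distrib sum_divide_distrib mult.commute)

lemma tendsto_cmod_received_scaled:
  assumes "\<xi> i \<noteq> 0"
  shows "((\<lambda>s. cmod (received \<theta> \<xi> w s i) * inverse s) \<longlongrightarrow> cmod (\<xi> i)) at_top"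
proof -
  let ?a = "cis (\<theta> i) * \<xi> i"
  have n: "cmod ?a = cmod (\<xi> i)" by (simp add: norm_mult)
  have "((\<lambda>s. cmod (received \<theta> \<xi> w s i) - s * cmod (\<xi> i)) \<longlongrightarrow> Re (cnj (sgn ?a) * w i)) at_top"
    using tendsto_cmod_diff_at_top[of ?a "w i"] assms unfolding n by (simp add: received_def mult_ac)
  then have l: "((\<lambda>s. (cmod (received \<theta> \<xi> w s i) - s * cmod (\<xi> i)) * inverse s + cmod (\<xi> i)) \<longlongrightarrow>
      Re (cnj (sgn ?a) * w i) * 0 + cmod (\<xi> i)) at_top"
    by (intro tendsto_intros tendsto_inverse_0_at_top filterlim_ident)
  have "\<forall>\<^sub>F s in at_top. (cmod (received \<theta> \<xi> w s i) - s * cmod (\<xi> i)) * inverse s + cmod (\<xi> i) =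
      cmod (received \<theta> \<xi> w s i) * inverse s"
    using eventually_gt_at_top[of 0] by eventually_elim (simp add: field_simps)
  from Lim_transform_eventually[OF l this] show ?thesis by simp
qed

lemma tendsto_symbol_var:
  assumes "\<xi> m \<noteq> 0"
  shows "((\<lambda>s. symbol_var m (sent \<xi> s) (received \<theta> \<xi> w s)) \<longlongrightarrow> limit_var m \<xi>) at_top"
proof -
  have l: "((\<lambda>s. 1 + ((inverse s)\<^sup>2 + (cmod (received \<theta> \<xi> w s m) * inverse s)\<^sup>2) * spread m (\<lambda>i. cmod (\<xi> i))) \<longlongrightarrow>
      1 + (0\<^sup>2 + (cmod (\<xi> m))\<^sup>2) * spread m (\<lambda>i. cmod (\<xi> i))) at_top"
    by (intro tendsto_intros tendsto_cmod_received_scaled assms tendsto_inverse_0_at_top filterlim_ident)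
  have "\<forall>\<^sub>F s in at_top. 1 + ((inverse s)\<^sup>2 + (cmod (received \<theta> \<xi> w s m) * inverse s)\<^sup>2) * spread m (\<lambda>i. cmod (\<xi> i)) =
      symbol_var m (sent \<xi> s) (received \<theta> \<xi> w s)"
    using eventually_gt_at_top[of 0]
    by eventually_elim (simp add: symbol_var_def spread_sent power_mult_distrib field_simps)
  from Lim_transform_eventually[OF l this] show ?thesis
    by (simp add: limit_var_def)
qed

text \<open>The phase of the prediction is wrong by order \<open>1 / s\<close> while the symbol it
  multiplies is of order \<open>s\<close>; the product has a finite limit given by linearising
  \<open>cis\<close>.\<close>

lemma tendsto_prediction_error:
  assumes nz: "\<And>i. i \<le> m \<Longrightarrow> \<xi> i \<noteq> 0"
    and \<theta>: "cis (\<theta> m) = cis (\<Sum>i<m. of_int (comb_coef m i) * \<theta> i)"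
  shows "((\<lambda>s. received \<theta> \<xi> w s m - pred_phase m (sent \<xi> s) (received \<theta> \<xi> w s) * sent \<xi> s m) \<longlongrightarrow>
    limit_error m \<theta> \<xi> w) at_top"
proof -
  let ?T = "\<lambda>s. \<Sum>i<m. of_int (comb_coef m i) * phase_error \<theta> \<xi> w s i"
  let ?\<tau> = "\<Sum>i<m. of_int (comb_coef m i) * Im (cis (- \<theta> i) * w i / \<xi> i)"
  have "((\<lambda>s. \<Sum>i<m. of_int (comb_coef m i) * (s * phase_error \<theta> \<xi> w s i)) \<longlongrightarrow> ?\<tau>) at_top"
    by (intro tendsto_intros tendsto_phase_error)
  then have "((\<lambda>s. s * ?T s) \<longlongrightarrow> ?\<tau>) at_top"
    by (simp add: sum_distrib_left mult_ac)
  then have "((\<lambda>s. of_real s * (cis (?T s) - 1)) \<longlongrightarrow> \<i> * of_real ?\<tau>) at_top"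
    by (rule tendsto_cis_minus_one_at_top)
  then have l: "((\<lambda>s. w m - cis (\<theta> m) * \<xi> m * (of_real s * (cis (?T s) - 1))) \<longlongrightarrow>
      w m - cis (\<theta> m) * \<xi> m * (\<i> * of_real ?\<tau>)) at_top"
    by (intro tendsto_diff tendsto_const tendsto_mult_left)
  have "\<forall>\<^sub>F s in at_top. \<forall>i\<in>{..<m}. cis (obs_phase (sent \<xi> s) (received \<theta> \<xi> w s) i) = cis (\<theta> i + phase_error \<theta> \<xi> w s i)"
    using nz by (intro eventually_ball_finite ballI eventually_cis_obs_phase) auto
  then have "\<forall>\<^sub>F s in at_top. w m - cis (\<theta> m) * \<xi> m * (of_real s * (cis (?T s) - 1)) =
      received \<theta> \<xi> w s m - pred_phase m (sent \<xi> s) (received \<theta> \<xi> w s) * sent \<xi> s m"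
  proof eventually_elim
    case (elim s)
    have "pred_phase m (sent \<xi> s) (received \<theta> \<xi> w s) =
        cis (\<Sum>i<m. of_int (comb_coef m i) * (\<theta> i + phase_error \<theta> \<xi> w s i))"
      unfolding pred_phase_def by (rule cis_sum_cong) (use elim in auto)
    also have "\<dots> = cis ((\<Sum>i<m. of_int (comb_coef m i) * \<theta> i) + ?T s)"
      by (simp add: distrib_left sum.distrib)
    also have "\<dots> = cis (\<theta> m) * cis (?T s)"
      unfolding \<theta> by (simp add: cis_mult)
    finally show ?case
      by (simp add: received_def sent_def algebra_simps)
  qed
  from Lim_transform_eventually[OF l this] show ?thesis
    by (simp add: limit_error_def mult_ac)
qed

lemma tendsto_gauss_score:
  assumes nz: "\<And>i. i \<le> m \<Longrightarrow> \<xi> i \<noteq> 0"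
    and \<theta>: "cis (\<theta> m) = cis (\<Sum>i<m. of_int (comb_coef m i) * \<theta> i)"
  shows "((\<lambda>s. gauss_score s (symbol_var m (sent \<xi> s) (received \<theta> \<xi> w s))
      (pred_phase m (sent \<xi> s) (received \<theta> \<xi> w s) * sent \<xi> s m) (received \<theta> \<xi> w s m) - 2 * ln s) \<longlongrightarrow>
    - ln (limit_var m \<xi>) - (cmod (limit_error m \<theta> \<xi> w))\<^sup>2 / limit_var m \<xi> + (cmod (\<xi> m))\<^sup>2) at_top"
proof -
  let ?V = "\<lambda>s. symbol_var m (sent \<xi> s) (received \<theta> \<xi> w s)"
  let ?d = "\<lambda>s. received \<theta> \<xi> w s m - pred_phase m (sent \<xi> s) (received \<theta> \<xi> w s) * sent \<xi> s m"
  let ?r = "\<lambda>s. cmod (received \<theta> \<xi> w s m) * inverse s"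
  have V: "(?V \<longlongrightarrow> limit_var m \<xi>) at_top"
    by (rule tendsto_symbol_var) (use nz in simp)
  have V0: "limit_var m \<xi> > 0" using limit_var_ge_1[of m \<xi>] by linarith
  have d: "(?d \<longlongrightarrow> limit_error m \<theta> \<xi> w) at_top"
    by (rule tendsto_prediction_error[OF nz \<theta>])
  have i: "((\<lambda>s::real. inverse s) \<longlongrightarrow> 0) at_top"
    by (intro tendsto_inverse_0_at_top filterlim_ident)
  have r: "(?r \<longlongrightarrow> cmod (\<xi> m)) at_top"
    by (rule tendsto_cmod_received_scaled) (use nz in simp)
  \<comment> \<open>Dividing through by \<open>s\<^sup>2\<close> writes the score minus
    \<open>2 * ln s\<close> in terms of quantities that all converge.\<close>
  have l: "((\<lambda>s. ln (1 / ?V s + (inverse s)\<^sup>2) - (cmod (?d s))\<^sup>2 / ?V s + (?r s)\<^sup>2 / (1 + ?V s * (inverse s)\<^sup>2)) \<longlongrightarrow>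
      ln (1 / limit_var m \<xi> + 0\<^sup>2) - (cmod (limit_error m \<theta> \<xi> w))\<^sup>2 / limit_var m \<xi> +
      (cmod (\<xi> m))\<^sup>2 / (1 + limit_var m \<xi> * 0\<^sup>2)) at_top"
    using V0 by (intro tendsto_intros V d i r) auto
  have "\<forall>\<^sub>F s in at_top. ln (1 / ?V s + (inverse s)\<^sup>2) - (cmod (?d s))\<^sup>2 / ?V s + (?r s)\<^sup>2 / (1 + ?V s * (inverse s)\<^sup>2) =
      gauss_score s (?V s) (pred_phase m (sent \<xi> s) (received \<theta> \<xi> w s) * sent \<xi> s m) (received \<theta> \<xi> w s m) - 2 * ln s"
    using eventually_gt_at_top[of 0]
  proof eventually_elim
    case (elim s)
    define v where "v = ?V s"
    have v: "v > 0" using symbol_var_ge_1[of m "sent \<xi> s" "received \<theta> \<xi> w s"] by (simp add: v_def)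
    have 1: "1 / v + (inverse s)\<^sup>2 = ((s\<^sup>2 + v) / v) / s\<^sup>2"
      using v elim by (simp add: field_simps)
    have 2: "ln (((s\<^sup>2 + v) / v) / s\<^sup>2) = ln ((s\<^sup>2 + v) / v) - 2 * ln s"
    proof -
      have "s\<^sup>2 + v > 0" using v by (simp add: add_nonneg_pos)
      then show ?thesis
        using v elim by (subst ln_div) (auto simp: ln_realpow)
    qed
    have 3: "(?r s)\<^sup>2 / (1 + v * (inverse s)\<^sup>2) = (cmod (received \<theta> \<xi> w s m))\<^sup>2 / (s\<^sup>2 + v)"
    proof -
      have "(?r s)\<^sup>2 = (cmod (received \<theta> \<xi> w s m))\<^sup>2 / s\<^sup>2" "1 + v * (inverse s)\<^sup>2 = (s\<^sup>2 + v) / s\<^sup>2"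
        using elim by (auto simp: power_mult_distrib field_simps)
      then show ?thesis using elim by simp
    qed
    show ?case
      unfolding v_def[symmetric] 1 2 3 gauss_score_def by simp
  qed
  from Lim_transform_eventually[OF l this] show ?thesis
    using V0 by (simp add: ln_div)
qed

text \<open>Both the squared error and the variance contain the possibly huge factor
  \<open>spread\<close>; it cancels in the quotient, leaving a polynomial in the noise energy
  \<open>R\<close>. The constants are \<open>18 = 2 + 16\<close>, from the symbol's own noise and
  from the phase errors.\<close>

lemma prediction_error_bound:
  fixes w :: "nat \<Rightarrow> complex"
  assumes nz: "\<And>i. i \<le> m \<Longrightarrow> \<xi> i \<noteq> 0" and s: "s \<ge> 1"
    and \<theta>: "cis (\<theta> m) = cis (\<Sum>i<m. of_int (comb_coef m i) * \<theta> i)"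
  defines "R \<equiv> \<Sum>i\<le>m. (cmod (w i))\<^sup>2"
  shows "(cmod (received \<theta> \<xi> w s m - pred_phase m (sent \<xi> s) (received \<theta> \<xi> w s) * sent \<xi> s m))\<^sup>2 /
    symbol_var m (sent \<xi> s) (received \<theta> \<xi> w s) \<le> 18 * R + 16 * R\<^sup>2"
proof -
  let ?o = "obs_phase (sent \<xi> s) (received \<theta> \<xi> w s)"
  let ?V = "symbol_var m (sent \<xi> s) (received \<theta> \<xi> w s)"
  let ?\<kappa> = "spread m (\<lambda>i. cmod (\<xi> i))"
  let ?y = "cmod (received \<theta> \<xi> w s m)"
  define R' where "R' = (\<Sum>i<m. (cmod (w i))\<^sup>2)"
  have s0: "s > 0" "s\<^sup>2 > 0" using s by auto
  have R: "R = (cmod (w m))\<^sup>2 + R'"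
    by (simp add: R_def R'_def lessThan_Suc_atMost[symmetric])
  have R'0: "R' \<ge> 0" unfolding R'_def by (intro sum_nonneg) auto
  define S where "S = (\<Sum>i<m. (\<bar>of_int (comb_coef m i)\<bar> / cmod (\<xi> i)) * cmod (w i))"
  have S0: "S \<ge> 0" unfolding S_def by (intro sum_nonneg) auto
  \<comment> \<open>Cauchy-Schwarz separates the amplitudes, collected in the spread, from the
    noise.\<close>
  have S2: "S\<^sup>2 \<le> ?\<kappa> * R'"
  proof -
    have "S\<^sup>2 \<le> (\<Sum>i<m. (\<bar>of_int (comb_coef m i)\<bar> / cmod (\<xi> i))\<^sup>2) * (\<Sum>i<m. (cmod (w i))\<^sup>2)"
      unfolding S_def by (rule Cauchy_Schwarz_ineq_sum)
    then show ?thesis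
      by (simp add: spread_def R'_def power_divide)
  qed
  have "cmod (cis (\<theta> m) - pred_phase m (sent \<xi> s) (received \<theta> \<xi> w s)) =
      cmod (cis (\<Sum>i<m. of_int (comb_coef m i) * ?o i) - cis (\<Sum>i<m. of_int (comb_coef m i) * \<theta> i))"
    unfolding \<theta> pred_phase_def by (rule norm_minus_commute)
  also have "\<dots> \<le> (\<Sum>i<m. \<bar>of_int (comb_coef m i)\<bar> * cmod (cis (?o i) - cis (\<theta> i)))"
    by (rule cis_sum_diff_le)
  also have "\<dots> \<le> (\<Sum>i<m. \<bar>of_int (comb_coef m i)\<bar> * (2 * cmod (w i) / (s * cmod (\<xi> i))))"
    using nz s0 by (intro sum_mono mult_left_mono cis_obs_phase_diff_le) auto
  also have "\<dots> = 2 / s * S"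
    unfolding S_def sum_distrib_left by (intro sum.cong refl) (simp add: field_simps)
  finally have e: "cmod (cis (\<theta> m) - pred_phase m (sent \<xi> s) (received \<theta> \<xi> w s)) \<le> 2 / s * S" .
  have "received \<theta> \<xi> w s m - pred_phase m (sent \<xi> s) (received \<theta> \<xi> w s) * sent \<xi> s m =
      w m + (cis (\<theta> m) - pred_phase m (sent \<xi> s) (received \<theta> \<xi> w s)) * sent \<xi> s m"
    by (simp add: received_def sent_def algebra_simps)
  then have "(cmod (received \<theta> \<xi> w s m - pred_phase m (sent \<xi> s) (received \<theta> \<xi> w s) * sent \<xi> s m))\<^sup>2 \<le>
      2 * (cmod (w m))\<^sup>2 + 2 * (cmod ((cis (\<theta> m) - pred_phase m (sent \<xi> s) (received \<theta> \<xi> w s)) * sent \<xi> s m))\<^sup>2"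
    using cmod_add_power2_le by metis
  also have "(cmod ((cis (\<theta> m) - pred_phase m (sent \<xi> s) (received \<theta> \<xi> w s)) * sent \<xi> s m))\<^sup>2 \<le> (2 * cmod (\<xi> m) * S)\<^sup>2"
  proof (intro power_mono)
    have "cmod ((cis (\<theta> m) - pred_phase m (sent \<xi> s) (received \<theta> \<xi> w s)) * sent \<xi> s m) \<le> 2 / s * S * (s * cmod (\<xi> m))"
      unfolding norm_mult using s0 S0 by (intro mult_mono e) (auto simp: sent_def norm_mult)
    then show "cmod ((cis (\<theta> m) - pred_phase m (sent \<xi> s) (received \<theta> \<xi> w s)) * sent \<xi> s m) \<le> 2 * cmod (\<xi> m) * S"
      using s0 by (simp add: mult_ac)
  qed simp
  also have "(2 * cmod (\<xi> m) * S)\<^sup>2 = 4 * (cmod (\<xi> m))\<^sup>2 * S\<^sup>2"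
    by (simp add: power_mult_distrib)
  finally have d: "(cmod (received \<theta> \<xi> w s m - pred_phase m (sent \<xi> s) (received \<theta> \<xi> w s) * sent \<xi> s m))\<^sup>2 \<le>
      2 * (cmod (w m))\<^sup>2 + 8 * ((cmod (\<xi> m))\<^sup>2 * S\<^sup>2)" by simp
  have V1: "?V \<ge> 1" by (rule symbol_var_ge_1)
  have \<kappa>0: "?\<kappa> \<ge> 0" by (rule spread_nonneg)
  \<comment> \<open>The variance uses the received energy; replacing it by the sent energy costs a
    noise factor. The 1 added to the squared output in \<open>symbol_var\<close> covers the case in
    which noise has nearly cancelled the symbol.\<close>
  have \<kappa>V: "(cmod (\<xi> m))\<^sup>2 * ?\<kappa> \<le> 2 * (1 + (cmod (w m))\<^sup>2) * ?V"
  proof -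
    have "(cmod (\<xi> m))\<^sup>2 = s\<^sup>2 * (cmod (\<xi> m))\<^sup>2 / s\<^sup>2"
      using s0 by simp
    also have "\<dots> \<le> (2 * ?y\<^sup>2 + 2 * (cmod (w m))\<^sup>2) / s\<^sup>2"
      using cmod_received_bounds(3)[OF s0(1)] by (rule divide_right_mono) simp
    also have "\<dots> \<le> (2 * (1 + (cmod (w m))\<^sup>2) * (1 + ?y\<^sup>2)) / s\<^sup>2"
      by (intro divide_right_mono) (auto simp: algebra_simps)
    finally have "(cmod (\<xi> m))\<^sup>2 * ?\<kappa> \<le> (2 * (1 + (cmod (w m))\<^sup>2) * (1 + ?y\<^sup>2)) / s\<^sup>2 * ?\<kappa>"
      using \<kappa>0 by (rule mult_right_mono)
    also have "\<dots> = 2 * (1 + (cmod (w m))\<^sup>2) * ((1 + ?y\<^sup>2) * (?\<kappa> / s\<^sup>2))"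
      by simp
    also have "\<dots> \<le> 2 * (1 + (cmod (w m))\<^sup>2) * ?V"
      by (intro mult_left_mono) (auto simp: symbol_var_def spread_sent[OF s0(1)])
    finally show ?thesis .
  qed
  have "8 * ((cmod (\<xi> m))\<^sup>2 * S\<^sup>2) \<le> 8 * ((cmod (\<xi> m))\<^sup>2 * (?\<kappa> * R'))"
    using S2 by (intro mult_left_mono) auto
  also have "\<dots> = 8 * (((cmod (\<xi> m))\<^sup>2 * ?\<kappa>) * R')"
    by (simp add: mult.assoc)
  also have "\<dots> \<le> 8 * ((2 * (1 + (cmod (w m))\<^sup>2) * ?V) * R')"
    using R'0 \<kappa>V by (intro mult_left_mono mult_right_mono) auto
  also have "\<dots> = 16 * (1 + (cmod (w m))\<^sup>2) * R' * ?V"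
    by simp
  also have "\<dots> \<le> 16 * (1 + R) * R * ?V"
    using V1 R R'0 by (intro mult_right_mono mult_mono) auto
  finally have "(cmod (received \<theta> \<xi> w s m - pred_phase m (sent \<xi> s) (received \<theta> \<xi> w s) * sent \<xi> s m))\<^sup>2 \<le>
      2 * (cmod (w m))\<^sup>2 + 16 * (1 + R) * R * ?V"
    using d by linarith
  also have "2 * (cmod (w m))\<^sup>2 \<le> 2 * R * ?V"
    using V1 R R'0 mult_mono[of "2 * (cmod (w m))\<^sup>2" "2 * R" 1 ?V] by simp
  finally have "(cmod (received \<theta> \<xi> w s m - pred_phase m (sent \<xi> s) (received \<theta> \<xi> w s) * sent \<xi> s m))\<^sup>2 \<le>
      (18 * R + 16 * R\<^sup>2) * ?V"
    by (simp add: algebra_simps power2_eq_square)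
  then show ?thesis
    using V1 by (simp add: divide_le_eq)
qed

text \<open>The majorant consists of input energies, noise moments up to the fourth and logarithms
  of single amplitudes, all integrable and free of \<open>s\<close>.\<close>

lemma gauss_score_bound:
  fixes w :: "nat \<Rightarrow> complex"
  assumes nz: "\<And>i. i \<le> m \<Longrightarrow> \<xi> i \<noteq> 0" and s: "s \<ge> 1"
    and \<theta>: "cis (\<theta> m) = cis (\<Sum>i<m. of_int (comb_coef m i) * \<theta> i)"
  defines "R \<equiv> \<Sum>i\<le>m. (cmod (w i))\<^sup>2"
  shows "\<bar>gauss_score s (symbol_var m (sent \<xi> s) (received \<theta> \<xi> w s))
      (pred_phase m (sent \<xi> s) (received \<theta> \<xi> w s) * sent \<xi> s m) (received \<theta> \<xi> w s m) - 2 * ln s\<bar> \<le>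
    2 + 4 * (cmod (\<xi> m))\<^sup>2 + 4 * (cmod (w m))\<^sup>2 +
    (\<Sum>i<m. ln (1 + (of_int (comb_coef m i))\<^sup>2 / (cmod (\<xi> i))\<^sup>2)) + 18 * R + 16 * R\<^sup>2"
proof -
  let ?\<kappa> = "spread m (\<lambda>i. cmod (\<xi> i))"
  let ?y = "cmod (received \<theta> \<xi> w s m)"
  define v where "v = symbol_var m (sent \<xi> s) (received \<theta> \<xi> w s)"
  define B where "B = 2 * (cmod (\<xi> m))\<^sup>2 + 2 * (cmod (w m))\<^sup>2"
  define \<Lambda> where "\<Lambda> = (\<Sum>i<m. ln (1 + (of_int (comb_coef m i))\<^sup>2 / (cmod (\<xi> i))\<^sup>2))"
  have s0: "s > 0" "s\<^sup>2 \<ge> 1" using s by auto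
  have v: "v \<ge> 1" unfolding v_def by (rule symbol_var_ge_1)
  have \<kappa>0: "?\<kappa> \<ge> 0" by (rule spread_nonneg)
  have B0: "B \<ge> 0" by (simp add: B_def)
  have ys: "?y\<^sup>2 / s\<^sup>2 \<le> B"
  proof -
    have "2 * (cmod (w m))\<^sup>2 * 1 \<le> 2 * (cmod (w m))\<^sup>2 * s\<^sup>2"
      using s0 by (intro mult_left_mono) auto
    then have "?y\<^sup>2 \<le> B * s\<^sup>2"
      using cmod_received_bounds(2)[OF s0(1), where \<theta>=\<theta> and \<xi>=\<xi> and w=w and i=m]
      unfolding B_def distrib_right by (simp add: mult_ac)
    then show ?thesis using s0 by (simp add: divide_le_eq)
  qed
  have ln_lower: "- (1 + B + \<Lambda>) \<le> - ln v"
  proof -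
    have "v = 1 + (1 / s\<^sup>2 + ?y\<^sup>2 / s\<^sup>2) * ?\<kappa>"
      using s0 by (simp add: v_def symbol_var_def spread_sent[OF s0(1)] field_simps)
    also have "\<dots> \<le> 1 + (1 + B) * ?\<kappa>"
      using ys s0 \<kappa>0 by (intro add_left_mono mult_right_mono add_mono) auto
    \<comment> \<open>Bounding by a product lets the logarithm split into an energy part and a
      spread part.\<close>
    also have "\<dots> \<le> (1 + (1 + B)) * (1 + ?\<kappa>)"
      using B0 \<kappa>0 by (simp add: algebra_simps)
    finally have "ln v \<le> ln ((1 + (1 + B)) * (1 + ?\<kappa>))"
      using v by (intro ln_mono) auto
    also have "\<dots> = ln (1 + (1 + B)) + ln (1 + ?\<kappa>)"
      using B0 \<kappa>0 by (intro ln_mult_pos) auto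
    also have "ln (1 + (1 + B)) \<le> 1 + B"
      using B0 by (intro ln_add_one_self_le_self) auto
    also have "ln (1 + ?\<kappa>) \<le> \<Lambda>"
      unfolding spread_def \<Lambda>_def by (intro ln_one_plus_sum_le) auto
    finally show ?thesis by simp
  qed
  have ln_eq: "ln ((s\<^sup>2 + v) / v) - 2 * ln s = ln (1 / v + 1 / s\<^sup>2)"
  proof -
    have "1 / v + 1 / s\<^sup>2 = ((s\<^sup>2 + v) / v) / s\<^sup>2"
      using v s0 by (simp add: field_simps)
    then show ?thesis
      using v s0 by (simp only:) (subst ln_div, auto simp: ln_realpow add_nonneg_pos)
  qed
  have up: "ln (1 / v + 1 / s\<^sup>2) \<le> 1"
  proof -
    have "1 / v + 1 / s\<^sup>2 \<le> 1 + 1"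
      using v s0 by (intro add_mono) auto
    then have "ln (1 / v + 1 / s\<^sup>2) \<le> ln (1 + 1)"
      using v s0 by (intro ln_mono) (auto intro!: add_pos_nonneg)
    also have "\<dots> \<le> 1"
      by (rule ln_add_one_self_le_self) simp
    finally show ?thesis .
  qed
  have lo: "- ln v \<le> ln (1 / v + 1 / s\<^sup>2)"
  proof -
    have "- ln v = ln (1 / v)" using v by (simp add: ln_div)
    also have "\<dots> \<le> ln (1 / v + 1 / s\<^sup>2)" using v s0 by (intro ln_mono) auto
    finally show ?thesis .
  qed
  have last: "0 \<le> ?y\<^sup>2 / (s\<^sup>2 + v)" "?y\<^sup>2 / (s\<^sup>2 + v) \<le> B"
  proof -
    have "?y\<^sup>2 / (s\<^sup>2 + v) \<le> ?y\<^sup>2 / s\<^sup>2"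
      using v s0 by (intro divide_left_mono) (auto intro!: mult_pos_pos add_pos_pos)
    then show "?y\<^sup>2 / (s\<^sup>2 + v) \<le> B" using ys by linarith
  qed (use v s0 in simp)
  let ?e = "(cmod (received \<theta> \<xi> w s m - pred_phase m (sent \<xi> s) (received \<theta> \<xi> w s) * sent \<xi> s m))\<^sup>2 / v"
  have e: "?e \<le> 18 * R + 16 * R\<^sup>2"
    unfolding v_def R_def by (rule prediction_error_bound[OF nz s \<theta>])
  have e0: "0 \<le> ?e" using v by simp
  have \<Lambda>0: "\<Lambda> \<ge> 0" unfolding \<Lambda>_def by (intro sum_nonneg) auto
  have R0: "0 \<le> R" unfolding R_def by (intro sum_nonneg) auto
  have "gauss_score s v (pred_phase m (sent \<xi> s) (received \<theta> \<xi> w s) * sent \<xi> s m) (received \<theta> \<xi> w s m) - 2 * ln s =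
      ln (1 / v + 1 / s\<^sup>2) - ?e + ?y\<^sup>2 / (s\<^sup>2 + v)"
    unfolding gauss_score_def ln_eq[symmetric] by simp
  then have "\<bar>gauss_score s v (pred_phase m (sent \<xi> s) (received \<theta> \<xi> w s) * sent \<xi> s m) (received \<theta> \<xi> w s m) - 2 * ln s\<bar> \<le>
      2 + 2 * B + \<Lambda> + 18 * R + 16 * R\<^sup>2"
    using ln_lower up lo last e e0 B0 \<Lambda>0 R0 zero_le_power2[of R] by linarith
  then show ?thesis
    unfolding v_def \<Lambda>_def B_def by (simp add: algebra_simps)
qed

section \<open>Expected scores at high power\<close>

text \<open>Subtracting \<open>c * ln s\<close> removes the growth of the score, so one integrable
  \<open>B\<close> can dominate for all \<open>s \<ge> 1\<close>; \<open>c\<close> will be 1 or 2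
  depending on the symbol.\<close>

lemma dominated_convergence_minus_ln:
  fixes f :: "real \<Rightarrow> 'a \<Rightarrow> real"
  assumes "prob_space P"
    and f[measurable]: "\<And>s. f s \<in> borel_measurable P" and G[measurable]: "G \<in> borel_measurable P"
    and lim: "AE z in P. ((\<lambda>s. f s z - c * ln s) \<longlongrightarrow> G z) at_top"
    and bound: "\<And>s. s \<ge> 1 \<Longrightarrow> AE z in P. \<bar>f s z - c * ln s\<bar> \<le> B z" and B: "integrable P B"
  shows "\<And>s. s \<ge> 1 \<Longrightarrow> integrable P (f s)" and "integrable P G"
    and "((\<lambda>s. (\<integral>z. f s z \<partial>P) - c * ln s) \<longlongrightarrow> (\<integral>z. G z \<partial>P)) at_top"
proof -
  interpret prob_space P by fact
  show int: "integrable P (f s)" if "s \<ge> 1" for s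
  proof -
    have "integrable P (\<lambda>z. f s z - c * ln s)"
    proof (rule Bochner_Integration.integrable_bound[OF B])
      show "AE z in P. norm (f s z - c * ln s) \<le> norm (B z)"
        using bound[OF that] by eventually_elim auto
    qed measurable
    then have "integrable P (\<lambda>z. (f s z - c * ln s) + c * ln s)"
      by (rule Bochner_Integration.integrable_add) simp
    then show ?thesis by simp
  qed
  have ev: "\<forall>\<^sub>F s in at_top. AE z in P. norm (f s z - c * ln s) \<le> B z"
    using eventually_ge_at_top[of "1::real"] by eventually_elim (use bound in auto)
  have "((\<lambda>s. \<integral>z. f s z - c * ln s \<partial>P) \<longlongrightarrow> (\<integral>z. G z \<partial>P)) at_top"
    by (rule integral_dominated_convergence_at_top[OF G _ B lim ev]) measurable
  moreover have "\<forall>\<^sub>F s in at_top. (\<integral>z. f s z - c * ln s \<partial>P) = (\<integral>z. f s z \<partial>P) - c * ln s"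
    using eventually_ge_at_top[of "1::real"] by eventually_elim (use int prob_space in simp)
  ultimately show "((\<lambda>s. (\<integral>z. f s z \<partial>P) - c * ln s) \<longlongrightarrow> (\<integral>z. G z \<partial>P)) at_top"
    by (rule Lim_transform_eventually)
  show "integrable P G"
    by (rule integrable_dominated_convergence_at_top[OF G _ B lim ev]) measurable
qed

section \<open>Second moments of linear forms in the noise\<close>

text \<open>The summands are centred and independent, so the cross terms vanish and the variances,
  half the squared moduli of the coefficients, add up.\<close>

lemma nn_integral_quadratic_form:
  assumes M: "M \<ge> 1" and J: "J \<subseteq> {..<M}" and k: "k \<ge> 1"
  shows "(\<integral>\<^sup>+w. ennreal ((\<Sum>i\<in>J. Re (\<alpha> i * w (k, i)))\<^sup>2) \<partial>additive_noise M) = ennreal ((\<Sum>i\<in>J. (cmod (\<alpha> i))\<^sup>2) / 2)"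
proof -
  let ?A = "additive_noise M"
  interpret W: prob_space ?A by (rule prob_space_additive_noise)
  have fin: "finite J" using J by (rule finite_subset) simp
  let ?f = "\<lambda>i w. Re (\<alpha> i * w (k, i))"
  have comp: "(\<lambda>w. w (k, i)) \<in> borel_measurable ?A" and d: "distr ?A borel (\<lambda>w. w (k, i)) = std_complex_normal" if "i \<in> J" for i
  proof -
    have I: "(k, i) \<in> {1..} \<times> {..<M}" using that J k by auto
    show c: "(\<lambda>w. w (k, i)) \<in> borel_measurable ?A"
      using measurable_component_singleton[OF I, of "\<lambda>_. std_complex_normal"] by (simp cong: measurable_cong_sets)
    have "distr ?A borel (\<lambda>w. w (k, i)) = distr ?A std_complex_normal (\<lambda>w. w (k, i))"
      by (intro distr_cong) auto
    also have "\<dots> = std_complex_normal"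
      using I by (intro distr_PiM_component prob_space_std_complex_normal)
    finally show "distr ?A borel (\<lambda>w. w (k, i)) = std_complex_normal" .
  qed
  have i1: "integrable ?A (?f i)" if "i \<in> J" for i
    using integrable_distr_eq[OF comp[OF that], of "\<lambda>w. Re (\<alpha> i * w)"] integrable_Re_std_complex_normal[of "\<alpha> i"]
    unfolding d[OF that] by simp
  have e1: "(\<integral>w. ?f i w \<partial>?A) = 0" if "i \<in> J" for i
    using integral_distr[OF comp[OF that], of "\<lambda>w. Re (\<alpha> i * w)"] integral_Re_std_complex_normal[of "\<alpha> i"]
    unfolding d[OF that] by simp
  have i2: "integrable ?A (\<lambda>w. (?f i w)\<^sup>2)" if "i \<in> J" for i
    using integrable_distr_eq[OF comp[OF that], of "\<lambda>w. (Re (\<alpha> i * w))\<^sup>2"] integrable_Re_power2_std_complex_normal[of "\<alpha> i"]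
    unfolding d[OF that] by simp
  have e2: "(\<integral>w. (?f i w)\<^sup>2 \<partial>?A) = (cmod (\<alpha> i))\<^sup>2 / 2" if "i \<in> J" for i
    using integral_distr[OF comp[OF that], of "\<lambda>w. (Re (\<alpha> i * w))\<^sup>2"] integral_Re_power2_std_complex_normal[of "\<alpha> i"]
    unfolding d[OF that] by simp
  have prod: "integrable ?A (\<lambda>w. ?f i w * ?f j w) \<and>
      (\<integral>w. ?f i w * ?f j w \<partial>?A) = (if i = j then (cmod (\<alpha> i))\<^sup>2 / 2 else 0)" if ij: "i \<in> J" "j \<in> J" for i j
  proof (cases "i = j")
    case True
    then show ?thesis using i2[OF ij(1)] e2[OF ij(1)] by (simp add: power2_eq_square)
  next
    case False
    have "W.indep_vars (\<lambda>_. borel) (\<lambda>p w. w p) ({k} \<times> {i, j})"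
      by (rule W.indep_vars_subset[OF indep_vars_additive_noise[OF M]]) (use ij J k in auto)
    then have "W.indep_vars (\<lambda>_. borel) (\<lambda>p w. Re (\<alpha> (snd p) * w p)) ({k} \<times> {i, j})"
      by (rule W.indep_vars_compose2) measurable
    then have ind: "W.indep_vars (\<lambda>_. borel) (\<lambda>p w. Re (\<alpha> (snd p) * w p)) {(k, i), (k, j)}"
      by (simp add: insert_Times_insert)
    have int: "\<And>p. p \<in> {(k, i), (k, j)} \<Longrightarrow> integrable ?A (\<lambda>w. Re (\<alpha> (snd p) * w p))"
      using i1 ij by auto
    have "integrable ?A (\<lambda>w. \<Prod>p\<in>{(k, i), (k, j)}. Re (\<alpha> (snd p) * w p))"
      by (rule W.indep_vars_integrable[OF _ ind int]) auto
    moreover have "(\<integral>w. (\<Prod>p\<in>{(k, i), (k, j)}. Re (\<alpha> (snd p) * w p)) \<partial>?A) =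
        (\<Prod>p\<in>{(k, i), (k, j)}. \<integral>w. Re (\<alpha> (snd p) * w p) \<partial>?A)"
      by (rule W.indep_vars_lebesgue_integral[OF _ ind int]) auto
    ultimately show ?thesis
      using False e1[OF ij(1)] by simp
  qed
  have sq: "(\<Sum>i\<in>J. ?f i w)\<^sup>2 = (\<Sum>i\<in>J. \<Sum>j\<in>J. ?f i w * ?f j w)" for w
    unfolding power2_eq_square by (rule sum_product)
  have int: "integrable ?A (\<lambda>w. (\<Sum>i\<in>J. ?f i w)\<^sup>2)"
    unfolding sq using prod by (intro Bochner_Integration.integrable_sum) auto
  have "(\<integral>w. (\<Sum>i\<in>J. ?f i w)\<^sup>2 \<partial>?A) = (\<Sum>i\<in>J. \<Sum>j\<in>J. \<integral>w. ?f i w * ?f j w \<partial>?A)"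
    unfolding sq using prod
    by (subst Bochner_Integration.integral_sum) (auto intro!: sum.cong Bochner_Integration.integral_sum Bochner_Integration.integrable_sum)
  also have "\<dots> = (\<Sum>i\<in>J. \<Sum>j\<in>J. if i = j then (cmod (\<alpha> i))\<^sup>2 / 2 else 0)"
    using prod by (intro sum.cong refl) auto
  also have "\<dots> = (\<Sum>i\<in>J. (cmod (\<alpha> i))\<^sup>2) / 2"
    using fin by (simp add: sum_divide_distrib)
  finally have e: "(\<integral>w. (\<Sum>i\<in>J. ?f i w)\<^sup>2 \<partial>?A) = (\<Sum>i\<in>J. (cmod (\<alpha> i))\<^sup>2) / 2" .
  show ?thesis
    unfolding e[symmetric] by (rule nn_integral_eq_integral[OF int]) simp
qed

text \<open>In the frame aligned with the tangential direction, the real part of the error has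
  second moment \<open>limit_var / 2\<close> and the imaginary part, carrying only the symbol's own
  noise, has 1/2. Their sum is at most \<open>limit_var\<close> because the latter is at least
  1.\<close>

lemma nn_integral_limit_error:
  assumes M: "m < M" and nz: "\<And>i. i \<le> m \<Longrightarrow> \<xi> i \<noteq> 0"
  shows "(\<integral>\<^sup>+w. ennreal ((cmod (limit_error m \<theta> \<xi> (\<lambda>i. w (2, i))))\<^sup>2) \<partial>additive_noise M) \<le> ennreal (limit_var m \<xi>)"
proof -
  define q where "q = - \<i> * (cis (\<theta> m) * \<xi> m)"
  define a where "a = cnj (sgn q)"
  \<comment> \<open>Coefficients of the real part after the rotation by \<open>a\<close>; for
    \<open>i < m\<close> the factor \<open>- \<i>\<close> turns the imaginary part of the phase
    error into a real part.\<close>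
  define \<beta> where "\<beta> i = (if i = m then a else of_real (cmod q * of_int (comb_coef m i)) * (- \<i> * (cis (- \<theta> i) / \<xi> i)))" for i
  have q: "q \<noteq> 0" "cmod q = cmod (\<xi> m)"
    using nz[of m] by (auto simp: q_def norm_mult)
  have a: "cmod a = 1" "a * q = of_real (cmod q)"
  proof -
    show "cmod a = 1" using q by (simp add: a_def norm_sgn)
    have "a * q = (q * cnj q) / of_real (cmod q)"
      by (simp add: a_def sgn_div_norm scaleR_conv_of_real divide_inverse mult_ac)
    also have "q * cnj q = of_real ((cmod q)\<^sup>2)"
      by (rule complex_norm_square[symmetric])
    finally show "a * q = of_real (cmod q)"
      using q by (simp add: power2_eq_square)
  qed
  have decomp: "(cmod (limit_error m \<theta> \<xi> (\<lambda>i. w (2, i))))\<^sup>2 =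
      (\<Sum>i\<in>{..m}. Re (\<beta> i * w (2, i)))\<^sup>2 + (\<Sum>i\<in>{m}. Re (- \<i> * a * w (2, i)))\<^sup>2" for w :: "nat \<times> nat \<Rightarrow> complex"
  proof -
    let ?\<tau> = "\<Sum>i<m. of_int (comb_coef m i) * Im (cis (- \<theta> i) * w (2, i) / \<xi> i)"
    have le: "limit_error m \<theta> \<xi> (\<lambda>i. w (2, i)) = w (2, m) + q * of_real ?\<tau>"
      by (simp add: limit_error_def q_def)
    have "a * limit_error m \<theta> \<xi> (\<lambda>i. w (2, i)) = a * w (2, m) + of_real (cmod q * ?\<tau>)"
      unfolding le distrib_left mult.assoc[symmetric] a(2) by simp
    moreover have "cmod (limit_error m \<theta> \<xi> (\<lambda>i. w (2, i))) = cmod (a * limit_error m \<theta> \<xi> (\<lambda>i. w (2, i)))"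
      using a by (simp add: norm_mult)
    ultimately have c: "(cmod (limit_error m \<theta> \<xi> (\<lambda>i. w (2, i))))\<^sup>2 = (Re (a * w (2, m)) + cmod q * ?\<tau>)\<^sup>2 + (Im (a * w (2, m)))\<^sup>2"
      by (simp only: cmod_power2 plus_complex.sel Re_complex_of_real Im_complex_of_real add_0_right)
    have "cmod q * ?\<tau> = (\<Sum>i<m. Re (\<beta> i * w (2, i)))"
      unfolding sum_distrib_left
    proof (intro sum.cong refl)
      fix i assume "i \<in> {..<m}"
      define z where "z = cis (- \<theta> i) * w (2, i) / \<xi> i"
      have "\<beta> i * w (2, i) = (cmod q * of_int (comb_coef m i)) *\<^sub>R (- \<i> * z)"
        using \<open>i \<in> {..<m}\<close> by (simp add: \<beta>_def z_def scaleR_conv_of_real)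
      then show "cmod q * (of_int (comb_coef m i) * Im (cis (- \<theta> i) * w (2, i) / \<xi> i)) = Re (\<beta> i * w (2, i))"
        unfolding z_def[symmetric] by simp
    qed
    then have "Re (a * w (2, m)) + cmod q * ?\<tau> = (\<Sum>i\<in>{..m}. Re (\<beta> i * w (2, i)))"
      unfolding lessThan_Suc_atMost[symmetric] sum.lessThan_Suc by (simp only: \<beta>_def[of m] if_True refl add.commute)
    then show ?thesis unfolding c by simp
  qed
  have norm: "(\<Sum>i\<in>{..m}. (cmod (\<beta> i))\<^sup>2) = limit_var m \<xi>"
  proof -
    have "(\<Sum>i<m. (cmod (\<beta> i))\<^sup>2) = (\<Sum>i<m. (cmod (\<xi> m))\<^sup>2 * ((of_int (comb_coef m i))\<^sup>2 / (cmod (\<xi> i))\<^sup>2))"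
      by (intro sum.cong refl) (auto simp: \<beta>_def norm_mult norm_divide q power_mult_distrib power_divide)
    then show ?thesis
      using a by (simp add: lessThan_Suc_atMost[symmetric] \<beta>_def limit_var_def spread_def sum_distrib_left)
  qed
  have comp[measurable]: "(\<lambda>w. w (2, i)) \<in> borel_measurable (additive_noise M)" if "i \<le> m" for i
  proof -
    have "(2::nat, i) \<in> {1..} \<times> {..<M}" using that M by auto
    from measurable_component_singleton[OF this, of "\<lambda>_. std_complex_normal"] show ?thesis
      by (simp cong: measurable_cong_sets)
  qed
  have m1: "(\<lambda>w. ennreal ((\<Sum>i\<in>{..m}. Re (\<beta> i * w (2, i)))\<^sup>2)) \<in> borel_measurable (additive_noise M)"
    by (intro measurable_compose[OF _ measurable_ennreal] borel_measurable_power borel_measurable_sum) measurable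
  have m2: "(\<lambda>w. ennreal ((\<Sum>i\<in>{m}. Re (- \<i> * a * w (2, i)))\<^sup>2)) \<in> borel_measurable (additive_noise M)"
    by (intro measurable_compose[OF _ measurable_ennreal] borel_measurable_power borel_measurable_sum) measurable
  have "(\<integral>\<^sup>+w. ennreal ((cmod (limit_error m \<theta> \<xi> (\<lambda>i. w (2, i))))\<^sup>2) \<partial>additive_noise M) =
      (\<integral>\<^sup>+w. ennreal ((\<Sum>i\<in>{..m}. Re (\<beta> i * w (2, i)))\<^sup>2) \<partial>additive_noise M) +
      (\<integral>\<^sup>+w. ennreal ((\<Sum>i\<in>{m}. Re (- \<i> * a * w (2, i)))\<^sup>2) \<partial>additive_noise M)"
    unfolding decomp by (subst nn_integral_add[symmetric, OF m1 m2]) (simp only: ennreal_plus zero_le_power2)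
  also have "(\<integral>\<^sup>+w. ennreal ((\<Sum>i\<in>{..m}. Re (\<beta> i * w (2, i)))\<^sup>2) \<partial>additive_noise M) = ennreal ((\<Sum>i\<in>{..m}. (cmod (\<beta> i))\<^sup>2) / 2)"
    using M by (intro nn_integral_quadratic_form) auto
  also have "(\<integral>\<^sup>+w. ennreal ((\<Sum>i\<in>{m}. Re (- \<i> * a * w (2, i)))\<^sup>2) \<partial>additive_noise M) = ennreal ((\<Sum>i\<in>{m}. (cmod (- \<i> * a))\<^sup>2) / 2)"
    using M by (intro nn_integral_quadratic_form) auto
  also have "ennreal ((\<Sum>i\<in>{..m}. (cmod (\<beta> i))\<^sup>2) / 2) + ennreal ((\<Sum>i\<in>{m}. (cmod (- \<i> * a))\<^sup>2) / 2) =
      ennreal (limit_var m \<xi> / 2 + 1 / 2)"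
    unfolding norm using a limit_var_ge_1[of m \<xi>] by (subst ennreal_plus[symmetric]) (auto simp: norm_mult)
  also have "\<dots> \<le> ennreal (limit_var m \<xi>)"
    using limit_var_ge_1[of m \<xi>] by (intro ennreal_leI) simp
  finally show ?thesis .
qed

lemma cis_comb_phase: "cis (comb_phase \<omega> k m) = cis (phase (fst \<omega>) k + real m * phase (fst (snd \<omega>)) k)"
  by (simp add: comb_phase_def split_beta')

text \<open>The squared coefficients, 4 and 1 for \<open>m = 2\<close> and three ones otherwise, are
  the weights that appear in \<open>g_hsnr\<close>.\<close>

lemma sum_comb_coef:
  fixes f :: "nat \<Rightarrow> real"
  assumes "m \<ge> 2"
  shows "(\<Sum>i<m. of_int (comb_coef m i) * f i) =
    (if m = 2 then 2 * f 1 - f 0 else f (m - 1) + f (m - 2) - f (m - 3))"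
    and "(\<Sum>i<m. (of_int (comb_coef m i))\<^sup>2 * f i) =
    (if m = 2 then 4 * f 1 + f 0 else f (m - 1) + f (m - 2) + f (m - 3))"
proof -
  have *: "(\<Sum>i<m. of_int (comb_coef m i) * f i) =
    (if m = 2 then 2 * f 1 - f 0 else f (m - 1) + f (m - 2) - f (m - 3)) \<and>
    (\<Sum>i<m. (of_int (comb_coef m i))\<^sup>2 * f i) =
    (if m = 2 then 4 * f 1 + f 0 else f (m - 1) + f (m - 2) + f (m - 3))"
  proof (cases "m = 2")
    case True
    have "{..<2::nat} = {0, 1}" by auto
    then show ?thesis using True by (simp add: comb_coef_def)
  next
    case False
    define n where "n = m - 3"
    have m: "m = n + 3" using False assms by (simp add: n_def)
    have sub: "{n, n + 1, n + 2} \<subseteq> {..<m}" using m by auto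
    have "(\<Sum>i<m. of_int (comb_coef m i) * f i) = (\<Sum>i\<in>{n, n + 1, n + 2}. of_int (comb_coef m i) * f i)"
      by (rule sum.mono_neutral_right[OF _ sub]) (auto simp: comb_coef_def m)
    moreover have "(\<Sum>i<m. (of_int (comb_coef m i))\<^sup>2 * f i) = (\<Sum>i\<in>{n, n + 1, n + 2}. (of_int (comb_coef m i))\<^sup>2 * f i)"
      by (rule sum.mono_neutral_right[OF _ sub]) (auto simp: comb_coef_def m)
    ultimately show ?thesis
      using False by (simp add: comb_coef_def m)
  qed
  show "(\<Sum>i<m. of_int (comb_coef m i) * f i) =
    (if m = 2 then 2 * f 1 - f 0 else f (m - 1) + f (m - 2) - f (m - 3))" using * by blast
  show "(\<Sum>i<m. (of_int (comb_coef m i))\<^sup>2 * f i) =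
    (if m = 2 then 4 * f 1 + f 0 else f (m - 1) + f (m - 2) + f (m - 3))" using * by blast
qed

text \<open>\<open>comb_phase\<close> is already reduced modulo the period, so affinity in the index
  holds only after applying \<open>cis\<close>; integrality of the coefficients lets the reduction
  pass through the sum.\<close>

lemma comb_phase_prediction:
  assumes "m \<ge> 2"
  shows "cis (comb_phase \<omega> k m) = cis (\<Sum>i<m. of_int (comb_coef m i) * comb_phase \<omega> k i)"
proof -
  let ?p = "phase (fst \<omega>) k" and ?q = "phase (fst (snd \<omega>)) k"
  have "cis (\<Sum>i<m. of_int (comb_coef m i) * comb_phase \<omega> k i) = cis (\<Sum>i<m. of_int (comb_coef m i) * (?p + real i * ?q))"
    by (rule cis_sum_cong) (rule cis_comb_phase)
  also have "(\<Sum>i<m. of_int (comb_coef m i) * (?p + real i * ?q)) = ?p + real m * ?q"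
    unfolding sum_comb_coef(1)[OF assms] using assms by (auto simp: of_nat_diff algebra_simps numeral_3_eq_3 not_less_eq_eq)
  finally show ?thesis by (simp add: cis_comb_phase)
qed

section \<open>One probability space for all powers\<close>

locale comb_channel =
  fixes M :: nat and \<sigma>\<^sub>c \<sigma>\<^sub>r :: real
  assumes M: "M \<ge> 2" and \<sigma>: "\<sigma>\<^sub>c > 0" "\<sigma>\<^sub>r > 0"
begin

abbreviation N where "N \<equiv> noise_space M \<sigma>\<^sub>c \<sigma>\<^sub>r"
abbreviation \<Omega> where "\<Omega> \<equiv> blocks_law M 2 \<Otimes>\<^sub>M N"

text \<open>Written on the unscaled input with \<open>s\<close> as a parameter, so that all powers
  share the space \<open>\<Omega>\<close> and dominated convergence applies. Block 2 is the scored
  block and block 1 its phase reference.\<close>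

definition score :: "real \<Rightarrow> nat \<Rightarrow> (nat \<Rightarrow> nat \<Rightarrow> complex) \<times> noise \<Rightarrow> real" where
  "score s m z = symbol_score \<sigma>\<^sub>c \<sigma>\<^sub>r s
     (sent (fst z 1) s) (received (comb_phase (snd z) 1) (fst z 1) (comb_additive (snd z) 1) s)
     (sent (fst z 2) s) (received (comb_phase (snd z) 2) (fst z 2) (comb_additive (snd z) 2) s) m"

lemma prob_space_N: "prob_space N"
  by (rule prob_space_noise_space[OF \<sigma>])

sublocale B: prob_space "blocks_law M 2"
  by (rule prob_space_blocks_law)

sublocale N: prob_space N
  by (rule prob_space_N)

sublocale \<Omega>: pair_prob_space "blocks_law M 2" N ..

lemma block_score_scale_blocks:
  "block_score M \<sigma>\<^sub>c \<sigma>\<^sub>r s (scale_blocks M 2 s \<xi>) (comb_output M 2 (scale_blocks M 2 s \<xi>) \<omega>) 2 =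
    (\<Sum>m<M. score s m (\<xi>, \<omega>))"
  unfolding block_score_def score_def
  by (intro sum.cong refl symbol_score_cong)
    (auto simp: scale_blocks_def sent_def received_def comb_output_def cis_conv_exp)

lemma measurable_fst_component:
  assumes "k \<in> {1, 2}" "i < M"
  shows "(\<lambda>z. fst z k i) \<in> borel_measurable \<Omega>"
proof -
  have "(\<lambda>x. x k i) \<in> borel_measurable (blocks_law M 2)"
    using measurable_block_component[of k 2 i M] assms by (auto cong: measurable_cong_sets)
  from measurable_compose[OF measurable_fst this] show ?thesis .
qed

lemma measurable_snd_component:
  assumes "k \<in> {1, 2}" "i < M"
  shows "(\<lambda>z. comb_additive (snd z) k i) \<in> borel_measurable \<Omega>"
proof -
  have "(\<lambda>\<omega>. comb_additive \<omega> k i) \<in> borel_measurable N"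
    using assms by (intro measurable_comb_additive) auto
  from measurable_compose[OF measurable_snd this] show ?thesis .
qed

lemma measurable_phase_component: "(\<lambda>z. comb_phase (snd z) k i) \<in> borel_measurable \<Omega>"
  by measurable

lemma measurable_score [measurable]:
  assumes "m < M"
  shows "score s m \<in> borel_measurable \<Omega>"
proof -
  have 1: "(\<lambda>z. sent (fst z k) s i) \<in> borel_measurable \<Omega>" if "k \<in> {1, 2}" "i \<le> m" for k i
    unfolding sent_def using that assms
    by (intro borel_measurable_times borel_measurable_const measurable_fst_component) auto
  have 2: "(\<lambda>z. received (comb_phase (snd z) k) (fst z k) (comb_additive (snd z) k) s i) \<in> borel_measurable \<Omega>"
    if "k \<in> {1, 2}" "i \<le> m" for k i
    unfolding received_def using that assms
    by (intro borel_measurable_add borel_measurable_times borel_measurable_const measurable_compose[OF _ measurable_cis]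
        measurable_fst_component measurable_snd_component measurable_phase_component) auto
  show ?thesis
    unfolding score_def by (intro measurable_symbol_score 1 2) auto
qed

lemma distr_fst_component:
  assumes "k \<in> {1, 2}" "i < M"
  shows "distr \<Omega> borel (\<lambda>z. fst z k i) = symbol_law i"
proof -
  have m: "(\<lambda>x. x k i) \<in> borel_measurable (blocks_law M 2)"
    using measurable_block_component[of k 2 i M] assms by (auto cong: measurable_cong_sets)
  have "distr \<Omega> borel (\<lambda>z. fst z k i) = distr (distr \<Omega> (blocks_law M 2) fst) borel (\<lambda>x. x k i)"
    using m by (subst distr_distr) (auto simp: comp_def)
  then show ?thesis
    using assms distr_blocks_law_component[of k 2 i M] by (auto simp: N.distr_pair_fst)
qed

lemma distr_snd_component:
  assumes "k \<in> {1, 2}" "i < M"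
  shows "distr \<Omega> borel (\<lambda>z. comb_additive (snd z) k i) = std_complex_normal"
proof -
  have m: "(\<lambda>\<omega>. comb_additive \<omega> k i) \<in> borel_measurable N"
    using assms by (intro measurable_comb_additive) auto
  have "distr \<Omega> borel (\<lambda>z. comb_additive (snd z) k i) = distr (distr \<Omega> N snd) borel (\<lambda>\<omega>. comb_additive \<omega> k i)"
    using m by (subst distr_distr) (auto simp: comp_def)
  also have "\<dots> = distr N borel (\<lambda>\<omega>. comb_additive \<omega> k i)"
    by (simp only: distr_pair_snd[OF B.prob_space_axioms N.prob_space_axioms])
  also have "\<dots> = std_complex_normal"
    using assms by (intro distr_comb_additive \<sigma>) auto
  finally show ?thesis .
qed

lemma integrable_fst_component:
  assumes "k \<in> {1, 2}" "i < M" "f \<in> borel_measurable borel" "integrable (symbol_law i) f"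
  shows "integrable \<Omega> (\<lambda>z. f (fst z k i) :: real)"
  using integrable_distr_eq[OF measurable_fst_component[OF assms(1,2)] assms(3)] assms(4)
  unfolding distr_fst_component[OF assms(1,2)] by simp

lemma integral_fst_component:
  assumes "k \<in> {1, 2}" "i < M" "f \<in> borel_measurable borel"
  shows "(\<integral>z. f (fst z k i) \<partial>\<Omega>) = (\<integral>x. f x \<partial>symbol_law i :: real)"
  using integral_distr[OF measurable_fst_component[OF assms(1,2)] assms(3)]
  unfolding distr_fst_component[OF assms(1,2)] by simp

lemma integrable_snd_component:
  assumes "k \<in> {1, 2}" "i < M" "f \<in> borel_measurable borel" "integrable std_complex_normal f"
  shows "integrable \<Omega> (\<lambda>z. f (comb_additive (snd z) k i) :: real)"
  using integrable_distr_eq[OF measurable_snd_component[OF assms(1,2)] assms(3)] assms(4)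
  unfolding distr_snd_component[OF assms(1,2)] by simp

lemma integrable_cmod2_fst: "i < M \<Longrightarrow> integrable \<Omega> (\<lambda>z. (cmod (fst z 2 i))\<^sup>2)"
  and integral_cmod2_fst: "i < M \<Longrightarrow> (\<integral>z. (cmod (fst z 2 i))\<^sup>2 \<partial>\<Omega>) = alpha_star i"
  using integrable_fst_component[of 2 i "\<lambda>x. (cmod x)\<^sup>2"] integral_fst_component[of 2 i "\<lambda>x. (cmod x)\<^sup>2"]
    has_bochner_integral_symbol_law_power2[of i]
  by (auto simp: has_bochner_integral_iff)

lemma integrable_cmod2_snd: "i < M \<Longrightarrow> integrable \<Omega> (\<lambda>z. (cmod (comb_additive (snd z) 2 i))\<^sup>2)"
  using integrable_snd_component[of 2 i "\<lambda>x. (cmod x)\<^sup>2"] has_bochner_integral_cmod_power2_std_complex_normal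
  by (auto simp: has_bochner_integral_iff)

lemma integrable_cmod4_snd: "i < M \<Longrightarrow> integrable \<Omega> (\<lambda>z. (cmod (comb_additive (snd z) 2 i)) ^ 4)"
  using integrable_snd_component[of 2 i "\<lambda>x. (cmod x) ^ 4"] integrable_cmod_power4_std_complex_normal
  by auto

lemma AE_fst_nonzero: "AE z in \<Omega>. \<forall>k\<in>{1, 2}. \<forall>i\<in>{..<M}. fst z k i \<noteq> 0"
proof (intro AE_finite_allI)
  fix k :: nat and i assume ki: "k \<in> {1, 2}" "i \<in> {..<M}"
  have "AE x in distr \<Omega> borel (\<lambda>z. fst z k i). x \<noteq> 0"
    using ki AE_symbol_law_nonzero by (simp only: distr_fst_component lessThan_iff)
  then show "AE z in \<Omega>. fst z k i \<noteq> 0"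
    using measurable_fst_component[of k i] ki by (subst (asm) AE_distr_iff) auto
qed auto

lemma nn_integral_\<Omega>:
  assumes h: "h \<in> borel_measurable \<Omega>"
  shows "(\<integral>\<^sup>+z. h z \<partial>\<Omega>) = (\<integral>\<^sup>+x. \<integral>\<^sup>+s. \<integral>\<^sup>+r. \<integral>\<^sup>+w. h (x, s, r, w) \<partial>additive_noise M \<partial>phase_source \<sigma>\<^sub>r
    \<partial>phase_source \<sigma>\<^sub>c \<partial>blocks_law M 2)"
proof -
  interpret R: prob_space "phase_source \<sigma>\<^sub>r" by (rule prob_space_phase_source[OF \<sigma>(2)])
  interpret W: prob_space "additive_noise M" by (rule prob_space_additive_noise)
  interpret RW: pair_prob_space "phase_source \<sigma>\<^sub>r" "additive_noise M" ..
  have "(\<integral>\<^sup>+z. h z \<partial>\<Omega>) = (\<integral>\<^sup>+x. \<integral>\<^sup>+\<omega>. h (x, \<omega>) \<partial>N \<partial>blocks_law M 2)"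
    by (rule N.nn_integral_fst[OF h, symmetric])
  also have "\<dots> = (\<integral>\<^sup>+x. \<integral>\<^sup>+s. \<integral>\<^sup>+r. \<integral>\<^sup>+w. h (x, s, r, w) \<partial>additive_noise M \<partial>phase_source \<sigma>\<^sub>r
    \<partial>phase_source \<sigma>\<^sub>c \<partial>blocks_law M 2)"
  proof (intro nn_integral_cong)
    fix x assume x: "x \<in> space (blocks_law M 2)"
    have hx: "(\<lambda>\<omega>. h (x, \<omega>)) \<in> borel_measurable (phase_source \<sigma>\<^sub>c \<Otimes>\<^sub>M phase_source \<sigma>\<^sub>r \<Otimes>\<^sub>M additive_noise M)"
      using measurable_compose[OF measurable_Pair1'[OF x] h] unfolding noise_space_alt by simp
    have "(\<integral>\<^sup>+\<omega>. h (x, \<omega>) \<partial>N) = (\<integral>\<^sup>+s. \<integral>\<^sup>+z. h (x, s, z) \<partial>(phase_source \<sigma>\<^sub>r \<Otimes>\<^sub>M additive_noise M) \<partial>phase_source \<sigma>\<^sub>c)"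
      unfolding noise_space_alt by (rule RW.nn_integral_fst[OF hx, symmetric])
    also have "\<dots> = (\<integral>\<^sup>+s. \<integral>\<^sup>+r. \<integral>\<^sup>+w. h (x, s, r, w) \<partial>additive_noise M \<partial>phase_source \<sigma>\<^sub>r \<partial>phase_source \<sigma>\<^sub>c)"
    proof (intro nn_integral_cong W.nn_integral_fst[symmetric])
      fix s assume "s \<in> space (phase_source \<sigma>\<^sub>c)"
      from measurable_compose[OF measurable_Pair1'[OF this] hx]
      show "(\<lambda>z. h (x, s, z)) \<in> borel_measurable (phase_source \<sigma>\<^sub>r \<Otimes>\<^sub>M additive_noise M)" .
    qed
    finally show "(\<integral>\<^sup>+\<omega>. h (x, \<omega>) \<partial>N) = (\<integral>\<^sup>+s. \<integral>\<^sup>+r. \<integral>\<^sup>+w. h (x, s, r, w) \<partial>additive_noise M \<partial>phase_source \<sigma>\<^sub>r \<partial>phase_source \<sigma>\<^sub>c)" .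
  qed
  finally show ?thesis .
qed

text \<open>Integrates over the additive noise first, with input and phases frozen; it is enough
  that the inner bound holds uniformly in the phases.\<close>

lemma nn_integral_\<Omega>_le:
  assumes h: "h \<in> borel_measurable \<Omega>"
    and le: "AE x in blocks_law M 2. \<forall>s r. (\<integral>\<^sup>+w. h (x, s, r, w) \<partial>additive_noise M) \<le> c"
  shows "(\<integral>\<^sup>+z. h z \<partial>\<Omega>) \<le> c"
proof -
  interpret R: prob_space "phase_source \<sigma>\<^sub>r" by (rule prob_space_phase_source[OF \<sigma>(2)])
  interpret C: prob_space "phase_source \<sigma>\<^sub>c" by (rule prob_space_phase_source[OF \<sigma>(1)])
  have "(\<integral>\<^sup>+z. h z \<partial>\<Omega>) \<le> (\<integral>\<^sup>+x. \<integral>\<^sup>+s. \<integral>\<^sup>+r. c \<partial>phase_source \<sigma>\<^sub>r \<partial>phase_source \<sigma>\<^sub>c \<partial>blocks_law M 2)"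
    unfolding nn_integral_\<Omega>[OF h]
  proof (intro nn_integral_mono_AE, use le in eventually_elim)
    fix x assume "\<forall>s r. (\<integral>\<^sup>+w. h (x, s, r, w) \<partial>additive_noise M) \<le> c"
    then show "(\<integral>\<^sup>+s. \<integral>\<^sup>+r. \<integral>\<^sup>+w. h (x, s, r, w) \<partial>additive_noise M \<partial>phase_source \<sigma>\<^sub>r \<partial>phase_source \<sigma>\<^sub>c) \<le>
        (\<integral>\<^sup>+s. \<integral>\<^sup>+r. c \<partial>phase_source \<sigma>\<^sub>r \<partial>phase_source \<sigma>\<^sub>c)"
      by (intro nn_integral_mono) blast
  qed
  also have "\<dots> = c"
    using R.emeasure_space_1 C.emeasure_space_1 B.emeasure_space_1 by simp
  finally show ?thesis .
qed

lemma AE_blocks_nonzero: "AE x in blocks_law M 2. \<forall>i\<in>{..<M}. x 2 i \<noteq> 0"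
proof (intro AE_finite_allI)
  fix i assume i: "i \<in> {..<M}"
  have m: "(\<lambda>x. x 2 i) \<in> borel_measurable (blocks_law M 2)"
    using measurable_block_component[of 2 2 i M] i by (auto cong: measurable_cong_sets)
  have "AE x in distr (blocks_law M 2) borel (\<lambda>x. x 2 i). x \<noteq> 0"
    using i AE_symbol_law_nonzero by (subst distr_blocks_law_component) auto
  then show "AE x in blocks_law M 2. x 2 i \<noteq> 0"
    using m by (subst (asm) AE_distr_iff) auto
qed auto

section \<open>The symbols carrying the phase increments\<close>

text \<open>Index 2 is the step from block 1 to block 2; \<open>m = 0\<close> selects the centre
  process and any other value the rate process.\<close>

definition increment :: "nat \<Rightarrow> (nat \<Rightarrow> nat \<Rightarrow> complex) \<times> noise \<Rightarrow> real" where
  "increment m z = (if m = 0 then snd (fst (snd z)) 2 else snd (fst (snd (snd z))) 2)"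

definition dev :: "nat \<Rightarrow> real" where
  "dev m = (if m = 0 then \<sigma>\<^sub>c else \<sigma>\<^sub>r)"

lemma dev_pos: "dev m > 0"
  using \<sigma> by (simp add: dev_def)

lemma distr_phase_source_increment:
  assumes "\<sigma>' > 0"
  shows "distr (phase_source \<sigma>') borel (\<lambda>s. snd s 2) = wrapped_normal \<sigma>'"
proof -
  have m: "(\<lambda>w. w 2) \<in> borel_measurable (increments \<sigma>')"
    using measurable_component_singleton[of 2 "{1::nat..}" "\<lambda>_. wrapped_normal \<sigma>'"] by (simp cong: measurable_cong_sets)
  have "distr (phase_source \<sigma>') borel (\<lambda>s. snd s 2) = distr (distr (phase_source \<sigma>') (increments \<sigma>') snd) borel (\<lambda>w. w 2)"
    using m by (subst distr_distr) (auto simp: comp_def phase_source_def)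
  also have "\<dots> = distr (increments \<sigma>') borel (\<lambda>w. w 2)"
    unfolding phase_source_def
    by (simp only: distr_pair_snd[OF prob_space_uniform_phase prob_space_increments[OF assms]])
  also have "\<dots> = distr (increments \<sigma>') (wrapped_normal \<sigma>') (\<lambda>w. w 2)"
    by (intro distr_cong) auto
  also have "\<dots> = wrapped_normal \<sigma>'"
    using assms by (intro distr_PiM_component prob_space_wrapped_normal) auto
  finally show ?thesis .
qed

lemma measurable_increment: "increment m \<in> borel_measurable \<Omega>"
proof -
  have [measurable]: "(\<lambda>s. snd s 2) \<in> borel_measurable (phase_source \<sigma>')" for \<sigma>'
    by (rule measurable_snd_phase_source) simp
  show ?thesis
    unfolding increment_def noise_space_alt by (cases "m = 0") auto
qed

lemma distr_increment: "distr \<Omega> borel (increment m) = wrapped_normal (dev m)"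
proof -
  interpret R: prob_space "phase_source \<sigma>\<^sub>r" by (rule prob_space_phase_source[OF \<sigma>(2)])
  interpret C: prob_space "phase_source \<sigma>\<^sub>c" by (rule prob_space_phase_source[OF \<sigma>(1)])
  interpret W: prob_space "additive_noise M" by (rule prob_space_additive_noise)
  interpret RW: pair_prob_space "phase_source \<sigma>\<^sub>r" "additive_noise M" ..
  have m[measurable]: "(\<lambda>s. snd s 2) \<in> borel_measurable (phase_source \<sigma>')" for \<sigma>'
    by (rule measurable_snd_phase_source) simp
  have snd_eq: "distr \<Omega> N snd = N"
    by (rule distr_pair_snd[OF B.prob_space_axioms N.prob_space_axioms])
  have c: "distr N (phase_source \<sigma>\<^sub>c) fst = phase_source \<sigma>\<^sub>c"
    unfolding noise_space_alt by (rule RW.distr_pair_fst)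
  have r: "distr (distr N (phase_source \<sigma>\<^sub>r \<Otimes>\<^sub>M additive_noise M) snd) (phase_source \<sigma>\<^sub>r) fst = phase_source \<sigma>\<^sub>r"
    unfolding noise_space_alt
    by (simp only: distr_pair_snd[OF C.prob_space_axioms RW.prob_space_axioms] W.distr_pair_fst)
  have fstm[measurable]: "fst \<in> measurable N (phase_source \<sigma>\<^sub>c)" "snd \<in> measurable N (phase_source \<sigma>\<^sub>r \<Otimes>\<^sub>M additive_noise M)"
    unfolding noise_space_alt by auto
  show ?thesis
  proof (cases "m = 0")
    case True
    have "distr \<Omega> borel (increment m) = distr (distr (distr \<Omega> N snd) (phase_source \<sigma>\<^sub>c) fst) borel (\<lambda>s. snd s 2)"
      using True by (simp add: distr_distr comp_def increment_def[abs_def])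
    then show ?thesis
      using True by (simp add: snd_eq c distr_phase_source_increment \<sigma> dev_def)
  next
    case False
    have m3: "(\<lambda>z. snd (fst z) 2) \<in> borel_measurable (phase_source \<sigma>\<^sub>r \<Otimes>\<^sub>M additive_noise M)"
      by (rule measurable_compose[OF measurable_fst m])
    have m4: "(\<lambda>\<omega>. snd (fst (snd \<omega>)) 2) \<in> borel_measurable N"
      by (rule measurable_compose[OF fstm(2) m3])
    have "distr \<Omega> borel (increment m) = distr (distr \<Omega> N snd) borel (\<lambda>\<omega>. snd (fst (snd \<omega>)) 2)"
      using False by (subst distr_distr[OF m4]) (simp_all add: comp_def increment_def[abs_def])
    also have "\<dots> = distr (distr N (phase_source \<sigma>\<^sub>r \<Otimes>\<^sub>M additive_noise M) snd) borel (\<lambda>z. snd (fst z) 2)"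
      unfolding snd_eq by (subst distr_distr[OF m3 fstm(2)]) (simp add: comp_def)
    also have "\<dots> = distr (distr (distr N (phase_source \<sigma>\<^sub>r \<Otimes>\<^sub>M additive_noise M) snd) (phase_source \<sigma>\<^sub>r) fst) borel (\<lambda>s. snd s 2)"
      by (subst distr_distr[OF m]) (simp_all add: comp_def)
    finally show ?thesis
      using False by (simp only: r distr_phase_source_increment[OF \<sigma>(2)]) (simp add: dev_def)
  qed
qed

lemma cis_phase_Suc: "cis (phase s (Suc k)) = cis (phase s k + snd s (Suc k))"
  by (simp add: circ_add_def add.commute)

lemma cis_phase_2: "cis (phase s 2) = cis (phase s 1 + snd s 2)"
  using cis_phase_Suc[of s 1] by (simp add: numeral_2_eq_2)

definition phase_arg :: "real \<Rightarrow> nat \<Rightarrow> (nat \<Rightarrow> nat \<Rightarrow> complex) \<times> noise \<Rightarrow> real" where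
  "phase_arg s m z =
    (let p' = obs_phase (sent (fst z 1) s) (received (comb_phase (snd z) 1) (fst z 1) (comb_additive (snd z) 1) s);
         p = obs_phase (sent (fst z 2) s) (received (comb_phase (snd z) 2) (fst z 2) (comb_additive (snd z) 2) s)
     in if m = 0 then p 0 - p' 0 else p 1 - p 0 - p' 1 + p' 0)"

text \<open>Written multiplicatively through \<open>cis\<close>, the phases of the reference block
  cancel, and what remains is the increment and a combination of phase errors that tends to
  0.\<close>

lemma tendsto_phase_arg:
  assumes m: "m < 2" and nz: "\<forall>k\<in>{1, 2}. \<forall>i\<in>{..<M}. fst z k i \<noteq> 0"
    and \<delta>: "- pi < increment m z" "increment m z < pi"
  shows "((\<lambda>s. phase_score (dev m) (phase_arg s m z)) \<longlongrightarrow> ln (2 * pi * wrapped_normal_density (dev m) (increment m z))) at_top"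
proof -
  let ?e = "\<lambda>k i s. phase_error (comb_phase (snd z) k) (fst z k) (comb_additive (snd z) k) s i"
  let ?o = "\<lambda>k i s. obs_phase (sent (fst z k) s) (received (comb_phase (snd z) k) (fst z k) (comb_additive (snd z) k) s) i"
  have ev: "\<forall>\<^sub>F s in at_top. cis (?o k i s) = cis (comb_phase (snd z) k i + ?e k i s)" if "k \<in> {1, 2}" "i < M" for k i
    using nz that by (intro eventually_cis_obs_phase) auto
  have e0: "((\<lambda>s. ?e k i s) \<longlongrightarrow> 0) at_top" for k i
    by (rule tendsto_phase_error_0)
  define E where "E s = (if m = 0 then ?e 2 0 s - ?e 1 0 s else ?e 2 1 s - ?e 2 0 s - ?e 1 1 s + ?e 1 0 s)" for s
  have E: "(E \<longlongrightarrow> 0) at_top"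
  proof -
    have "((\<lambda>s. ?e 2 0 s - ?e 1 0 s) \<longlongrightarrow> 0 - 0) at_top"
      "((\<lambda>s. ?e 2 1 s - ?e 2 0 s - ?e 1 1 s + ?e 1 0 s) \<longlongrightarrow> 0 - 0 - 0 + 0) at_top"
      by (intro tendsto_intros e0)+
    then show ?thesis unfolding E_def[abs_def] by (cases "m = 0") simp_all
  qed
  let ?c = "fst (snd z)" and ?r = "fst (snd (snd z))"
  have cp: "cis (comb_phase (snd z) k i) = cis (phase ?c k) * cis (real i * phase ?r k)" for k i
    by (simp add: cis_comb_phase cis_mult)
  \<comment> \<open>The product form hides the reduction modulo the period in the phase
    recursion.\<close>
  have ph2: "cis (phase ?c 2) = cis (phase ?c 1) * cis (snd ?c 2)" "cis (phase ?r 2) = cis (phase ?r 1) * cis (snd ?r 2)"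
    by (simp_all only: cis_phase_2 cis_mult)
  have nzc: "cis t \<noteq> 0" for t by simp
  have "\<forall>\<^sub>F s in at_top. cis (phase_arg s m z) = cis (increment m z + E s)"
  proof (cases "m = 0")
    case True
    have "\<forall>\<^sub>F s in at_top. cis (?o 2 0 s) = cis (comb_phase (snd z) 2 0 + ?e 2 0 s)"
      "\<forall>\<^sub>F s in at_top. cis (?o 1 0 s) = cis (comb_phase (snd z) 1 0 + ?e 1 0 s)"
      using M by (auto intro!: ev)
    then show ?thesis
    proof eventually_elim
      case (elim s)
      have "cis (phase_arg s m z) = cis (?o 2 0 s) / cis (?o 1 0 s)"
        using True by (simp add: phase_arg_def Let_def cis_divide)
      also have "\<dots> = (cis (comb_phase (snd z) 2 0) * cis (?e 2 0 s)) / (cis (comb_phase (snd z) 1 0) * cis (?e 1 0 s))"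
        unfolding elim cis_mult ..
      also have "\<dots> = cis (snd ?c 2) * (cis (?e 2 0 s) / cis (?e 1 0 s))"
        unfolding cp ph2 by simp
      finally show ?case
        using True by (simp add: increment_def E_def cis_divide cis_mult)
    qed
  next
    case False
    have "\<forall>\<^sub>F s in at_top. cis (?o 2 1 s) = cis (comb_phase (snd z) 2 1 + ?e 2 1 s)"
      "\<forall>\<^sub>F s in at_top. cis (?o 2 0 s) = cis (comb_phase (snd z) 2 0 + ?e 2 0 s)"
      "\<forall>\<^sub>F s in at_top. cis (?o 1 1 s) = cis (comb_phase (snd z) 1 1 + ?e 1 1 s)"
      "\<forall>\<^sub>F s in at_top. cis (?o 1 0 s) = cis (comb_phase (snd z) 1 0 + ?e 1 0 s)"
      using M by (auto intro!: ev)
    then show ?thesis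
    proof eventually_elim
      case (elim s)
      have "cis (phase_arg s m z) = cis (?o 2 1 s) / cis (?o 2 0 s) / cis (?o 1 1 s) * cis (?o 1 0 s)"
        using False by (simp add: phase_arg_def Let_def cis_divide cis_mult)
      also have "\<dots> = (cis (comb_phase (snd z) 2 1) * cis (?e 2 1 s)) / (cis (comb_phase (snd z) 2 0) * cis (?e 2 0 s)) /
          (cis (comb_phase (snd z) 1 1) * cis (?e 1 1 s)) * (cis (comb_phase (snd z) 1 0) * cis (?e 1 0 s))"
        unfolding elim cis_mult ..
      also have "\<dots> = cis (snd ?r 2) * (cis (?e 2 1 s) / cis (?e 2 0 s) / cis (?e 1 1 s) * cis (?e 1 0 s))"
        unfolding cp of_nat_0 of_nat_1 mult_1 mult_zero_left ph2 by (simp add: field_simps)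
      finally show ?case
        using False by (simp add: increment_def E_def cis_divide cis_mult)
    qed
  qed
  then show ?thesis
    by (rule tendsto_phase_score[OF dev_pos \<delta> E])
qed

lemma score_eq_amp_phase:
  assumes "m < 2"
  shows "score s m z = amp_score s (cmod (sent (fst z 2) s m))
      (cmod (received (comb_phase (snd z) 2) (fst z 2) (comb_additive (snd z) 2) s m)) +
    phase_score (dev m) (phase_arg s m z)"
proof -
  have "m = 0 \<or> m = 1" using assms by auto
  then show ?thesis
    by (auto simp: score_def symbol_score_def phase_arg_def Let_def dev_def)
qed

text \<open>The squared radial component of the additive noise, which is the limit of the squared
  modulus deviation in \<open>amp_score\<close>.\<close>

definition amp_noise :: "nat \<Rightarrow> (nat \<Rightarrow> nat \<Rightarrow> complex) \<times> noise \<Rightarrow> real" where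
  "amp_noise m z = (Re (cnj (sgn (cis (comb_phase (snd z) 2 m) * fst z 2 m)) * comb_additive (snd z) 2 m))\<^sup>2"

lemma measurable_amp_noise:
  assumes "m < M"
  shows "amp_noise m \<in> borel_measurable \<Omega>"
proof -
  have [measurable]: "(\<lambda>z. fst z 2 m) \<in> borel_measurable \<Omega>" "(\<lambda>z. comb_additive (snd z) 2 m) \<in> borel_measurable \<Omega>"
    using assms by (auto intro: measurable_fst_component measurable_snd_component)
  have [measurable]: "(sgn :: complex \<Rightarrow> complex) \<in> borel_measurable borel"
    unfolding sgn_div_norm[abs_def] by measurable
  have [measurable]: "cnj \<in> borel_measurable borel"
    by (intro borel_measurable_continuous_onI continuous_intros)
  show ?thesis
    unfolding amp_noise_def by measurable
qed

lemma nn_integral_amp_noise: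
  assumes m: "m < M"
  shows "(\<integral>\<^sup>+z. ennreal (amp_noise m z) \<partial>\<Omega>) \<le> ennreal (1 / 2)"
proof (rule nn_integral_\<Omega>_le)
  show "(\<lambda>z. ennreal (amp_noise m z)) \<in> borel_measurable \<Omega>"
    using measurable_amp_noise[OF m] by measurable
  show "AE x in blocks_law M 2. \<forall>s r. (\<integral>\<^sup>+w. ennreal (amp_noise m (x, s, r, w)) \<partial>additive_noise M) \<le> ennreal (1 / 2)"
    using AE_blocks_nonzero
  proof eventually_elim
    case (elim x)
    show ?case
    proof (intro allI)
      fix s r
      let ?a = "cnj (sgn (cis (comb_phase (s, r, undefined) 2 m) * x 2 m))"
      have "cmod ?a = 1"
        using elim m by (simp add: norm_sgn)
      moreover have "amp_noise m (x, s, r, w) = (\<Sum>i\<in>{m}. Re (?a * w (2, i)))\<^sup>2" for w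
        by (simp add: amp_noise_def comb_additive_def comb_phase_def)
      ultimately show "(\<integral>\<^sup>+w. ennreal (amp_noise m (x, s, r, w)) \<partial>additive_noise M) \<le> ennreal (1 / 2)"
        using nn_integral_quadratic_form[of M "{m}" 2 "\<lambda>_. ?a"] m by simp
    qed
  qed
qed

lemma integrable_amp_noise:
  assumes "m < M"
  shows "integrable \<Omega> (amp_noise m)" "(\<integral>z. amp_noise m z \<partial>\<Omega>) \<le> 1 / 2"
proof -
  have nn: "0 \<le> amp_noise m z" for z by (simp add: amp_noise_def)
  show "integrable \<Omega> (amp_noise m)"
  proof (rule integrableI_nonneg[OF measurable_amp_noise[OF assms]])
    show "(\<integral>\<^sup>+z. ennreal (amp_noise m z) \<partial>\<Omega>) < \<infinity>"
      using nn_integral_amp_noise[OF assms] by (rule le_less_trans) (simp only: infinity_ennreal_def ennreal_less_top)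
  qed (use nn in auto)
  show "(\<integral>z. amp_noise m z \<partial>\<Omega>) \<le> 1 / 2"
    by (rule integral_real_bounded[OF _ nn_integral_amp_noise[OF assms]]) simp
qed

definition increment_ln_density :: "nat \<Rightarrow> real" where
  "increment_ln_density m = (\<integral>t. ln (2 * pi * wrapped_normal_density (dev m) t) \<partial>wrapped_normal (dev m))"

text \<open>In the limit the mean energy, equal to the shape 1/2, compensates the mean squared
  radial noise, at most 1/2. Only the sign loss \<open>- ln 2\<close> and the mean log density of
  the increment are left.\<close>

theorem expected_amp_phase_score:
  assumes m: "m < 2"
  shows "\<exists>L. (\<forall>s\<ge>1. integrable \<Omega> (score s m)) \<and>
    ((\<lambda>s. (\<integral>z. score s m z \<partial>\<Omega>) - 1 * ln s) \<longlongrightarrow> L) at_top \<and> - ln 2 + increment_ln_density m \<le> L"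
proof -
  have mM: "m < M" using m M by simp
  obtain C where C: "\<And>t. \<bar>phase_score (dev m) t\<bar> \<le> C"
    using phase_score_bounded[OF dev_pos] by blast
  define l where "l t = ln (2 * pi * wrapped_normal_density (dev m) t)" for t
  have [measurable]: "l \<in> borel_measurable borel"
    unfolding l_def by measurable
  define G where "G z = - ln 2 + (cmod (fst z 2 m))\<^sup>2 - amp_noise m z + l (increment m z)" for z
  let ?B = "\<lambda>z. 2 + 2 * (cmod (fst z 2 m))\<^sup>2 + 3 * (cmod (comb_additive (snd z) 2 m))\<^sup>2 + C"
  note [measurable] = measurable_increment measurable_amp_noise[OF mM]
  have [measurable]: "(\<lambda>z. fst z 2 m) \<in> borel_measurable \<Omega>"
    using mM by (auto intro: measurable_fst_component)
  have AEi: "AE z in \<Omega>. - pi < increment m z \<and> increment m z < pi"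
  proof -
    have "AE t in distr \<Omega> borel (increment m). - pi < t \<and> t < pi"
      unfolding distr_increment by (rule AE_wrapped_normal[OF dev_pos])
    then show ?thesis
      by (subst (asm) AE_distr_iff) auto
  qed
  have lim: "AE z in \<Omega>. ((\<lambda>s. score s m z - 1 * ln s) \<longlongrightarrow> G z) at_top"
    using AE_fst_nonzero AEi
  proof eventually_elim
    case (elim z)
    have nz: "fst z 2 m \<noteq> 0" using elim(1) mM by auto
    from tendsto_add[OF tendsto_amp_score[where \<xi>="fst z 2" and i=m and \<theta>="comb_phase (snd z) 2" and w="comb_additive (snd z) 2", OF nz]
        tendsto_phase_arg[OF m elim(1)]] elim(2)
    show ?case
      unfolding score_eq_amp_phase[OF m] G_def amp_noise_def l_def by (simp add: algebra_simps)
  qed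
  have bound: "AE z in \<Omega>. \<bar>score s m z - 1 * ln s\<bar> \<le> ?B z" if s: "s \<ge> 1" for s
  proof (intro AE_I2)
    fix z
    show "\<bar>score s m z - 1 * ln s\<bar> \<le> ?B z"
      using amp_score_bound[OF s, of "fst z 2" m "comb_phase (snd z) 2" "comb_additive (snd z) 2"]
        C[of "phase_arg s m z"]
      unfolding score_eq_amp_phase[OF m] by linarith
  qed
  have B: "integrable \<Omega> ?B"
    using integrable_cmod2_fst[OF mM] integrable_cmod2_snd[OF mM] by auto
  have G: "G \<in> borel_measurable \<Omega>"
    unfolding G_def by measurable
  note D = dominated_convergence_minus_ln[OF \<Omega>.prob_space_axioms measurable_score[OF mM] G lim bound B]
  have li: "integrable \<Omega> (\<lambda>z. l (increment m z))"
  proof (rule \<Omega>.integrable_const_bound[of _ C])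
    show "AE z in \<Omega>. norm (l (increment m z)) \<le> C"
      using AEi
    proof eventually_elim
      case (elim z)
      then have "l (increment m z) = phase_score (dev m) (increment m z)"
        by (simp add: l_def phase_score_def wrap_pi_id)
      then show ?case using C[of "increment m z"] by simp
    qed
  qed measurable
  have le: "(\<integral>z. l (increment m z) \<partial>\<Omega>) = increment_ln_density m"
    using integral_distr[OF measurable_increment[of m], of l]
    unfolding distr_increment increment_ln_density_def l_def by simp
  have "(\<integral>z. G z \<partial>\<Omega>) = - ln 2 + alpha_star m - (\<integral>z. amp_noise m z \<partial>\<Omega>) + increment_ln_density m"
    unfolding G_def
    using li le integrable_amp_noise(1)[OF mM] integrable_cmod2_fst[OF mM] integral_cmod2_fst[OF mM] \<Omega>.prob_space
    by simp
  moreover have "alpha_star m = 1 / 2" using m by (simp add: alpha_star_def)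
  ultimately have "- ln 2 + increment_ln_density m \<le> (\<integral>z. G z \<partial>\<Omega>)"
    using integrable_amp_noise(2)[OF mM] by linarith
  then show ?thesis
    using D by blast
qed

end

section \<open>The symbols with predicted phase\<close>

lemma prob_space_amplitude_law: "prob_space (amplitude_law m)"
  unfolding distr_cmod_symbol_law[symmetric]
  by (rule prob_space.prob_space_distr[OF prob_space_symbol_law]) simp

lemma sets_amplitude_law [measurable_cong, simp]: "sets (amplitude_law m) = sets borel"
  by (simp add: amplitude_law_def)

lemma distr_block_law_amplitudes:
  "distr (block_law M) (Pi\<^sub>M {..<M} amplitude_law) (compose {..<M} cmod) = Pi\<^sub>M {..<M} amplitude_law"
proof -
  have "distr (block_law M) (Pi\<^sub>M {..<M} amplitude_law) (compose {..<M} cmod) =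
      Pi\<^sub>M {..<M} (\<lambda>i. distr (symbol_law i) (amplitude_law i) cmod)"
    unfolding block_law_def
    by (rule distr_PiM_finite_prob_space') (auto intro: prob_space_symbol_law prob_space_amplitude_law cong: measurable_cong_sets)
  also have "\<dots> = Pi\<^sub>M {..<M} amplitude_law"
  proof (intro PiM_cong refl)
    fix i
    have "distr (symbol_law i) (amplitude_law i) cmod = distr (symbol_law i) borel cmod"
      by (intro distr_cong) auto
    then show "distr (symbol_law i) (amplitude_law i) cmod = amplitude_law i"
      by (simp add: distr_cmod_symbol_law)
  qed
  finally show ?thesis .
qed

text \<open>Identifies the integrand with the logarithm of the limiting variance, expressed through
  the moduli of the input symbols.\<close>

lemma g_hsnr_eq:
  assumes "m \<ge> 2"
  shows "g_hsnr M m = (\<integral>u. ln (1 + (u m)\<^sup>2 * spread m u) \<partial>Pi\<^sub>M {..<M} amplitude_law) / ln 2"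
proof -
  have "(if m = 2
            then log 2 (1 + 4 * ((u 2)\<^sup>2 / (u 1)\<^sup>2) + (u 2)\<^sup>2 / (u 0)\<^sup>2)
            else log 2 (1 + (u m)\<^sup>2 / (u (m - 1))\<^sup>2 + (u m)\<^sup>2 / (u (m - 2))\<^sup>2
                          + (u m)\<^sup>2 / (u (m - 3))\<^sup>2)) = ln (1 + (u m)\<^sup>2 * spread m u) / ln 2" for u
  proof -
    have "spread m u = (\<Sum>i<m. (of_int (comb_coef m i))\<^sup>2 * (1 / (u i)\<^sup>2))"
      by (simp add: spread_def)
    then show ?thesis
      unfolding sum_comb_coef(2)[OF assms] by (auto simp: log_def algebra_simps)
  qed
  then show ?thesis
    unfolding g_hsnr_def by simp
qed

context comb_channel
begin

lemma distr_fst_block: "distr \<Omega> (block_law M) (\<lambda>z. fst z 2) = block_law M"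
proof -
  have m: "(\<lambda>\<xi>. \<xi> 2) \<in> measurable (blocks_law M 2) (block_law M)"
    unfolding blocks_law_def by (rule measurable_component_singleton) simp
  have "distr \<Omega> (block_law M) (\<lambda>z. fst z 2) = distr (distr \<Omega> (blocks_law M 2) fst) (block_law M) (\<lambda>\<xi>. \<xi> 2)"
    using m by (subst distr_distr) (auto simp: comp_def)
  also have "\<dots> = distr (blocks_law M 2) (block_law M) (\<lambda>\<xi>. \<xi> 2)"
    by (simp only: N.distr_pair_fst)
  also have "\<dots> = block_law M"
    unfolding blocks_law_def by (rule distr_PiM_component) (auto simp: prob_space_block_law)
  finally show ?thesis .
qed

lemma integral_ln_limit_var:
  assumes m: "2 \<le> m" "m < M"
  shows "(\<integral>z. ln (limit_var m (fst z 2)) \<partial>\<Omega>) = ln 2 * g_hsnr M m"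
proof -
  let ?h = "\<lambda>u :: nat \<Rightarrow> real. ln (1 + (u m)\<^sup>2 * spread m u)"
  have uc: "(\<lambda>u. u i) \<in> borel_measurable (Pi\<^sub>M {..<M} amplitude_law)" if "i < M" for i
    using measurable_component_singleton[of i "{..<M}" amplitude_law] that by (simp cong: measurable_cong_sets)
  have sp: "spread m \<in> borel_measurable (Pi\<^sub>M {..<M} amplitude_law)"
    unfolding spread_def[abs_def] using m
    by (intro borel_measurable_sum borel_measurable_divide borel_measurable_power borel_measurable_const uc) auto
  have h: "?h \<in> borel_measurable (Pi\<^sub>M {..<M} amplitude_law)"
    using m by (intro borel_measurable_ln borel_measurable_add borel_measurable_times borel_measurable_power
        borel_measurable_const uc sp)
  have c: "compose {..<M} cmod \<in> measurable (block_law M) (Pi\<^sub>M {..<M} amplitude_law)"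
  proof -
    have "(\<lambda>x. x i) \<in> borel_measurable (block_law M)" if "i < M" for i
      using measurable_component_singleton[of i "{..<M}" "\<lambda>_. borel"] that by (simp cong: measurable_cong_sets)
    then show ?thesis
      unfolding compose_def by (intro measurable_restrict) (auto cong: measurable_cong_sets)
  qed
  have m2: "(\<lambda>z. fst z 2) \<in> measurable \<Omega> (block_law M)"
  proof -
    have "(\<lambda>\<xi>. \<xi> 2) \<in> measurable (blocks_law M 2) (block_law M)"
      unfolding blocks_law_def by (rule measurable_component_singleton) simp
    from measurable_compose[OF measurable_fst this] show ?thesis .
  qed
  have "(\<integral>u. ?h u \<partial>Pi\<^sub>M {..<M} amplitude_law) =
      (\<integral>u. ?h u \<partial>distr (distr \<Omega> (block_law M) (\<lambda>z. fst z 2)) (Pi\<^sub>M {..<M} amplitude_law) (compose {..<M} cmod))"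
    by (simp only: distr_fst_block distr_block_law_amplitudes)
  also have "\<dots> = (\<integral>x. ?h (compose {..<M} cmod x) \<partial>distr \<Omega> (block_law M) (\<lambda>z. fst z 2))"
    using c h by (intro integral_distr) simp_all
  also have "\<dots> = (\<integral>z. ?h (compose {..<M} cmod (fst z 2)) \<partial>\<Omega>)"
    by (rule integral_distr[OF m2 measurable_compose[OF c h]])
  also have "\<dots> = (\<integral>z. ln (limit_var m (fst z 2)) \<partial>\<Omega>)"
  proof (intro Bochner_Integration.integral_cong refl arg_cong[where f=ln])
    fix z :: "(nat \<Rightarrow> nat \<Rightarrow> complex) \<times> noise"
    show "1 + (compose {..<M} cmod (fst z 2) m)\<^sup>2 * spread m (compose {..<M} cmod (fst z 2)) = limit_var m (fst z 2)"
      using m by (simp add: limit_var_def spread_def compose_def)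
  qed
  finally show ?thesis
    unfolding g_hsnr_eq[OF m(1)] by simp
qed

text \<open>The mean energy 1 compensates the normalised squared error, whose mean is at most 1, so
  what remains is minus the mean of the logarithm of \<open>limit_var\<close>.\<close>

theorem expected_gauss_score:
  assumes m: "2 \<le> m" "m < M"
  shows "\<exists>L. (\<forall>s\<ge>1. integrable \<Omega> (score s m)) \<and>
    ((\<lambda>s. (\<integral>z. score s m z \<partial>\<Omega>) - 2 * ln s) \<longlongrightarrow> L) at_top \<and> - ln 2 * g_hsnr M m \<le> L"
proof -
  let ?\<Theta> = "\<lambda>z :: (nat \<Rightarrow> nat \<Rightarrow> complex) \<times> noise. comb_phase (snd z) 2" and ?W = "\<lambda>z :: (nat \<Rightarrow> nat \<Rightarrow> complex) \<times> noise. comb_additive (snd z) 2"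
  let ?V = "\<lambda>z :: (nat \<Rightarrow> nat \<Rightarrow> complex) \<times> noise. limit_var m (fst z 2)"
  let ?E = "\<lambda>z :: (nat \<Rightarrow> nat \<Rightarrow> complex) \<times> noise. (cmod (limit_error m (?\<Theta> z) (fst z 2) (?W z)))\<^sup>2 / ?V z"
  let ?R = "\<lambda>z :: (nat \<Rightarrow> nat \<Rightarrow> complex) \<times> noise. \<Sum>i\<le>m. (cmod (?W z i))\<^sup>2"
  let ?\<Lambda> = "\<lambda>z :: (nat \<Rightarrow> nat \<Rightarrow> complex) \<times> noise. \<Sum>i<m. ln (1 + (of_int (comb_coef m i))\<^sup>2 / (cmod (fst z 2 i))\<^sup>2)"
  define G where "G z = - ln (?V z) - ?E z + (cmod (fst z 2 m))\<^sup>2" for z :: "(nat \<Rightarrow> nat \<Rightarrow> complex) \<times> noise"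
  let ?B = "\<lambda>z :: (nat \<Rightarrow> nat \<Rightarrow> complex) \<times> noise. 2 + 4 * (cmod (fst z 2 m))\<^sup>2 + 4 * (cmod (?W z m))\<^sup>2 + ?\<Lambda> z + 18 * ?R z + 16 * (?R z)\<^sup>2"
  have score: "score s m z = gauss_score s (symbol_var m (sent (fst z 2) s) (received (?\<Theta> z) (fst z 2) (?W z) s))
      (pred_phase m (sent (fst z 2) s) (received (?\<Theta> z) (fst z 2) (?W z) s) * sent (fst z 2) s m)
      (received (?\<Theta> z) (fst z 2) (?W z) s m)" for s z
    using m by (simp add: score_def symbol_score_def)
  have \<theta>: "cis (?\<Theta> z m) = cis (\<Sum>i<m. of_int (comb_coef m i) * ?\<Theta> z i)" for z
    by (rule comb_phase_prediction[OF m(1)])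
  have xc: "(\<lambda>z. fst z 2 i) \<in> borel_measurable \<Omega>" if "i \<le> m" for i
    using m that by (intro measurable_fst_component) auto
  have xn: "(\<lambda>z. cmod (fst z 2 i)) \<in> borel_measurable \<Omega>" if "i \<le> m" for i
    using measurable_compose[OF xc[OF that] borel_measurable_norm] .
  have wc: "(\<lambda>z. ?W z i) \<in> borel_measurable \<Omega>" if "i \<le> m" for i
    using m that by (intro measurable_snd_component) auto
  have lim: "AE z in \<Omega>. ((\<lambda>s. score s m z - 2 * ln s) \<longlongrightarrow> G z) at_top"
    using AE_fst_nonzero
  proof eventually_elim
    case (elim z)
    show ?case
      unfolding score G_def using elim m by (intro tendsto_gauss_score \<theta>) auto
  qed
  have bound: "AE z in \<Omega>. \<bar>score s m z - 2 * ln s\<bar> \<le> ?B z" if s: "s \<ge> 1" for s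
    using AE_fst_nonzero
  proof eventually_elim
    case (elim z)
    show ?case
      unfolding score using elim m by (intro gauss_score_bound \<theta> s) auto
  qed
  have Ri: "integrable \<Omega> ?R"
    using m by (intro Bochner_Integration.integrable_sum integrable_cmod2_snd) auto
  \<comment> \<open>The squared noise energy comes from the quadratic term of the error bound; it is
    controlled by fourth moments of the individual noise variables.\<close>
  have R2i: "integrable \<Omega> (\<lambda>z. (?R z)\<^sup>2)"
  proof (rule Bochner_Integration.integrable_bound)
    show "integrable \<Omega> (\<lambda>z. (\<Sum>i\<le>m. (cmod (?W z i)) ^ 4) * real (card {..m}))"
      using m by (intro integrable_mult_left Bochner_Integration.integrable_sum integrable_cmod4_snd) auto
    show "AE z in \<Omega>. norm ((?R z)\<^sup>2) \<le> norm ((\<Sum>i\<le>m. (cmod (?W z i)) ^ 4) * real (card {..m}))"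
    proof (intro AE_I2)
      fix z :: "(nat \<Rightarrow> nat \<Rightarrow> complex) \<times> noise"
      have "(?R z)\<^sup>2 \<le> (\<Sum>i\<le>m. ((cmod (?W z i))\<^sup>2)\<^sup>2) * real (card {..m})"
        by (rule sum_squared_le_sum_of_squares)
      then show "norm ((?R z)\<^sup>2) \<le> norm ((\<Sum>i\<le>m. (cmod (?W z i)) ^ 4) * real (card {..m}))"
        by (simp add: power_mult[symmetric] abs_of_nonneg sum_nonneg)
    qed
  qed (use Ri in auto)
  have \<Lambda>i: "integrable \<Omega> ?\<Lambda>"
    using m by (intro Bochner_Integration.integrable_sum
        integrable_fst_component[where f="\<lambda>x. ln (1 + (of_int (comb_coef m _))\<^sup>2 / (cmod x)\<^sup>2)"] integrable_symbol_law_ln) auto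
  have B: "integrable \<Omega> ?B"
    using Ri R2i \<Lambda>i integrable_cmod2_fst[OF m(2)] integrable_cmod2_snd[OF m(2)] by auto
  have Vm[measurable]: "?V \<in> borel_measurable \<Omega>"
    unfolding limit_var_def spread_def
    by (intro borel_measurable_add borel_measurable_times borel_measurable_sum borel_measurable_divide
        borel_measurable_power borel_measurable_const xn) auto
  have Em: "(\<lambda>z. limit_error m (?\<Theta> z) (fst z 2) (?W z)) \<in> borel_measurable \<Omega>"
  proof -
    have "(\<lambda>z. of_int (comb_coef m i) * Im (cis (- ?\<Theta> z i) * ?W z i / fst z 2 i)) \<in> borel_measurable \<Omega>" if i: "i < m" for i
    proof -
      note [measurable] = xc[OF less_imp_le[OF i]] wc[OF less_imp_le[OF i]]
      show ?thesis by measurable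
    qed
    then have [measurable]: "(\<lambda>z. \<Sum>i<m. of_int (comb_coef m i) * Im (cis (- ?\<Theta> z i) * ?W z i / fst z 2 i)) \<in> borel_measurable \<Omega>"
      by (intro borel_measurable_sum) simp
    note [measurable] = xc[OF order_refl] wc[OF order_refl]
    show ?thesis
      unfolding limit_error_def by measurable
  qed
  have [measurable]: "?E \<in> borel_measurable \<Omega>"
    using Em by measurable
  have [measurable]: "(\<lambda>z. fst z 2 m) \<in> borel_measurable \<Omega>"
    by (rule xc) simp
  have Gm: "G \<in> borel_measurable \<Omega>"
    unfolding G_def by measurable
  note D = dominated_convergence_minus_ln[OF \<Omega>.prob_space_axioms measurable_score[OF m(2)] Gm lim bound B]
  have V1: "1 \<le> ?V z" for z by (rule limit_var_ge_1)
  have lnVi: "integrable \<Omega> (\<lambda>z. ln (?V z))"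
  proof (rule Bochner_Integration.integrable_bound)
    show "integrable \<Omega> (\<lambda>z. (cmod (fst z 2 m))\<^sup>2 + ?\<Lambda> z)"
      using \<Lambda>i integrable_cmod2_fst[OF m(2)] by auto
    show "AE z in \<Omega>. norm (ln (?V z)) \<le> norm ((cmod (fst z 2 m))\<^sup>2 + ?\<Lambda> z)"
    proof (intro AE_I2)
      fix z :: "(nat \<Rightarrow> nat \<Rightarrow> complex) \<times> noise"
      let ?\<kappa> = "spread m (\<lambda>i. cmod (fst z 2 i))" and ?u = "(cmod (fst z 2 m))\<^sup>2"
      have \<kappa>: "?\<kappa> \<ge> 0" by (rule spread_nonneg)
      have "?V z \<le> (1 + ?u) * (1 + ?\<kappa>)"
        using \<kappa> by (simp add: limit_var_def algebra_simps)
      then have "ln (?V z) \<le> ln ((1 + ?u) * (1 + ?\<kappa>))"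
        using less_le_trans[OF zero_less_one V1[of z]] by (intro ln_mono)
      also have "\<dots> = ln (1 + ?u) + ln (1 + ?\<kappa>)"
        using \<kappa> by (intro ln_mult_pos) (auto simp: add_pos_nonneg)
      also have "ln (1 + ?u) \<le> ?u"
        by (rule ln_add_one_self_le_self) simp
      also have "ln (1 + ?\<kappa>) \<le> ?\<Lambda> z"
        unfolding spread_def by (rule ln_one_plus_sum_le) auto
      finally have "ln (?V z) \<le> ?u + ?\<Lambda> z" by simp
      moreover have "0 \<le> ln (?V z)" using V1[of z] by simp
      ultimately show "norm (ln (?V z)) \<le> norm (?u + ?\<Lambda> z)" by simp
    qed
  qed measurable
  \<comment> \<open>The variance depends on the input only, so the noise is averaged first for a
    fixed input without zero symbols.\<close>
  have nnE: "(\<integral>\<^sup>+z. ennreal (?E z) \<partial>\<Omega>) \<le> 1"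
  proof (rule nn_integral_\<Omega>_le)
    show "AE x in blocks_law M 2. \<forall>s r. (\<integral>\<^sup>+w. ennreal (?E (x, s, r, w)) \<partial>additive_noise M) \<le> 1"
      using AE_blocks_nonzero
    proof eventually_elim
      case (elim x)
      show ?case
      proof (intro allI)
        fix s r
        let ?\<theta> = "comb_phase (s, r, \<lambda>_. 0) 2"
        let ?v = "limit_var m (x 2)"
        have v: "?v \<ge> 1" by (rule limit_var_ge_1)
        have eq: "?E (x, s, r, w) = (cmod (limit_error m ?\<theta> (x 2) (\<lambda>i. w (2, i))))\<^sup>2 / ?v" for w
          by (simp add: comb_additive_def comb_phase_def)
        have wm: "(\<lambda>w. w (2, i)) \<in> borel_measurable (additive_noise M)" if "i \<le> m" for i
        proof -
          have "(2::nat, i) \<in> {1..} \<times> {..<M}" using that m by auto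
          from measurable_component_singleton[OF this, of "\<lambda>_. std_complex_normal"] show ?thesis
            by (simp cong: measurable_cong_sets)
        qed
        have lm: "(\<lambda>w. limit_error m ?\<theta> (x 2) (\<lambda>i. w (2, i))) \<in> borel_measurable (additive_noise M)"
        proof -
          have "(\<lambda>w. of_int (comb_coef m i) * Im (cis (- ?\<theta> i) * w (2, i) / x 2 i)) \<in> borel_measurable (additive_noise M)" if i: "i < m" for i
          proof -
            note [measurable] = wm[OF less_imp_le[OF i]]
            show ?thesis by measurable
          qed
          then have [measurable]: "(\<lambda>w. \<Sum>i<m. of_int (comb_coef m i) * Im (cis (- ?\<theta> i) * w (2, i) / x 2 i)) \<in> borel_measurable (additive_noise M)"
            by (intro borel_measurable_sum) simp
          note [measurable] = wm[OF order_refl]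
          show ?thesis
            unfolding limit_error_def by measurable
        qed
        have "(\<integral>\<^sup>+w. ennreal (?E (x, s, r, w)) \<partial>additive_noise M) =
            (\<integral>\<^sup>+w. ennreal (1 / ?v) * ennreal ((cmod (limit_error m ?\<theta> (x 2) (\<lambda>i. w (2, i))))\<^sup>2) \<partial>additive_noise M)"
          unfolding eq using v by (intro nn_integral_cong) (simp flip: ennreal_mult')
        also have "\<dots> = ennreal (1 / ?v) * (\<integral>\<^sup>+w. ennreal ((cmod (limit_error m ?\<theta> (x 2) (\<lambda>i. w (2, i))))\<^sup>2) \<partial>additive_noise M)"
          by (rule nn_integral_cmult, rule measurable_compose[OF lm]) measurable
        also have "\<dots> \<le> ennreal (1 / ?v) * ennreal ?v"
          using elim m by (intro mult_left_mono nn_integral_limit_error) auto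
        also have "\<dots> = 1"
          using v by (simp flip: ennreal_mult')
        finally show "(\<integral>\<^sup>+w. ennreal (?E (x, s, r, w)) \<partial>additive_noise M) \<le> 1" .
      qed
    qed
  qed measurable
  have E0: "0 \<le> ?E z" for z
    using V1[of z] by simp
  have Ei: "integrable \<Omega> ?E"
  proof (rule integrableI_nonneg)
    show "(\<integral>\<^sup>+z. ennreal (?E z) \<partial>\<Omega>) < \<infinity>"
      using nnE by (rule le_less_trans) simp
  qed (use E0 in auto)
  have E1: "(\<integral>z. ?E z \<partial>\<Omega>) \<le> 1"
    using nnE by (intro integral_real_bounded) (auto simp: one_ennreal_def)
  have "(\<integral>z. G z \<partial>\<Omega>) = - (\<integral>z. ln (?V z) \<partial>\<Omega>) - (\<integral>z. ?E z \<partial>\<Omega>) + alpha_star m"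
    unfolding G_def using lnVi Ei integrable_cmod2_fst[OF m(2)] integral_cmod2_fst[OF m(2)] by simp
  moreover have "alpha_star m = 1" using m by (simp add: alpha_star_def)
  ultimately have "- ln 2 * g_hsnr M m \<le> (\<integral>z. G z \<partial>\<Omega>)"
    using E1 integral_ln_limit_var[OF m] by simp
  then show ?thesis
    using D by blast
qed

section \<open>Entropy of the increments and the constant of the bound\<close>

text \<open>The phase scores use densities relative to the uniform phase, the entropy uses Lebesgue
  densities; each of the two independent increments contributes a correction of
  \<open>log 2 (2 * pi)\<close>.\<close>

lemma increment_entropy_eq:
  "increment_entropy \<sigma>\<^sub>c \<sigma>\<^sub>r = 2 * log 2 (2 * pi) - (increment_ln_density 0 + increment_ln_density 1) / ln 2"
proof -
  interpret C: prob_space "wrapped_normal \<sigma>\<^sub>c" by (rule prob_space_wrapped_normal[OF \<sigma>(1)])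
  interpret R: prob_space "wrapped_normal \<sigma>\<^sub>r" by (rule prob_space_wrapped_normal[OF \<sigma>(2)])
  interpret CR: pair_prob_space "wrapped_normal \<sigma>\<^sub>c" "wrapped_normal \<sigma>\<^sub>r" ..
  let ?P = "wrapped_normal \<sigma>\<^sub>c \<Otimes>\<^sub>M wrapped_normal \<sigma>\<^sub>r"
  let ?L = "lborel \<Otimes>\<^sub>M lborel :: (real \<times> real) measure"
  define p where "p \<sigma> t = indicator {-pi..<pi} t * wrapped_normal_density \<sigma> t" for \<sigma> t :: real
  have [measurable]: "p \<sigma> \<in> borel_measurable borel" for \<sigma>
    unfolding p_def[abs_def] by measurable
  have p0: "0 \<le> p \<sigma>' t" if "\<sigma>' > 0" for \<sigma>' t
    using wrapped_normal_density_pos[OF that, of t] by (auto simp: p_def wrap_pi_id split: split_indicator)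
  have W: "wrapped_normal \<sigma>' = density lborel (\<lambda>t. ennreal (p \<sigma>' t))" if "\<sigma>' > 0" for \<sigma>'
    unfolding p_def by (rule wrapped_normal_eq_density[OF that])
  define f where "f z = p \<sigma>\<^sub>c (fst z) * p \<sigma>\<^sub>r (snd z)" for z
  have [measurable]: "f \<in> borel_measurable ?L"
    unfolding f_def by measurable
  have f0: "0 \<le> f z" for z using p0 \<sigma> by (simp add: f_def)
  have Pf: "?P = density ?L (\<lambda>z. ennreal (f z))"
  proof -
    have "?P = density ?L (\<lambda>(x, y). ennreal (p \<sigma>\<^sub>c x) * ennreal (p \<sigma>\<^sub>r y))"
      unfolding W[OF \<sigma>(1)] W[OF \<sigma>(2)]
      by (rule pair_measure_density)
        (auto simp: W[OF \<sigma>(2), symmetric] intro: R.sigma_finite_measure_axioms lborel.sigma_finite_measure_axioms)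
    also have "\<dots> = density ?L (\<lambda>z. ennreal (f z))"
      using p0 \<sigma> by (intro density_cong) (auto simp: f_def ennreal_mult)
    finally show ?thesis .
  qed
  have id: "distr ?P ?L (\<lambda>(\<delta>\<^sub>c, \<delta>\<^sub>r). (\<delta>\<^sub>c, \<delta>\<^sub>r)) = ?P"
  proof -
    have "distr ?P ?L (\<lambda>(\<delta>\<^sub>c, \<delta>\<^sub>r). (\<delta>\<^sub>c, \<delta>\<^sub>r)) = distr ?P ?P (\<lambda>x. x)"
      by (intro distr_cong sets_pair_measure_cong) auto
    then show ?thesis by simp
  qed
  have "increment_entropy \<sigma>\<^sub>c \<sigma>\<^sub>r = - KL_divergence 2 ?L ?P"
    unfolding increment_entropy_def CR.entropy_def id ..
  also have "KL_divergence 2 ?L ?P = (\<integral>z. f z * log 2 (f z) \<partial>?L)"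
    unfolding Pf by (rule lborel_pair.KL_density) (auto simp: f0)
  also have "\<dots> = (\<integral>z. log 2 (f z) \<partial>?P)"
    unfolding Pf by (subst integral_density) (auto simp: f0)
  also have "\<dots> = (\<integral>z. (ln (2 * pi * wrapped_normal_density \<sigma>\<^sub>c (fst z)) +
      ln (2 * pi * wrapped_normal_density \<sigma>\<^sub>r (snd z)) - 2 * ln (2 * pi)) / ln 2 \<partial>?P)"
  proof (rule integral_cong_AE)
    have m1: "AE z in ?P. - pi < fst z \<and> fst z < pi"
    proof -
      have "AE t in distr ?P (wrapped_normal \<sigma>\<^sub>c) fst. - pi < t \<and> t < pi"
        unfolding R.distr_pair_fst by (rule AE_wrapped_normal[OF \<sigma>(1)])
      then show ?thesis by (subst (asm) AE_distr_iff) auto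
    qed
    have m2: "AE z in ?P. - pi < snd z \<and> snd z < pi"
    proof -
      have "AE t in distr ?P (wrapped_normal \<sigma>\<^sub>r) snd. - pi < t \<and> t < pi"
        unfolding distr_pair_snd[OF C.prob_space_axioms R.prob_space_axioms] by (rule AE_wrapped_normal[OF \<sigma>(2)])
      then show ?thesis by (subst (asm) AE_distr_iff) auto
    qed
    show "AE z in ?P. log 2 (f z) = (ln (2 * pi * wrapped_normal_density \<sigma>\<^sub>c (fst z)) +
      ln (2 * pi * wrapped_normal_density \<sigma>\<^sub>r (snd z)) - 2 * ln (2 * pi)) / ln 2"
      using m1 m2
    proof eventually_elim
      case (elim z)
      have pc: "wrapped_normal_density \<sigma>\<^sub>c (fst z) > 0" "wrapped_normal_density \<sigma>\<^sub>r (snd z) > 0"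
        using wrapped_normal_density_pos[OF \<sigma>(1), of "fst z"] wrapped_normal_density_pos[OF \<sigma>(2), of "snd z"] elim
        by (auto simp: wrap_pi_id)
      then have "ln (f z) = ln (wrapped_normal_density \<sigma>\<^sub>c (fst z)) + ln (wrapped_normal_density \<sigma>\<^sub>r (snd z))"
        using elim by (simp add: f_def p_def ln_mult_pos)
      moreover have "ln (2 * pi * wrapped_normal_density \<sigma>\<^sub>c (fst z)) = ln (2 * pi) + ln (wrapped_normal_density \<sigma>\<^sub>c (fst z))"
        "ln (2 * pi * wrapped_normal_density \<sigma>\<^sub>r (snd z)) = ln (2 * pi) + ln (wrapped_normal_density \<sigma>\<^sub>r (snd z))"
        using pc by (auto intro!: ln_mult_pos)
      ultimately show ?case by (simp add: log_def)
    qed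
  qed (auto simp: Pf)
  also have "\<dots> = (increment_ln_density 0 + increment_ln_density 1 - 2 * ln (2 * pi)) / ln 2"
  proof -
    have li: "integrable (wrapped_normal \<sigma>') (\<lambda>t. ln (2 * pi * wrapped_normal_density \<sigma>' t))" if s: "\<sigma>' > 0" for \<sigma>'
    proof -
      interpret S: prob_space "wrapped_normal \<sigma>'" by (rule prob_space_wrapped_normal[OF s])
      obtain K where K: "\<And>t. \<bar>phase_score \<sigma>' t\<bar> \<le> K"
        using phase_score_bounded[OF s] by blast
      show ?thesis
      proof (rule S.integrable_const_bound[of _ K])
        show "AE t in wrapped_normal \<sigma>'. norm (ln (2 * pi * wrapped_normal_density \<sigma>' t)) \<le> K"
          using AE_wrapped_normal[OF s]
        proof eventually_elim
          case (elim t)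
          then show ?case using K[of t] by (simp add: phase_score_def wrap_pi_id)
        qed
      qed measurable
    qed
    have mf: "(\<lambda>t. ln (2 * pi * wrapped_normal_density \<sigma>' t)) \<in> borel_measurable (wrapped_normal \<sigma>'')" for \<sigma>' \<sigma>''
      by measurable
    have d1: "distr ?P (wrapped_normal \<sigma>\<^sub>c) fst = wrapped_normal \<sigma>\<^sub>c"
      by (rule R.distr_pair_fst)
    have d2: "distr ?P (wrapped_normal \<sigma>\<^sub>r) snd = wrapped_normal \<sigma>\<^sub>r"
      by (rule distr_pair_snd[OF C.prob_space_axioms R.prob_space_axioms])
    have i1: "integrable ?P (\<lambda>z. ln (2 * pi * wrapped_normal_density \<sigma>\<^sub>c (fst z)))"
      using integrable_distr_eq[OF measurable_fst mf[of \<sigma>\<^sub>c \<sigma>\<^sub>c], of "wrapped_normal \<sigma>\<^sub>r"] li[OF \<sigma>(1)] unfolding d1 by blast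
    have i2: "integrable ?P (\<lambda>z. ln (2 * pi * wrapped_normal_density \<sigma>\<^sub>r (snd z)))"
      using integrable_distr_eq[OF measurable_snd mf[of \<sigma>\<^sub>r \<sigma>\<^sub>r], of "wrapped_normal \<sigma>\<^sub>c"] li[OF \<sigma>(2)] unfolding d2 by blast
    have e1: "(\<integral>z. ln (2 * pi * wrapped_normal_density \<sigma>\<^sub>c (fst z)) \<partial>?P) = increment_ln_density 0"
      using integral_distr[OF measurable_fst mf[of \<sigma>\<^sub>c \<sigma>\<^sub>c], of "wrapped_normal \<sigma>\<^sub>r"]
      unfolding d1 increment_ln_density_def dev_def by simp
    have e2: "(\<integral>z. ln (2 * pi * wrapped_normal_density \<sigma>\<^sub>r (snd z)) \<partial>?P) = increment_ln_density 1"
      using integral_distr[OF measurable_snd mf[of \<sigma>\<^sub>r \<sigma>\<^sub>r], of "wrapped_normal \<sigma>\<^sub>c"]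
      unfolding d2 increment_ln_density_def dev_def by simp
    show ?thesis
      using i1 i2 e1 e2 CR.prob_space by simp
  qed
  finally show ?thesis
    by (simp add: log_def diff_divide_distrib add_divide_distrib)
qed

text \<open>\<open>J s\<close> is the expected score of one block in bits. Its constant combines two
  sign losses of one bit each with the corrections \<open>2 * log 2 (2 * pi)\<close> from the
  entropy, which together give \<open>2 * log 2 pi\<close>.\<close>

theorem expected_block_score:
  "\<exists>J. (\<forall>s\<ge>1. \<forall>\<rho>. s\<^sup>2 * (real M - 1) \<le> \<rho> \<longrightarrow> ereal (J s) \<le> comb_capacity M \<sigma>\<^sub>c \<sigma>\<^sub>r \<rho>) \<and>
    (\<exists>L. ((\<lambda>s. J s - (real M - 1) * log 2 (s\<^sup>2)) \<longlongrightarrow> L) at_top \<and>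
      2 * log 2 pi - increment_entropy \<sigma>\<^sub>c \<sigma>\<^sub>r - (\<Sum>m=2..M-1. g_hsnr M m) \<le> L)"
proof -
  \<comment> \<open>The coefficient of \<open>ln s\<close> for each symbol: one for a real
    amplitude, two for a full complex symbol. The total is \<open>2 * (real M - 1)\<close>, which is
    the factor of \<open>log 2 (s\<^sup>2)\<close>.\<close>
  define k :: "nat \<Rightarrow> real" where "k m = (if m < 2 then 1 else 2)" for m
  define l where "l m = (if m < 2 then - ln 2 + increment_ln_density m else - ln 2 * g_hsnr M m)" for m
  have "\<forall>m\<in>{..<M}. \<exists>L. (\<forall>s\<ge>1. integrable \<Omega> (score s m)) \<and>
    ((\<lambda>s. (\<integral>z. score s m z \<partial>\<Omega>) - k m * ln s) \<longlongrightarrow> L) at_top \<and> l m \<le> L"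
  proof
    fix m assume "m \<in> {..<M}"
    then show "\<exists>L. (\<forall>s\<ge>1. integrable \<Omega> (score s m)) \<and>
      ((\<lambda>s. (\<integral>z. score s m z \<partial>\<Omega>) - k m * ln s) \<longlongrightarrow> L) at_top \<and> l m \<le> L"
      using expected_amp_phase_score[of m] expected_gauss_score[of m]
      by (cases "m < 2") (simp_all add: k_def l_def)
  qed
  from bchoice[OF this] obtain L where L: "\<forall>m\<in>{..<M}. (\<forall>s\<ge>1. integrable \<Omega> (score s m)) \<and>
    ((\<lambda>s. (\<integral>z. score s m z \<partial>\<Omega>) - k m * ln s) \<longlongrightarrow> L m) at_top \<and> l m \<le> L m" ..
  have int: "\<And>m s. m < M \<Longrightarrow> s \<ge> 1 \<Longrightarrow> integrable \<Omega> (score s m)"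
    and lim: "\<And>m. m < M \<Longrightarrow> ((\<lambda>s. (\<integral>z. score s m z \<partial>\<Omega>) - k m * ln s) \<longlongrightarrow> L m) at_top"
    and le: "\<And>m. m < M \<Longrightarrow> l m \<le> L m"
    using L by (meson lessThan_iff)+
  define J where "J s = (\<Sum>m<M. \<integral>z. score s m z \<partial>\<Omega>) / ln 2" for s
  have split: "(\<Sum>m<M. h m) = h 0 + h 1 + (\<Sum>m=2..M-1. h m)" for h :: "nat \<Rightarrow> real"
  proof -
    have "{..<M} = insert 0 (insert 1 {2..M-1})" using M by auto
    then show ?thesis by simp
  qed
  have cap: "ereal (J s) \<le> comb_capacity M \<sigma>\<^sub>c \<sigma>\<^sub>r \<rho>" if s: "s \<ge> 1" and \<rho>: "s\<^sup>2 * (real M - 1) \<le> \<rho>" for s \<rho>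
  proof -
    have s0: "s > 0" using s by simp
    let ?T = "\<lambda>(\<xi>, \<omega>). (scale_blocks M 2 s \<xi>, \<omega>)"
    let ?g = "\<lambda>z. block_score M \<sigma>\<^sub>c \<sigma>\<^sub>r s (fst z) (comb_output M 2 (fst z) (snd z)) 2"
    have sc: "scale_blocks M 2 s \<in> measurable (blocks_law M 2) (comb_input M 2 s)"
      by measurable
    have T: "?T \<in> measurable \<Omega> (comb_input M 2 s \<Otimes>\<^sub>M N)"
      unfolding split_beta' using sc by measurable
    \<comment> \<open>Transfers the expectation from the scaled input of the channel to the unscaled
      one on the common space.\<close>
    have D: "distr \<Omega> (comb_input M 2 s \<Otimes>\<^sub>M N) ?T = comb_input M 2 s \<Otimes>\<^sub>M N"
    proof -
      have i1: "distr (blocks_law M 2) (comb_input M 2 s) (scale_blocks M 2 s) = comb_input M 2 s"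
        unfolding comb_input_def by (intro distr_cong) auto
      have "distr (blocks_law M 2) (comb_input M 2 s) (scale_blocks M 2 s) \<Otimes>\<^sub>M distr N N (\<lambda>x. x) =
          distr \<Omega> (comb_input M 2 s \<Otimes>\<^sub>M N) ?T"
        by (rule pair_measure_distr[OF sc]) (auto intro: N.sigma_finite_measure_axioms)
      then show ?thesis by (simp add: i1)
    qed
    have g: "?g \<in> borel_measurable (comb_input M 2 s \<Otimes>\<^sub>M N)"
    proof -
      have a: "(\<lambda>z. block_score M \<sigma>\<^sub>c \<sigma>\<^sub>r s (fst z) (snd z) 2) \<in> borel_measurable (block_space M 2 \<Otimes>\<^sub>M block_space M 2)"
        by (rule measurable_block_score) simp
      have b: "(\<lambda>z. (fst z, comb_output M 2 (fst z) (snd z))) \<in> measurable (comb_input M 2 s \<Otimes>\<^sub>M N) (block_space M 2 \<Otimes>\<^sub>M block_space M 2)"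
        by measurable
      from measurable_compose[OF b a] show ?thesis by simp
    qed
    have eq: "?g (?T z) = (\<Sum>m<M. score s m z)" for z
      by (simp add: split_beta' block_score_scale_blocks)
    have i: "integrable \<Omega> (\<lambda>z. ?g (?T z))"
      unfolding eq using int[OF _ s] by (intro Bochner_Integration.integrable_sum) auto
    then have "integrable (comb_input M 2 s \<Otimes>\<^sub>M N) ?g"
      using integrable_distr_eq[OF T g] unfolding D by simp
    then have c: "ereal ((\<integral>z. ?g z \<partial>(comb_input M 2 s \<Otimes>\<^sub>M N)) / ln 2) \<le> comb_capacity M \<sigma>\<^sub>c \<sigma>\<^sub>r \<rho>"
      using comb_capacity_ge_block_score[OF M s0 \<sigma> \<rho>] by (simp add: split_beta')
    have "(\<integral>z. ?g z \<partial>(comb_input M 2 s \<Otimes>\<^sub>M N)) = (\<integral>z. (\<Sum>m<M. score s m z) \<partial>\<Omega>)"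
      using integral_distr[OF T g] unfolding D eq .
    also have "\<dots> = (\<Sum>m<M. \<integral>z. score s m z \<partial>\<Omega>)"
      using int[OF _ s] by (intro Bochner_Integration.integral_sum) auto
    finally show ?thesis
      using c unfolding J_def by simp
  qed
  have "((\<lambda>s. (\<Sum>m<M. (\<integral>z. score s m z \<partial>\<Omega>) - k m * ln s) / ln 2) \<longlongrightarrow> (\<Sum>m<M. L m) / ln 2) at_top"
    by (intro tendsto_intros lim) auto
  moreover have "\<forall>\<^sub>F s in at_top. (\<Sum>m<M. (\<integral>z. score s m z \<partial>\<Omega>) - k m * ln s) / ln 2 = J s - (real M - 1) * log 2 (s\<^sup>2)"
    using eventually_gt_at_top[of 0]
  proof eventually_elim
    case (elim s)
    have "(\<Sum>m<M. k m) = 2 * (real M - 1)"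
      unfolding split using M by (simp add: k_def of_nat_diff)
    then show ?case
      using elim
      by (simp add: J_def sum_subtractf log_def ln_realpow diff_divide_distrib flip: sum_distrib_right)
  qed
  ultimately have limJ: "((\<lambda>s. J s - (real M - 1) * log 2 (s\<^sup>2)) \<longlongrightarrow> (\<Sum>m<M. L m) / ln 2) at_top"
    by (rule Lim_transform_eventually)
  have "2 * log 2 pi - increment_entropy \<sigma>\<^sub>c \<sigma>\<^sub>r - (\<Sum>m=2..M-1. g_hsnr M m) = (\<Sum>m<M. l m) / ln 2"
  proof -
    have "(\<Sum>m<M. l m) = - 2 * ln 2 + (increment_ln_density 0 + increment_ln_density 1) - ln 2 * (\<Sum>m=2..M-1. g_hsnr M m)"
      unfolding split by (simp add: l_def sum_distrib_left sum_negf)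
    moreover have "log 2 (2 * pi) = 1 + log 2 pi"
      by (simp add: log_mult)
    ultimately show ?thesis
      unfolding increment_entropy_eq by (simp add: field_simps)
  qed
  also have "\<dots> \<le> (\<Sum>m<M. L m) / ln 2"
    using le by (intro divide_right_mono sum_mono) auto
  finally show ?thesis
    using cap limJ by blast
qed

end

section \<open>Passage from the scale to the power\<close>

text \<open>Covers powers below \<open>M - 1\<close>, for which the input scale would be less than
  1.\<close>

lemma comb_capacity_nonneg:
  assumes "M \<ge> 1" "\<sigma>\<^sub>c > 0" "\<sigma>\<^sub>r > 0" "\<rho> > 0"
  shows "0 \<le> comb_capacity M \<sigma>\<^sub>c \<sigma>\<^sub>r \<rho>"
proof -
  obtain \<mu> where \<mu>: "\<mu> \<in> input_laws M 1 \<rho>"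
    using input_laws_nonempty[OF assms(4)] by blast
  have "ereal 0 \<le> ereal (comb_MI M \<sigma>\<^sub>c \<sigma>\<^sub>r 1 \<mu> / real 1)"
    using comb_MI_nonneg[OF assms(1) _ assms(2,3) \<mu>] by simp
  also have "\<dots> \<le> comb_capacity M \<sigma>\<^sub>c \<sigma>\<^sub>r \<rho>"
    by (rule comb_capacity_ge[OF assms(1) _ assms(2,3,4) \<mu>]) simp
  finally show ?thesis by (simp add: zero_ereal_def)
qed

theorem theorem4:
  fixes M :: nat and \<sigma>\<^sub>c \<sigma>\<^sub>r :: real
  assumes "M \<ge> 2" and "\<sigma>\<^sub>c > 0" and "\<sigma>\<^sub>r > 0"
  shows "\<exists>\<epsilon> :: real \<Rightarrow> real. (\<epsilon> \<longlongrightarrow> 0) at_top \<and>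
    (\<forall>\<rho>>0. comb_capacity M \<sigma>\<^sub>c \<sigma>\<^sub>r \<rho> \<ge>
      ereal ((real M - 1) * log 2 (\<rho> / (real M - 1)) + 2 * log 2 pi
        - increment_entropy \<sigma>\<^sub>c \<sigma>\<^sub>r - (\<Sum>m=2..M-1. g_hsnr M m) + \<epsilon> \<rho>))"
proof -
  interpret comb_channel M \<sigma>\<^sub>c \<sigma>\<^sub>r
    by standard fact+
  define c where "c = 2 * log 2 pi - increment_entropy \<sigma>\<^sub>c \<sigma>\<^sub>r - (\<Sum>m=2..M-1. g_hsnr M m)"
  define K where "K = real M - 1"
  have K: "K > 0" using assms(1) by (simp add: K_def)
  obtain J L where J: "\<And>s \<rho>. s \<ge> 1 \<Longrightarrow> s\<^sup>2 * K \<le> \<rho> \<Longrightarrow> ereal (J s) \<le> comb_capacity M \<sigma>\<^sub>c \<sigma>\<^sub>r \<rho>"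
    and lim: "((\<lambda>s. J s - K * log 2 (s\<^sup>2)) \<longlongrightarrow> L) at_top" and L: "c \<le> L"
    using expected_block_score unfolding c_def K_def by blast
  \<comment> \<open>The scale that spends the whole power; \<open>\<rho> \<ge> K\<close> is
    equivalent to a scale of at least 1.\<close>
  define S where "S \<rho> = sqrt (\<rho> / K)" for \<rho>
  define main where "main \<rho> = K * log 2 (\<rho> / K) + c" for \<rho>
  \<comment> \<open>The limit \<open>L\<close> may exceed \<open>c\<close>, so the plain difference
    need not vanish; the minimum with 0 discards the surplus. Below \<open>K\<close> the choice
    makes the claimed bound equal to 0.\<close>
  define \<epsilon> where "\<epsilon> \<rho> = (if \<rho> \<ge> K then min 0 (J (S \<rho>) - main \<rho>) else - main \<rho>)" for \<rho>
  have "filterlim S at_top at_top"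
  proof -
    have "filterlim (\<lambda>\<rho>. \<rho> * inverse K) at_top at_top"
      using K by (intro filterlim_at_top_mult_tendsto_pos[of _ "inverse K"] tendsto_const filterlim_ident) auto
    then show ?thesis
      unfolding S_def divide_inverse by (rule filterlim_compose[OF sqrt_at_top])
  qed
  then have "((\<lambda>\<rho>. J (S \<rho>) - K * log 2 ((S \<rho>)\<^sup>2)) \<longlongrightarrow> L) at_top"
    by (rule filterlim_compose[OF lim])
  then have l1: "((\<lambda>\<rho>. min 0 (J (S \<rho>) - K * log 2 ((S \<rho>)\<^sup>2) - c)) \<longlongrightarrow> min 0 (L - c)) at_top"
    by (intro tendsto_intros)
  have l2: "min 0 (L - c) = 0" using L by simp
  have "\<forall>\<^sub>F \<rho> in at_top. min 0 (J (S \<rho>) - K * log 2 ((S \<rho>)\<^sup>2) - c) = \<epsilon> \<rho>"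
    using eventually_ge_at_top[of K]
  proof eventually_elim
    case (elim \<rho>)
    then have "(S \<rho>)\<^sup>2 = \<rho> / K" using K by (simp add: S_def)
    then show ?case using elim by (simp add: \<epsilon>_def main_def algebra_simps)
  qed
  from Lim_transform_eventually[OF l1 this] have "(\<epsilon> \<longlongrightarrow> 0) at_top"
    unfolding l2 .
  moreover have "ereal (main \<rho> + \<epsilon> \<rho>) \<le> comb_capacity M \<sigma>\<^sub>c \<sigma>\<^sub>r \<rho>" if \<rho>: "\<rho> > 0" for \<rho>
  proof (cases "\<rho> \<ge> K")
    case True
    then have "S \<rho> \<ge> 1" "(S \<rho>)\<^sup>2 * K \<le> \<rho>"
      using K by (auto simp: S_def)
    then have "ereal (J (S \<rho>)) \<le> comb_capacity M \<sigma>\<^sub>c \<sigma>\<^sub>r \<rho>"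
      by (rule J)
    moreover have "ereal (main \<rho> + \<epsilon> \<rho>) \<le> ereal (J (S \<rho>))"
      using True by (simp add: \<epsilon>_def min_def)
    ultimately show ?thesis by (rule order_trans[rotated])
  next
    case False
    then show ?thesis
      using comb_capacity_nonneg[of M \<sigma>\<^sub>c \<sigma>\<^sub>r \<rho>] assms \<rho> by (simp add: \<epsilon>_def zero_ereal_def)
  qed
  ultimately show ?thesis
    unfolding main_def c_def K_def by (intro exI[of _ \<epsilon>]) (simp add: algebra_simps)
qed

end
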